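(* Let $E$ and $F$ be finite graphs with no sources and no sinks, let $\mathsf{k}$ be a field, and let $L_{\mathsf{k}}(E)$ and $L_{\mathsf{k}}(F)$ be the associated Leavitt path algebras with coefficients in $\mathsf{k}$. If there is an order-preserving $\mathbb{Z}[x,x^{-1}]$-module isomorphism $K_0^{\mathrm{gr}}(L_{\mathsf{k}}(E))\cong K_0^{\mathrm{gr}}(L_{\mathsf{k}}(F))$, then there is an equivalence of categories $$\mathrm{mod}\text{-}L_{\mathsf{k}}(E)\approx \mathrm{mod}\text{-}L_{\mathsf{k}}(F),$$ as well as graded equivalences of categories $$\mathrm{gr}\text{-}L_{\mathsf{k}}(E)\approx_{\mathrm{gr}}\mathrm{gr}\text{-}L_{\mathsf{k}}(F)\quad\text{and}\quad \mathrm{gr}^{\mathbb{Z}}\text{-}L_{\mathsf{k}}(E)\approx_{\mathrm{gr}}\mathrm{gr}^{\mathbb{Z}}\text{-}L_{\mathsf{k}}(F).$$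
   Context: A graph $E=(E^0,E^1,r,s)$ is a directed graph with vertex set $E^0$, edge set $E^1$, and range and source maps $r,s:E^1\to E^0$; it is finite if $E^0$ and $E^1$ are finite. A vertex $v$ is a sink if $s^{-1}(v)=\varnothing$, regular otherwise, and a source if $r^{-1}(v)=\varnothing$. The Leavitt path algebra $L_{\mathsf{k}}(E)$ of a finite graph $E$ is the $\mathsf{k}$-algebra generated by $\{v\mid v\in E^0\}\cup\{e,e^*\mid e\in E^1\}$ subject to: (1) $vw=\delta_{vw}v$ for $v,w\in E^0$; (2) $s(e)e=e\,r(e)=e$ and $r(e)e^*=e^*s(e)=e^*$ for $e\in E^1$; (3) $e^*e'=\delta_{ee'}r(e)$ for $e,e'\in E^1$; (4) $\sum_{e\in s^{-1}(v)}ee^*=v$ for every regular vertex $v$. It is unital and $\mathbb{Z}$-graded by $\deg v=0$, $\deg e=1$, $\deg e^*=-1$. Modules are unital right modules. For a $\mathbb{Z}$-graded $\mathsf{k}$-algebra $R$ and a graded right module $M=\bigoplus_{i\in\mathbb{Z}}M_i$, the shift $M(n)$, $n\in\mathbb{Z}$, is the graded module with $M(n)_i=M_{n+i}$. Let $\mathcal{V}^{\mathrm{gr}}(R)$ be the commutative monoid of graded isomorphism classes $[P]$ of finitely generated graded projective right $R$-modules with $[P]+[Q]=[P\oplus Q]$; $\mathbb{Z}$ acts on it by ${}^n[P]=[P(n)]$. $K_0^{\mathrm{gr}}(R)$ is its group completion, a $\mathbb{Z}[x,x^{-1}]$-module via the induced action ($x^n$ acts as ${}^n(-)$). For Leavitt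 path algebras of finite graphs $\mathcal{V}^{\mathrm{gr}}$ is cancellative, so it is regarded as a submonoid of $K_0^{\mathrm{gr}}$. An order-preserving $\mathbb{Z}[x,x^{-1}]$-module isomorphism $\phi:K_0^{\mathrm{gr}}(L_{\mathsf{k}}(E))\to K_0^{\mathrm{gr}}(L_{\mathsf{k}}(F))$ is a module isomorphism carrying $\mathcal{V}^{\mathrm{gr}}(L_{\mathsf{k}}(E))$ onto $\mathcal{V}^{\mathrm{gr}}(L_{\mathsf{k}}(F))$. Categories: $\mathrm{mod}\text{-}R$ is the category of right $R$-modules that are finite dimensional over $\mathsf{k}$, with module homomorphisms. $\mathrm{gr}\text{-}R$ is the category of $\mathbb{Z}$-graded right $R$-modules that are finite dimensional over $\mathsf{k}$, and $\mathrm{gr}^{\mathbb{Z}}\text{-}R$ is the category of locally finite graded right $R$-modules, i.e. graded modules $M=\bigoplus_i M_i$ with $\dim_{\mathsf{k}}M_i<\infty$ for every $i\in\mathbb{Z}$; in both, morphisms are the degree-preserving module homomorphisms. A functor $\mathcal{F}$ between such categories of graded modules is graded if $\mathcal{F}(M(n))=\mathcal{F}(M)(n)$ for all $M$ and all $n\in\mathbb{Z}$; $\approx_{\mathrm{gr}}$ denotes an equivalence of categories given by a graded functor (one commuting with the shifts). *)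

theory Defs
  imports
    "Graph_Theory.Digraph"
    "HOL-Library.Poly_Mapping"
    "HOL-Library.FuncSet"
    "HOL-Algebra.Algebra"
begin

section \<open>Graphs\<close>

text \<open>
  A graph is a \<^typ>\<open>('v, 'e) pre_digraph\<close> with source map \<^const>\<open>tail\<close> and range map
  \<^const>\<open>head\<close>; parallel edges and loops are allowed. Finite graphs are the instances of
  \<^locale>\<open>fin_digraph\<close>.
\<close>

definition is_sink :: "('v, 'e) pre_digraph \<Rightarrow> 'v \<Rightarrow> bool" where
  "is_sink G v \<longleftrightarrow> v \<in> verts G \<and> out_arcs G v = {}"

definition is_regular :: "('v, 'e) pre_digraph \<Rightarrow> 'v \<Rightarrow> bool" where
  "is_regular G v \<longleftrightarrow> v \<in> verts G \<and> \<not> is_sink G v"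

definition is_source :: "('v, 'e) pre_digraph \<Rightarrow> 'v \<Rightarrow> bool" where
  "is_source G v \<longleftrightarrow> v \<in> verts G \<and> in_arcs G v = {}"


section \<open>Free algebras\<close>

text \<open>
  The free monoid, written additively so that the convolution product of
  \<^theory>\<open>HOL-Library.Poly_Mapping\<close> makes \<open>'g word \<Rightarrow>\<^sub>0 'k\<close> the free associative unital
  \<open>'k\<close>-algebra on the type \<open>'g\<close>.
\<close>

datatype 'g word = Word (letters: "'g list")

instantiation word :: (type) monoid_add
begin

definition zero_word :: "'a word" where
  "zero_word = Word []"

definition plus_word :: "'a word \<Rightarrow> 'a word \<Rightarrow> 'a word" where
  "plus_word u w = Word (letters u @ letters w)"

instance
  by standard (simp_all add: zero_word_def plus_word_def)

end

definition free_algebra :: "'g set \<Rightarrow> ('g word \<Rightarrow>\<^sub>0 'k::field) ring" where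
  "free_algebra S =
     \<lparr>carrier = {p. \<forall>w \<in> Poly_Mapping.keys p. set (letters w) \<subseteq> S},
      monoid.mult = (*), one = 1, ring.zero = 0, add = (+)\<rparr>"

definition gen :: "'g \<Rightarrow> ('g word \<Rightarrow>\<^sub>0 'k::field)" where
  "gen g = Poly_Mapping.single (Word [g]) 1"


section \<open>Leavitt path algebras\<close>

text \<open>
  A \<open>\<int>\<close>-graded \<open>'k\<close>-algebra is a ring with scalar multiplication \<^const>\<open>smult\<close> by the field type
  \<open>'k\<close> and homogeneous components \<open>hcomp\<close>.
\<close>

record ('k, 'r) galgebra = "('k, 'r) module" +
  hcomp :: "int \<Rightarrow> 'r set"

datatype ('v, 'e) lgen = Vert 'v | Edge 'e | Ghost 'e

definition leavitt_gens :: "('v, 'e) pre_digraph \<Rightarrow> ('v, 'e) lgen set" where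
  "leavitt_gens G = Vert ` verts G \<union> Edge ` arcs G \<union> Ghost ` arcs G"

text \<open>
  The presentation of the Leavitt path algebra is one of algebras that need not have a unit a priori;
  the identity is then the sum of all vertices. Since \<^const>\<open>free_algebra\<close> is unital, the last
  relation is needed to identify its unit with that sum.
\<close>

definition leavitt_relations ::
    "('v, 'e) pre_digraph \<Rightarrow> (('v, 'e) lgen word \<Rightarrow>\<^sub>0 'k::field) set" where
  "leavitt_relations G =
     {gen (Vert v) * gen (Vert w) - (if v = w then gen (Vert v) else 0) | v w.
        v \<in> verts G \<and> w \<in> verts G} \<union>
     {gen (Vert (tail G e)) * gen (Edge e) - gen (Edge e) | e. e \<in> arcs G} \<union>
     {gen (Edge e) * gen (Vert (head G e)) - gen (Edge e) | e. e \<in> arcs G} \<union>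
     {gen (Vert (head G e)) * gen (Ghost e) - gen (Ghost e) | e. e \<in> arcs G} \<union>
     {gen (Ghost e) * gen (Vert (tail G e)) - gen (Ghost e) | e. e \<in> arcs G} \<union>
     {gen (Ghost e) * gen (Edge f) - (if e = f then gen (Vert (head G e)) else 0) | e f.
        e \<in> arcs G \<and> f \<in> arcs G} \<union>
     {(\<Sum>e \<in> out_arcs G v. gen (Edge e) * gen (Ghost e)) - gen (Vert v) | v. is_regular G v} \<union>
     {(\<Sum>v \<in> verts G. gen (Vert v)) - 1}"

definition leavitt_ideal ::
    "('v, 'e) pre_digraph \<Rightarrow> (('v, 'e) lgen word \<Rightarrow>\<^sub>0 'k::field) set" where
  "leavitt_ideal G = genideal (free_algebra (leavitt_gens G)) (leavitt_relations G)"

fun letter_degree :: "('v, 'e) lgen \<Rightarrow> int" where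
  "letter_degree (Vert v) = 0"
| "letter_degree (Edge e) = 1"
| "letter_degree (Ghost e) = - 1"

definition word_degree :: "('v, 'e) lgen word \<Rightarrow> int" where
  "word_degree w = sum_list (map letter_degree (letters w))"

definition leavitt_algebra ::
    "'k::field itself \<Rightarrow> ('v, 'e) pre_digraph \<Rightarrow>
      ('k, (('v, 'e) lgen word \<Rightarrow>\<^sub>0 'k) set) galgebra" where
  "leavitt_algebra K G =
     (let A = free_algebra (leavitt_gens G); I = leavitt_ideal G; Q = A Quot I in
      \<lparr>carrier = carrier Q, monoid.mult = monoid.mult Q, one = one Q, ring.zero = \<zero>\<^bsub>Q\<^esub>, add = add Q,
       smult = (\<lambda>c x. \<Union>p \<in> x. a_r_coset A I (Poly_Mapping.single 0 c * p)),
       hcomp = (\<lambda>n. a_r_coset A I `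
         {p \<in> carrier A. \<forall>w \<in> Poly_Mapping.keys p. word_degree w = n})\<rparr>)"


section \<open>Right modules\<close>

text \<open>
  As for \<^const>\<open>smult\<close> in \<^theory>\<open>HOL-Algebra.Module\<close>, the fields \<^const>\<open>monoid.mult\<close> and
  \<^const>\<open>one\<close> inherited from the ring record carry no information about the module.
\<close>

record ('r, 'm) rmodule = "'m ring" +
  ract :: "'m \<Rightarrow> 'r \<Rightarrow> 'm"

locale right_module = R: ring R + M: abelian_group M
  for R :: "('k, 'r) galgebra" and M :: "('r, 'm, 'z) rmodule_scheme" +
  assumes ract_closed:
      "\<lbrakk>x \<in> carrier M; r \<in> carrier R\<rbrakk> \<Longrightarrow> ract M x r \<in> carrier M"
    and ract_add_left:
      "\<lbrakk>x \<in> carrier M; y \<in> carrier M; r \<in> carrier R\<rbrakk> \<Longrightarrow>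
        ract M (x \<oplus>\<^bsub>M\<^esub> y) r = ract M x r \<oplus>\<^bsub>M\<^esub> ract M y r"
    and ract_add_right:
      "\<lbrakk>x \<in> carrier M; r \<in> carrier R; s \<in> carrier R\<rbrakk> \<Longrightarrow>
        ract M x (r \<oplus>\<^bsub>R\<^esub> s) = ract M x r \<oplus>\<^bsub>M\<^esub> ract M x s"
    and ract_assoc:
      "\<lbrakk>x \<in> carrier M; r \<in> carrier R; s \<in> carrier R\<rbrakk> \<Longrightarrow>
        ract M x (r \<otimes>\<^bsub>R\<^esub> s) = ract M (ract M x r) s"
    and ract_one:
      "x \<in> carrier M \<Longrightarrow> ract M x \<one>\<^bsub>R\<^esub> = x"

text \<open>
  Homomorphisms are extensional, so that equality of functions is equality of morphisms.
\<close>

definition rmod_hom ::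
    "('k, 'r) galgebra \<Rightarrow> ('r, 'm, 'y) rmodule_scheme \<Rightarrow> ('r, 'n, 'z) rmodule_scheme \<Rightarrow>
      ('m \<Rightarrow> 'n) set" where
  "rmod_hom R M N =
     {f \<in> carrier M \<rightarrow>\<^sub>E carrier N.
        (\<forall>x \<in> carrier M. \<forall>y \<in> carrier M. f (x \<oplus>\<^bsub>M\<^esub> y) = f x \<oplus>\<^bsub>N\<^esub> f y) \<and>
        (\<forall>x \<in> carrier M. \<forall>r \<in> carrier R. f (ract M x r) = ract N (f x) r)}"

text \<open>
  A module over a unital \<open>'k\<close>-algebra \<open>R\<close> is a \<open>'k\<close>-vector space via \<open>c x = x (c 1)\<close>.
\<close>

definition scal ::
    "('k::field, 'r) galgebra \<Rightarrow> ('r, 'm, 'z) rmodule_scheme \<Rightarrow> 'k \<Rightarrow> 'm \<Rightarrow> 'm" where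
  "scal R M c x = ract M x (c \<odot>\<^bsub>R\<^esub> \<one>\<^bsub>R\<^esub>)"

definition fin_dim ::
    "('k::field, 'r) galgebra \<Rightarrow> ('r, 'm, 'z) rmodule_scheme \<Rightarrow> 'm set \<Rightarrow> bool" where
  "fin_dim R M V \<longleftrightarrow>
     (\<exists>B. finite B \<and> B \<subseteq> V \<and> (\<forall>x \<in> V. \<exists>c :: 'm \<Rightarrow> 'k. x = (\<Oplus>\<^bsub>M\<^esub>b \<in> B. scal R M (c b) b)))"

definition fin_gen :: "('k, 'r) galgebra \<Rightarrow> ('r, 'm, 'z) rmodule_scheme \<Rightarrow> bool" where
  "fin_gen R M \<longleftrightarrow>
     (\<exists>B. finite B \<and> B \<subseteq> carrier M \<and>
        (\<forall>x \<in> carrier M. \<exists>a \<in> B \<rightarrow> carrier R. x = (\<Oplus>\<^bsub>M\<^esub>b \<in> B. ract M b (a b))))"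


section \<open>Graded right modules\<close>

record ('r, 'm) gmodule = "('r, 'm) rmodule" +
  gcomp :: "int \<Rightarrow> 'm set"

locale graded_module = right_module R M
  for R :: "('k, 'r) galgebra" and M :: "('r, 'm) gmodule" +
  assumes gcomp_subgroup: "additive_subgroup (gcomp M i) M"
    and gcomp_ract:
      "\<lbrakk>x \<in> gcomp M i; r \<in> hcomp R j\<rbrakk> \<Longrightarrow> ract M x r \<in> gcomp M (i + j)"
    and direct_sum:
      "x \<in> carrier M \<Longrightarrow>
        \<exists>!c :: int \<Rightarrow> 'm. (\<forall>i. c i \<in> gcomp M i) \<and> finite {i. c i \<noteq> \<zero>\<^bsub>M\<^esub>} \<and>
          x = (\<Oplus>\<^bsub>M\<^esub>i \<in> {i. c i \<noteq> \<zero>\<^bsub>M\<^esub>}. c i)"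

definition shift :: "int \<Rightarrow> ('r, 'm) gmodule \<Rightarrow> ('r, 'm) gmodule" where
  "shift n M = M\<lparr>gcomp := (\<lambda>i. gcomp M (n + i))\<rparr>"

definition gr_hom ::
    "('k, 'r) galgebra \<Rightarrow> ('r, 'm) gmodule \<Rightarrow> ('r, 'n) gmodule \<Rightarrow> ('m \<Rightarrow> 'n) set" where
  "gr_hom R M N = {f \<in> rmod_hom R M N. \<forall>i. f ` gcomp M i \<subseteq> gcomp N i}"

definition gr_isomorphic ::
    "('k, 'r) galgebra \<Rightarrow> ('r, 'm) gmodule \<Rightarrow> ('r, 'n) gmodule \<Rightarrow> bool" where
  "gr_isomorphic R M N \<longleftrightarrow> (\<exists>f \<in> gr_hom R M N. bij_betw f (carrier M) (carrier N))"

definition gr_dsum :: "('r, 'm) gmodule \<Rightarrow> ('r, 'n) gmodule \<Rightarrow> ('r, 'm \<times> 'n) gmodule" where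
  "gr_dsum M N =
     \<lparr>carrier = carrier M \<times> carrier N, monoid.mult = undefined, one = undefined,
      ring.zero = (\<zero>\<^bsub>M\<^esub>, \<zero>\<^bsub>N\<^esub>),
      add = (\<lambda>(x, y) (x', y'). (x \<oplus>\<^bsub>M\<^esub> x', y \<oplus>\<^bsub>N\<^esub> y')),
      ract = (\<lambda>(x, y) r. (ract M x r, ract N y r)),
      gcomp = (\<lambda>i. gcomp M i \<times> gcomp N i)\<rparr>"


section \<open>The graded Grothendieck group\<close>

text \<open>
  From here on \<open>'u\<close> plays the role of a universe: the modules considered are those
  whose carrier is a set of elements of \<open>'u\<close>. If \<open>'u\<close> is infinite and at least as large as \<open>'k\<close>,
  every finitely generated module over a Leavitt path algebra of a finite graph, and every locally
  finite graded module, is isomorphic to one of these.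

  Graded projectivity is the lifting property against surjections in the category of graded modules.
\<close>

definition gr_projective :: "('k, 'r) galgebra \<Rightarrow> ('r, 'u) gmodule \<Rightarrow> bool" where
  "gr_projective R P \<longleftrightarrow>
     (\<forall>(M :: ('r, 'u) gmodule) (N :: ('r, 'u) gmodule) g f.
        graded_module R M \<and> graded_module R N \<and>
        g \<in> gr_hom R M N \<and> g ` carrier M = carrier N \<and> f \<in> gr_hom R P N \<longrightarrow>
        (\<exists>h \<in> gr_hom R P M. \<forall>x \<in> carrier P. g (h x) = f x))"

definition fg_gr_proj :: "'u itself \<Rightarrow> ('k, 'r) galgebra \<Rightarrow> ('r, 'u) gmodule set" where
  "fg_gr_proj U R = {P. graded_module R P \<and> fin_gen R P \<and> gr_projective R P}"

definition gr_iso_class ::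
    "('k, 'r) galgebra \<Rightarrow> ('r, 'u) gmodule \<Rightarrow> ('r, 'u) gmodule set" where
  "gr_iso_class R P = {Q \<in> fg_gr_proj TYPE('u) R. gr_isomorphic R Q P}"

text \<open>
  The monoid of graded isomorphism classes, as a multiplicatively written monoid. The carrier of \<open>gr_dsum P Q\<close> lives in \<open>'u \<times> 'u\<close>, so \<open>[P \<oplus> Q]\<close> is the class of all
  modules over \<open>'u\<close> isomorphic to it; the neutral element is the class of the zero modules.
\<close>

definition Vgr :: "'u itself \<Rightarrow> ('k, 'r) galgebra \<Rightarrow> ('r, 'u) gmodule set monoid" where
  "Vgr U R =
     \<lparr>carrier = gr_iso_class R ` fg_gr_proj U R,
      monoid.mult = (\<lambda>x y. {S \<in> fg_gr_proj U R. \<exists>P \<in> x. \<exists>Q \<in> y. gr_isomorphic R S (gr_dsum P Q)}),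
      one = {P \<in> fg_gr_proj U R. carrier P = {\<zero>\<^bsub>P\<^esub>}}\<rparr>"

text \<open>
  The group completion of a commutative monoid \<open>V\<close>: the pair \<open>(a, b)\<close> stands for the difference of
  \<open>a\<close> and \<open>b\<close>.
\<close>

definition gc_rel :: "('a, 'z) monoid_scheme \<Rightarrow> (('a \<times> 'a) \<times> ('a \<times> 'a)) set" where
  "gc_rel V = {((a, b), (c, d)).
     a \<in> carrier V \<and> b \<in> carrier V \<and> c \<in> carrier V \<and> d \<in> carrier V \<and>
     (\<exists>t \<in> carrier V. (a \<otimes>\<^bsub>V\<^esub> d) \<otimes>\<^bsub>V\<^esub> t = (c \<otimes>\<^bsub>V\<^esub> b) \<otimes>\<^bsub>V\<^esub> t)}"

definition gc_diff :: "('a, 'z) monoid_scheme \<Rightarrow> 'a \<Rightarrow> 'a \<Rightarrow> ('a \<times> 'a) set" where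
  "gc_diff V a b = gc_rel V `` {(a, b)}"

definition group_completion :: "('a, 'z) monoid_scheme \<Rightarrow> ('a \<times> 'a) set ring" where
  "group_completion V =
     \<lparr>carrier = (carrier V \<times> carrier V) // gc_rel V,
      monoid.mult = undefined, one = undefined,
      ring.zero = gc_diff V \<one>\<^bsub>V\<^esub> \<one>\<^bsub>V\<^esub>,
      add = (\<lambda>x y. \<Union>(a, b) \<in> x. \<Union>(c, d) \<in> y. gc_diff V (a \<otimes>\<^bsub>V\<^esub> c) (b \<otimes>\<^bsub>V\<^esub> d))\<rparr>"

text \<open>
  The Laurent polynomial ring \<open>\<int>[x, x\<^sup>-\<^sup>1]\<close> is the group ring \<open>int \<Rightarrow>\<^sub>0 int\<close> with convolution, where
  \<open>x\<^sup>n\<close> is \<open>Poly_Mapping.single n 1\<close>.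
\<close>

type_synonym laurent = "int \<Rightarrow>\<^sub>0 int"

text \<open>
  \<open>shift n ` a\<close> is the isomorphism class of \<open>P(n)\<close> if \<open>a\<close> is that of \<open>P\<close>.
\<close>

definition K0gr_shift ::
    "'u itself \<Rightarrow> ('k, 'r) galgebra \<Rightarrow> int \<Rightarrow>
      (('r, 'u) gmodule set \<times> ('r, 'u) gmodule set) set \<Rightarrow>
      (('r, 'u) gmodule set \<times> ('r, 'u) gmodule set) set" where
  "K0gr_shift U R n x = (\<Union>(a, b) \<in> x. gc_diff (Vgr U R) (shift n ` a) (shift n ` b))"

definition K0gr ::
    "'u itself \<Rightarrow> ('k, 'r) galgebra \<Rightarrow>
      (laurent, (('r, 'u) gmodule set \<times> ('r, 'u) gmodule set) set) module" where
  "K0gr U R =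
     (let K = group_completion (Vgr U R) in
      \<lparr>carrier = carrier K, monoid.mult = undefined, one = undefined, ring.zero = \<zero>\<^bsub>K\<^esub>, add = add K,
       smult = (\<lambda>p x. \<Oplus>\<^bsub>K\<^esub>n \<in> Poly_Mapping.keys p.
         [Poly_Mapping.lookup p n] \<cdot>\<^bsub>K\<^esub> K0gr_shift U R n x)\<rparr>)"

definition K0gr_pos ::
    "'u itself \<Rightarrow> ('k, 'r) galgebra \<Rightarrow>
      (('r, 'u) gmodule set \<times> ('r, 'u) gmodule set) set set" where
  "K0gr_pos U R = (\<lambda>a. gc_diff (Vgr U R) a \<one>\<^bsub>Vgr U R\<^esub>) ` carrier (Vgr U R)"

definition K0gr_order_iso ::
    "'u itself \<Rightarrow> ('k, 'r) galgebra \<Rightarrow> ('l, 's) galgebra \<Rightarrow>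
      ((('r, 'u) gmodule set \<times> ('r, 'u) gmodule set) set \<Rightarrow>
       (('s, 'u) gmodule set \<times> ('s, 'u) gmodule set) set) set" where
  "K0gr_order_iso U R S =
     {\<phi> \<in> iso (add_monoid (K0gr U R)) (add_monoid (K0gr U S)).
        (\<forall>p. \<forall>x \<in> carrier (K0gr U R). \<phi> (p \<odot>\<^bsub>K0gr U R\<^esub> x) = p \<odot>\<^bsub>K0gr U S\<^esub> \<phi> x) \<and>
        \<phi> ` K0gr_pos U R = K0gr_pos U S}"


section \<open>Categories and equivalences\<close>

text \<open>
  \<open>Comp C A B D g f\<close> is the composite of \<open>f : A \<rightarrow> B\<close> and \<open>g : B \<rightarrow> D\<close>.
\<close>

record ('o, 'a) category =
  Obj :: "'o set"
  Hom :: "'o \<Rightarrow> 'o \<Rightarrow> 'a set"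
  Ident :: "'o \<Rightarrow> 'a"
  Comp :: "'o \<Rightarrow> 'o \<Rightarrow> 'o \<Rightarrow> 'a \<Rightarrow> 'a \<Rightarrow> 'a"

record ('o, 'a, 'p, 'b) fctr =
  omap :: "'o \<Rightarrow> 'p"
  amap :: "'o \<Rightarrow> 'o \<Rightarrow> 'a \<Rightarrow> 'b"

definition is_functor ::
    "('o, 'a) category \<Rightarrow> ('p, 'b) category \<Rightarrow> ('o, 'a, 'p, 'b) fctr \<Rightarrow> bool" where
  "is_functor C D F \<longleftrightarrow>
     (\<forall>A \<in> Obj C. omap F A \<in> Obj D) \<and>
     (\<forall>A \<in> Obj C. \<forall>B \<in> Obj C. \<forall>f \<in> Hom C A B.
        amap F A B f \<in> Hom D (omap F A) (omap F B)) \<and>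
     (\<forall>A \<in> Obj C. amap F A A (Ident C A) = Ident D (omap F A)) \<and>
     (\<forall>A \<in> Obj C. \<forall>B \<in> Obj C. \<forall>Z \<in> Obj C. \<forall>f \<in> Hom C A B. \<forall>g \<in> Hom C B Z.
        amap F A Z (Comp C A B Z g f) =
          Comp D (omap F A) (omap F B) (omap F Z) (amap F B Z g) (amap F A B f))"

definition id_functor :: "('o, 'a, 'o, 'a) fctr" where
  "id_functor = \<lparr>omap = (\<lambda>A. A), amap = (\<lambda>A B f. f)\<rparr>"

definition comp_functor ::
    "('p, 'b, 'q, 'c) fctr \<Rightarrow> ('o, 'a, 'p, 'b) fctr \<Rightarrow> ('o, 'a, 'q, 'c) fctr" where
  "comp_functor G F =
     \<lparr>omap = (\<lambda>A. omap G (omap F A)),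
      amap = (\<lambda>A B f. amap G (omap F A) (omap F B) (amap F A B f))\<rparr>"

definition cat_isos :: "('o, 'a) category \<Rightarrow> 'o \<Rightarrow> 'o \<Rightarrow> 'a set" where
  "cat_isos C A B =
     {f \<in> Hom C A B. \<exists>g \<in> Hom C B A. Comp C A B A g f = Ident C A \<and> Comp C B A B f g = Ident C B}"

definition naturally_isomorphic ::
    "('o, 'a) category \<Rightarrow> ('p, 'b) category \<Rightarrow>
      ('o, 'a, 'p, 'b) fctr \<Rightarrow> ('o, 'a, 'p, 'b) fctr \<Rightarrow> bool" where
  "naturally_isomorphic C D F G \<longleftrightarrow>
     (\<exists>\<eta>. (\<forall>A \<in> Obj C. \<eta> A \<in> cat_isos D (omap F A) (omap G A)) \<and>
        (\<forall>A \<in> Obj C. \<forall>B \<in> Obj C. \<forall>f \<in> Hom C A B.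
           Comp D (omap F A) (omap F B) (omap G B) (\<eta> B) (amap F A B f) =
           Comp D (omap F A) (omap G A) (omap G B) (amap G A B f) (\<eta> A)))"

definition is_equivalence ::
    "('o, 'a) category \<Rightarrow> ('p, 'b) category \<Rightarrow> ('o, 'a, 'p, 'b) fctr \<Rightarrow> bool" where
  "is_equivalence C D F \<longleftrightarrow> is_functor C D F \<and>
     (\<exists>G. is_functor D C G \<and>
        naturally_isomorphic C C (comp_functor G F) id_functor \<and>
        naturally_isomorphic D D (comp_functor F G) id_functor)"

definition equivalent_categories ::
    "('o, 'a) category \<Rightarrow> ('p, 'b) category \<Rightarrow> bool" where
  "equivalent_categories C D \<longleftrightarrow> (\<exists>F. is_equivalence C D F)"


section \<open>Categories of modules\<close>

definition mod_cat ::
    "'u itself \<Rightarrow> ('k::field, 'r) galgebra \<Rightarrow> (('r, 'u) rmodule, 'u \<Rightarrow> 'u) category" where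
  "mod_cat U R =
     \<lparr>Obj = {M. right_module R M \<and> fin_dim R M (carrier M)},
      Hom = rmod_hom R,
      Ident = (\<lambda>M. \<lambda>x \<in> carrier M. x),
      Comp = (\<lambda>M N P g f. compose (carrier M) g f)\<rparr>"

definition gr_cat ::
    "'u itself \<Rightarrow> ('k::field, 'r) galgebra \<Rightarrow> (('r, 'u) gmodule, 'u \<Rightarrow> 'u) category" where
  "gr_cat U R =
     \<lparr>Obj = {M. graded_module R M \<and> fin_dim R M (carrier M)},
      Hom = gr_hom R,
      Ident = (\<lambda>M. \<lambda>x \<in> carrier M. x),
      Comp = (\<lambda>M N P g f. compose (carrier M) g f)\<rparr>"

definition grZ_cat ::
    "'u itself \<Rightarrow> ('k::field, 'r) galgebra \<Rightarrow> (('r, 'u) gmodule, 'u \<Rightarrow> 'u) category" where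
  "grZ_cat U R =
     \<lparr>Obj = {M. graded_module R M \<and> (\<forall>i. fin_dim R M (gcomp M i))},
      Hom = gr_hom R,
      Ident = (\<lambda>M. \<lambda>x \<in> carrier M. x),
      Comp = (\<lambda>M N P g f. compose (carrier M) g f)\<rparr>"

text \<open>
  The shift functors leave the underlying maps of morphisms unchanged, so commuting with them means
  the following two equations.
\<close>

definition graded_functor ::
    "(('r, 'u) gmodule, 'u \<Rightarrow> 'u) category \<Rightarrow>
      (('r, 'u) gmodule, 'u \<Rightarrow> 'u, ('s, 'u) gmodule, 'u \<Rightarrow> 'u) fctr \<Rightarrow> bool" where
  "graded_functor C F \<longleftrightarrow>
     (\<forall>M \<in> Obj C. \<forall>n. omap F (shift n M) = shift n (omap F M)) \<and>
     (\<forall>M \<in> Obj C. \<forall>N \<in> Obj C. \<forall>f \<in> Hom C M N. \<forall>n.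
        amap F (shift n M) (shift n N) f = amap F M N f)"

definition graded_equivalent ::
    "(('r, 'u) gmodule, 'u \<Rightarrow> 'u) category \<Rightarrow> (('s, 'u) gmodule, 'u \<Rightarrow> 'u) category \<Rightarrow> bool" where
  "graded_equivalent C D \<longleftrightarrow> (\<exists>F. is_equivalence C D F \<and> graded_functor C F)"

end

theory Submission imports Defs "HOL-Combinatorics.Permutations" begin

text \<open>
  Call a vertex entryless if it lies on a cycle all of whose vertices have in-degree one. On a module
  that is finite dimensional, or graded with finite-dimensional components, every other vertex acts as
  zero: a nonzero element supported there could be pushed forward along arbitrarily long paths, and the
  many paths arriving at the same end point would produce too many linearly independent elements. So
  all three categories depend only on the set of entryless vertices with its predecessor permutation.

  That permutation can be read off the ordered graded Grothendieck group. Every finitely generated graded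
  projective module has a graded basis whose members sit at vertices, hence a finite multiset of pairs
  (vertex, degree) as its type, and replacing \<open>(v, m)\<close> by the pairs \<open>(head e, m + 1)\<close> for the arcs
  \<open>e\<close> leaving \<open>v\<close> gives another type of the same module. The additive maps to the naturals
  on the positive cone are then the nonnegative functions \<open>d(v, m)\<close> that equal the sum of
  \<open>d(head e, m + 1)\<close> over those arcs. Such functions are supported on the entryless vertices, and they
  are freely generated by the counts of basis elements along the orbits of the entryless vertices. An order
  isomorphism therefore induces mutually inverse matrices of natural numbers, that is, a bijection of the
  entryless vertices, and compatibility with the shift makes it commute with the predecessor maps.
\<close>

section \<open>Entryless cycles\<close>

text \<open>The substitution of generators behind the passage to entryless vertices is not a
  homomorphism of Leavitt path algebras: it sends everything off the cycles to zero, which breaks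
  the unit relation and the sum relation at vertices of a cycle with exits. Both are restored on
  modules where the other vertices act as zero, so modules are twisted only there. The twist keeps
  carriers, additions and maps; hence it stays inside the universe and commutes with shifts on the
  nose. The type of a module is far from unique, so what is read off a type must be shown invariant.
  The count along an orbit is the dimension of a space of graded homomorphisms into a module that is
  one-dimensional in every degree. It is additive and so descends to the group completion. The
  finiteness on both sides of the argument is the same: a bound on the number of walks with a given
  end point.\<close>

locale leavitt_graph = fin_digraph G for G :: "('v, 'e) pre_digraph" +
  assumes out_arcs_nonempty: "v \<in> verts G \<Longrightarrow> out_arcs G v \<noteq> {}"
    and in_arcs_nonempty: "v \<in> verts G \<Longrightarrow> in_arcs G v \<noteq> {}"
begin

lemma finite_out [simp]: "finite (out_arcs G v)" and finite_in [simp]: "finite (in_arcs G v)"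
  by (auto intro: finite_subset[OF _ finite_arcs])

section \<open>Paths from a vertex and walks to a vertex\<close>

fun paths :: "nat \<Rightarrow> 'v \<Rightarrow> 'e list set" where
  "paths 0 v = {[]}"
| "paths (Suc n) v = {e # es | e es. e \<in> out_arcs G v \<and> es \<in> paths n (head G e)}"

primrec endpt :: "'v \<Rightarrow> 'e list \<Rightarrow> 'v" where
  "endpt v [] = v"
| "endpt v (e # es) = endpt (head G e) es"

lemma paths_Suc_eq: "paths (Suc n) v = (\<Union>e\<in>out_arcs G v. (#) e ` paths n (head G e))"
  by auto

lemma finite_paths [simp]: "finite (paths n v)"
  by (induction n arbitrary: v) (auto simp: paths_Suc_eq simp del: paths.simps(2))

lemma endpt_in_verts: "v \<in> verts G \<Longrightarrow> es \<in> paths n v \<Longrightarrow> endpt v es \<in> verts G"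
  by (induction n arbitrary: v es) auto

lemma endpt_snoc [simp]: "endpt v (es @ [e]) = head G e"
  by (induction es arbitrary: v) auto

lemma length_paths: "es \<in> paths n v \<Longrightarrow> length es = n"
  by (induction n arbitrary: v es) auto

lemma paths_snoc:
  "es @ [e] \<in> paths (Suc n) v \<longleftrightarrow> es \<in> paths n v \<and> e \<in> out_arcs G (endpt v es)"
  by (induction es arbitrary: v n) (auto dest: length_paths, (case_tac n; auto)+)

definition walks_to :: "nat \<Rightarrow> 'v \<Rightarrow> ('v \<times> 'e list) set" where
  "walks_to n w = {(u, es). u \<in> verts G \<and> es \<in> paths n u \<and> endpt u es = w}"

text \<open>Counts by the last arc, the direction in which in-degrees appear: several arcs entering
  a vertex make the number grow. By \<open>card_walks_to\<close> this is the size of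
  \<open>walks_to\<close> at every vertex of the graph.\<close>

fun nwalks :: "nat \<Rightarrow> 'v \<Rightarrow> nat" where
  "nwalks 0 w = 1"
| "nwalks (Suc n) w = (\<Sum>e\<in>in_arcs G w. nwalks n (tail G e))"

lemma finite_walks_to [simp]: "finite (walks_to n w)"
  by (rule finite_subset[of _ "Sigma (verts G) (paths n)"]) (auto simp: walks_to_def)

text \<open>Paths are built at the front and walks are counted at the end, so the last arc is split
  off with \<open>rev_cases\<close> and \<open>paths_snoc\<close>.\<close>

lemma walks_to_Suc:
  "walks_to (Suc n) w = (\<Union>e\<in>in_arcs G w. (\<lambda>(u, es). (u, es @ [e])) ` walks_to n (tail G e))"
proof -
  have "x \<in> walks_to (Suc n) w \<longleftrightarrow>
      (\<exists>e\<in>in_arcs G w. x \<in> (\<lambda>(u, es). (u, es @ [e])) ` walks_to n (tail G e))" for x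
  proof (cases x)
    case (Pair u fs)
    show ?thesis
    proof (cases fs rule: rev_cases)
      case Nil
      then show ?thesis using Pair by (auto simp: walks_to_def)
    next
      case (snoc es e)
      then show ?thesis using Pair
        by (auto simp: walks_to_def paths_snoc image_iff simp del: paths.simps(2))
    qed
  qed
  then show ?thesis unfolding set_eq_iff UN_iff by blast
qed

lemma card_walks_to: "w \<in> verts G \<Longrightarrow> card (walks_to n w) = nwalks n w"
proof (induction n arbitrary: w)
  case 0
  then have "walks_to 0 w = {(w, [])}" by (auto simp: walks_to_def)
  then show ?case by simp
next
  case (Suc n)
  have "card (walks_to (Suc n) w) =
      (\<Sum>e\<in>in_arcs G w. card ((\<lambda>(u, es). (u, es @ [e])) ` walks_to n (tail G e)))"
    unfolding walks_to_Suc by (rule card_UN_disjoint) auto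
  also have "\<dots> = (\<Sum>e\<in>in_arcs G w. nwalks n (tail G e))"
    using Suc.IH by (intro sum.cong refl) (subst card_image, auto simp: inj_on_def)
  finally show ?case by simp
qed

text \<open>Without sources a walk can be prolonged backwards from every vertex. Positivity makes a
  second incoming arc raise the count strictly in \<open>walk_in_cyc\<close>.\<close>

lemma nwalks_pos: "w \<in> verts G \<Longrightarrow> nwalks n w > 0"
proof (induction n arbitrary: w)
  case (Suc n)
  obtain e where "e \<in> in_arcs G w" using in_arcs_nonempty[OF Suc.prems] by blast
  then have "nwalks n (tail G e) > 0" using Suc.IH by auto
  then show ?case using \<open>e \<in> in_arcs G w\<close> by (auto simp: sum_pos2 intro!: bexI[of _ e])
qed auto

section \<open>Predecessors and entryless vertices\<close>

definition in_arc :: "'v \<Rightarrow> 'e" where "in_arc v = (SOME e. e \<in> in_arcs G v)"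
definition pre :: "'v \<Rightarrow> 'v" where "pre v = tail G (in_arc v)"

text \<open>The cycle is traced backwards because only that direction is deterministic: an entryless
  cycle may have exits, so its vertices can have several outgoing arcs. At the vertices concerned,
  the choice in \<open>in_arc\<close> is between one arc only.\<close>

definition cyc :: "'v set" where
  "cyc = {v \<in> verts G. (\<exists>n>0. (pre ^^ n) v = v) \<and>
     (\<forall>k. in_arcs G ((pre ^^ k) v) = {in_arc ((pre ^^ k) v)})}"

lemma cyc_in_verts: "v \<in> cyc \<Longrightarrow> v \<in> verts G" by (simp add: cyc_def)

lemma finite_cyc [simp]: "finite cyc"
  by (rule finite_subset[OF _ finite_verts]) (auto simp: cyc_def)

lemma cyc_in_arcs: "v \<in> cyc \<Longrightarrow> in_arcs G v = {in_arc v}"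
  unfolding cyc_def by (metis (mono_tags, lifting) funpow_0 mem_Collect_eq)

lemma pre_in_cyc: assumes "v \<in> cyc" shows "pre v \<in> cyc"
proof -
  have "in_arc v \<in> arcs G" using cyc_in_arcs[OF assms] by (auto simp: set_eq_iff)
  then have "pre v \<in> verts G" by (simp add: pre_def)
  moreover obtain n where "n > 0" "(pre ^^ n) v = v" using assms by (auto simp: cyc_def)
  then have "(pre ^^ n) (pre v) = pre v" by (metis funpow_swap1)
  moreover have "in_arcs G ((pre ^^ k) (pre v)) = {in_arc ((pre ^^ k) (pre v))}" for k
    using assms unfolding cyc_def by (metis (mono_tags, lifting) funpow_Suc_right comp_apply mem_Collect_eq)
  ultimately show ?thesis using \<open>n > 0\<close> by (auto simp: cyc_def)
qed

text \<open>The unique arc into a vertex of an entryless cycle comes from that cycle. Consequently a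
  path that ends in \<open>cyc\<close> has all its vertices there, and what leaves
  \<open>cyc\<close> never returns.\<close>

lemma head_in_cyc:
  assumes "e \<in> arcs G" "head G e \<in> cyc"
  shows "e = in_arc (head G e)" "tail G e = pre (head G e)" "tail G e \<in> cyc"
proof -
  show "e = in_arc (head G e)" using cyc_in_arcs[OF assms(2)] assms(1) by (auto simp: set_eq_iff)
  then show "tail G e = pre (head G e)" by (simp add: pre_def)
  then show "tail G e \<in> cyc" using pre_in_cyc[OF assms(2)] by simp
qed

lemma in_arc_cyc:
  assumes "v \<in> cyc" shows "in_arc v \<in> arcs G" "head G (in_arc v) = v" "tail G (in_arc v) = pre v"
  using cyc_in_arcs[OF assms] by (auto simp: set_eq_iff pre_def)

lemma funpow_pre_in_cyc: "v \<in> cyc \<Longrightarrow> (pre ^^ n) v \<in> cyc"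
  by (induction n) (auto intro: pre_in_cyc)

lemma pre_image_cyc: "pre ` cyc = cyc"
proof
  show "cyc \<subseteq> pre ` cyc"
  proof
    fix v assume v: "v \<in> cyc"
    then obtain n where n: "n > 0" "(pre ^^ n) v = v" by (auto simp: cyc_def)
    then have "v = pre ((pre ^^ (n - 1)) v)" by (metis Suc_diff_1 comp_apply funpow.simps(2))
    then show "v \<in> pre ` cyc" using funpow_pre_in_cyc[OF v] by blast
  qed
qed (auto intro: pre_in_cyc)

lemma inj_on_pre: "inj_on pre cyc"
  by (intro eq_card_imp_inj_on) (auto simp: pre_image_cyc)

lemma pre_inject: "v \<in> cyc \<Longrightarrow> w \<in> cyc \<Longrightarrow> pre v = pre w \<longleftrightarrow> v = w"
  using inj_on_pre by (auto simp: inj_on_def)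

lemma exists_period: "\<exists>q>0. \<forall>v\<in>cyc. (pre ^^ q) v = v"
proof -
  have "\<forall>v\<in>cyc. \<exists>n>0. (pre ^^ n) v = v" by (simp add: cyc_def)
  then have "\<forall>v\<in>cyc. \<exists>n. n > 0 \<and> (pre ^^ n) v = v" by blast
  from bchoice[OF this] obtain N where N: "\<And>v. v \<in> cyc \<Longrightarrow> N v > (0::nat) \<and> (pre ^^ N v) v = v"
    by blast
  have "(pre ^^ (\<Prod>v\<in>cyc. N v)) v = v" if "v \<in> cyc" for v
  proof -
    have "N v dvd (\<Prod>v\<in>cyc. N v)" using that by (intro dvd_prodI) auto
    then show ?thesis
      using N[OF that] funpow_mod_eq[of "N v" pre v "\<Prod>v\<in>cyc. N v"] by (simp add: dvd_imp_mod_0)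
  qed
  moreover have "(\<Prod>v\<in>cyc. N v) > 0" using N by (simp add: prod_pos)
  ultimately show ?thesis by blast
qed

definition period :: nat where "period = (SOME q. q > 0 \<and> (\<forall>v\<in>cyc. (pre ^^ q) v = v))"

lemma period_pos: "period > 0" and funpow_period: "v \<in> cyc \<Longrightarrow> (pre ^^ period) v = v"
  using someI_ex[of "\<lambda>q. q > 0 \<and> (\<forall>v\<in>cyc. (pre ^^ q) v = v)"] exists_period
  unfolding period_def by blast+

text \<open>The \<open>m\<close>-th iterate of \<open>pre\<close> for an arbitrary integer
  \<open>m\<close>: on \<open>cyc\<close> the map is a permutation whose order divides
  \<open>period\<close>, and reducing the exponent modulo \<open>period\<close> gives a meaning to
  negative \<open>m\<close>.\<close>

definition phase :: "'v \<Rightarrow> int \<Rightarrow> 'v" where "phase v m = (pre ^^ nat (m mod int period)) v"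

lemma phase_0 [simp]: "phase v 0 = v" by (simp add: phase_def)

lemma phase_in_cyc: "v \<in> cyc \<Longrightarrow> phase v m \<in> cyc"
  by (simp add: phase_def funpow_pre_in_cyc)

lemma phase_Suc: assumes "v \<in> cyc" shows "phase v (m + 1) = pre (phase v m)"
proof -
  let ?a = "nat (m mod int period)"
  have "nat ((m + 1) mod int period) = Suc ?a mod period"
    using period_pos by (simp add: nat_mod_as_int mod_add_right_eq add.commute)
  then show ?thesis
    using funpow_mod_eq[OF funpow_period[OF assms], of "Suc ?a"] by (simp add: phase_def)
qed

lemma phase_pre: assumes "v \<in> cyc" shows "phase (pre v) m = phase v (m + 1)"
  using phase_Suc[OF assms, of m] by (simp add: phase_def funpow_swap1)

lemma pre_phase_minus: assumes "v \<in> cyc" shows "pre (phase v (m - 1)) = phase v m"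
  using phase_Suc[OF assms, of "m - 1"] by simp

lemma inj_on_phase: "inj_on (\<lambda>v. phase v m) cyc"
proof -
  have "inj_on (pre ^^ n) cyc" for n
    by (induction n) (auto simp: inj_on_def pre_inject funpow_pre_in_cyc)
  then show ?thesis by (simp add: phase_def)
qed

lemma phase_image: "(\<lambda>v. phase v m) ` cyc = cyc"
  using inj_on_phase[of m] by (intro endo_inj_surj) (auto intro: phase_in_cyc)

text \<open>Unrolls the cycle through \<open>z\<close> into a line indexed by the integers:
  \<open>m\<close> steps back from \<open>v\<close> lead to \<open>z\<close>, so \<open>v\<close> is
  the vertex reached from \<open>z\<close> after \<open>m\<close> steps along the cycle. For
  \<open>z\<close> in \<open>cyc\<close> every degree carries exactly one vertex of the
  line.\<close>

definition on_orbit :: "'v \<Rightarrow> 'v \<Rightarrow> int \<Rightarrow> bool" where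
  "on_orbit z v m \<longleftrightarrow> v \<in> cyc \<and> phase v m = z"

lemma on_orbit_in_verts: "on_orbit z v m \<Longrightarrow> v \<in> verts G"
  by (simp add: on_orbit_def cyc_in_verts)

lemma on_orbit_unique: "on_orbit z v m \<Longrightarrow> on_orbit z w m \<Longrightarrow> v = w"
  using inj_on_phase[of m] by (auto simp: on_orbit_def inj_on_def)

lemma on_orbit_exists: assumes "z \<in> cyc" obtains v where "on_orbit z v m"
proof -
  obtain v where "v \<in> cyc" "phase v m = z" using phase_image[of m] assms by (metis imageE)
  then show ?thesis using that by (auto simp: on_orbit_def)
qed

lemma on_orbit_tail: "e \<in> arcs G \<Longrightarrow> on_orbit z (head G e) (m + 1) \<Longrightarrow> on_orbit z (tail G e) m"
  using head_in_cyc[of e] by (auto simp: on_orbit_def phase_pre)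

lemma on_orbit_head_unique:
  "e \<in> arcs G \<Longrightarrow> f \<in> arcs G \<Longrightarrow> on_orbit z (head G e) m \<Longrightarrow> on_orbit z (head G f) m \<Longrightarrow> e = f"
  by (metis head_in_cyc(1) on_orbit_def on_orbit_unique)

lemma on_orbit_out:
  assumes "on_orbit z v m" obtains e where "e \<in> out_arcs G v" "on_orbit z (head G e) (m + 1)"
proof -
  have v: "v \<in> cyc" "phase v m = z" using assms by (auto simp: on_orbit_def)
  then obtain w where w: "w \<in> cyc" "pre w = v" using pre_image_cyc by (metis imageE)
  show ?thesis
    using that[of "in_arc w"] v w in_arc_cyc[OF w(1)] phase_pre[OF w(1), of m]
    by (auto simp: on_orbit_def)
qed

text \<open>Starting the line one vertex earlier moves it by one degree. This is where the grading
  shift and the predecessor map meet.\<close>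

lemma on_orbit_pre: assumes "z \<in> cyc" shows "on_orbit (pre z) v m \<longleftrightarrow> on_orbit z v (m - 1)"
  using assms pre_phase_minus[of v m] pre_inject[of "phase v (m - 1)" z] phase_in_cyc[of v "m - 1"]
  unfolding on_orbit_def by metis

text \<open>Every walk to \<open>a n\<close> continues to \<open>a (Suc n)\<close>, so the counts
  increase along the given walk and, being bounded, become constant. From then on no second arc can
  enter, and since there are finitely many vertices the walk runs around an entryless cycle; by
  \<open>head_in_cyc\<close> its beginning lies in \<open>cyc\<close> too.\<close>

lemma walk_in_cyc:
  assumes walk: "\<And>n. \<exists>e\<in>arcs G. tail G e = a n \<and> head G e = a (Suc n)"
    and bound: "\<And>n. nwalks n (a n) \<le> D"
  shows "a 0 \<in> cyc"
proof -
  define f where "f n = nwalks n (a n)" for n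
  have a_verts: "a n \<in> verts G" for n using walk[of n] tail_in_verts by metis
  have step: "f n \<le> f (Suc n) \<and> (f (Suc n) = f n \<longrightarrow> in_arcs G (a (Suc n)) = {in_arc (a (Suc n))} \<and>
      pre (a (Suc n)) = a n)" for n
  proof -
    obtain e where e: "e \<in> arcs G" "tail G e = a n" "head G e = a (Suc n)" using walk by blast
    \<comment> \<open>The arc of the walk itself contributes \<open>f n\<close>; every other arc
      into \<open>a (Suc n)\<close> adds a positive number.\<close>
    have eq: "f (Suc n) = f n + (\<Sum>e'\<in>in_arcs G (a (Suc n)) - {e}. nwalks n (tail G e'))"
      using e by (simp add: f_def sum.remove[of _ e])
    moreover have "in_arcs G (a (Suc n)) = {e}" if "f (Suc n) = f n"
    proof (rule ccontr)
      assume "in_arcs G (a (Suc n)) \<noteq> {e}"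
      moreover have "e \<in> in_arcs G (a (Suc n))" using e by simp
      ultimately obtain e' where e': "e' \<in> in_arcs G (a (Suc n)) - {e}" by blast
      then have "(\<Sum>e'\<in>in_arcs G (a (Suc n)) - {e}. nwalks n (tail G e')) \<ge> nwalks n (tail G e')"
        by (intro member_le_sum) auto
      moreover have "nwalks n (tail G e') > 0" using e' by (intro nwalks_pos) auto
      ultimately show False using eq that by simp
    qed
    moreover have "in_arc (a (Suc n)) = e" if "in_arcs G (a (Suc n)) = {e}"
      using that by (simp add: in_arc_def)
    ultimately show ?thesis using e by (auto simp: pre_def)
  qed
  then have "mono f" by (simp add: incseq_SucI)
  have fin: "finite (range f)"
    by (rule finite_subset[of _ "{..D}"]) (auto simp: f_def bound)
  then obtain n0 where n0: "f n0 = Max (range f)" using Max_in[of "range f"] by (auto simp: image_iff)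
  have const: "f n = f n0" if "n \<ge> n0" for n
    using monoD[OF \<open>mono f\<close> that] n0 Max_ge[OF fin, of "f n"] by simp
  have single: "in_arcs G (a (Suc n)) = {in_arc (a (Suc n))}" "pre (a (Suc n)) = a n"
    if "n \<ge> n0" for n
  proof -
    have "f (Suc n) = f n" using const[OF that] const[of "Suc n"] that by simp
    then show "in_arcs G (a (Suc n)) = {in_arc (a (Suc n))}" "pre (a (Suc n)) = a n"
      using step[of n] by blast+
  qed
  \<comment> \<open>Beyond \<open>n0\<close> the arc of the walk is the only one into its head, so
    \<open>pre\<close> retraces the walk.\<close>
  have rewind: "(pre ^^ k) (a (n + k)) = a n" if "n \<ge> n0" for n k
  proof (induction k)
    case (Suc k)
    have "(pre ^^ Suc k) (a (n + Suc k)) = (pre ^^ k) (pre (a (Suc (n + k))))" by (simp add: funpow_swap1)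
    then show ?case using single(2)[of "n + k"] that Suc by simp
  qed simp
  \<comment> \<open>The range starts at \<open>Suc n0\<close> because \<open>single\<close>
    describes the vertex after step \<open>n\<close>, not the one before it.\<close>
  have "\<not> inj_on a {Suc n0..}"
  proof
    assume "inj_on a {Suc n0..}"
    moreover have "finite (a ` {Suc n0..})" by (rule finite_subset[OF _ finite_verts]) (auto simp: a_verts)
    ultimately show False using infinite_Ici finite_imageD by blast
  qed
  then obtain p q where "p \<ge> Suc n0" "q \<ge> Suc n0" "p \<noteq> q" "a p = a q"
    by (auto simp: inj_on_def)
  then obtain p q where pq: "p \<ge> Suc n0" "p < q" "a p = a q"
    by (metis linorder_neqE_nat)
  define l where "l = q - p"
  have l: "l > 0" "(pre ^^ l) (a q) = a q" using rewind[of p l] pq by (auto simp: l_def)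
  have "in_arcs G ((pre ^^ k) (a q)) = {in_arc ((pre ^^ k) (a q))}" for k
  proof -
    have eq: "(pre ^^ k) (a q) = (pre ^^ (k mod l)) (a q)" using funpow_mod_eq[OF l(2), of k] by simp
    have "k mod l < l" "p + l = q" using l pq by (auto simp: l_def)
    \<comment> \<open>At most \<open>l - 1\<close> steps back from \<open>q\<close> end strictly
      after \<open>p\<close>, where the incoming arc is already known to be unique.\<close>
    then have "q = Suc (q - Suc (k mod l)) + k mod l" "q - Suc (k mod l) \<ge> n0"
      using pq(1) by linarith+
    then obtain r where r: "q = Suc r + k mod l" "r \<ge> n0" by blast
    have "(pre ^^ (k mod l)) (a q) = a (Suc r)"
      using rewind[of "Suc r" "k mod l"] r by simp
    then show ?thesis using single(1)[OF r(2)] eq by simp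
  qed
  then have "a q \<in> cyc" using l a_verts by (auto simp: cyc_def)
  moreover have "a n \<in> cyc" if "a (Suc n) \<in> cyc" for n
    using walk[of n] that head_in_cyc(3) by metis
  ultimately show ?thesis by (induction q) auto
qed

lemma sum_over_heads: "(\<Sum>w\<in>verts G. \<Sum>e\<in>in_arcs G w. h e) = (\<Sum>e\<in>arcs G. h e)"
proof -
  have eq: "arcs G = (\<Union>w\<in>verts G. in_arcs G w)" by auto
  have "sum h (\<Union>w\<in>verts G. in_arcs G w) = (\<Sum>w\<in>verts G. \<Sum>e\<in>in_arcs G w. h e)"
    by (rule sum.UNION_disjoint) auto
  then show ?thesis unfolding eq[symmetric] by (rule sym)
qed

lemma sum_over_tails: "(\<Sum>w\<in>verts G. \<Sum>e\<in>out_arcs G w. h e) = (\<Sum>e\<in>arcs G. h e)"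
proof -
  have eq: "arcs G = (\<Union>w\<in>verts G. out_arcs G w)" by auto
  have "sum h (\<Union>w\<in>verts G. out_arcs G w) = (\<Sum>w\<in>verts G. \<Sum>e\<in>out_arcs G w. h e)"
    by (rule sum.UNION_disjoint) auto
  then show ?thesis unfolding eq[symmetric] by (rule sym)
qed

section \<open>Nonnegative functions satisfying the arc relation\<close>

context
  fixes d :: "'v \<Rightarrow> int \<Rightarrow> nat"
  assumes d: "\<And>v m. v \<in> verts G \<Longrightarrow> d v m = (\<Sum>e\<in>out_arcs G v. d (head G e) (m + 1))"
begin

text \<open>Expanding each \<open>d v m\<close> over all paths of length \<open>n\<close> from
  \<open>v\<close> and collecting equal end points counts every \<open>w\<close> once per walk to
  it. The right-hand side does not involve \<open>n\<close>, which yields a uniform bound on the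
  number of walks to any vertex where \<open>d\<close> is positive.\<close>

lemma nwalks_mass:
  "(\<Sum>w\<in>verts G. nwalks n w * d w (m + int n)) = (\<Sum>w\<in>verts G. d w m)"
proof (induction n)
  case (Suc n)
  have "(\<Sum>w\<in>verts G. nwalks (Suc n) w * d w (m + int (Suc n))) =
      (\<Sum>w\<in>verts G. \<Sum>e\<in>in_arcs G w. nwalks n (tail G e) * d (head G e) (m + int n + 1))"
    by (auto simp: sum_distrib_left algebra_simps intro!: sum.cong)
  also have "\<dots> = (\<Sum>v\<in>verts G. \<Sum>e\<in>out_arcs G v. nwalks n (tail G e) * d (head G e) (m + int n + 1))"
    by (simp only: sum_over_heads sum_over_tails)
  also have "\<dots> = (\<Sum>v\<in>verts G. nwalks n v * d v (m + int n))"
    by (auto simp: sum_distrib_left d[of _ "m + int n"] intro!: sum.cong)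
  finally show ?case using Suc by simp
qed simp

text \<open>A positive value passes to the head of some outgoing arc, which produces an infinite
  walk with positive values. As naturals these are at least one, so the conserved mass bounds the
  number of walks and \<open>walk_in_cyc\<close> applies.\<close>

lemma support_in_cyc:
  assumes v: "v \<in> verts G" "d v m > 0" shows "v \<in> cyc"
proof -
  have "\<exists>w. w \<in> verts G \<and> d w (m + int (Suc n)) > 0 \<and> (\<exists>e\<in>arcs G. tail G e = u \<and> head G e = w)"
    if "u \<in> verts G \<and> d u (m + int n) > 0" for u n
  proof -
    have "(\<Sum>e\<in>out_arcs G u. d (head G e) (m + int n + 1)) \<noteq> 0"
      using d[of u "m + int n"] that by linarith
    then obtain e where "e \<in> out_arcs G u" "d (head G e) (m + int n + 1) \<noteq> 0"
      by (meson sum.not_neutral_contains_not_neutral)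
    then show ?thesis by (intro exI[of _ "head G e"]) (auto simp: algebra_simps)
  qed
  note next_vertex = this
  \<comment> \<open>The clause for \<open>n = 0\<close> makes the chosen walk start at
    \<open>v\<close>.\<close>
  define P where "P n w \<longleftrightarrow> w \<in> verts G \<and> d w (m + int n) > 0 \<and> (n = 0 \<longrightarrow> w = v)" for n w
  have "\<exists>w. P 0 w" using v by (auto simp: P_def)
  moreover have "\<exists>w. P (Suc n) w \<and> (\<exists>e\<in>arcs G. tail G e = u \<and> head G e = w)" if "P n u" for u n
    using next_vertex[of u n] that by (auto simp: P_def)
  ultimately obtain a where a': "\<And>n. P n (a n)"
      "\<And>n. \<exists>e\<in>arcs G. tail G e = a n \<and> head G e = a (Suc n)"
    using dependent_nat_choice[of P "\<lambda>n u w. \<exists>e\<in>arcs G. tail G e = u \<and> head G e = w"] by blast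
  then have a: "a 0 = v" "\<And>n. a n \<in> verts G" "\<And>n. d (a n) (m + int n) > 0"
    by (auto simp: P_def)
  have "nwalks n (a n) \<le> (\<Sum>w\<in>verts G. d w m)" for n
  proof -
    have "nwalks n (a n) \<le> nwalks n (a n) * d (a n) (m + int n)" using a(3)[of n] by simp
    also have "\<dots> \<le> (\<Sum>w\<in>verts G. nwalks n w * d w (m + int n))"
      by (rule member_le_sum[where f = "\<lambda>w. nwalks n w * d w (m + int n)"]) (auto simp: a(2))
    finally show ?thesis by (simp add: nwalks_mass)
  qed
  then show ?thesis using walk_in_cyc[of a "\<Sum>w\<in>verts G. d w m", OF a'(2)] a(1) by simp
qed

text \<open>The other arcs leaving \<open>pre w\<close> contribute nothing: a head in
  \<open>cyc\<close> would have the predecessor \<open>pre w\<close> and hence be \<open>w\<close>,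
  and outside \<open>cyc\<close> the function vanishes.\<close>

lemma d_pre: assumes "w \<in> cyc" shows "d (pre w) m = d w (m + 1)"
proof -
  have "d (pre w) m = (\<Sum>e\<in>out_arcs G (pre w). d (head G e) (m + 1))"
    by (rule d) (use pre_in_cyc[OF assms] cyc_in_verts in blast)
  also have "\<dots> = (\<Sum>e\<in>{in_arc w}. d (head G e) (m + 1))"
  proof (rule sum.mono_neutral_right)
    show "\<forall>i\<in>out_arcs G (pre w) - {in_arc w}. d (head G i) (m + 1) = 0"
    proof
      fix e assume e: "e \<in> out_arcs G (pre w) - {in_arc w}"
      show "d (head G e) (m + 1) = 0"
      proof (rule ccontr)
        assume "d (head G e) (m + 1) \<noteq> 0"
        then have "head G e \<in> cyc" using support_in_cyc[of "head G e" "m + 1"] e by auto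
        then show False using head_in_cyc[of e] e assms pre_inject[of "head G e" w] by auto
      qed
    qed
  qed (use assms in_arc_cyc in auto)
  also have "\<dots> = d w (m + 1)" using assms in_arc_cyc by simp
  finally show ?thesis .
qed

lemma d_funpow: "w \<in> cyc \<Longrightarrow> d ((pre ^^ k) w) m = d w (m + int k)"
  by (induction k arbitrary: m) (auto simp: d_pre funpow_pre_in_cyc algebra_simps)

text \<open>By \<open>d_pre\<close> the function is constant along each unrolled cycle, so the value
  at \<open>(v, m)\<close> is that of the vertex of the same line in degree zero.\<close>

lemma d_eq_phase: assumes "v \<in> verts G" shows "d v m = (if v \<in> cyc then d (phase v m) 0 else 0)"
proof (cases "v \<in> cyc")
  case True
  have per: "d v (m + int period * int k) = d v m" for m k
  proof -
    have "(pre ^^ (period * k)) v = v"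
      using funpow_mod_eq[OF funpow_period[OF True], of "period * k"] by simp
    then show ?thesis using d_funpow[OF True, of "period * k" m] by simp
  qed
  \<comment> \<open>Negative multiples follow from the nonnegative case started at the shifted
    argument.\<close>
  have per': "d v (m + int period * k) = d v m" for m k
    using per[of m "nat k"] per[of "m + int period * k" "nat (- k)"]
    by (cases "k \<ge> 0") (auto simp: algebra_simps)
  have "d v m = d v (m mod int period)"
    using per'[of "m mod int period" "m div int period"] by (simp add: add.commute)
  also have "\<dots> = d (phase v m) 0"
    using d_funpow[OF True, of "nat (m mod int period)" 0] period_pos by (simp add: phase_def)
  finally show ?thesis using True by simp
next
  case False
  then show ?thesis using support_in_cyc[OF assms, of m] by auto
qed

end

end

section \<open>The free algebra and the relation of congruence modulo the Leavitt ideal\<close>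

context
  fixes S :: "'g set"
begin

lemma fa_carrier_iff: "p \<in> carrier (free_algebra S) \<longleftrightarrow> (\<forall>w\<in>Poly_Mapping.keys p. set (letters w) \<subseteq> S)"
  by (simp add: free_algebra_def)

lemma fa_zero [simp]: "0 \<in> carrier (free_algebra S)" by (simp add: fa_carrier_iff)

lemma fa_one [simp]: "1 \<in> carrier (free_algebra S)"
  by (simp add: fa_carrier_iff zero_word_def)

lemma fa_scalar [simp]: "Poly_Mapping.single 0 c \<in> carrier (free_algebra S)"
  by (simp add: fa_carrier_iff zero_word_def)

lemma fa_single: "set (letters w) \<subseteq> S \<Longrightarrow> Poly_Mapping.single w c \<in> carrier (free_algebra S)"
  by (simp add: fa_carrier_iff)

lemma fa_gen [simp]: "g \<in> S \<Longrightarrow> gen g \<in> carrier (free_algebra S)"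
  by (simp add: fa_carrier_iff gen_def)

lemma fa_add [simp]:
  "p \<in> carrier (free_algebra S) \<Longrightarrow> q \<in> carrier (free_algebra S) \<Longrightarrow> p + q \<in> carrier (free_algebra S)"
  using Poly_Mapping.keys_add[of p q] by (auto simp: fa_carrier_iff)

lemma fa_uminus [simp]: "p \<in> carrier (free_algebra S) \<Longrightarrow> - p \<in> carrier (free_algebra S)"
  by (auto simp: fa_carrier_iff in_keys_iff)

lemma fa_diff [simp]:
  "p \<in> carrier (free_algebra S) \<Longrightarrow> q \<in> carrier (free_algebra S) \<Longrightarrow> p - q \<in> carrier (free_algebra S)"
  using fa_add[of p "- q"] by simp

lemma fa_mult [simp]:
  "p \<in> carrier (free_algebra S) \<Longrightarrow> q \<in> carrier (free_algebra S) \<Longrightarrow> p * q \<in> carrier (free_algebra S)"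
  unfolding fa_carrier_iff
proof
  fix w assume *: "\<forall>w\<in>Poly_Mapping.keys p. set (letters w) \<subseteq> S"
    "\<forall>w\<in>Poly_Mapping.keys q. set (letters w) \<subseteq> S" "w \<in> Poly_Mapping.keys (p * q)"
  then obtain a b where "a \<in> Poly_Mapping.keys p" "b \<in> Poly_Mapping.keys q" "w = a + b"
    using Poly_Mapping.keys_mult[of p q] by blast
  then show "set (letters w) \<subseteq> S" using * by (simp add: plus_word_def)
qed

lemma fa_sum [simp]:
  "(\<And>i. i \<in> T \<Longrightarrow> f i \<in> carrier (free_algebra S)) \<Longrightarrow> sum f T \<in> carrier (free_algebra S)"
  by (induction T rule: infinite_finite_induct) auto

lemma fa_sel [simp]:
  "monoid.mult (free_algebra S) = (*)" "one (free_algebra S) = 1"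
  "ring.zero (free_algebra S) = 0" "add (free_algebra S) = (+)"
  by (simp_all add: free_algebra_def)

lemma fa_ring: "ring (free_algebra S :: ('g word \<Rightarrow>\<^sub>0 'k::field) ring)"
proof (rule ringI)
  show "abelian_group (free_algebra S :: ('g word \<Rightarrow>\<^sub>0 'k) ring)"
    by (rule abelian_groupI) (auto simp: algebra_simps intro!: bexI[of _ "- _"])
  show "Group.monoid (free_algebra S :: ('g word \<Rightarrow>\<^sub>0 'k) ring)"
    by (rule monoidI) (auto simp: algebra_simps)
qed (auto simp: algebra_simps)

lemma fa_a_inv [simp]:
  assumes "p \<in> carrier (free_algebra S)" shows "a_inv (free_algebra S) p = - (p :: 'g word \<Rightarrow>\<^sub>0 'k::field)"
proof -
  interpret ring "free_algebra S :: ('g word \<Rightarrow>\<^sub>0 'k) ring" by (rule fa_ring)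
  show ?thesis using assms by (intro minus_equality) auto
qed

lemma fa_a_minus [simp]:
  "p \<in> carrier (free_algebra S) \<Longrightarrow> q \<in> carrier (free_algebra S) \<Longrightarrow>
    a_minus (free_algebra S) p q = p - (q :: 'g word \<Rightarrow>\<^sub>0 'k::field)"
  by (simp add: a_minus_def)

end

text \<open>Adds the monomials of the support one at a time, so that all partial sums stay in the
  free algebra on \<open>S\<close>.\<close>

lemma poly_word_induct [consumes 1, case_names zero add]:
  fixes p :: "'g word \<Rightarrow>\<^sub>0 'k::field"
  assumes "p \<in> carrier (free_algebra S)" and "P 0"
    and "\<And>w c q. set (letters w) \<subseteq> S \<Longrightarrow> q \<in> carrier (free_algebra S) \<Longrightarrow> P q \<Longrightarrow>
      P (Poly_Mapping.single w c + q)"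
  shows "P p"
proof -
  let ?f = "\<lambda>K. \<Sum>w\<in>K. Poly_Mapping.single w (Poly_Mapping.lookup p w)"
  have "P (?f K) \<and> ?f K \<in> carrier (free_algebra S)" if "K \<subseteq> Poly_Mapping.keys p" for K
    using finite_subset[OF that finite_keys] that
  proof (induction K rule: finite_induct)
    case empty
    then show ?case using assms(2) by (simp add: free_algebra_def)
  next
    case (insert w K)
    have w: "set (letters w) \<subseteq> S" using assms(1) insert by (auto simp: free_algebra_def)
    have "Poly_Mapping.single w (Poly_Mapping.lookup p w) \<in> carrier (free_algebra S)"
      by (rule fa_single[OF w])
    then show ?case using insert assms(3)[OF w] by simp
  qed
  moreover have "?f (Poly_Mapping.keys p) = p"
    by (rule poly_mapping_eqI) (simp add: lookup_sum lookup_single when_def sum.delta in_keys_iff)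
  ultimately show ?thesis by (metis order_refl)
qed

lemma poly_induct [case_names zero add]:
  fixes p :: "'g word \<Rightarrow>\<^sub>0 'k::field"
  assumes "P 0" and "\<And>w c q. P q \<Longrightarrow> P (Poly_Mapping.single w c + q)"
  shows "P p"
  by (rule poly_word_induct[of p UNIV]) (use assms in \<open>auto simp: free_algebra_def\<close>)

lemma single_scalar: "Poly_Mapping.single w c = Poly_Mapping.single 0 c * Poly_Mapping.single w (1::'k::field)"
  for w :: "'g word"
  by (simp add: mult_single)

text \<open>The word \<open>0\<close> is the empty one, so these monomials are the scalars, and they
  are central.\<close>

lemma scalar_commute:
  "Poly_Mapping.single 0 c * p = p * Poly_Mapping.single (0 :: 'g word) (c :: 'k::field)"
  by (induction p rule: poly_induct) (simp_all add: algebra_simps mult_single)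

lemma scalar_left_commute:
  "p * (Poly_Mapping.single 0 c * q) = Poly_Mapping.single (0 :: 'g word) (c :: 'k::field) * (p * q)"
  by (metis scalar_commute mult.assoc)

section \<open>Homogeneous parts in the free algebra\<close>

definition homog :: "int \<Rightarrow> (('v, 'e) lgen word \<Rightarrow>\<^sub>0 'k::field) \<Rightarrow> bool" where
  "homog n p \<longleftrightarrow> (\<forall>w\<in>Poly_Mapping.keys p. word_degree w = n)"

lift_definition hpart :: "int \<Rightarrow> (('v, 'e) lgen word \<Rightarrow>\<^sub>0 'k::field) \<Rightarrow> (('v, 'e) lgen word \<Rightarrow>\<^sub>0 'k)" is
  "\<lambda>n f w. if word_degree w = n then f w else 0"
  by (rule finite_subset[rotated]) auto

lemma word_degree_plus: "word_degree (u + w) = word_degree u + word_degree w"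
  by (simp add: word_degree_def plus_word_def)

lemma word_degree_0 [simp]: "word_degree 0 = 0"
  by (simp add: word_degree_def zero_word_def)

lemma hpart_add: "hpart n (p + q) = hpart n p + hpart n q"
  by (rule poly_mapping_eqI) (simp add: hpart.rep_eq lookup_add)

lemma hpart_zero [simp]: "hpart n 0 = 0"
  by (rule poly_mapping_eqI) (simp add: hpart.rep_eq)

lemma hpart_sum: "hpart n (sum f T) = (\<Sum>i\<in>T. hpart n (f i))"
  by (induction T rule: infinite_finite_induct) (auto simp: hpart_add)

lemma hpart_single: "hpart n (Poly_Mapping.single w c) = (if word_degree w = n then Poly_Mapping.single w c else 0)"
  by (rule poly_mapping_eqI) (auto simp: hpart.rep_eq lookup_single when_def)

lemma hpart_homog: "homog m p \<Longrightarrow> hpart n p = (if m = n then p else 0)"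
  by (rule poly_mapping_eqI) (auto simp: hpart.rep_eq homog_def in_keys_iff)

lemma homog_hpart [simp]: "homog n (hpart n p)"
  by (auto simp: homog_def in_keys_iff hpart.rep_eq split: if_splits)

lemma keys_hpart: "Poly_Mapping.keys (hpart n p) \<subseteq> Poly_Mapping.keys p"
  by (auto simp: in_keys_iff hpart.rep_eq split: if_splits)

lemma fa_hpart [simp]: "p \<in> carrier (free_algebra S) \<Longrightarrow> hpart n p \<in> carrier (free_algebra S)"
  using keys_hpart[of n p] by (auto simp: fa_carrier_iff)

lemma sum_hpart:
  assumes "finite D" "word_degree ` Poly_Mapping.keys p \<subseteq> D" shows "(\<Sum>n\<in>D. hpart n p) = p"
proof (rule poly_mapping_eqI)
  fix w
  show "Poly_Mapping.lookup (\<Sum>n\<in>D. hpart n p) w = Poly_Mapping.lookup p w"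
    using assms by (cases "w \<in> Poly_Mapping.keys p")
      (auto simp: lookup_sum hpart.rep_eq sum.delta' in_keys_iff)
qed

lemma hpart_single_mult:
  "hpart n (Poly_Mapping.single w c * p) = Poly_Mapping.single w c * hpart (n - word_degree w) p"
proof (induction p rule: poly_induct)
  case (add u d q)
  then show ?case
    by (simp add: algebra_simps hpart_add hpart_single mult_single word_degree_plus)
qed simp

lemma hpart_mult_single:
  "hpart n (p * Poly_Mapping.single w c) = hpart (n - word_degree w) p * Poly_Mapping.single w c"
proof (induction p rule: poly_induct)
  case (add u d q)
  then show ?case
    by (simp add: algebra_simps hpart_add hpart_single mult_single word_degree_plus)
qed simp

lemma homog_0 [simp]: "homog n 0" by (simp add: homog_def)

lemma homog_scalar [simp]: "homog 0 (Poly_Mapping.single 0 c)" by (simp add: homog_def)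

lemma homog_1 [simp]: "homog 0 1" by (simp add: homog_def)

lemma homog_gen: "letter_degree g = n \<Longrightarrow> homog n (gen g)"
  by (simp add: homog_def gen_def word_degree_def)

lemma homog_add: "homog n p \<Longrightarrow> homog n q \<Longrightarrow> homog n (p + q)"
  using Poly_Mapping.keys_add[of p q] by (auto simp: homog_def)

lemma homog_uminus: "homog n p \<Longrightarrow> homog n (- p)"
  by (auto simp: homog_def in_keys_iff)

lemma homog_diff: "homog n p \<Longrightarrow> homog n q \<Longrightarrow> homog n (p - q)"
  using homog_add[of n p "- q"] homog_uminus by auto

lemma homog_sum: "(\<And>i. i \<in> T \<Longrightarrow> homog n (f i)) \<Longrightarrow> homog n (sum f T)"
  by (induction T rule: infinite_finite_induct) (auto intro: homog_add)

lemma homog_mult: "homog m p \<Longrightarrow> homog n q \<Longrightarrow> m + n = k \<Longrightarrow> homog k (p * q)"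
  unfolding homog_def
proof
  fix w assume *: "\<forall>w\<in>Poly_Mapping.keys p. word_degree w = m"
    "\<forall>w\<in>Poly_Mapping.keys q. word_degree w = n" "m + n = k" "w \<in> Poly_Mapping.keys (p * q)"
  then obtain a b where "a \<in> Poly_Mapping.keys p" "b \<in> Poly_Mapping.keys q" "w = a + b"
    using Poly_Mapping.keys_mult[of p q] by blast
  then show "word_degree w = k" using * by (simp add: word_degree_plus)
qed

section \<open>The Leavitt ideal and its quotient\<close>

locale leavitt = leavitt_graph G for G :: "('v, 'e) pre_digraph" +
  fixes K :: "'k::field itself"
begin

abbreviation FA :: "(('v, 'e) lgen word \<Rightarrow>\<^sub>0 'k) ring" where "FA \<equiv> free_algebra (leavitt_gens G)"
abbreviation LI :: "(('v, 'e) lgen word \<Rightarrow>\<^sub>0 'k) set" where "LI \<equiv> leavitt_ideal G"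
abbreviation LA :: "('k, (('v, 'e) lgen word \<Rightarrow>\<^sub>0 'k) set) galgebra" where "LA \<equiv> leavitt_algebra K G"
abbreviation proj :: "(('v, 'e) lgen word \<Rightarrow>\<^sub>0 'k) \<Rightarrow> (('v, 'e) lgen word \<Rightarrow>\<^sub>0 'k) set" where
  "proj \<equiv> a_r_coset FA LI"
abbreviation vx :: "'v \<Rightarrow> (('v, 'e) lgen word \<Rightarrow>\<^sub>0 'k)" where "vx v \<equiv> gen (Vert v)"
abbreviation ed :: "'e \<Rightarrow> (('v, 'e) lgen word \<Rightarrow>\<^sub>0 'k)" where "ed e \<equiv> gen (Edge e)"
abbreviation gh :: "'e \<Rightarrow> (('v, 'e) lgen word \<Rightarrow>\<^sub>0 'k)" where "gh e \<equiv> gen (Ghost e)"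
abbreviation scl :: "'k \<Rightarrow> (('v, 'e) lgen word \<Rightarrow>\<^sub>0 'k)" where "scl c \<equiv> Poly_Mapping.single 0 c"

lemma gens [simp]:
  "Vert v \<in> leavitt_gens G \<longleftrightarrow> v \<in> verts G"
  "Edge e \<in> leavitt_gens G \<longleftrightarrow> e \<in> arcs G"
  "Ghost e \<in> leavitt_gens G \<longleftrightarrow> e \<in> arcs G"
  by (auto simp: leavitt_gens_def)

sublocale FA: ring FA by (rule fa_ring)

lemma relations_carrier: "leavitt_relations G \<subseteq> carrier FA"
  unfolding leavitt_relations_def by (auto intro!: fa_diff fa_sum fa_mult fa_gen simp: is_regular_def)

sublocale LI: ideal LI FA
  unfolding leavitt_ideal_def by (rule FA.genideal_ideal[OF relations_carrier])

lemma relations_LI: "leavitt_relations G \<subseteq> LI"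
  unfolding leavitt_ideal_def by (rule FA.genideal_self[OF relations_carrier])

lemma LI_mult_left [simp]: "p \<in> LI \<Longrightarrow> a \<in> carrier FA \<Longrightarrow> a * p \<in> LI"
  using LI.I_l_closed by fastforce

lemma LI_mult_right [simp]: "p \<in> LI \<Longrightarrow> a \<in> carrier FA \<Longrightarrow> p * a \<in> LI"
  using LI.I_r_closed by fastforce

lemma LI_add [simp]: "p \<in> LI \<Longrightarrow> q \<in> LI \<Longrightarrow> p + q \<in> LI"
  using LI.a_closed by fastforce

lemma LI_zero [simp]: "0 \<in> LI"
  using LI.zero_closed by simp

lemma LI_uminus [simp]: "p \<in> LI \<Longrightarrow> - p \<in> LI"
  using LI.a_inv_closed[of p] by simp

text \<open>Turns a claim about the whole ideal into a check on the relations: elements with a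
  property that survives sums and multiplication from both sides form an ideal. Closure under
  negation comes from multiplying by \<open>- 1\<close>.\<close>

lemma LI_minimal:
  assumes "J \<subseteq> carrier FA" "0 \<in> J" "\<And>p q. p \<in> J \<Longrightarrow> q \<in> J \<Longrightarrow> p + q \<in> J"
    and l: "\<And>p a. p \<in> J \<Longrightarrow> a \<in> carrier FA \<Longrightarrow> a * p \<in> J"
    and "\<And>p a. p \<in> J \<Longrightarrow> a \<in> carrier FA \<Longrightarrow> p * a \<in> J" "leavitt_relations G \<subseteq> J"
  shows "LI \<subseteq> J"
  unfolding leavitt_ideal_def
proof (rule FA.genideal_minimal)
  show "ideal J FA"
  proof (rule idealI)
    show "subgroup J (add_monoid FA)"
    proof
      fix p assume p: "p \<in> J"
      have "- p \<in> J" using l[OF p, of "- 1"] by simp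
      moreover have "inv\<^bsub>add_monoid FA\<^esub> p = - p"
        using fa_a_inv[of p "leavitt_gens G"] p assms(1) by (auto simp: a_inv_def)
      ultimately show "inv\<^bsub>add_monoid FA\<^esub> p \<in> J" by simp
    qed (use assms in auto)
  qed (use assms fa_ring in auto)
qed (use assms in auto)

text \<open>Membership in the free algebra is part of the relation, so that chains of congruences
  carry it along.\<close>

definition cong :: "(('v, 'e) lgen word \<Rightarrow>\<^sub>0 'k) \<Rightarrow> (('v, 'e) lgen word \<Rightarrow>\<^sub>0 'k) \<Rightarrow> bool" (infix \<open>\<doteq>\<close> 50) where
  "p \<doteq> q \<longleftrightarrow> p \<in> carrier FA \<and> q \<in> carrier FA \<and> p - q \<in> LI"

lemma cong_carrier: "p \<doteq> q \<Longrightarrow> p \<in> carrier FA" "p \<doteq> q \<Longrightarrow> q \<in> carrier FA"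
  by (auto simp: cong_def)

lemma cong_refl [simp]: "p \<in> carrier FA \<Longrightarrow> p \<doteq> p" by (simp add: cong_def)

lemma cong_sym: "p \<doteq> q \<Longrightarrow> q \<doteq> p"
  using LI_uminus[of "p - q"] by (simp add: cong_def)

lemma cong_trans [trans]: assumes "p \<doteq> q" "q \<doteq> r" shows "p \<doteq> r"
  using LI_add[of "p - q" "q - r"] assms by (simp add: cong_def)

lemma cong_eq_trans [trans]: "p \<doteq> q \<Longrightarrow> q = r \<Longrightarrow> p \<doteq> r" "p = q \<Longrightarrow> q \<doteq> r \<Longrightarrow> p \<doteq> r" by auto

lemma cong_add: assumes "p \<doteq> q" "p' \<doteq> q'" shows "p + p' \<doteq> q + q'"
  using LI_add[of "p - q" "p' - q'"] assms by (simp add: cong_def algebra_simps)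

lemma cong_sum: "(\<And>i. i \<in> S \<Longrightarrow> f i \<doteq> g i) \<Longrightarrow> sum f S \<doteq> sum g S"
  by (induction S rule: infinite_finite_induct) (auto intro: cong_add)

lemma cong_mult: assumes "p \<doteq> q" "p' \<doteq> q'" shows "p * p' \<doteq> q * q'"
proof -
  have "p * (p' - q') \<in> LI" "(p - q) * q' \<in> LI"
    using assms by (auto simp: cong_def)
  then have "p * (p' - q') + (p - q) * q' \<in> LI" by simp
  then show ?thesis using assms by (simp add: cong_def algebra_simps)
qed

lemma cong_mult_left: "p \<doteq> q \<Longrightarrow> a \<in> carrier FA \<Longrightarrow> a * p \<doteq> a * q"
  by (rule cong_mult) auto

lemma cong_mult_right: "p \<doteq> q \<Longrightarrow> a \<in> carrier FA \<Longrightarrow> p * a \<doteq> q * a"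
  by (rule cong_mult) auto

lemma cong_0_iff: "p \<doteq> 0 \<longleftrightarrow> p \<in> LI"
  by (auto simp: cong_def)

lemma relation_cong:
  "p - q \<in> leavitt_relations G \<Longrightarrow> p \<in> carrier FA \<Longrightarrow> q \<in> carrier FA \<Longrightarrow> p \<doteq> q"
  using relations_LI by (auto simp: cong_def)

lemma VV: "v \<in> verts G \<Longrightarrow> w \<in> verts G \<Longrightarrow> vx v * vx w \<doteq> (if v = w then vx v else 0)"
  by (rule relation_cong) (auto simp: leavitt_relations_def)

lemma VX: "e \<in> arcs G \<Longrightarrow> vx (tail G e) * ed e \<doteq> ed e"
  by (rule relation_cong) (auto simp: leavitt_relations_def)

lemma XV: "e \<in> arcs G \<Longrightarrow> ed e * vx (head G e) \<doteq> ed e"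
  by (rule relation_cong) (auto simp: leavitt_relations_def)

lemma VY: "e \<in> arcs G \<Longrightarrow> vx (head G e) * gh e \<doteq> gh e"
  by (rule relation_cong) (auto simp: leavitt_relations_def)

lemma YV: "e \<in> arcs G \<Longrightarrow> gh e * vx (tail G e) \<doteq> gh e"
  by (rule relation_cong) (auto simp: leavitt_relations_def)

lemma YX: "e \<in> arcs G \<Longrightarrow> f \<in> arcs G \<Longrightarrow> gh e * ed f \<doteq> (if e = f then vx (head G e) else 0)"
  by (rule relation_cong) (auto simp: leavitt_relations_def)

lemma is_regular_iff: "is_regular G v \<longleftrightarrow> v \<in> verts G"
  using out_arcs_nonempty by (auto simp: is_regular_def is_sink_def)

lemma sum_XY: "v \<in> verts G \<Longrightarrow> (\<Sum>e\<in>out_arcs G v. ed e * gh e) \<doteq> vx v"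
  by (rule relation_cong)
    (auto simp: leavitt_relations_def is_regular_iff intro!: fa_sum fa_mult fa_gen)

lemma sum_V: "(\<Sum>v\<in>verts G. vx v) \<doteq> 1"
  by (rule relation_cong) (auto simp: leavitt_relations_def)

lemma VV' : "v \<in> verts G \<Longrightarrow> vx v * vx v \<doteq> vx v" using VV[of v v] by simp

lemma VV_ne: "v \<in> verts G \<Longrightarrow> w \<in> verts G \<Longrightarrow> v \<noteq> w \<Longrightarrow> vx v * vx w \<doteq> 0" using VV[of v w] by simp

lemma relation_homog:
  fixes p :: "('v, 'e) lgen word \<Rightarrow>\<^sub>0 'k"
  assumes p: "p \<in> leavitt_relations G" shows "\<exists>n. homog n p"
proof -
  have *: "homog 0 (vx v)" "homog 1 (ed e)" "homog (- 1) (gh e)" for v e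
    by (auto intro: homog_gen)
  have **: "homog 0 (vx v * vx w)" "homog 1 (vx v * ed e)" "homog 1 (ed e * vx v)"
    "homog (- 1) (vx v * gh e)" "homog (- 1) (gh e * vx v)" "homog 0 (gh e * ed f)" "homog 0 (ed e * gh f)"
    for v w e f
    by (rule homog_mult[OF *(1) *(1)] homog_mult[OF *(1) *(2)] homog_mult[OF *(2) *(1)]
      homog_mult[OF *(1) *(3)] homog_mult[OF *(3) *(1)] homog_mult[OF *(3) *(2)] homog_mult[OF *(2) *(3)], simp)+
  have "homog 0 p \<or> homog 1 p \<or> homog (- 1) p"
    using p unfolding leavitt_relations_def
    by (elim UnE) (auto simp: * ** homog_diff homog_sum)
  then show ?thesis by blast
qed

text \<open>The ideal is graded because its generators are homogeneous: the elements all of whose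
  homogeneous parts lie in it form an ideal that contains the relations.\<close>

lemma LI_hpart: assumes "p \<in> LI" shows "hpart n p \<in> LI"
proof -
  have "LI \<subseteq> {p \<in> carrier FA. \<forall>n. hpart n p \<in> LI}"
  proof (rule LI_minimal)
    fix p a assume p: "p \<in> {p \<in> carrier FA. \<forall>n. hpart n p \<in> LI}" and a: "a \<in> carrier FA"
    show "a * p \<in> {p \<in> carrier FA. \<forall>n. hpart n p \<in> LI}"
      using a
    proof (induction a rule: poly_word_induct)
      case (add w c q)
      then show ?case using p fa_single[OF add(1), of c]
        by (auto simp: algebra_simps hpart_add hpart_single_mult intro!: LI_add)
    qed simp
    show "p * a \<in> {p \<in> carrier FA. \<forall>n. hpart n p \<in> LI}"
      using a
    proof (induction a rule: poly_word_induct)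
      case (add w c q)
      then show ?case using p fa_single[OF add(1), of c]
        by (auto simp: algebra_simps hpart_add hpart_mult_single intro!: LI_add)
    qed simp
  next
    show "leavitt_relations G \<subseteq> {p \<in> carrier FA. \<forall>n. hpart n p \<in> LI}"
    proof
      fix p :: "('v, 'e) lgen word \<Rightarrow>\<^sub>0 'k" assume p: "p \<in> leavitt_relations G"
      then obtain m where "homog m p" using relation_homog by blast
      then show "p \<in> {p \<in> carrier FA. \<forall>n. hpart n p \<in> LI}"
        using p relations_carrier relations_LI by (auto simp: hpart_homog)
    qed
  qed (auto simp: hpart_add)
  then show ?thesis using assms by auto
qed

lemma proj_eq_iff: "p \<in> carrier FA \<Longrightarrow> q \<in> carrier FA \<Longrightarrow> proj p = proj q \<longleftrightarrow> p \<doteq> q"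
  using FA.quotient_eq_iff_same_a_r_cos[OF LI.is_ideal, of p q] by (simp add: cong_def)

lemma LA_sel:
  "carrier LA = carrier (FA Quot LI)" "monoid.mult LA = monoid.mult (FA Quot LI)"
  "one LA = one (FA Quot LI)" "ring.zero LA = ring.zero (FA Quot LI)" "add LA = add (FA Quot LI)"
  "smult LA = (\<lambda>c x. \<Union>p \<in> x. proj (scl c * p))"
  "hcomp LA n = proj ` {p \<in> carrier FA. homog n p}"
  by (simp_all add: leavitt_algebra_def Let_def homog_def)

lemma carrier_LA: "carrier LA = proj ` carrier FA"
  by (auto simp: LA_sel FactRing_def A_RCOSETS_def RCOSETS_def a_r_coset_def)

lemma proj_closed [simp]: "p \<in> carrier FA \<Longrightarrow> proj p \<in> carrier LA" by (simp add: carrier_LA)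

lemma proj_mult: "p \<in> carrier FA \<Longrightarrow> q \<in> carrier FA \<Longrightarrow> proj p \<otimes>\<^bsub>LA\<^esub> proj q = proj (p * q)"
  using LI.rcoset_mult_add[of p q] by (simp add: LA_sel FactRing_def)

lemma proj_add: "p \<in> carrier FA \<Longrightarrow> q \<in> carrier FA \<Longrightarrow> proj p \<oplus>\<^bsub>LA\<^esub> proj q = proj (p + q)"
  using LI.a_rcos_sum[of p q] by (simp add: LA_sel FactRing_def)

lemma one_LA: "\<one>\<^bsub>LA\<^esub> = proj 1" by (simp add: LA_sel FactRing_def)

lemma zero_LA: "\<zero>\<^bsub>LA\<^esub> = proj 0"
  using FA.a_rcos_zero[OF LI.is_ideal LI_zero] by (simp add: LA_sel FactRing_def)

lemma proj_refl: "p \<in> carrier FA \<Longrightarrow> p \<in> proj p"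
  by (rule LI.a_rcos_self) simp

lemma mem_projD: assumes "q \<in> proj p" "p \<in> carrier FA" shows "q \<doteq> p"
proof -
  obtain i where "i \<in> LI" "q = i + p" using assms by (auto simp: a_r_coset_def')
  then show ?thesis using assms by (simp add: cong_def)
qed

text \<open>All representatives of the coset lead to the same coset, so the union that defines
  \<open>smult\<close> collapses.\<close>

lemma smult_proj: assumes "p \<in> carrier FA" shows "c \<odot>\<^bsub>LA\<^esub> proj p = proj (scl c * p)"
proof -
  have "proj (scl c * q) = proj (scl c * p)" if "q \<in> proj p" for q
    using cong_mult_left[OF mem_projD[OF that assms], of "scl c"] mem_projD[OF that assms]
    by (subst proj_eq_iff) (auto dest: cong_carrier)
  then have "(\<Union>q\<in>proj p. proj (scl c * q)) = proj (scl c * p)" using proj_refl[OF assms] by blast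
  then show ?thesis by (simp only: LA_sel)
qed

lemma smult_one: "c \<odot>\<^bsub>LA\<^esub> \<one>\<^bsub>LA\<^esub> = proj (scl c)"
  by (simp add: one_LA smult_proj)

sublocale LA: ring LA
proof (rule ringI)
  show "abelian_group LA"
  proof (rule abelian_groupI)
    fix x assume "x \<in> carrier LA"
    then obtain p where "p \<in> carrier FA" "x = proj p" by (auto simp: carrier_LA)
    then show "\<exists>y\<in>carrier LA. y \<oplus>\<^bsub>LA\<^esub> x = \<zero>\<^bsub>LA\<^esub>"
      by (intro bexI[of _ "proj (- p)"]) (auto simp: proj_add zero_LA)
  qed (auto simp: carrier_LA proj_add zero_LA algebra_simps)
  show "Group.monoid LA"
    by (rule monoidI) (auto simp: carrier_LA proj_mult one_LA algebra_simps)
qed (auto simp: carrier_LA proj_mult proj_add algebra_simps)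

end

section \<open>Modules over the Leavitt path algebra\<close>

lemma (in abelian_group) finsum_swap:
  assumes "\<And>i j. i \<in> I \<Longrightarrow> j \<in> J \<Longrightarrow> f i j \<in> carrier G" and "finite I" "finite J"
  shows "(\<Oplus>i\<in>I. \<Oplus>j\<in>J. f i j) = (\<Oplus>j\<in>J. \<Oplus>i\<in>I. f i j)"
  using assms(2,1)
proof (induction I rule: finite_induct)
  case empty
  then show ?case by simp
next
  case (insert a I)
  have "(\<Oplus>j\<in>J. \<Oplus>i\<in>insert a I. f i j) = (\<Oplus>j\<in>J. f a j \<oplus> (\<Oplus>i\<in>I. f i j))"
    using insert by (intro finsum_cong') auto
  also have "\<dots> = (\<Oplus>j\<in>J. f a j) \<oplus> (\<Oplus>j\<in>J. \<Oplus>i\<in>I. f i j)"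
    using insert by (intro finsum_addf) auto
  also have "(\<Oplus>j\<in>J. \<Oplus>i\<in>I. f i j) = (\<Oplus>i\<in>I. \<Oplus>j\<in>J. f i j)"
    using insert by simp
  also have "(\<Oplus>j\<in>J. f a j) \<oplus> (\<Oplus>i\<in>I. \<Oplus>j\<in>J. f i j) = (\<Oplus>i\<in>insert a I. \<Oplus>j\<in>J. f i j)"
    using insert by (intro finsum_insert[symmetric]) (auto intro!: finsum_closed)
  finally show ?case by simp
qed

lemma (in abelian_group) finsum_single:
  assumes "finite I" "i \<in> I" "x \<in> carrier G"
  shows "(\<Oplus>j\<in>I. if j = i then x else \<zero>) = x"
  using add.finprod_singleton_swap[OF assms(2,1), of "\<lambda>_. x"] assms(3) by simp

lemma (in abelian_group) finsum_all_zero: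
  "(\<And>i. i \<in> I \<Longrightarrow> f i = \<zero>) \<Longrightarrow> (\<Oplus>i\<in>I. f i) = \<zero>"
  by (rule add.finprod_one_eqI)

context leavitt
begin

abbreviation act ::
  "((('v, 'e) lgen word \<Rightarrow>\<^sub>0 'k) set, 'm, 'z) rmodule_scheme \<Rightarrow> 'm \<Rightarrow> (('v, 'e) lgen word \<Rightarrow>\<^sub>0 'k) \<Rightarrow> 'm"
  where "act M x p \<equiv> ract M x (proj p)"

text \<open>Every element of the algebra is the class of an element of the free algebra, so the
  axioms can be checked on representatives through \<open>act\<close>.\<close>

lemma right_moduleI:
  fixes M :: "((('v, 'e) lgen word \<Rightarrow>\<^sub>0 'k) set, 'm, 'z) rmodule_scheme"
  assumes "abelian_group M"
    and "\<And>x p. x \<in> carrier M \<Longrightarrow> p \<in> carrier FA \<Longrightarrow> act M x p \<in> carrier M"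
    and "\<And>x y p. x \<in> carrier M \<Longrightarrow> y \<in> carrier M \<Longrightarrow> p \<in> carrier FA \<Longrightarrow>
      act M (x \<oplus>\<^bsub>M\<^esub> y) p = act M x p \<oplus>\<^bsub>M\<^esub> act M y p"
    and "\<And>x p q. x \<in> carrier M \<Longrightarrow> p \<in> carrier FA \<Longrightarrow> q \<in> carrier FA \<Longrightarrow>
      act M x (p + q) = act M x p \<oplus>\<^bsub>M\<^esub> act M x q"
    and "\<And>x p q. x \<in> carrier M \<Longrightarrow> p \<in> carrier FA \<Longrightarrow> q \<in> carrier FA \<Longrightarrow>
      act M x (p * q) = act M (act M x p) q"
    and "\<And>x. x \<in> carrier M \<Longrightarrow> act M x 1 = x"
  shows "right_module LA M"
proof -
  interpret M: abelian_group M by fact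
  show ?thesis
    by unfold_locales (use assms in \<open>auto simp: carrier_LA proj_add proj_mult one_LA\<close>)
qed

context
  fixes M :: "((('v, 'e) lgen word \<Rightarrow>\<^sub>0 'k) set, 'm, 'z) rmodule_scheme"
  assumes M: "right_module LA M"
begin

lemma module_abelian_group: "abelian_group M"
  using M right_module.axioms(2) by blast

interpretation M: abelian_group M by (rule module_abelian_group)

lemma act_closed [simp]: "x \<in> carrier M \<Longrightarrow> p \<in> carrier FA \<Longrightarrow> act M x p \<in> carrier M"
  using right_module.ract_closed[OF M] by simp

lemma act_add_left:
  "x \<in> carrier M \<Longrightarrow> y \<in> carrier M \<Longrightarrow> p \<in> carrier FA \<Longrightarrow>
    act M (x \<oplus>\<^bsub>M\<^esub> y) p = act M x p \<oplus>\<^bsub>M\<^esub> act M y p"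
  using right_module.ract_add_left[OF M] by simp

lemma act_add:
  "x \<in> carrier M \<Longrightarrow> p \<in> carrier FA \<Longrightarrow> q \<in> carrier FA \<Longrightarrow>
    act M x (p + q) = act M x p \<oplus>\<^bsub>M\<^esub> act M x q"
  using right_module.ract_add_right[OF M, of x "proj p" "proj q"] by (simp add: proj_add)

lemma act_mult:
  "x \<in> carrier M \<Longrightarrow> p \<in> carrier FA \<Longrightarrow> q \<in> carrier FA \<Longrightarrow> act M x (p * q) = act M (act M x p) q"
  using right_module.ract_assoc[OF M, of x "proj p" "proj q"] by (simp add: proj_mult)

lemma act_one [simp]: "x \<in> carrier M \<Longrightarrow> act M x 1 = x"
  using right_module.ract_one[OF M] by (simp add: one_LA)

lemma act_cong: "p \<doteq> q \<Longrightarrow> act M x p = act M x q"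
  using proj_eq_iff[of p q] cong_carrier[of p q] by simp

lemma act_zero [simp]: "x \<in> carrier M \<Longrightarrow> act M x 0 = \<zero>\<^bsub>M\<^esub>"
  using act_add[of x 0 0] M.add.l_cancel_one[of "act M x 0" "act M x 0"] by simp

lemma act_zero_left [simp]: "p \<in> carrier FA \<Longrightarrow> act M \<zero>\<^bsub>M\<^esub> p = \<zero>\<^bsub>M\<^esub>"
  using act_add_left[of "\<zero>\<^bsub>M\<^esub>" "\<zero>\<^bsub>M\<^esub>" p] M.add.l_cancel_one[of "act M \<zero>\<^bsub>M\<^esub> p" "act M \<zero>\<^bsub>M\<^esub> p"]
  by simp

lemma act_LI: "x \<in> carrier M \<Longrightarrow> p \<in> LI \<Longrightarrow> act M x p = \<zero>\<^bsub>M\<^esub>"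
  using act_cong[of p 0 x] by (simp add: cong_0_iff)

lemma act_uminus: assumes "x \<in> carrier M" "p \<in> carrier FA" shows "act M x (- p) = \<ominus>\<^bsub>M\<^esub> act M x p"
  using M.minus_equality[of "act M x (- p)" "act M x p"] act_add[of x "- p" p] assms by simp

lemma act_sum:
  "x \<in> carrier M \<Longrightarrow> (\<And>i. i \<in> S \<Longrightarrow> f i \<in> carrier FA) \<Longrightarrow>
    act M x (sum f S) = (\<Oplus>\<^bsub>M\<^esub>i\<in>S. act M x (f i))"
  by (induction S rule: infinite_finite_induct) (auto simp: act_add Pi_def)

lemma act_finsum:
  "p \<in> carrier FA \<Longrightarrow> (\<And>i. i \<in> S \<Longrightarrow> f i \<in> carrier M) \<Longrightarrow>
    act M (finsum M f S) p = (\<Oplus>\<^bsub>M\<^esub>i\<in>S. act M (f i) p)"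
  by (induction S rule: infinite_finite_induct) (auto simp: act_add_left Pi_def)

lemma vertex_decomposition: assumes "x \<in> carrier M" shows "x = (\<Oplus>\<^bsub>M\<^esub>v\<in>verts G. act M x (vx v))"
proof -
  have "x = act M x (\<Sum>v\<in>verts G. vx v)" using act_cong[OF sum_V, of x] assms by simp
  also have "\<dots> = (\<Oplus>\<^bsub>M\<^esub>v\<in>verts G. act M x (vx v))" by (rule act_sum) (use assms in auto)
  finally show ?thesis .
qed

end

section \<open>Linear combinations with coefficients in the free algebra\<close>

abbreviation comb ::
  "((('v, 'e) lgen word \<Rightarrow>\<^sub>0 'k) set, 'm, 'z) rmodule_scheme \<Rightarrow> 'i set \<Rightarrow> ('i \<Rightarrow> 'm) \<Rightarrow>
    ('i \<Rightarrow> (('v, 'e) lgen word \<Rightarrow>\<^sub>0 'k)) \<Rightarrow> 'm" where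
  "comb M I b p \<equiv> (\<Oplus>\<^bsub>M\<^esub>i\<in>I. act M (b i) (p i))"

context
  fixes M :: "((('v, 'e) lgen word \<Rightarrow>\<^sub>0 'k) set, 'm, 'z) rmodule_scheme"
    and I :: "'i set" and b :: "'i \<Rightarrow> 'm"
  assumes M: "right_module LA M" and b: "b \<in> I \<rightarrow> carrier M"
begin

interpretation M: abelian_group M by (rule module_abelian_group[OF M])

lemma b_closed [simp]: "i \<in> I \<Longrightarrow> b i \<in> carrier M" using b by auto

lemma comb_closed: "p \<in> I \<rightarrow> carrier FA \<Longrightarrow> comb M I b p \<in> carrier M"
  by (rule M.finsum_closed) (auto simp: Pi_def act_closed[OF M])

lemma comb_add:
  "p \<in> I \<rightarrow> carrier FA \<Longrightarrow> q \<in> I \<rightarrow> carrier FA \<Longrightarrow>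
    comb M I b (\<lambda>i. p i + q i) = comb M I b p \<oplus>\<^bsub>M\<^esub> comb M I b q"
proof -
  assume pq: "p \<in> I \<rightarrow> carrier FA" "q \<in> I \<rightarrow> carrier FA"
  then have "comb M I b (\<lambda>i. p i + q i) = (\<Oplus>\<^bsub>M\<^esub>i\<in>I. act M (b i) (p i) \<oplus>\<^bsub>M\<^esub> act M (b i) (q i))"
    by (intro M.finsum_cong') (auto simp: Pi_def act_closed[OF M] act_add[OF M])
  also have "\<dots> = comb M I b p \<oplus>\<^bsub>M\<^esub> comb M I b q"
    using pq by (intro M.finsum_addf) (auto simp: Pi_def act_closed[OF M])
  finally show ?thesis .
qed

lemma comb_uminus:
  assumes "p \<in> I \<rightarrow> carrier FA" shows "comb M I b (\<lambda>i. - p i) = \<ominus>\<^bsub>M\<^esub> comb M I b p"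
proof -
  have "comb M I b (\<lambda>i. - p i) \<oplus>\<^bsub>M\<^esub> comb M I b p = comb M I b (\<lambda>i. - p i + p i)"
    using assms by (intro comb_add[symmetric]) (auto simp: Pi_def)
  also have "\<dots> = \<zero>\<^bsub>M\<^esub>" by (rule M.finsum_all_zero) (auto simp: Pi_def act_zero[OF M])
  finally show ?thesis using assms by (intro M.minus_equality[symmetric]) (auto simp: Pi_def intro!: comb_closed)
qed

lemma comb_diff:
  assumes "p \<in> I \<rightarrow> carrier FA" "q \<in> I \<rightarrow> carrier FA"
  shows "comb M I b (\<lambda>i. p i - q i) = comb M I b p \<ominus>\<^bsub>M\<^esub> comb M I b q"
  using comb_add[of p "\<lambda>i. - q i"] comb_uminus[of q] assms by (simp add: a_minus_def Pi_def)

lemma comb_act: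
  assumes "p \<in> I \<rightarrow> carrier FA" "q \<in> carrier FA"
  shows "act M (comb M I b p) q = comb M I b (\<lambda>i. p i * q)"
  using assms by (subst act_finsum[OF M]) (auto simp: Pi_def act_closed[OF M] act_mult[OF M] intro!: M.finsum_cong')

lemma comb_cong:
  assumes "\<And>i. i \<in> I \<Longrightarrow> p i \<doteq> q i" shows "comb M I b p = comb M I b q"
proof -
  have "q i \<in> carrier FA" if "i \<in> I" for i using cong_carrier[OF assms[OF that]] by blast
  then show ?thesis
    by (intro M.finsum_cong') (auto simp: Pi_def act_closed[OF M] intro!: act_cong[OF M] assms)
qed

lemma comb_sum:
  assumes "\<And>i j. i \<in> I \<Longrightarrow> j \<in> J \<Longrightarrow> p i j \<in> carrier FA" "finite I" "finite J"
  shows "comb M I b (\<lambda>i. \<Sum>j\<in>J. p i j) = (\<Oplus>\<^bsub>M\<^esub>j\<in>J. comb M I b (\<lambda>i. p i j))"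
proof -
  have "comb M I b (\<lambda>i. \<Sum>j\<in>J. p i j) = (\<Oplus>\<^bsub>M\<^esub>i\<in>I. \<Oplus>\<^bsub>M\<^esub>j\<in>J. act M (b i) (p i j))"
    using assms by (intro M.finsum_cong') (auto simp: Pi_def act_closed[OF M] intro!: act_sum[OF M] M.finsum_closed)
  also have "\<dots> = (\<Oplus>\<^bsub>M\<^esub>j\<in>J. comb M I b (\<lambda>i. p i j))"
    using assms by (intro M.finsum_swap) (auto simp: Pi_def act_closed[OF M])
  finally show ?thesis .
qed

lemma comb_single:
  assumes "finite I" "i \<in> I" "p \<in> carrier FA"
  shows "comb M I b (\<lambda>j. if j = i then p else 0) = act M (b i) p"
proof -
  have "comb M I b (\<lambda>j. if j = i then p else 0) = (\<Oplus>\<^bsub>M\<^esub>j\<in>I. if j = i then act M (b i) p else \<zero>\<^bsub>M\<^esub>)"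
    using assms by (intro M.finsum_cong') (auto simp: Pi_def act_closed[OF M] act_zero[OF M])
  then show ?thesis using assms by (simp add: M.finsum_single act_closed[OF M])
qed

text \<open>Substituting combinations of \<open>b\<close> into a combination of \<open>c\<close>
  multiplies the coefficient matrices.\<close>

lemma comb_comb:
  assumes "finite I" "finite J" "\<And>j. j \<in> J \<Longrightarrow> c j = comb M I b (\<lambda>i. p i j)"
    and "\<And>i j. i \<in> I \<Longrightarrow> j \<in> J \<Longrightarrow> p i j \<in> carrier FA" and q: "\<And>j. j \<in> J \<Longrightarrow> q j \<in> carrier FA"
  shows "comb M J c q = comb M I b (\<lambda>i. \<Sum>j\<in>J. p i j * q j)"
proof -
  have "comb M J c q = (\<Oplus>\<^bsub>M\<^esub>j\<in>J. comb M I b (\<lambda>i. p i j * q j))"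
    using assms by (intro M.finsum_cong') (auto simp: Pi_def comb_act Pi_def intro!: comb_closed)
  also have "\<dots> = comb M I b (\<lambda>i. \<Sum>j\<in>J. p i j * q j)"
    using assms by (intro comb_sum[symmetric]) auto
  finally show ?thesis .
qed

end

section \<open>Module homomorphisms\<close>

lemma hom_closed: "f \<in> rmod_hom LA M N \<Longrightarrow> x \<in> carrier M \<Longrightarrow> f x \<in> carrier N"
  by (auto simp: rmod_hom_def)

lemma hom_add: "f \<in> rmod_hom LA M N \<Longrightarrow> x \<in> carrier M \<Longrightarrow> y \<in> carrier M \<Longrightarrow> f (x \<oplus>\<^bsub>M\<^esub> y) = f x \<oplus>\<^bsub>N\<^esub> f y"
  by (auto simp: rmod_hom_def)

lemma hom_act: "f \<in> rmod_hom LA M N \<Longrightarrow> x \<in> carrier M \<Longrightarrow> p \<in> carrier FA \<Longrightarrow> f (act M x p) = act N (f x) p"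
  by (auto simp: rmod_hom_def)

lemma rmod_homI:
  assumes "f \<in> extensional (carrier M)" "\<And>x. x \<in> carrier M \<Longrightarrow> f x \<in> carrier N"
    "\<And>x y. x \<in> carrier M \<Longrightarrow> y \<in> carrier M \<Longrightarrow> f (x \<oplus>\<^bsub>M\<^esub> y) = f x \<oplus>\<^bsub>N\<^esub> f y"
    "\<And>x p. x \<in> carrier M \<Longrightarrow> p \<in> carrier FA \<Longrightarrow> f (act M x p) = act N (f x) p"
  shows "f \<in> rmod_hom LA M N"
  using assms by (auto simp: rmod_hom_def carrier_LA PiE_def)

lemma gr_homD: "f \<in> gr_hom LA M N \<Longrightarrow> f \<in> rmod_hom LA M N"
  "f \<in> gr_hom LA M N \<Longrightarrow> x \<in> gcomp M i \<Longrightarrow> f x \<in> gcomp N i"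
  by (auto simp: gr_hom_def)

lemma gr_homI: "f \<in> rmod_hom LA M N \<Longrightarrow> (\<And>x i. x \<in> gcomp M i \<Longrightarrow> f x \<in> gcomp N i) \<Longrightarrow> f \<in> gr_hom LA M N"
  by (auto simp: gr_hom_def)

context
  fixes M :: "((('v, 'e) lgen word \<Rightarrow>\<^sub>0 'k) set, 'm, 'y) rmodule_scheme"
    and N :: "((('v, 'e) lgen word \<Rightarrow>\<^sub>0 'k) set, 'n, 'z) rmodule_scheme" and f
  assumes M: "right_module LA M" and N: "right_module LA N" and f: "f \<in> rmod_hom LA M N"
begin

interpretation M: abelian_group M by (rule module_abelian_group[OF M])
interpretation N: abelian_group N by (rule module_abelian_group[OF N])

lemma hom_zero: "f \<zero>\<^bsub>M\<^esub> = \<zero>\<^bsub>N\<^esub>"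
  using hom_add[OF f, of "\<zero>\<^bsub>M\<^esub>" "\<zero>\<^bsub>M\<^esub>"] hom_closed[OF f, of "\<zero>\<^bsub>M\<^esub>"]
    N.add.l_cancel_one[of "f \<zero>\<^bsub>M\<^esub>" "f \<zero>\<^bsub>M\<^esub>"] by simp

lemma hom_finsum:
  "(\<And>i. i \<in> S \<Longrightarrow> g i \<in> carrier M) \<Longrightarrow> f (finsum M g S) = (\<Oplus>\<^bsub>N\<^esub>i\<in>S. f (g i))"
  by (induction S rule: infinite_finite_induct)
    (auto simp: hom_zero hom_add[OF f] hom_closed[OF f] Pi_def)

lemma hom_comb:
  assumes "b \<in> I \<rightarrow> carrier M" "p \<in> I \<rightarrow> carrier FA"
  shows "f (comb M I b p) = comb N I (\<lambda>i. f (b i)) p"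
  using assms by (subst hom_finsum)
    (auto simp: Pi_def act_closed[OF M] act_closed[OF N] hom_act[OF f] hom_closed[OF f] intro!: N.finsum_cong')

end

section \<open>Graded modules and homogeneous coefficients\<close>

lemma graded_right: "graded_module LA M \<Longrightarrow> right_module LA M"
  by (rule graded_module.axioms(1))

lemma hcomp_LA: "hcomp LA n = proj ` {p \<in> carrier FA. homog n p}" by (rule LA_sel)

text \<open>Replaces the unique family of finite support by the existence of some finite
  decomposition together with independence over finite index sets. The family of a decomposition is
  cut off to zero outside its index set.\<close>

lemma graded_moduleI:
  fixes M :: "((('v, 'e) lgen word \<Rightarrow>\<^sub>0 'k) set, 'm) gmodule"
  assumes M: "right_module LA M"
    and "\<And>i. gcomp M i \<subseteq> carrier M" "\<And>i. \<zero>\<^bsub>M\<^esub> \<in> gcomp M i"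
    and "\<And>i x y. x \<in> gcomp M i \<Longrightarrow> y \<in> gcomp M i \<Longrightarrow> x \<oplus>\<^bsub>M\<^esub> y \<in> gcomp M i"
    and a: "\<And>i j x p. x \<in> gcomp M i \<Longrightarrow> p \<in> carrier FA \<Longrightarrow> homog j p \<Longrightarrow> act M x p \<in> gcomp M (i + j)"
    and ex: "\<And>x. x \<in> carrier M \<Longrightarrow> \<exists>D c. finite D \<and> (\<forall>i. c i \<in> gcomp M i) \<and> x = (\<Oplus>\<^bsub>M\<^esub>i\<in>D. c i)"
    and ind: "\<And>D c i. finite D \<Longrightarrow> (\<And>i. c i \<in> gcomp M i) \<Longrightarrow> (\<Oplus>\<^bsub>M\<^esub>i\<in>D. c i) = \<zero>\<^bsub>M\<^esub> \<Longrightarrow> i \<in> D \<Longrightarrow> c i = \<zero>\<^bsub>M\<^esub>"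
  shows "graded_module LA M"
proof -
  interpret M: abelian_group M by (rule module_abelian_group[OF M])
  have sub: "x \<in> carrier M" if "x \<in> gcomp M i" for x i using that assms(2) by blast
  \<comment> \<open>Negation is the action of the scalar \<open>- 1\<close>, which has degree
    zero.\<close>
  have inv: "\<ominus>\<^bsub>M\<^esub> x \<in> gcomp M i" if "x \<in> gcomp M i" for x i
    using a[OF that, of "- 1" 0] act_uminus[OF M, of x 1] sub[OF that] act_one[OF M]
    by (simp add: homog_uminus)
  show ?thesis
  proof (intro graded_module.intro M graded_module_axioms.intro)
    show "additive_subgroup (gcomp M i) M" for i
      by (rule additive_subgroupI, rule subgroup.intro)
        (use assms inv in \<open>auto simp: a_inv_def[symmetric]\<close>)
    show "ract M x r \<in> gcomp M (i + j)" if "x \<in> gcomp M i" "r \<in> hcomp LA j" for x r i j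
      using a that by (auto simp: hcomp_LA)
    fix x assume x: "x \<in> carrier M"
    obtain D c where c: "finite D" "\<And>i. c i \<in> gcomp M i" "x = (\<Oplus>\<^bsub>M\<^esub>i\<in>D. c i)" using ex[OF x] by blast
    define c' where "c' i = (if i \<in> D then c i else \<zero>\<^bsub>M\<^esub>)" for i
    have norm: "(\<Oplus>\<^bsub>M\<^esub>i\<in>{i. d i \<noteq> \<zero>\<^bsub>M\<^esub>}. d i) = (\<Oplus>\<^bsub>M\<^esub>i\<in>E. d i)"
      if "finite E" "{i. d i \<noteq> \<zero>\<^bsub>M\<^esub>} \<subseteq> E" "\<And>i. d i \<in> gcomp M i" for d E
      by (rule M.add.finprod_mono_neutral_cong_left) (use that sub in auto)
    show "\<exists>!c. (\<forall>i. c i \<in> gcomp M i) \<and> finite {i. c i \<noteq> \<zero>\<^bsub>M\<^esub>} \<and> x = (\<Oplus>\<^bsub>M\<^esub>i\<in>{i. c i \<noteq> \<zero>\<^bsub>M\<^esub>}. c i)"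
    proof (rule ex1I[of _ c'])
      have fin: "finite {i. c' i \<noteq> \<zero>\<^bsub>M\<^esub>}" using c by (auto simp: c'_def intro: finite_subset)
      have c'g: "c' i \<in> gcomp M i" for i using c assms(3) by (auto simp: c'_def)
      have "(\<Oplus>\<^bsub>M\<^esub>i\<in>{i. c' i \<noteq> \<zero>\<^bsub>M\<^esub>}. c' i) = (\<Oplus>\<^bsub>M\<^esub>i\<in>D. c' i)"
        by (rule norm) (use c c'g in \<open>auto simp: c'_def split: if_splits\<close>)
      also have "\<dots> = x" unfolding c(3) by (rule M.finsum_cong') (use c sub in \<open>auto simp: c'_def\<close>)
      finally show c'x: "(\<forall>i. c' i \<in> gcomp M i) \<and> finite {i. c' i \<noteq> \<zero>\<^bsub>M\<^esub>} \<and> x = (\<Oplus>\<^bsub>M\<^esub>i\<in>{i. c' i \<noteq> \<zero>\<^bsub>M\<^esub>}. c' i)"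
        using fin c'g by auto
      fix d assume d: "(\<forall>i. d i \<in> gcomp M i) \<and> finite {i. d i \<noteq> \<zero>\<^bsub>M\<^esub>} \<and> x = (\<Oplus>\<^bsub>M\<^esub>i\<in>{i. d i \<noteq> \<zero>\<^bsub>M\<^esub>}. d i)"
      \<comment> \<open>Over the union of both supports the two decompositions can be subtracted
        term by term.\<close>
      define E where "E = {i. d i \<noteq> \<zero>\<^bsub>M\<^esub>} \<union> {i. c' i \<noteq> \<zero>\<^bsub>M\<^esub>}"
      have E: "finite E" using d fin by (auto simp: E_def)
      have xd: "x = (\<Oplus>\<^bsub>M\<^esub>i\<in>E. d i)" using norm[OF E, of d] d by (auto simp: E_def)
      have xc: "x = (\<Oplus>\<^bsub>M\<^esub>i\<in>E. c' i)" using norm[OF E, of c'] c'x by (auto simp: E_def)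
      have sd: "(\<Oplus>\<^bsub>M\<^esub>i\<in>E. d i) \<oplus>\<^bsub>M\<^esub> (\<Oplus>\<^bsub>M\<^esub>i\<in>E. \<ominus>\<^bsub>M\<^esub> c' i) = (\<Oplus>\<^bsub>M\<^esub>i\<in>E. d i \<ominus>\<^bsub>M\<^esub> c' i)"
        using d c'g sub by (subst M.finsum_addf[symmetric]) (auto simp: a_minus_def)
      have "(\<Oplus>\<^bsub>M\<^esub>i\<in>E. c' i) \<oplus>\<^bsub>M\<^esub> (\<Oplus>\<^bsub>M\<^esub>i\<in>E. \<ominus>\<^bsub>M\<^esub> c' i) = (\<Oplus>\<^bsub>M\<^esub>i\<in>E. c' i \<oplus>\<^bsub>M\<^esub> \<ominus>\<^bsub>M\<^esub> c' i)"
        using c'g sub by (subst M.finsum_addf[symmetric]) auto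
      also have "\<dots> = \<zero>\<^bsub>M\<^esub>" by (rule M.finsum_all_zero) (use sub[OF c'g] in \<open>simp add: M.r_neg\<close>)
      finally have z: "(\<Oplus>\<^bsub>M\<^esub>i\<in>E. d i \<ominus>\<^bsub>M\<^esub> c' i) = \<zero>\<^bsub>M\<^esub>" using sd xd xc by simp
      show "d = c'"
      proof
        fix i
        have g: "d i \<ominus>\<^bsub>M\<^esub> c' i \<in> gcomp M i" for i
          using d c'g inv assms(4) by (auto simp: a_minus_def)
        have "d i \<ominus>\<^bsub>M\<^esub> c' i = \<zero>\<^bsub>M\<^esub>" if "i \<in> E"
          using ind[OF E, of "\<lambda>i. d i \<ominus>\<^bsub>M\<^esub> c' i", OF g z that] .
        show "d i = c' i"
        proof (cases "i \<in> E")
          case True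
          then have "d i \<oplus>\<^bsub>M\<^esub> \<ominus>\<^bsub>M\<^esub> c' i = \<zero>\<^bsub>M\<^esub>"
            using \<open>i \<in> E \<Longrightarrow> d i \<ominus>\<^bsub>M\<^esub> c' i = \<zero>\<^bsub>M\<^esub>\<close> by (simp add: a_minus_def)
          then show ?thesis
            using M.minus_equality[of "d i" "\<ominus>\<^bsub>M\<^esub> c' i"] d sub[OF c'g[of i]] sub[of "d i" i] by simp
        qed (auto simp: E_def)
      qed
    qed
  qed
qed

context
  fixes M :: "((('v, 'e) lgen word \<Rightarrow>\<^sub>0 'k) set, 'm) gmodule"
  assumes gM: "graded_module LA M"
begin

interpretation M: abelian_group M by (rule module_abelian_group[OF graded_right[OF gM]])

lemma gcomp_carrier: "x \<in> gcomp M i \<Longrightarrow> x \<in> carrier M"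
  using additive_subgroup.a_subset[OF graded_module.gcomp_subgroup[OF gM]] by blast

lemma gcomp_zero: "\<zero>\<^bsub>M\<^esub> \<in> gcomp M i"
  using additive_subgroup.zero_closed[OF graded_module.gcomp_subgroup[OF gM]] by blast

lemma gcomp_add: "x \<in> gcomp M i \<Longrightarrow> y \<in> gcomp M i \<Longrightarrow> x \<oplus>\<^bsub>M\<^esub> y \<in> gcomp M i"
  using additive_subgroup.a_closed[OF graded_module.gcomp_subgroup[OF gM]] by blast

lemma gcomp_finsum: "(\<And>j. j \<in> S \<Longrightarrow> f j \<in> gcomp M i) \<Longrightarrow> finsum M f S \<in> gcomp M i"
proof (induction S rule: infinite_finite_induct)
  case (insert x F)
  have "f \<in> F \<rightarrow> carrier M" "f x \<in> carrier M" using insert gcomp_carrier by blast+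
  then show ?case using insert by (simp add: gcomp_add)
qed (simp_all add: gcomp_zero)

lemma gcomp_act:
  "x \<in> gcomp M i \<Longrightarrow> p \<in> carrier FA \<Longrightarrow> homog j p \<Longrightarrow> i + j = k \<Longrightarrow> act M x p \<in> gcomp M k"
  using graded_module.gcomp_ract[OF gM, of x i "proj p" j] by (auto simp: hcomp_LA)

lemma gcomp_decomposition:
  assumes "x \<in> carrier M"
  obtains D c where "finite D" "\<And>i. c i \<in> gcomp M i" "x = (\<Oplus>\<^bsub>M\<^esub>i\<in>D. c i)"
proof -
  obtain c where "\<forall>i. c i \<in> gcomp M i" "finite {i. c i \<noteq> \<zero>\<^bsub>M\<^esub>}" "x = (\<Oplus>\<^bsub>M\<^esub>i\<in>{i. c i \<noteq> \<zero>\<^bsub>M\<^esub>}. c i)"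
    using graded_module.direct_sum[OF gM assms] by blast
  then show ?thesis using that by blast
qed

lemma gcomp_decomposition_at:
  assumes "x \<in> carrier M"
  obtains D c where "finite D" "k \<in> D" "\<And>i. c i \<in> gcomp M i" "x = (\<Oplus>\<^bsub>M\<^esub>i\<in>D. c i)"
proof -
  obtain D c where c: "finite D" "\<And>i. c i \<in> gcomp M i" "x = (\<Oplus>\<^bsub>M\<^esub>i\<in>D. c i)"
    using gcomp_decomposition[OF assms] by blast
  define c' where "c' i = (if i \<in> D then c i else \<zero>\<^bsub>M\<^esub>)" for i
  have g: "c' i \<in> gcomp M i" for i using c(2) by (auto simp: c'_def gcomp_zero)
  have "(\<Oplus>\<^bsub>M\<^esub>i\<in>D. c i) = (\<Oplus>\<^bsub>M\<^esub>i\<in>insert k D. c' i)"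
    by (rule M.add.finprod_mono_neutral_cong_left)
      (use c(1) gcomp_carrier[OF c(2)] gcomp_carrier[OF g] in \<open>auto simp: c'_def\<close>)
  then show ?thesis using that[of "insert k D" c'] c g by simp
qed

lemma gcomp_independent:
  assumes "finite D" and c: "\<And>i. i \<in> D \<Longrightarrow> c i \<in> gcomp M i" and "(\<Oplus>\<^bsub>M\<^esub>i\<in>D. c i) = \<zero>\<^bsub>M\<^esub>" and "i \<in> D"
  shows "c i = \<zero>\<^bsub>M\<^esub>"
proof -
  define c' where "c' i = (if i \<in> D then c i else \<zero>\<^bsub>M\<^esub>)" for i
  have g: "c' i \<in> gcomp M i" for i using c by (auto simp: c'_def gcomp_zero)
  have "(\<Oplus>\<^bsub>M\<^esub>i\<in>{i. c' i \<noteq> \<zero>\<^bsub>M\<^esub>}. c' i) = (\<Oplus>\<^bsub>M\<^esub>i\<in>D. c i)"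
    by (rule M.add.finprod_mono_neutral_cong_left)
      (use assms gcomp_carrier in \<open>auto simp: c'_def split: if_splits\<close>)
  moreover have "finite {i. c' i \<noteq> \<zero>\<^bsub>M\<^esub>}"
    using assms(1) by (rule finite_subset[rotated]) (auto simp: c'_def)
  ultimately have "c' = (\<lambda>_. \<zero>\<^bsub>M\<^esub>)"
  proof -
    let ?P = "\<lambda>c. (\<forall>i. c i \<in> gcomp M i) \<and> finite {i. c i \<noteq> \<zero>\<^bsub>M\<^esub>} \<and>
      \<zero>\<^bsub>M\<^esub> = (\<Oplus>\<^bsub>M\<^esub>i\<in>{i. c i \<noteq> \<zero>\<^bsub>M\<^esub>}. c i)"
    assume "finsum M c' {i. c' i \<noteq> \<zero>\<^bsub>M\<^esub>} = finsum M c D" "finite {i. c' i \<noteq> \<zero>\<^bsub>M\<^esub>}"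
    then have 1: "?P c'" using g assms(3) by simp
    have 2: "?P (\<lambda>_. \<zero>\<^bsub>M\<^esub>)" using gcomp_zero by simp
    show ?thesis
      using the1_equality[of ?P, OF graded_module.direct_sum[OF gM M.zero_closed] 1]
        the1_equality[of ?P, OF graded_module.direct_sum[OF gM M.zero_closed] 2] by simp
  qed
  then show ?thesis using assms(4) by (auto simp: c'_def fun_eq_iff split: if_splits)
qed

text \<open>Subtracting \<open>x\<close> from the term in its own degree leaves a decomposition of
  zero, to which independence applies.\<close>

lemma gcomp_unique:
  assumes "finite D" and c: "\<And>i. i \<in> D \<Longrightarrow> c i \<in> gcomp M i" and "(\<Oplus>\<^bsub>M\<^esub>i\<in>D. c i) = x" "x \<in> gcomp M k" "k \<in> D"
  shows "c k = x"
proof -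
  have m: "\<ominus>\<^bsub>M\<^esub> x \<in> gcomp M k"
    using additive_subgroup.a_inv_closed[OF graded_module.gcomp_subgroup[OF gM]] assms(4) by blast
  define d where "d i = (if i = k then \<ominus>\<^bsub>M\<^esub> x else \<zero>\<^bsub>M\<^esub>)" for i
  have dg: "d i \<in> gcomp M i" for i using m by (auto simp: d_def gcomp_zero)
  have "(\<Oplus>\<^bsub>M\<^esub>i\<in>D. c i \<oplus>\<^bsub>M\<^esub> d i) = x \<oplus>\<^bsub>M\<^esub> (\<Oplus>\<^bsub>M\<^esub>i\<in>D. d i)"
    using c dg gcomp_carrier assms(3) by (subst M.finsum_addf) auto
  also have "(\<Oplus>\<^bsub>M\<^esub>i\<in>D. d i) = \<ominus>\<^bsub>M\<^esub> x"
    using assms m gcomp_carrier unfolding d_def by (intro M.finsum_single) auto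
  finally have "(\<Oplus>\<^bsub>M\<^esub>i\<in>D. c i \<oplus>\<^bsub>M\<^esub> d i) = \<zero>\<^bsub>M\<^esub>"
    using gcomp_carrier assms(4) by (simp add: M.r_neg)
  then have "c k \<oplus>\<^bsub>M\<^esub> d k = \<zero>\<^bsub>M\<^esub>"
    using gcomp_independent[OF assms(1), of "\<lambda>i. c i \<oplus>\<^bsub>M\<^esub> d i" k] c dg gcomp_add assms(5) by auto
  then show ?thesis
    using M.minus_equality[of "c k" "\<ominus>\<^bsub>M\<^esub> x"] gcomp_carrier c assms(4,5) by (auto simp: d_def)
qed

text \<open>Cutting the coefficient of \<open>b i\<close> into its parts of degree
  \<open>d - m i\<close> splits the combination into its graded components; being homogeneous, it
  equals the component in degree \<open>k\<close>.\<close>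

lemma homogeneous_coefficients:
  assumes I: "finite I" and b: "\<And>i. i \<in> I \<Longrightarrow> b i \<in> gcomp M (m i)" and p: "p \<in> I \<rightarrow> carrier FA"
    and x: "comb M I b p \<in> gcomp M k"
  shows "comb M I b p = comb M I b (\<lambda>i. hpart (k - m i) (p i))"
proof -
  note rM = graded_right[OF gM]
  have bc: "b \<in> I \<rightarrow> carrier M" using b gcomp_carrier by auto
  \<comment> \<open>All degrees that occur in the terms, together with \<open>k\<close>, which may
    be missing among them if the combination is zero.\<close>
  define D where "D = insert k (\<Union>i\<in>I. (\<lambda>w. word_degree w + m i) ` Poly_Mapping.keys (p i))"
  have D: "finite D" using I by (auto simp: D_def)
  define c where "c d = comb M I b (\<lambda>i. hpart (d - m i) (p i))" for d
  have cg: "c d \<in> gcomp M d" for d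
    unfolding c_def
  proof (rule gcomp_finsum)
    fix i assume i: "i \<in> I"
    then show "act M (b i) (hpart (d - m i) (p i)) \<in> gcomp M d"
      using p by (intro gcomp_act[OF b[OF i], of _ "d - m i"]) (auto simp: Pi_def)
  qed
  have "(\<Oplus>\<^bsub>M\<^esub>d\<in>D. c d) = comb M I b (\<lambda>i. \<Sum>d\<in>D. hpart (d - m i) (p i))"
    unfolding c_def using p D I by (intro comb_sum[OF rM bc, symmetric]) (auto simp: Pi_def)
  also have "\<dots> = comb M I b p"
  proof (rule comb_cong[OF rM bc])
    fix i assume i: "i \<in> I"
    have "(\<Sum>d\<in>D. hpart (d - m i) (p i)) = (\<Sum>n\<in>(\<lambda>d. d - m i) ` D. hpart n (p i))"
      by (subst sum.reindex) (auto simp: inj_on_def)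
    also have "\<dots> = p i"
    proof (rule sum_hpart)
      show "word_degree ` Poly_Mapping.keys (p i) \<subseteq> (\<lambda>d. d - m i) ` D"
      proof
        fix n assume "n \<in> word_degree ` Poly_Mapping.keys (p i)"
        then have "n + m i \<in> D" using i by (auto simp: D_def)
        then show "n \<in> (\<lambda>d. d - m i) ` D" by (intro image_eqI[of _ _ "n + m i"]) auto
      qed
    qed (use D in auto)
    finally show "(\<Sum>d\<in>D. hpart (d - m i) (p i)) \<doteq> p i" using p i by (simp add: Pi_def)
  qed
  finally have eq: "(\<Oplus>\<^bsub>M\<^esub>d\<in>D. c d) = comb M I b p" .
  have "c k = comb M I b p"
    by (rule gcomp_unique[OF D cg eq x]) (simp add: D_def)
  then show ?thesis by (simp add: c_def)
qed

end

end

section \<open>Graded bases\<close>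

context leavitt
begin

text \<open>An element of degree \<open>m\<close> fixed by the vertex \<open>v\<close> is the same
  as a graded homomorphism from the right ideal generated by \<open>v\<close>, with its generator
  placed in degree \<open>m\<close>. A frame is thus a graded homomorphism from a finite direct sum
  of such modules.\<close>

definition frame :: "((('v, 'e) lgen word \<Rightarrow>\<^sub>0 'k) set, 'm) gmodule \<Rightarrow> 'i set \<Rightarrow> ('i \<Rightarrow> 'm) \<Rightarrow>
    ('i \<Rightarrow> 'v) \<Rightarrow> ('i \<Rightarrow> int) \<Rightarrow> bool" where
  "frame M I b v m \<longleftrightarrow> finite I \<and>
     (\<forall>i\<in>I. v i \<in> verts G \<and> b i \<in> gcomp M (m i) \<and> act M (b i) (vx (v i)) = b i)"

definition spans :: "((('v, 'e) lgen word \<Rightarrow>\<^sub>0 'k) set, 'm) gmodule \<Rightarrow> 'i set \<Rightarrow> ('i \<Rightarrow> 'm) \<Rightarrow> bool" where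
  "spans M I b \<longleftrightarrow> (\<forall>x\<in>carrier M. \<exists>p\<in>I \<rightarrow> carrier FA. x = comb M I b p)"

text \<open>Says that this homomorphism is an isomorphism. Since \<open>b i\<close> is fixed by
  \<open>v i\<close>, the coefficient \<open>p i\<close> matters only through
  \<open>vx (v i) * p i\<close>, so uniqueness is required of that product alone.\<close>

definition basis :: "((('v, 'e) lgen word \<Rightarrow>\<^sub>0 'k) set, 'm) gmodule \<Rightarrow> 'i set \<Rightarrow> ('i \<Rightarrow> 'm) \<Rightarrow>
    ('i \<Rightarrow> 'v) \<Rightarrow> ('i \<Rightarrow> int) \<Rightarrow> bool" where
  "basis M I b v m \<longleftrightarrow> frame M I b v m \<and> spans M I b \<and>
     (\<forall>p\<in>I \<rightarrow> carrier FA. comb M I b p = \<zero>\<^bsub>M\<^esub> \<longrightarrow> (\<forall>i\<in>I. vx (v i) * p i \<in> LI))"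

lemma frameD:
  assumes "frame M I b v m"
  shows "finite I" "i \<in> I \<Longrightarrow> v i \<in> verts G" "i \<in> I \<Longrightarrow> b i \<in> gcomp M (m i)"
    "i \<in> I \<Longrightarrow> act M (b i) (vx (v i)) = b i"
  using assms by (auto simp: frame_def)

lemma frame_closed: "graded_module LA M \<Longrightarrow> frame M I b v m \<Longrightarrow> b \<in> I \<rightarrow> carrier M"
  by (auto simp: frame_def intro: gcomp_carrier)

lemma basisD:
  assumes "basis M I b v m"
  shows "frame M I b v m" "spans M I b"
    "p \<in> I \<rightarrow> carrier FA \<Longrightarrow> comb M I b p = \<zero>\<^bsub>M\<^esub> \<Longrightarrow> i \<in> I \<Longrightarrow> vx (v i) * p i \<in> LI"
  using assms by (auto simp: basis_def)

lemma spansD: "spans M I b \<Longrightarrow> x \<in> carrier M \<Longrightarrow> \<exists>p. p \<in> I \<rightarrow> carrier FA \<and> x = comb M I b p"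
  by (auto simp: spans_def)

lemma comb_vx:
  assumes gM: "graded_module LA M" and F: "frame M I b v m" and p: "p \<in> I \<rightarrow> carrier FA"
  shows "comb M I b (\<lambda>i. vx (v i) * p i) = comb M I b p"
proof -
  note rM = graded_right[OF gM]
  interpret M: abelian_group M by (rule module_abelian_group[OF rM])
  have c: "b i \<in> carrier M" if "i \<in> I" for i using frame_closed[OF gM F] that by auto
  show ?thesis
  proof (rule M.finsum_cong')
    show "act M (b i) (vx (v i) * p i) = act M (b i) (p i)" if "i \<in> I" for i
      using act_mult[OF rM c[OF that], of "vx (v i)" "p i"] frameD[OF F] that p by (simp add: Pi_def)
  qed (use c p in \<open>auto simp: Pi_def act_closed[OF rM]\<close>)
qed

lemma basis_coefficients:
  assumes gP: "graded_module LA P" and B: "basis P I b v m"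
    and p: "p \<in> I \<rightarrow> carrier FA" and q: "q \<in> I \<rightarrow> carrier FA" and eq: "comb P I b p = comb P I b q" and i: "i \<in> I"
  shows "vx (v i) * p i \<doteq> vx (v i) * q i"
proof -
  note rP = graded_right[OF gP] and F = basisD(1)[OF B]
  interpret P: abelian_group P by (rule module_abelian_group[OF rP])
  have "comb P I b (\<lambda>i. p i - q i) = \<zero>\<^bsub>P\<^esub>"
    using comb_diff[OF rP frame_closed[OF gP F] p q] comb_closed[OF rP frame_closed[OF gP F] q] eq
    by (simp add: a_minus_def P.r_neg)
  then have "vx (v i) * (p i - q i) \<in> LI"
    using basisD(3)[OF B, of "\<lambda>i. p i - q i"] p q i by (auto simp: Pi_def)
  then show ?thesis
    using p q i frameD(2)[OF F] by (auto simp: cong_def Pi_def algebra_simps)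
qed

text \<open>The universal property: basis elements may be sent to any elements of the same degrees
  and vertices. The map is computed from arbitrarily chosen coefficients, which is harmless because
  \<open>vx (v i) * p i\<close> is determined up to congruence and \<open>y i\<close> is fixed by
  \<open>v i\<close>.\<close>

lemma basis_hom:
  assumes gP: "graded_module LA P" and B: "basis P I b v m" and gN: "graded_module LA N" and Y: "frame N I y v m"
  shows "\<exists>h. h \<in> gr_hom LA P N \<and> (\<forall>p. p \<in> I \<rightarrow> carrier FA \<longrightarrow> h (comb P I b p) = comb N I y p) \<and>
    (\<forall>i\<in>I. h (b i) = y i)"
proof -
  note rP = graded_right[OF gP] and rN = graded_right[OF gN] and F = basisD(1)[OF B]
  interpret P: abelian_group P by (rule module_abelian_group[OF rP])
  interpret N: abelian_group N by (rule module_abelian_group[OF rN])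
  note bc = frame_closed[OF gP F] and yc = frame_closed[OF gN Y]
  have wd: "comb N I y p = comb N I y q"
    if "p \<in> I \<rightarrow> carrier FA" "q \<in> I \<rightarrow> carrier FA" "comb P I b p = comb P I b q" for p q
    using comb_vx[OF gN Y that(1)] comb_vx[OF gN Y that(2)]
      comb_cong[OF rN yc basis_coefficients[OF gP B that]] by simp
  define co where "co x = (SOME p. p \<in> I \<rightarrow> carrier FA \<and> x = comb P I b p)" for x
  have co: "co x \<in> I \<rightarrow> carrier FA" "comb P I b (co x) = x" if "x \<in> carrier P" for x
    using someI_ex[OF spansD[OF basisD(2)[OF B] that]] unfolding co_def[symmetric] by simp_all
  define h where "h = (\<lambda>x\<in>carrier P. comb N I y (co x))"
  have h: "h (comb P I b p) = comb N I y p" if "p \<in> I \<rightarrow> carrier FA" for p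
  proof -
    have x: "comb P I b p \<in> carrier P" by (rule comb_closed[OF rP bc that])
    show ?thesis using wd[OF co(1)[OF x] that co(2)[OF x]] x by (simp add: h_def)
  qed
  have "h \<in> rmod_hom LA P N"
  proof (rule rmod_homI)
    show "h x \<in> carrier N" if "x \<in> carrier P" for x
      using co(1)[OF that] that comb_closed[OF rN yc] by (simp add: h_def)
    show "h (x \<oplus>\<^bsub>P\<^esub> z) = h x \<oplus>\<^bsub>N\<^esub> h z" if "x \<in> carrier P" "z \<in> carrier P" for x z
    proof -
      have s: "(\<lambda>i. co x i + co z i) \<in> I \<rightarrow> carrier FA" using co that by (auto simp: Pi_def)
      have "x \<oplus>\<^bsub>P\<^esub> z = comb P I b (\<lambda>i. co x i + co z i)"
        using comb_add[OF rP bc co(1)[OF that(1)] co(1)[OF that(2)]] co that by simp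
      then show ?thesis
        using h[OF s] comb_add[OF rN yc co(1)[OF that(1)] co(1)[OF that(2)]] that by (simp add: h_def)
    qed
    show "h (act P x q) = act N (h x) q" if "x \<in> carrier P" "q \<in> carrier FA" for x q
    proof -
      have s: "(\<lambda>i. co x i * q) \<in> I \<rightarrow> carrier FA" using co that by (auto simp: Pi_def)
      have "act P x q = comb P I b (\<lambda>i. co x i * q)"
        using comb_act[OF rP bc co(1)[OF that(1)] that(2)] co that by simp
      then show ?thesis
        using h[OF s] comb_act[OF rN yc co(1)[OF that(1)] that(2)] that by (simp add: h_def)
    qed
  qed (simp add: h_def)
  \<comment> \<open>The coefficients chosen for \<open>x\<close> need not be homogeneous, but their
    parts of the right degree represent \<open>x\<close> as well.\<close>
  moreover have "h x \<in> gcomp N k" if "x \<in> gcomp P k" for x k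
  proof -
    have x: "x \<in> carrier P" using gcomp_carrier[OF gP that] .
    have s: "(\<lambda>i. hpart (k - m i) (co x i)) \<in> I \<rightarrow> carrier FA" using co(1)[OF x] by (auto simp: Pi_def)
    have "x = comb P I b (\<lambda>i. hpart (k - m i) (co x i))"
      using homogeneous_coefficients[OF gP frameD(1)[OF F] frameD(3)[OF F] co(1)[OF x], where k = k] co(2)[OF x] that
      by simp
    then have "h x = comb N I y (\<lambda>i. hpart (k - m i) (co x i))" using h[OF s] by simp
    moreover have "act N (y i) (hpart (k - m i) (co x i)) \<in> gcomp N k" if "i \<in> I" for i
      using co(1)[OF x] that
      by (intro gcomp_act[OF gN frameD(3)[OF Y that], of _ "k - m i"]) (auto simp: Pi_def)
    ultimately show ?thesis by (simp add: gcomp_finsum[OF gN])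
  qed
  moreover have "h (b i) = y i" if "i \<in> I" for i
  proof -
    have b: "comb P I b (\<lambda>j. if j = i then 1 else 0) = b i" "comb N I y (\<lambda>j. if j = i then 1 else 0) = y i"
      using comb_single[OF rP bc frameD(1)[OF F] that, of 1] comb_single[OF rN yc frameD(1)[OF F] that, of 1]
        act_one[OF rP] act_one[OF rN] bc yc that by (auto simp: Pi_def)
    show ?thesis using h[of "\<lambda>j. if j = i then 1 else 0"] unfolding b by (simp add: Pi_def)
  qed
  ultimately show ?thesis using h by (intro exI[of _ h]) (simp add: gr_homI)
qed

lemma basis_iso:
  assumes gP: "graded_module LA P" and B: "basis P I b v m" and gQ: "graded_module LA Q" and C: "basis Q I c v m"
  shows "gr_isomorphic LA P Q"
proof -
  obtain h where h: "h \<in> gr_hom LA P Q" "\<And>p. p \<in> I \<rightarrow> carrier FA \<Longrightarrow> h (comb P I b p) = comb Q I c p"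
    using basis_hom[OF gP B gQ basisD(1)[OF C]] by blast
  obtain k where k: "k \<in> gr_hom LA Q P" "\<And>p. p \<in> I \<rightarrow> carrier FA \<Longrightarrow> k (comb Q I c p) = comb P I b p"
    using basis_hom[OF gQ C gP basisD(1)[OF B]] by blast
  have 1: "k (h x) = x" if x: "x \<in> carrier P" for x
  proof -
    obtain p where "p \<in> I \<rightarrow> carrier FA" "x = comb P I b p" using spansD[OF basisD(2)[OF B] x] by blast
    then show ?thesis using h(2)[of p] k(2)[of p] by simp
  qed
  have 2: "h (k x) = x" if x: "x \<in> carrier Q" for x
  proof -
    obtain p where "p \<in> I \<rightarrow> carrier FA" "x = comb Q I c p" using spansD[OF basisD(2)[OF C] x] by blast
    then show ?thesis using h(2)[of p] k(2)[of p] by simp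
  qed
  have "bij_betw h (carrier P) (carrier Q)"
    by (rule bij_betw_byWitness[where f' = k])
      (use 1 2 hom_closed[OF gr_homD(1)[OF h(1)]] hom_closed[OF gr_homD(1)[OF k(1)]] in auto)
  then show ?thesis using h by (auto simp: gr_isomorphic_def)
qed

text \<open>That the inverse preserves degrees is not formal, as \<open>gr_hom\<close> only asks for
  inclusions of components. The preimage of a homogeneous element is decomposed, and applying
  \<open>f\<close> shows that its component in that degree already maps to the element.\<close>

lemma gr_iso_inverse:
  assumes gM: "graded_module LA M" and gN: "graded_module LA N"
    and f: "f \<in> gr_hom LA M N" "bij_betw f (carrier M) (carrier N)"
  obtains g where "g \<in> gr_hom LA N M" "\<And>x. x \<in> carrier M \<Longrightarrow> g (f x) = x" "\<And>y. y \<in> carrier N \<Longrightarrow> f (g y) = y"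
proof -
  note rM = graded_right[OF gM] and rN = graded_right[OF gN] and fr = gr_homD(1)[OF f(1)]
  interpret M: abelian_group M by (rule module_abelian_group[OF rM])
  interpret N: abelian_group N by (rule module_abelian_group[OF rN])
  define g where "g = (\<lambda>y\<in>carrier N. inv_into (carrier M) f y)"
  have gf: "g (f x) = x" if "x \<in> carrier M" for x
    using bij_betw_inv_into_left[OF f(2) that] hom_closed[OF fr that] by (simp add: g_def)
  have fg: "f (g y) = y" "g y \<in> carrier M" if "y \<in> carrier N" for y
    using bij_betw_inv_into_right[OF f(2) that] bij_betwE[OF bij_betw_inv_into[OF f(2)]] that
    by (auto simp: g_def)
  have "g \<in> rmod_hom LA N M"
  proof (rule rmod_homI)
    show "g (x \<oplus>\<^bsub>N\<^esub> y) = g x \<oplus>\<^bsub>M\<^esub> g y" if "x \<in> carrier N" "y \<in> carrier N" for x y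
      using gf[of "g x \<oplus>\<^bsub>M\<^esub> g y"] hom_add[OF fr, of "g x" "g y"] fg that by simp
    show "g (act N x p) = act M (g x) p" if "x \<in> carrier N" "p \<in> carrier FA" for x p
      using gf[of "act M (g x) p"] hom_act[OF fr, of "g x" p] fg that act_closed[OF rM] by simp
  qed (use fg in \<open>auto simp: g_def\<close>)
  moreover have "g y \<in> gcomp M i" if "y \<in> gcomp N i" for y i
  proof -
    have y: "y \<in> carrier N" using gcomp_carrier[OF gN that] .
    obtain D c where c: "finite D" "i \<in> D" "\<And>i. c i \<in> gcomp M i" "g y = (\<Oplus>\<^bsub>M\<^esub>i\<in>D. c i)"
      using gcomp_decomposition_at[OF gM fg(2)[OF y], of i] by blast
    have "(\<Oplus>\<^bsub>N\<^esub>i\<in>D. f (c i)) = y"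
      using hom_finsum[OF rM rN fr, of D c] gcomp_carrier[OF gM c(3)] c(4) fg(1)[OF y] by simp
    then have "f (c i) = y"
      using gcomp_unique[OF gN c(1) gr_homD(2)[OF f(1) c(3)] _ that c(2)] by simp
    then show ?thesis using gf[OF gcomp_carrier[OF gM c(3)[of i]]] c(3)[of i] by simp
  qed
  ultimately show ?thesis using that[of g] gf fg by (simp add: gr_homI)
qed

lemma basis_transport:
  assumes gQ: "graded_module LA Q" and gP: "graded_module LA P" and iso: "gr_isomorphic LA Q P"
    and B: "basis P I b v m"
  obtains c where "basis Q I c v m"
proof -
  note rP = graded_right[OF gP] and rQ = graded_right[OF gQ] and F = basisD(1)[OF B]
  obtain f where f: "f \<in> gr_hom LA Q P" "bij_betw f (carrier Q) (carrier P)"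
    using iso by (auto simp: gr_isomorphic_def)
  obtain g where g: "g \<in> gr_hom LA P Q" "\<And>x. x \<in> carrier Q \<Longrightarrow> g (f x) = x" "\<And>y. y \<in> carrier P \<Longrightarrow> f (g y) = y"
    using gr_iso_inverse[OF gQ gP f] by blast
  note fr = gr_homD(1)[OF f(1)] and gr = gr_homD(1)[OF g(1)]
  note bc = frame_closed[OF gP F]
  have b: "b i \<in> carrier P" if "i \<in> I" for i using bc that by auto
  have F': "frame Q I (\<lambda>i. g (b i)) v m"
    unfolding frame_def
    using frameD[OF F] gr_homD(2)[OF g(1)] hom_act[OF gr b, of _ "vx (v _)"] by (metis fa_gen gens(1))
  have fc: "f (comb Q I (\<lambda>i. g (b i)) p) = comb P I b p" if "p \<in> I \<rightarrow> carrier FA" for p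
  proof -
    have "g (comb P I b p) = comb Q I (\<lambda>i. g (b i)) p" by (rule hom_comb[OF rP rQ gr bc that])
    then show ?thesis using g(3) comb_closed[OF rP bc that] by metis
  qed
  have "spans Q I (\<lambda>i. g (b i))"
    unfolding spans_def
  proof
    fix x assume x: "x \<in> carrier Q"
    obtain p where p: "p \<in> I \<rightarrow> carrier FA" "f x = comb P I b p"
      using spansD[OF basisD(2)[OF B] hom_closed[OF fr x]] by blast
    then have "x = comb Q I (\<lambda>i. g (b i)) p"
      using hom_comb[OF rP rQ gr bc p(1)] g(2)[OF x] by simp
    then show "\<exists>p\<in>I \<rightarrow> carrier FA. x = comb Q I (\<lambda>i. g (b i)) p" using p by blast
  qed
  moreover have "vx (v i) * p i \<in> LI"
    if "p \<in> I \<rightarrow> carrier FA" "comb Q I (\<lambda>i. g (b i)) p = \<zero>\<^bsub>Q\<^esub>" "i \<in> I" for p i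
    using basisD(3)[OF B that(1) _ that(3)] fc[OF that(1)] that(2) hom_zero[OF rQ rP fr] by simp
  ultimately show ?thesis using that F' unfolding basis_def by blast
qed

lemma comb_reindex:
  assumes rM: "right_module LA M" and s: "bij_betw s J I" and b: "b \<in> I \<rightarrow> carrier M" and p: "p \<in> I \<rightarrow> carrier FA"
  shows "comb M J (\<lambda>j. b (s j)) (\<lambda>j. p (s j)) = comb M I b p"
proof -
  interpret M: abelian_group M by (rule module_abelian_group[OF rM])
  have I: "I = s ` J" "inj_on s J" using s by (auto simp: bij_betw_def)
  show ?thesis
    unfolding I(1) using I b p
    by (intro M.finsum_reindex[symmetric]) (auto simp: Pi_def act_closed[OF rM])
qed

lemma basis_reindex:
  assumes gM: "graded_module LA M" and B: "basis M I b v m" and s: "bij_betw s J I"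
  shows "basis M J (\<lambda>j. b (s j)) (\<lambda>j. v (s j)) (\<lambda>j. m (s j))"
proof -
  note rM = graded_right[OF gM] and F = basisD(1)[OF B]
  have sI: "s j \<in> I" if "j \<in> J" for j using s that by (auto simp: bij_betw_def)
  define t where "t = inv_into J s"
  have t: "t i \<in> J" "s (t i) = i" if "i \<in> I" for i
    using s that unfolding t_def bij_betw_def by (auto simp: inv_into_into f_inv_into_f)
  have ts: "t (s j) = j" if "j \<in> J" for j using s that unfolding t_def bij_betw_def by simp
  have fin: "finite J" using frameD(1)[OF F] s bij_betw_finite by metis
  have "frame M J (\<lambda>j. b (s j)) (\<lambda>j. v (s j)) (\<lambda>j. m (s j))"
    using F sI fin by (auto simp: frame_def)
  moreover have "spans M J (\<lambda>j. b (s j))"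
    unfolding spans_def
  proof
    fix x assume "x \<in> carrier M"
    then obtain p where "p \<in> I \<rightarrow> carrier FA" "x = comb M I b p" using spansD[OF basisD(2)[OF B]] by blast
    then show "\<exists>p\<in>J \<rightarrow> carrier FA. x = comb M J (\<lambda>j. b (s j)) p"
      using comb_reindex[OF rM s frame_closed[OF gM F], of p] sI
      by (intro bexI[of _ "\<lambda>j. p (s j)"]) auto
  qed
  moreover have "vx (v (s j)) * p j \<in> LI"
    if "p \<in> J \<rightarrow> carrier FA" "comb M J (\<lambda>j. b (s j)) p = \<zero>\<^bsub>M\<^esub>" "j \<in> J" for p j
  proof -
    interpret M: abelian_group M by (rule module_abelian_group[OF rM])
    have pt: "(\<lambda>i. p (t i)) \<in> I \<rightarrow> carrier FA" using that(1) t by auto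
    have "comb M I b (\<lambda>i. p (t i)) = comb M J (\<lambda>j. b (s j)) (\<lambda>j. p (t (s j)))"
      using comb_reindex[OF rM s frame_closed[OF gM F] pt] by simp
    also have "\<dots> = comb M J (\<lambda>j. b (s j)) p"
      using ts that(1) frame_closed[OF gM F] sI
      by (intro M.finsum_cong') (auto simp: Pi_def act_closed[OF rM])
    finally show ?thesis
      using basisD(3)[OF B pt, of "s j"] that(2) sI[OF that(3)] ts[OF that(3)] by simp
  qed
  ultimately show ?thesis unfolding basis_def by blast
qed

lemma spans_imp_fin_gen:
  assumes gM: "graded_module LA M" and F: "frame M I b v m" and S: "spans M I b"
  shows "fin_gen LA M"
proof -
  note rM = graded_right[OF gM]
  note bc = frame_closed[OF gM F]
  have idc: "(\<lambda>x. x) \<in> b ` I \<rightarrow> carrier M" using bc by auto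
  have fI: "finite I" using frameD(1)[OF F] .
  show ?thesis
    unfolding fin_gen_def
  proof (intro exI[of _ "b ` I"] conjI ballI)
    fix x assume "x \<in> carrier M"
    then obtain p where p: "p \<in> I \<rightarrow> carrier FA" "x = comb M I b p" using spansD[OF S] by blast
    \<comment> \<open>\<open>fin_gen\<close> speaks of a set of generators, so if \<open>b\<close>
      repeats a value, the coefficients of the equal generators have to be added up.\<close>
    have bi: "b i = comb M (b ` I) (\<lambda>x. x) (\<lambda>y. if y = b i then 1 else 0)" if "i \<in> I" for i
      using comb_single[OF rM idc, of "b i" 1] fI that act_one[OF rM] bc by (auto simp: Pi_def)
    have "x = comb M (b ` I) (\<lambda>x. x) (\<lambda>y. \<Sum>i\<in>I. (if y = b i then 1 else 0) * p i)"
      unfolding p(2) by (rule comb_comb[OF rM idc _ _ bi]) (use fI p in auto)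
    moreover have "(\<lambda>y. proj (\<Sum>i\<in>I. (if y = b i then 1 else 0) * p i)) \<in> b ` I \<rightarrow> carrier LA"
      using p by (auto intro!: proj_closed fa_sum)
    ultimately show "\<exists>a\<in>b ` I \<rightarrow> carrier LA. x = (\<Oplus>\<^bsub>M\<^esub>b\<in>b ` I. ract M b (a b))"
      by (rule bexI)
  qed (use fI bc in auto)
qed

text \<open>It suffices to lift the images of the basis elements: a preimage is replaced by its
  component in degree \<open>m i\<close> and then multiplied by the vertex \<open>v i\<close>, which
  makes it admissible for \<open>basis_hom\<close>.\<close>

lemma basis_imp_gr_projective:
  fixes P :: "((('v, 'e) lgen word \<Rightarrow>\<^sub>0 'k) set, 'u) gmodule"
  assumes gP: "graded_module LA P" and B: "basis P I b v m"
  shows "gr_projective LA P"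
  unfolding gr_projective_def
proof (intro allI impI, elim conjE)
  fix M N :: "((('v, 'e) lgen word \<Rightarrow>\<^sub>0 'k) set, 'u) gmodule" and g f
  assume gM: "graded_module LA M" and gN: "graded_module LA N" and g: "g \<in> gr_hom LA M N"
    and surj: "g ` carrier M = carrier N" and f: "f \<in> gr_hom LA P N"
  note rP = graded_right[OF gP] and rM = graded_right[OF gM] and rN = graded_right[OF gN] and F = basisD(1)[OF B]
  note gh = gr_homD(1)[OF g] and fh = gr_homD(1)[OF f]
  note bc = frame_closed[OF gP F]
  have "\<exists>y. y \<in> gcomp M (m i) \<and> act M y (vx (v i)) = y \<and> g y = f (b i)" if i: "i \<in> I" for i
  proof -
    have bi: "b i \<in> carrier P" using bc i by auto
    obtain z where z: "z \<in> carrier M" "g z = f (b i)" using surj hom_closed[OF fh bi] by (metis imageE)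
    obtain D c where c: "finite D" "m i \<in> D" "\<And>j. c j \<in> gcomp M j" "z = (\<Oplus>\<^bsub>M\<^esub>j\<in>D. c j)"
      using gcomp_decomposition_at[OF gM z(1), of "m i"] by blast
    have "(\<Oplus>\<^bsub>N\<^esub>j\<in>D. g (c j)) = f (b i)"
      using hom_finsum[OF rM rN gh, of D c] gcomp_carrier[OF gM c(3)] c(4) z(2) by simp
    then have e: "g (c (m i)) = f (b i)"
      using gcomp_unique[OF gN c(1) gr_homD(2)[OF g c(3)] _ gr_homD(2)[OF f frameD(3)[OF F i]] c(2)] by simp
    define y where "y = act M (c (m i)) (vx (v i))"
    have cm: "c (m i) \<in> carrier M" using gcomp_carrier[OF gM c(3)] .
    have v: "v i \<in> verts G" using frameD(2)[OF F i] .
    have "y \<in> gcomp M (m i)" unfolding y_def using v by (intro gcomp_act[OF gM c(3), of _ 0]) (auto intro: homog_gen)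
    moreover have "act M y (vx (v i)) = y"
      unfolding y_def using act_mult[OF rM cm, of "vx (v i)" "vx (v i)"] act_cong[OF rM VV'[OF v]] v by simp
    moreover have "g y = f (b i)"
      unfolding y_def using hom_act[OF gh cm, of "vx (v i)"] hom_act[OF fh bi, of "vx (v i)"] e frameD(4)[OF F i] v
      by simp
    ultimately show ?thesis by blast
  qed
  then obtain y where y: "\<And>i. i \<in> I \<Longrightarrow> y i \<in> gcomp M (m i) \<and> act M (y i) (vx (v i)) = y i \<and> g (y i) = f (b i)"
    by metis
  have Y: "frame M I y v m" using y frameD[OF F] by (auto simp: frame_def)
  obtain h where h: "h \<in> gr_hom LA P M" "\<And>p. p \<in> I \<rightarrow> carrier FA \<Longrightarrow> h (comb P I b p) = comb M I y p"
    using basis_hom[OF gP B gM Y] by blast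
  show "\<exists>h\<in>gr_hom LA P M. \<forall>x\<in>carrier P. g (h x) = f x"
  proof (intro bexI[OF _ h(1)] ballI)
    fix x assume "x \<in> carrier P"
    then obtain p where p: "p \<in> I \<rightarrow> carrier FA" "x = comb P I b p" using spansD[OF basisD(2)[OF B]] by blast
    have "g (h x) = comb N I (\<lambda>i. g (y i)) p"
      using p h(2) hom_comb[OF rM rN gh frame_closed[OF gM Y] p(1)] by simp
    also have "\<dots> = comb N I (\<lambda>i. f (b i)) p"
    proof -
      interpret N: abelian_group N by (rule module_abelian_group[OF rN])
      show ?thesis
        using y p(1) hom_closed[OF fh] bc
        by (intro N.finsum_cong') (auto simp: Pi_def intro!: act_closed[OF rN])
    qed
    also have "\<dots> = f x" using p hom_comb[OF rP rN fh bc p(1)] by simp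
    finally show "g (h x) = f x" .
  qed
qed

end

text \<open>The sets have equal size, and after transport along any bijection the two families on
  \<open>A\<close> differ by a permutation.\<close>

lemma image_mset_eq_bij:
  assumes "finite A" "finite B" "image_mset f (mset_set A) = image_mset g (mset_set B)"
  shows "\<exists>s. bij_betw s A B \<and> (\<forall>x\<in>A. f x = g (s x))"
proof -
  have "size (image_mset f (mset_set A)) = size (image_mset g (mset_set B))" using assms(3) by simp
  then have "card A = card B" by simp
  then obtain h where h: "bij_betw h A B" using assms finite_same_card_bij by blast
  have "image_mset (\<lambda>x. g (h x)) (mset_set A) = image_mset g (image_mset h (mset_set A))"
    by (simp add: image_mset.compositionality comp_def)
  also have "image_mset h (mset_set A) = mset_set B"
    using h by (simp add: bij_betw_def image_mset_mset_set)
  finally have "image_mset f (mset_set A) = image_mset (\<lambda>x. g (h x)) (mset_set A)" using assms(3) by simp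
  from image_mset_eq_implies_permutes[OF assms(1) this]
  obtain p where p: "p permutes A" "\<forall>x\<in>A. f x = g (h (p x))" by metis
  have "bij_betw (\<lambda>x. h (p x)) A B"
    using bij_betw_trans[OF permutes_imp_bij[OF p(1)] h] by (simp add: comp_def)
  then show ?thesis using p(2) by (intro exI[of _ "\<lambda>x. h (p x)"]) simp
qed

context leavitt
begin

subsection \<open>Shifts\<close>

lemma shift_sel [simp]:
  "carrier (shift n M) = carrier M" "ract (shift n M) = ract M" "add (shift n M) = add M"
  "ring.zero (shift n M) = ring.zero M" "gcomp (shift n M) i = gcomp M (n + i)"
  by (simp_all add: shift_def)

lemma finsum_shift [simp]: "finsum (shift n M) f A = finsum M f A"
  by (simp add: finsum_def shift_def)

lemma abelian_group_shift: "abelian_group M \<Longrightarrow> abelian_group (shift n M)"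
  by (simp add: abelian_group_def abelian_monoid_def abelian_group_axioms_def)

lemma right_module_shift: assumes M: "right_module LA M" shows "right_module LA (shift n M)"
  by (rule right_moduleI)
    (use M in \<open>simp_all add: abelian_group_shift module_abelian_group act_add_left act_add act_mult\<close>)

lemma graded_module_shift: assumes gM: "graded_module LA M" shows "graded_module LA (shift n M)"
proof (rule graded_moduleI)
  note rM = graded_right[OF gM]
  interpret M: abelian_group M by (rule module_abelian_group[OF rM])
  show "right_module LA (shift n M)" by (rule right_module_shift[OF rM])
  have re: "finsum M (\<lambda>i. c (n + i)) ((\<lambda>d. d - n) ` D) = finsum M c D" if "\<And>i. c i \<in> gcomp M i" for c D
    using gcomp_carrier[OF gM that] by (subst M.finsum_reindex) (auto simp: inj_on_def)
  show "\<exists>D c. finite D \<and> (\<forall>i. c i \<in> gcomp (shift n M) i) \<and> x = (\<Oplus>\<^bsub>shift n M\<^esub>i\<in>D. c i)"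
    if "x \<in> carrier (shift n M)" for x
  proof -
    have "x \<in> carrier M" using that by simp
    then obtain D c where c: "finite D" "\<And>i. c i \<in> gcomp M i" "x = finsum M c D"
      using gcomp_decomposition[OF gM] by blast
    show ?thesis
      using c re[OF c(2)] by (intro exI[of _ "(\<lambda>d. d - n) ` D"] exI[of _ "\<lambda>i. c (n + i)"]) simp
  qed
  show "c i = \<zero>\<^bsub>shift n M\<^esub>"
    if "finite D" and c: "\<And>i. c i \<in> gcomp (shift n M) i" and "(\<Oplus>\<^bsub>shift n M\<^esub>i\<in>D. c i) = \<zero>\<^bsub>shift n M\<^esub>" "i \<in> D"
    for D c i
  proof -
    have g: "c (j - n) \<in> gcomp M j" for j using c[of "j - n"] by simp
    have "finsum M (\<lambda>j. c (j - n)) ((\<lambda>d. d + n) ` D) = finsum M c D"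
      using gcomp_carrier[OF gM g] by (subst M.finsum_reindex) (auto simp: inj_on_def)
    then have "finsum M (\<lambda>j. c (j - n)) ((\<lambda>d. d + n) ` D) = \<zero>\<^bsub>M\<^esub>" using that(3) by simp
    then show ?thesis
      using gcomp_independent[OF gM _ g, of "(\<lambda>d. d + n) ` D" "i + n"] that(1,4) by simp
  qed
  fix i j x p assume "x \<in> gcomp (shift n M) i" "p \<in> carrier FA" "homog j p"
  then show "act (shift n M) x p \<in> gcomp (shift n M) (i + j)"
    using gcomp_act[OF gM, of x "n + i" p j] by (simp add: add.assoc)
qed (use gcomp_carrier[OF gM] gcomp_zero[OF gM] gcomp_add[OF gM] in auto)

text \<open>Component \<open>i\<close> of the shift is component \<open>n + i\<close> of the module,
  so what had degree \<open>m\<close> now sits in degree \<open>m - n\<close>.\<close>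

lemma basis_shift: "basis M I b v m \<Longrightarrow> basis (shift n M) I b v (\<lambda>i. m i - n)"
  by (simp add: basis_def frame_def spans_def)

lemma shift_shift [simp]: "shift n (shift k M) = shift (n + k) M"
  by (simp add: shift_def algebra_simps)

lemma shift_0 [simp]: "shift 0 M = M"
  by (simp add: shift_def)

subsection \<open>Direct sums\<close>

lemma gr_dsum_sel [simp]:
  "carrier (gr_dsum M N) = carrier M \<times> carrier N" "\<zero>\<^bsub>gr_dsum M N\<^esub> = (\<zero>\<^bsub>M\<^esub>, \<zero>\<^bsub>N\<^esub>)"
  "add (gr_dsum M N) (x, y) (x', y') = (x \<oplus>\<^bsub>M\<^esub> x', y \<oplus>\<^bsub>N\<^esub> y')"
  "ract (gr_dsum M N) (x, y) r = (ract M x r, ract N y r)"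
  "gcomp (gr_dsum M N) i = gcomp M i \<times> gcomp N i"
  by (simp_all add: gr_dsum_def)

context
  fixes M :: "((('v, 'e) lgen word \<Rightarrow>\<^sub>0 'k) set, 'm) gmodule"
    and N :: "((('v, 'e) lgen word \<Rightarrow>\<^sub>0 'k) set, 'n) gmodule"
  assumes gM: "graded_module LA M" and gN: "graded_module LA N"
begin

interpretation M: abelian_group M by (rule module_abelian_group[OF graded_right[OF gM]])
interpretation N: abelian_group N by (rule module_abelian_group[OF graded_right[OF gN]])

lemma abelian_group_gr_dsum: "abelian_group (gr_dsum M N)"
proof (rule abelian_groupI)
  fix x assume "x \<in> carrier (gr_dsum M N)"
  then show "\<exists>y\<in>carrier (gr_dsum M N). y \<oplus>\<^bsub>gr_dsum M N\<^esub> x = \<zero>\<^bsub>gr_dsum M N\<^esub>"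
    by (cases x) (auto intro!: bexI[of _ "(\<ominus>\<^bsub>M\<^esub> fst x, \<ominus>\<^bsub>N\<^esub> snd x)"] simp: M.l_neg N.l_neg)
qed (auto simp: M.a_ac N.a_ac)

interpretation S: abelian_group "gr_dsum M N" by (rule abelian_group_gr_dsum)

lemma finsum_gr_dsum:
  "(\<And>i. i \<in> A \<Longrightarrow> f i \<in> carrier M) \<Longrightarrow> (\<And>i. i \<in> A \<Longrightarrow> g i \<in> carrier N) \<Longrightarrow>
    finsum (gr_dsum M N) (\<lambda>i. (f i, g i)) A = (finsum M f A, finsum N g A)"
proof (induction A rule: infinite_finite_induct)
  case (insert x F)
  then show ?case by (simp add: Pi_def)
qed simp_all

lemma graded_module_gr_dsum: "graded_module LA (gr_dsum M N)"
proof (rule graded_moduleI)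
  note rM = graded_right[OF gM] and rN = graded_right[OF gN]
  show "right_module LA (gr_dsum M N)"
    by (rule right_moduleI)
      (auto simp: abelian_group_gr_dsum act_closed[OF rM] act_closed[OF rN] act_add_left[OF rM] act_add_left[OF rN]
        act_add[OF rM] act_add[OF rN] act_mult[OF rM] act_mult[OF rN] act_one[OF rM] act_one[OF rN])
  show "\<exists>D c. finite D \<and> (\<forall>i. c i \<in> gcomp (gr_dsum M N) i) \<and> x = (\<Oplus>\<^bsub>gr_dsum M N\<^esub>i\<in>D. c i)"
    if "x \<in> carrier (gr_dsum M N)" for x
  proof -
    obtain y z where x: "x = (y, z)" "y \<in> carrier M" "z \<in> carrier N" using \<open>x \<in> carrier (gr_dsum M N)\<close> by auto
    obtain D c where c: "finite D" "\<And>i. c i \<in> gcomp M i" "y = finsum M c D"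
      using gcomp_decomposition[OF gM x(2)] by blast
    obtain E d where d: "finite E" "\<And>i. d i \<in> gcomp N i" "z = finsum N d E"
      using gcomp_decomposition[OF gN x(3)] by blast
    define c' where "c' i = (if i \<in> D then c i else \<zero>\<^bsub>M\<^esub>)" for i
    define d' where "d' i = (if i \<in> E then d i else \<zero>\<^bsub>N\<^esub>)" for i
    have g: "c' i \<in> gcomp M i" "d' i \<in> gcomp N i" for i
      using c(2) d(2) by (auto simp: c'_def d'_def gcomp_zero[OF gM] gcomp_zero[OF gN])
    have "y = finsum M c' (D \<union> E)"
      unfolding c(3) by (rule M.add.finprod_mono_neutral_cong_left)
        (use c(1) d(1) gcomp_carrier[OF gM g(1)] gcomp_carrier[OF gM c(2)] in \<open>auto simp: c'_def\<close>)
    moreover have "z = finsum N d' (D \<union> E)"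
      unfolding d(3) by (rule N.add.finprod_mono_neutral_cong_left)
        (use c(1) d(1) gcomp_carrier[OF gN g(2)] gcomp_carrier[OF gN d(2)] in \<open>auto simp: d'_def\<close>)
    ultimately show ?thesis
      using c(1) d(1) g x(1) finsum_gr_dsum[of "D \<union> E" c' d'] gcomp_carrier[OF gM g(1)] gcomp_carrier[OF gN g(2)]
      by (intro exI[of _ "D \<union> E"] exI[of _ "\<lambda>i. (c' i, d' i)"]) simp
  qed
  show "c i = \<zero>\<^bsub>gr_dsum M N\<^esub>"
    if D: "finite D" and c: "\<And>i. c i \<in> gcomp (gr_dsum M N) i"
      and z: "(\<Oplus>\<^bsub>gr_dsum M N\<^esub>i\<in>D. c i) = \<zero>\<^bsub>gr_dsum M N\<^esub>" and i: "i \<in> D"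
    for D c i
  proof -
    have g: "fst (c j) \<in> gcomp M j" "snd (c j) \<in> gcomp N j" for j using c[of j] by auto
    have "finsum (gr_dsum M N) (\<lambda>i. (fst (c i), snd (c i))) D = (finsum M (\<lambda>i. fst (c i)) D, finsum N (\<lambda>i. snd (c i)) D)"
      using gcomp_carrier[OF gM g(1)] gcomp_carrier[OF gN g(2)] by (intro finsum_gr_dsum) auto
    then have "finsum M (\<lambda>i. fst (c i)) D = \<zero>\<^bsub>M\<^esub>" "finsum N (\<lambda>i. snd (c i)) D = \<zero>\<^bsub>N\<^esub>" using z by simp_all
    then have "fst (c i) = \<zero>\<^bsub>M\<^esub>" "snd (c i) = \<zero>\<^bsub>N\<^esub>"
      using gcomp_independent[OF gM D g(1)] gcomp_independent[OF gN D g(2)] i by blast+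
    then show ?thesis by (simp add: prod_eq_iff)
  qed
  fix i j x p assume "x \<in> gcomp (gr_dsum M N) i" "p \<in> carrier FA" "homog j p"
  then show "act (gr_dsum M N) x p \<in> gcomp (gr_dsum M N) (i + j)"
    using gcomp_act[OF gM, of "fst x" i p j] gcomp_act[OF gN, of "snd x" i p j] by (cases x) auto
qed (use gcomp_carrier[OF gM] gcomp_zero[OF gM] gcomp_add[OF gM]
      gcomp_carrier[OF gN] gcomp_zero[OF gN] gcomp_add[OF gN] in auto)

lemma basis_gr_dsum:
  assumes B: "basis M I b v m" and C: "basis N J c v m" and IJ: "I \<inter> J = {}"
  shows "basis (gr_dsum M N) (I \<union> J) (\<lambda>i. if i \<in> I then (b i, \<zero>\<^bsub>N\<^esub>) else (\<zero>\<^bsub>M\<^esub>, c i)) v m"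
proof -
  note rM = graded_right[OF gM] and rN = graded_right[OF gN]
  note FB = basisD(1)[OF B] and FC = basisD(1)[OF C]
  note bc = frame_closed[OF gM FB] and cc = frame_closed[OF gN FC]
  have fin: "finite I" "finite J" using frameD(1)[OF FB] frameD(1)[OF FC] .
  let ?d = "\<lambda>i. if i \<in> I then (b i, \<zero>\<^bsub>N\<^esub>) else (\<zero>\<^bsub>M\<^esub>, c i)"
  have cmb: "comb (gr_dsum M N) (I \<union> J) ?d p = (comb M I b p, comb N J c p)" if p: "p \<in> I \<union> J \<rightarrow> carrier FA" for p
  proof -
    have "comb (gr_dsum M N) (I \<union> J) ?d p = finsum (gr_dsum M N) (\<lambda>i. (if i \<in> I then act M (b i) (p i) else \<zero>\<^bsub>M\<^esub>,
        if i \<in> J then act N (c i) (p i) else \<zero>\<^bsub>N\<^esub>)) (I \<union> J)"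
      using p bc cc IJ
      by (intro S.finsum_cong')
        (auto simp: Pi_def act_closed[OF rM] act_closed[OF rN] act_zero_left[OF rM] act_zero_left[OF rN])
    also have "\<dots> = (finsum M (\<lambda>i. if i \<in> I then act M (b i) (p i) else \<zero>\<^bsub>M\<^esub>) (I \<union> J),
        finsum N (\<lambda>i. if i \<in> J then act N (c i) (p i) else \<zero>\<^bsub>N\<^esub>) (I \<union> J))"
      using p bc cc by (intro finsum_gr_dsum) (auto simp: Pi_def act_closed[OF rM] act_closed[OF rN])
    also have "finsum M (\<lambda>i. if i \<in> I then act M (b i) (p i) else \<zero>\<^bsub>M\<^esub>) (I \<union> J) = comb M I b p"
      by (rule M.add.finprod_mono_neutral_cong_right)
        (use fin p bc in \<open>auto simp: Pi_def act_closed[OF rM]\<close>)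
    also have "finsum N (\<lambda>i. if i \<in> J then act N (c i) (p i) else \<zero>\<^bsub>N\<^esub>) (I \<union> J) = comb N J c p"
      by (rule N.add.finprod_mono_neutral_cong_right)
        (use fin p cc in \<open>auto simp: Pi_def act_closed[OF rN]\<close>)
    finally show ?thesis .
  qed
  have "frame (gr_dsum M N) (I \<union> J) ?d v m"
    using FB FC by (auto simp: frame_def gcomp_zero[OF gM] gcomp_zero[OF gN] act_zero_left[OF rM] act_zero_left[OF rN])
  moreover have "spans (gr_dsum M N) (I \<union> J) ?d"
    unfolding spans_def
  proof
    fix x assume "x \<in> carrier (gr_dsum M N)"
    then obtain y z where x: "x = (y, z)" "y \<in> carrier M" "z \<in> carrier N" by auto
    obtain p where p: "p \<in> I \<rightarrow> carrier FA" "y = comb M I b p" using spansD[OF basisD(2)[OF B] x(2)] by blast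
    obtain q where q: "q \<in> J \<rightarrow> carrier FA" "z = comb N J c q" using spansD[OF basisD(2)[OF C] x(3)] by blast
    define r where "r i = (if i \<in> I then p i else q i)" for i
    have r: "r \<in> I \<union> J \<rightarrow> carrier FA" using p q by (auto simp: r_def)
    have "comb M I b r = y" unfolding p(2)
      using p(1) bc by (intro M.finsum_cong') (auto simp: r_def Pi_def act_closed[OF rM])
    moreover have "comb N J c r = z" unfolding q(2)
      using q(1) cc IJ by (intro N.finsum_cong') (auto simp: r_def Pi_def act_closed[OF rN])
    ultimately have "x = comb (gr_dsum M N) (I \<union> J) ?d r" using cmb[OF r] x(1) by simp
    then show "\<exists>p\<in>I \<union> J \<rightarrow> carrier FA. x = comb (gr_dsum M N) (I \<union> J) ?d p" using r by (rule bexI)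
  qed
  moreover have "vx (v i) * p i \<in> LI"
    if p: "p \<in> I \<union> J \<rightarrow> carrier FA" and z: "comb (gr_dsum M N) (I \<union> J) ?d p = \<zero>\<^bsub>gr_dsum M N\<^esub>" and i: "i \<in> I \<union> J"
    for p i
  proof -
    have "comb M I b p = \<zero>\<^bsub>M\<^esub>" "comb N J c p = \<zero>\<^bsub>N\<^esub>" using cmb[OF p] z by simp_all
    then show ?thesis
      using basisD(3)[OF B, of p i] basisD(3)[OF C, of p i] p i by (auto simp: Pi_def)
  qed
  ultimately show ?thesis unfolding basis_def by blast
qed

end

subsection \<open>Transport of structure\<close>

text \<open>Vertex modules consist of cosets and direct sums of pairs, whereas \<open>Vgr\<close>
  and \<open>gr_projective\<close> only see modules over \<open>'u\<close>. An injection on the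
  carrier moves the whole structure there.\<close>

definition transp :: "('m \<Rightarrow> 'u) \<Rightarrow> ('r, 'm) gmodule \<Rightarrow> ('r, 'u) gmodule" where
  "transp \<iota> M = (let \<kappa> = inv_into (carrier M) \<iota> in
     \<lparr>carrier = \<iota> ` carrier M, monoid.mult = undefined, one = undefined, ring.zero = \<iota> \<zero>\<^bsub>M\<^esub>,
      add = (\<lambda>x y. \<iota> (\<kappa> x \<oplus>\<^bsub>M\<^esub> \<kappa> y)), ract = (\<lambda>x r. \<iota> (ract M (\<kappa> x) r)), gcomp = (\<lambda>i. \<iota> ` gcomp M i)\<rparr>)"

context
  fixes M :: "((('v, 'e) lgen word \<Rightarrow>\<^sub>0 'k) set, 'm) gmodule" and \<iota> :: "'m \<Rightarrow> 'u"
  assumes gM: "graded_module LA M" and inj: "inj_on \<iota> (carrier M)"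
begin

interpretation M: abelian_group M by (rule module_abelian_group[OF graded_right[OF gM]])

lemma transp_sel [simp]:
  "carrier (transp \<iota> M) = \<iota> ` carrier M" "\<zero>\<^bsub>transp \<iota> M\<^esub> = \<iota> \<zero>\<^bsub>M\<^esub>"
  "gcomp (transp \<iota> M) i = \<iota> ` gcomp M i"
  "x \<in> carrier M \<Longrightarrow> y \<in> carrier M \<Longrightarrow> \<iota> x \<oplus>\<^bsub>transp \<iota> M\<^esub> \<iota> y = \<iota> (x \<oplus>\<^bsub>M\<^esub> y)"
  "x \<in> carrier M \<Longrightarrow> ract (transp \<iota> M) (\<iota> x) r = \<iota> (ract M x r)"
  using inj by (simp_all add: transp_def Let_def)

lemma transp_eq_iff: "x \<in> carrier M \<Longrightarrow> y \<in> carrier M \<Longrightarrow> \<iota> x = \<iota> y \<longleftrightarrow> x = y"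
  using inj by (auto simp: inj_on_def)

lemma abelian_group_transp: "abelian_group (transp \<iota> M)"
proof (rule abelian_groupI)
  fix x assume "x \<in> carrier (transp \<iota> M)"
  then obtain y where "y \<in> carrier M" "x = \<iota> y" by auto
  then show "\<exists>y\<in>carrier (transp \<iota> M). y \<oplus>\<^bsub>transp \<iota> M\<^esub> x = \<zero>\<^bsub>transp \<iota> M\<^esub>"
    by (intro bexI[of _ "\<iota> (\<ominus>\<^bsub>M\<^esub> y)"]) (simp_all add: M.l_neg)
qed (auto simp: M.a_ac)

interpretation T: abelian_group "transp \<iota> M" by (rule abelian_group_transp)

lemma finsum_transp:
  "(\<And>i. i \<in> A \<Longrightarrow> f i \<in> carrier M) \<Longrightarrow> finsum (transp \<iota> M) (\<lambda>i. \<iota> (f i)) A = \<iota> (finsum M f A)"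
proof (induction A rule: infinite_finite_induct)
  case (insert x F)
  then show ?case by (simp add: Pi_def)
qed simp_all

lemma graded_module_transp: "graded_module LA (transp \<iota> M)"
proof (rule graded_moduleI)
  note rM = graded_right[OF gM]
  show "right_module LA (transp \<iota> M)"
    by (rule right_moduleI)
      (auto simp: abelian_group_transp act_closed[OF rM] act_add_left[OF rM] act_add[OF rM] act_mult[OF rM] act_one[OF rM])
  show "\<exists>D c. finite D \<and> (\<forall>i. c i \<in> gcomp (transp \<iota> M) i) \<and> x = (\<Oplus>\<^bsub>transp \<iota> M\<^esub>i\<in>D. c i)"
    if "x \<in> carrier (transp \<iota> M)" for x
  proof -
    obtain y where y: "y \<in> carrier M" "x = \<iota> y" using \<open>x \<in> carrier (transp \<iota> M)\<close> by auto
    obtain D c where c: "finite D" "\<And>i. c i \<in> gcomp M i" "y = finsum M c D"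
      using gcomp_decomposition[OF gM y(1)] by blast
    then show ?thesis
      using y finsum_transp[of D c] gcomp_carrier[OF gM c(2)]
      by (intro exI[of _ D] exI[of _ "\<lambda>i. \<iota> (c i)"]) auto
  qed
  show "c i = \<zero>\<^bsub>transp \<iota> M\<^esub>"
    if D: "finite D" and c: "\<And>i. c i \<in> gcomp (transp \<iota> M) i"
      and z: "(\<Oplus>\<^bsub>transp \<iota> M\<^esub>i\<in>D. c i) = \<zero>\<^bsub>transp \<iota> M\<^esub>" and i: "i \<in> D"
    for D c i
  proof -
    have "\<forall>j. \<exists>x. x \<in> gcomp M j \<and> c j = \<iota> x" using c by (auto simp: image_iff)
    then obtain d where d: "\<And>j. d j \<in> gcomp M j" "\<And>j. c j = \<iota> (d j)" by metis
    have dc: "d j \<in> carrier M" for j using gcomp_carrier[OF gM d(1)] .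
    have "(\<Oplus>\<^bsub>transp \<iota> M\<^esub>i\<in>D. \<iota> (d i)) = \<iota> (finsum M d D)" by (rule finsum_transp) (rule dc)
    then have "\<iota> (finsum M d D) = \<iota> \<zero>\<^bsub>M\<^esub>" using z unfolding d(2) by simp
    then have "finsum M d D = \<zero>\<^bsub>M\<^esub>" using dc by (subst (asm) transp_eq_iff) auto
    then show ?thesis using gcomp_independent[OF gM D d(1) _ i] d(2) by simp
  qed
  fix i j x p assume "x \<in> gcomp (transp \<iota> M) i" "p \<in> carrier FA" "homog j p"
  then show "act (transp \<iota> M) x p \<in> gcomp (transp \<iota> M) (i + j)"
    using gcomp_act[OF gM, of _ i p j] gcomp_carrier[OF gM] by auto
next
  fix i x y assume "x \<in> gcomp (transp \<iota> M) i" "y \<in> gcomp (transp \<iota> M) i"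
  then show "x \<oplus>\<^bsub>transp \<iota> M\<^esub> y \<in> gcomp (transp \<iota> M) i"
    using gcomp_add[OF gM] gcomp_carrier[OF gM] by auto
qed (use gcomp_carrier[OF gM] gcomp_zero[OF gM] in auto)

lemma basis_transp: assumes B: "basis M I b v m" shows "basis (transp \<iota> M) I (\<lambda>i. \<iota> (b i)) v m"
proof -
  note rM = graded_right[OF gM] and F = basisD(1)[OF B]
  note bc = frame_closed[OF gM F]
  have b: "b i \<in> carrier M" if "i \<in> I" for i using bc that by auto
  have cmb: "comb (transp \<iota> M) I (\<lambda>i. \<iota> (b i)) p = \<iota> (comb M I b p)" if p: "p \<in> I \<rightarrow> carrier FA" for p
  proof -
    have "comb (transp \<iota> M) I (\<lambda>i. \<iota> (b i)) p = (\<Oplus>\<^bsub>transp \<iota> M\<^esub>i\<in>I. \<iota> (act M (b i) (p i)))"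
      using p b by (intro T.finsum_cong') (auto simp: Pi_def act_closed[OF rM])
    then show ?thesis using p b by (simp add: finsum_transp Pi_def act_closed[OF rM])
  qed
  have "frame (transp \<iota> M) I (\<lambda>i. \<iota> (b i)) v m" using F b by (auto simp: frame_def)
  moreover have "spans (transp \<iota> M) I (\<lambda>i. \<iota> (b i))"
    using basisD(2)[OF B] cmb by (auto simp: spans_def intro: bexI[rotated])
  moreover have "vx (v i) * p i \<in> LI"
    if "p \<in> I \<rightarrow> carrier FA" "comb (transp \<iota> M) I (\<lambda>i. \<iota> (b i)) p = \<zero>\<^bsub>transp \<iota> M\<^esub>" "i \<in> I" for p i
    using basisD(3)[OF B that(1) _ that(3)] that(2) cmb[OF that(1)] comb_closed[OF rM bc that(1)]
    by (simp add: transp_eq_iff)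
  ultimately show ?thesis unfolding basis_def by blast
qed

end

end

subsection \<open>Types of modules with a graded basis\<close>

primrec encode_list :: "('u \<times> 'u \<Rightarrow> 'u) \<Rightarrow> 'u \<Rightarrow> 'u list \<Rightarrow> 'u" where
  "encode_list pr z [] = z"
| "encode_list pr z (x # xs) = pr (x, encode_list pr z xs)"

lemma encode_list_inject:
  "inj pr \<Longrightarrow> length xs = length ys \<Longrightarrow> encode_list pr z xs = encode_list pr z ys \<Longrightarrow> xs = ys"
  by (induction xs ys rule: list_induct2') (auto dest: injD)

text \<open>Iterated pairing with the length stored separately: the code of the empty list may
  itself be a pair, so \<open>encode_list\<close> alone separates only lists of equal
  length.\<close>

lemma infinite_inj_list:
  assumes "infinite (UNIV :: 'u set)" obtains l :: "'u list \<Rightarrow> 'u" where "inj l"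
proof -
  obtain nt :: "nat \<Rightarrow> 'u" where nt: "inj nt" using assms infinite_countable_subset by blast
  have "|UNIV \<times> UNIV :: ('u \<times> 'u) set| =o |UNIV :: 'u set|" by (rule card_of_Times_same_infinite[OF assms])
  then obtain pr :: "'u \<times> 'u \<Rightarrow> 'u" where "bij_betw pr (UNIV \<times> UNIV) UNIV" using card_of_ordIso by blast
  then have pr: "inj pr" by (simp add: bij_betw_def)
  have "inj (\<lambda>xs. pr (nt (length xs), encode_list pr (nt 0) xs))"
    using encode_list_inject[OF pr] injD[OF pr] injD[OF nt] by (intro injI) blast
  then show ?thesis by (rule that)
qed

text \<open>A polynomial is coded by a list of coded pairs of a word and its coefficient. The order
  of the list may be arbitrary, because equal codes give equal sets of pairs and these determine the
  polynomial.\<close>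

lemma free_algebra_inj:
  fixes \<iota> :: "'k::field \<Rightarrow> 'u"
  assumes inf: "infinite (UNIV :: 'u set)" and \<iota>: "inj \<iota>" and S: "finite S"
  obtains j :: "('g word \<Rightarrow>\<^sub>0 'k) \<Rightarrow> 'u" where "inj_on j (carrier (free_algebra S))"
proof -
  obtain l :: "'u list \<Rightarrow> 'u" where l: "inj l" using infinite_inj_list[OF inf] by blast
  obtain nt :: "nat \<Rightarrow> 'u" where nt: "inj nt" using inf infinite_countable_subset by blast
  obtain c :: "'g \<Rightarrow> nat" where c: "inj_on c S" using finite_imp_inj_to_nat_seg[OF S] by blast
  define gc where "gc g = nt (c g)" for g
  have gc: "inj_on gc S" using c injD[OF nt] by (auto simp: gc_def inj_on_def)
  define wc where "wc w = l (map gc (letters w))" for w :: "'g word"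
  have wc: "u = w" if "set (letters u) \<subseteq> S" "set (letters w) \<subseteq> S" "wc u = wc w" for u w
  proof -
    have "map gc (letters u) = map gc (letters w)" using injD[OF l] that(3) by (simp add: wc_def)
    then have "letters u = letters w"
      using that(1,2) gc by (intro map_inj_on[of gc]) (auto intro: inj_on_subset)
    then show ?thesis by (cases u; cases w) simp
  qed
  define ks where "ks p = (SOME xs. set xs = Poly_Mapping.keys p)" for p :: "'g word \<Rightarrow>\<^sub>0 'k"
  have ks: "set (ks p) = Poly_Mapping.keys p" for p
    unfolding ks_def using someI_ex[OF finite_list[OF finite_keys[of p]]] .
  define j where "j p = l (map (\<lambda>w. l [wc w, \<iota> (Poly_Mapping.lookup p w)]) (ks p))" for p
  have "p = q" if p: "p \<in> carrier (free_algebra S)" and q: "q \<in> carrier (free_algebra S)" and eq: "j p = j q" for p q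
  proof (rule poly_mapping_eqI)
    have sets: "(\<lambda>w. l [wc w, \<iota> (Poly_Mapping.lookup p w)]) ` Poly_Mapping.keys p =
        (\<lambda>w. l [wc w, \<iota> (Poly_Mapping.lookup q w)]) ` Poly_Mapping.keys q"
      using arg_cong[OF injD[OF l eq[unfolded j_def]], of set] by (simp add: ks)
    have key: "w \<in> Poly_Mapping.keys q \<and> Poly_Mapping.lookup q w = Poly_Mapping.lookup p w"
      if w: "w \<in> Poly_Mapping.keys p" and p: "p \<in> carrier (free_algebra S)" and q: "q \<in> carrier (free_algebra S)"
        and sets: "(\<lambda>w. l [wc w, \<iota> (Poly_Mapping.lookup p w)]) ` Poly_Mapping.keys p =
         (\<lambda>w. l [wc w, \<iota> (Poly_Mapping.lookup q w)]) ` Poly_Mapping.keys q" for p q w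
    proof -
      obtain u where u: "u \<in> Poly_Mapping.keys q"
        "l [wc w, \<iota> (Poly_Mapping.lookup p w)] = l [wc u, \<iota> (Poly_Mapping.lookup q u)]"
        using imageI[OF w, of "\<lambda>w. l [wc w, \<iota> (Poly_Mapping.lookup p w)]"] unfolding sets by blast
      then have "wc w = wc u" "\<iota> (Poly_Mapping.lookup p w) = \<iota> (Poly_Mapping.lookup q u)"
        using injD[OF l u(2)] by auto
      then show ?thesis using wc[of w u] u w p q injD[OF \<iota>] by (auto simp: fa_carrier_iff)
    qed
    fix w
    show "Poly_Mapping.lookup p w = Poly_Mapping.lookup q w"
    proof (cases "w \<in> Poly_Mapping.keys p")
      case True
      then show ?thesis using key[OF True p q sets] by simp
    next
      case False
      then have "w \<notin> Poly_Mapping.keys q" using key[OF _ q p sets[symmetric], of w] by blast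
      then show ?thesis using False by (simp add: in_keys_iff)
    qed
  qed
  then show ?thesis using that[of j] by (auto simp: inj_on_def)
qed

section \<open>Vertex modules and types\<close>

context leavitt
begin

text \<open>The right ideal generated by the vertex \<open>v\<close>, shifted by \<open>- n\<close>
  so that its generator has degree \<open>n\<close>.\<close>

definition vertex_module :: "'v \<Rightarrow> int \<Rightarrow>
    ((('v, 'e) lgen word \<Rightarrow>\<^sub>0 'k) set, (('v, 'e) lgen word \<Rightarrow>\<^sub>0 'k) set) gmodule" where
  "vertex_module v n = \<lparr>carrier = (\<lambda>p. proj (vx v * p)) ` carrier FA, monoid.mult = undefined, one = undefined,
     ring.zero = proj 0, add = add LA, ract = monoid.mult LA,
     gcomp = (\<lambda>i. (\<lambda>p. proj (vx v * p)) ` {p \<in> carrier FA. homog (i - n) p})\<rparr>"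

lemma vertex_module_sel [simp]:
  "carrier (vertex_module v n) = (\<lambda>p. proj (vx v * p)) ` carrier FA" "\<zero>\<^bsub>vertex_module v n\<^esub> = proj 0"
  "add (vertex_module v n) = add LA" "ract (vertex_module v n) = monoid.mult LA"
  "gcomp (vertex_module v n) i = (\<lambda>p. proj (vx v * p)) ` {p \<in> carrier FA. homog (i - n) p}"
  by (simp_all add: vertex_module_def)

context
  fixes v assumes v: "v \<in> verts G"
begin

lemma vertex_module_elem [simp]: "p \<in> carrier FA \<Longrightarrow> proj (vx v * p) \<in> carrier (vertex_module v n)"
  by simp

lemma abelian_group_vertex_module: "abelian_group (vertex_module v n)"
proof (rule abelian_groupI)
  fix x y assume "x \<in> carrier (vertex_module v n)" "y \<in> carrier (vertex_module v n)"
  then obtain p q where pq: "p \<in> carrier FA" "q \<in> carrier FA" "x = proj (vx v * p)" "y = proj (vx v * q)" by auto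
  then have "x \<oplus>\<^bsub>vertex_module v n\<^esub> y = proj (vx v * (p + q))" using v by (simp add: proj_add algebra_simps)
  then show "x \<oplus>\<^bsub>vertex_module v n\<^esub> y \<in> carrier (vertex_module v n)" using pq by auto
next
  show "\<zero>\<^bsub>vertex_module v n\<^esub> \<in> carrier (vertex_module v n)" by (auto intro!: image_eqI[of _ _ 0])
next
  fix x assume "x \<in> carrier (vertex_module v n)"
  then obtain p where p: "p \<in> carrier FA" "x = proj (vx v * p)" by auto
  then have "proj (vx v * - p) \<oplus>\<^bsub>vertex_module v n\<^esub> x = \<zero>\<^bsub>vertex_module v n\<^esub>"
    using v by (simp add: proj_add del: mult_minus_right) simp
  then show "\<exists>y\<in>carrier (vertex_module v n). y \<oplus>\<^bsub>vertex_module v n\<^esub> x = \<zero>\<^bsub>vertex_module v n\<^esub>"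
    using p(1) by (intro bexI[of _ "proj (vx v * - p)"] vertex_module_elem) auto
qed (use v in \<open>auto simp: proj_add algebra_simps\<close>)

lemma finsum_vertex_module:
  "(\<And>i. i \<in> A \<Longrightarrow> q i \<in> carrier FA) \<Longrightarrow>
    finsum (vertex_module v n) (\<lambda>i. proj (vx v * q i)) A = proj (vx v * sum q A)"
proof (induction A rule: infinite_finite_induct)
  case (infinite A)
  interpret abelian_group "vertex_module v n" by (rule abelian_group_vertex_module)
  show ?case using infinite by simp
next
  case empty
  interpret abelian_group "vertex_module v n" by (rule abelian_group_vertex_module)
  show ?case by simp
next
  case (insert x F)
  interpret abelian_group "vertex_module v n" by (rule abelian_group_vertex_module)
  have "finsum (vertex_module v n) (\<lambda>i. proj (vx v * q i)) (insert x F) =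
      proj (vx v * q x) \<oplus>\<^bsub>LA\<^esub> finsum (vertex_module v n) (\<lambda>i. proj (vx v * q i)) F"
    using insert by (subst finsum_insert) auto
  then show ?case using insert v by (simp add: proj_add algebra_simps)
qed

lemma graded_module_vertex_module: "graded_module LA (vertex_module v n)"
proof (rule graded_moduleI)
  show "right_module LA (vertex_module v n)"
  proof (rule right_moduleI)
    fix x p assume "x \<in> carrier (vertex_module v n)" "p \<in> carrier FA"
    then obtain q where "q \<in> carrier FA" "x = proj (vx v * q)" by auto
    then show "act (vertex_module v n) x p \<in> carrier (vertex_module v n)"
      using v \<open>p \<in> carrier FA\<close> by (auto simp: proj_mult mult.assoc intro!: image_eqI[of _ _ "q * p"])
  qed (use v in \<open>auto simp: abelian_group_vertex_module proj_add proj_mult algebra_simps\<close>)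
  show "\<exists>D c. finite D \<and> (\<forall>i. c i \<in> gcomp (vertex_module v n) i) \<and> x = (\<Oplus>\<^bsub>vertex_module v n\<^esub>i\<in>D. c i)"
    if "x \<in> carrier (vertex_module v n)" for x
  proof -
    obtain p where p: "p \<in> carrier FA" "x = proj (vx v * p)" using \<open>x \<in> carrier (vertex_module v n)\<close> by auto
    define D where "D = (\<lambda>w. word_degree w + n) ` Poly_Mapping.keys p"
    have "(\<Sum>i\<in>D. hpart (i - n) p) = (\<Sum>i\<in>(\<lambda>d. d - n) ` D. hpart i p)"
      by (subst sum.reindex) (auto simp: inj_on_def)
    also have "\<dots> = p"
      by (rule sum_hpart) (auto simp: D_def image_image)
    finally have "finsum (vertex_module v n) (\<lambda>i. proj (vx v * hpart (i - n) p)) D = x"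
      using p by (subst finsum_vertex_module) auto
    then show ?thesis
      using p by (intro exI[of _ D] exI[of _ "\<lambda>i. proj (vx v * hpart (i - n) p)"]) (auto simp: D_def)
  qed
  show "c i = \<zero>\<^bsub>vertex_module v n\<^esub>"
    if D: "finite D" and c: "\<And>i. c i \<in> gcomp (vertex_module v n) i"
      and z: "(\<Oplus>\<^bsub>vertex_module v n\<^esub>i\<in>D. c i) = \<zero>\<^bsub>vertex_module v n\<^esub>" and i: "i \<in> D"
    for D c i
  proof -
    have "\<forall>j. \<exists>p. p \<in> carrier FA \<and> homog (j - n) p \<and> c j = proj (vx v * p)" using c by (auto simp: image_iff)
    then obtain p where p: "\<And>j. p j \<in> carrier FA" "\<And>j. homog (j - n) (p j)" "\<And>j. c j = proj (vx v * p j)" by metis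
    have "proj (vx v * sum p D) = proj 0"
      using z finsum_vertex_module[of D p] p(1) unfolding p(3) by simp
    then have "vx v * sum p D \<in> LI"
      using proj_eq_iff[of "vx v * sum p D" 0] v p(1) by (simp add: cong_0_iff)
    \<comment> \<open>Independence of the components rests on the ideal being graded.\<close>
    then have "hpart (i - n) (vx v * sum p D) \<in> LI" by (rule LI_hpart)
    also have "hpart (i - n) (vx v * sum p D) = (\<Sum>j\<in>D. hpart (i - n) (vx v * p j))"
      by (simp add: sum_distrib_left hpart_sum)
    also have "\<dots> = (\<Sum>j\<in>D. if j = i then vx v * p i else 0)"
    proof (rule sum.cong[OF refl])
      fix j assume "j \<in> D"
      have "homog (j - n) (vx v * p j)" by (rule homog_mult[OF homog_gen[of _ 0] p(2)]) auto
      then show "hpart (i - n) (vx v * p j) = (if j = i then vx v * p i else 0)"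
        by (auto simp: hpart_homog)
    qed
    also have "\<dots> = vx v * p i" using D i by simp
    finally show ?thesis using proj_eq_iff[of "vx v * p i" 0] p v by (simp add: cong_0_iff)
  qed
  fix i j x p assume "x \<in> gcomp (vertex_module v n) i" "p \<in> carrier FA" "homog j p"
  then obtain q where "q \<in> carrier FA" "homog (i - n) q" "x = proj (vx v * q)" by auto
  then show "act (vertex_module v n) x p \<in> gcomp (vertex_module v n) (i + j)"
    using v \<open>p \<in> carrier FA\<close> homog_mult[OF \<open>homog (i - n) q\<close> \<open>homog j p\<close>, of "i + j - n"]
    by (auto simp: proj_mult mult.assoc intro!: image_eqI[of _ _ "q * p"])
next
  fix i x y assume "x \<in> gcomp (vertex_module v n) i" "y \<in> gcomp (vertex_module v n) i"
  then obtain p q where "p \<in> carrier FA" "homog (i - n) p" "x = proj (vx v * p)"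
    "q \<in> carrier FA" "homog (i - n) q" "y = proj (vx v * q)" by auto
  then show "x \<oplus>\<^bsub>vertex_module v n\<^esub> y \<in> gcomp (vertex_module v n) i"
    using v by (auto simp: proj_add algebra_simps homog_add intro!: image_eqI[of _ _ "p + q"])
qed (auto intro: image_eqI[of _ _ 0])

lemma basis_vertex_module: "basis (vertex_module v n) {i} (\<lambda>_. proj (vx v)) (\<lambda>_. v) (\<lambda>_. n)"
proof -
  interpret abelian_group "vertex_module v n" by (rule abelian_group_vertex_module)
  have mem: "proj (vx v) \<in> gcomp (vertex_module v n) n" by (auto intro!: image_eqI[of _ _ 1])
  have a: "comb (vertex_module v n) {i} (\<lambda>_. proj (vx v)) p = proj (vx v * p i)" if "p i \<in> carrier FA" for p
    using that v finsum_vertex_module[of "{i}" p n] by (simp add: proj_mult)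
  have "frame (vertex_module v n) {i} (\<lambda>_. proj (vx v)) (\<lambda>_. v) (\<lambda>_. n)"
    using v mem proj_eq_iff[of "vx v * vx v" "vx v"] VV'[OF v] by (auto simp: frame_def proj_mult)
  moreover have "spans (vertex_module v n) {i} (\<lambda>_. proj (vx v))"
    unfolding spans_def
  proof
    fix x assume "x \<in> carrier (vertex_module v n)"
    then obtain p where "p \<in> carrier FA" "x = proj (vx v * p)" by auto
    then show "\<exists>p\<in>{i} \<rightarrow> carrier FA. x = comb (vertex_module v n) {i} (\<lambda>_. proj (vx v)) p"
      using a[of "\<lambda>_. p"] by (intro bexI[of _ "\<lambda>_. p"]) auto
  qed
  moreover have "vx v * p j \<in> LI"
    if "p \<in> {i} \<rightarrow> carrier FA" "comb (vertex_module v n) {i} (\<lambda>_. proj (vx v)) p = \<zero>\<^bsub>vertex_module v n\<^esub>" "j \<in> {i}" for p j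
    using a[of p] that v proj_eq_iff[of "vx v * p i" 0] by (simp add: cong_0_iff Pi_def)
  ultimately show ?thesis unfolding basis_def by blast
qed

end

text \<open>Records the vertices and degrees of a basis up to order. The index set consists of
  naturals so that one fixed type can be quantified over; \<open>has_typeI\<close> brings any index
  set into this form. A module may have many types.\<close>

definition has_type :: "((('v, 'e) lgen word \<Rightarrow>\<^sub>0 'k) set, 'm) gmodule \<Rightarrow> ('v \<times> int) multiset \<Rightarrow> bool" where
  "has_type M \<mu> \<longleftrightarrow> (\<exists>(I :: nat set) b v m. basis M I b v m \<and> \<mu> = image_mset (\<lambda>i. (v i, m i)) (mset_set I))"

abbreviation valid :: "('v \<times> int) multiset \<Rightarrow> bool" where
  "valid \<mu> \<equiv> fst ` set_mset \<mu> \<subseteq> verts G"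

lemma basis_vm_cong:
  "basis M I b v m \<Longrightarrow> (\<And>i. i \<in> I \<Longrightarrow> v i = v' i) \<Longrightarrow> (\<And>i. i \<in> I \<Longrightarrow> m i = m' i) \<Longrightarrow> basis M I b v' m'"
  by (auto simp: basis_def frame_def)

lemma has_typeI:
  assumes gM: "graded_module LA M" and B: "basis M I b v m"
  shows "has_type M (image_mset (\<lambda>i. (v i, m i)) (mset_set I))"
proof -
  obtain h where h: "bij_betw h {0..<card I} I"
    using ex_bij_betw_nat_finite[OF frameD(1)[OF basisD(1)[OF B]]] by blast
  have "image_mset (\<lambda>i. (v i, m i)) (mset_set I) = image_mset (\<lambda>i. (v i, m i)) (image_mset h (mset_set {0..<card I}))"
    using h by (simp add: bij_betw_def image_mset_mset_set)
  also have "\<dots> = image_mset (\<lambda>j. (v (h j), m (h j))) (mset_set {0..<card I})"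
    by (simp add: image_mset.compositionality comp_def)
  finally show ?thesis using basis_reindex[OF gM B h] unfolding has_type_def by blast
qed

lemma has_type_valid: "has_type M \<mu> \<Longrightarrow> valid \<mu>"
proof -
  assume "has_type M \<mu>"
  then obtain I :: "nat set" and b v m where B: "basis M I b v m" "\<mu> = image_mset (\<lambda>i. (v i, m i)) (mset_set I)"
    by (auto simp: has_type_def)
  show ?thesis using frameD(1,2)[OF basisD(1)[OF B(1)]] B(2) by auto
qed

lemma has_type_iso:
  assumes gP: "graded_module LA P" and P: "has_type P \<mu>" and gQ: "graded_module LA Q" and Q: "has_type Q \<mu>"
  shows "gr_isomorphic LA P Q"
proof -
  obtain I :: "nat set" and b v m where B: "basis P I b v m" "\<mu> = image_mset (\<lambda>i. (v i, m i)) (mset_set I)"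
    using P by (auto simp: has_type_def)
  obtain J :: "nat set" and c w n where C: "basis Q J c w n" "\<mu> = image_mset (\<lambda>i. (w i, n i)) (mset_set J)"
    using Q by (auto simp: has_type_def)
  have fin: "finite I" "finite J" using frameD(1)[OF basisD(1)[OF B(1)]] frameD(1)[OF basisD(1)[OF C(1)]] .
  obtain s where s: "bij_betw s I J" "\<And>i. i \<in> I \<Longrightarrow> (v i, m i) = (w (s i), n (s i))"
    using image_mset_eq_bij[OF fin trans[OF B(2)[symmetric] C(2)]] by blast
  have "basis P I b (\<lambda>i. w (s i)) (\<lambda>i. n (s i))" by (rule basis_vm_cong[OF B(1)]) (use s(2) in auto)
  then show ?thesis by (rule basis_iso[OF gP _ gQ basis_reindex[OF gQ C(1) s(1)]])
qed

lemma has_type_transport: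
  assumes gQ: "graded_module LA Q" and gP: "graded_module LA P" and "gr_isomorphic LA Q P" and P: "has_type P \<mu>"
  shows "has_type Q \<mu>"
  using P basis_transport[OF gQ gP assms(3)] unfolding has_type_def by metis

lemma has_type_shift:
  assumes "has_type M \<mu>" shows "has_type (shift n M) (image_mset (\<lambda>(v, m). (v, m - n)) \<mu>)"
proof -
  obtain I :: "nat set" and b v m where B: "basis M I b v m" "\<mu> = image_mset (\<lambda>i. (v i, m i)) (mset_set I)"
    using assms by (auto simp: has_type_def)
  have "image_mset (\<lambda>(v, m). (v, m - n)) \<mu> = image_mset (\<lambda>i. (v i, m i - n)) (mset_set I)"
    by (simp add: B(2) image_mset.compositionality comp_def)
  then show ?thesis using basis_shift[OF B(1), of n] unfolding has_type_def by blast
qed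

lemma has_type_gr_dsum:
  assumes gM: "graded_module LA M" and M: "has_type M \<mu>" and gN: "graded_module LA N" and N: "has_type N \<nu>"
  shows "has_type (gr_dsum M N) (\<mu> + \<nu>)"
proof -
  obtain I :: "nat set" and b v m where B: "basis M I b v m" "\<mu> = image_mset (\<lambda>i. (v i, m i)) (mset_set I)"
    using M by (auto simp: has_type_def)
  obtain J :: "nat set" and c w n where C: "basis N J c w n" "\<nu> = image_mset (\<lambda>i. (w i, n i)) (mset_set J)"
    using N by (auto simp: has_type_def)
  have fin: "finite I" "finite J" using frameD(1)[OF basisD(1)[OF B(1)]] frameD(1)[OF basisD(1)[OF C(1)]] .
  \<comment> \<open>Tags make the two index sets disjoint, as \<open>basis_gr_dsum\<close>
    requires.\<close>
  let ?I = "{0 :: nat} \<times> I" and ?J = "{1 :: nat} \<times> J"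
  define v' where "v' k = (if fst k = 0 then v (snd k) else w (snd k))" for k :: "nat \<times> nat"
  define m' where "m' k = (if fst k = 0 then m (snd k) else n (snd k))" for k :: "nat \<times> nat"
  have bij: "bij_betw snd ?I I" "bij_betw snd ?J J" by (auto simp: bij_betw_def inj_on_def)
  have B': "basis M ?I (\<lambda>k. b (snd k)) v' m'"
    by (rule basis_vm_cong[OF basis_reindex[OF gM B(1) bij(1)]]) (auto simp: v'_def m'_def)
  have C': "basis N ?J (\<lambda>k. c (snd k)) v' m'"
    by (rule basis_vm_cong[OF basis_reindex[OF gN C(1) bij(2)]]) (auto simp: v'_def m'_def)
  have "has_type (gr_dsum M N) (image_mset (\<lambda>k. (v' k, m' k)) (mset_set (?I \<union> ?J)))"
    by (rule has_typeI[OF graded_module_gr_dsum[OF gM gN] basis_gr_dsum[OF gM gN B' C']]) auto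
  also have "mset_set (?I \<union> ?J) = mset_set ?I + mset_set ?J"
    using fin by (intro mset_set_Union) auto
  also have "image_mset (\<lambda>k. (v' k, m' k)) (mset_set ?I + mset_set ?J) =
      image_mset (\<lambda>k. (v' k, m' k)) (mset_set ?I) + image_mset (\<lambda>k. (v' k, m' k)) (mset_set ?J)" by simp
  also have "image_mset (\<lambda>k. (v' k, m' k)) (mset_set ?I) = image_mset (\<lambda>k. (v (snd k), m (snd k))) (mset_set ?I)"
    by (rule image_mset_cong) (use fin in \<open>auto simp: v'_def m'_def\<close>)
  also have "\<dots> = image_mset (\<lambda>i. (v i, m i)) (image_mset snd (mset_set ?I))"
    by (simp add: image_mset.compositionality comp_def)
  also have "image_mset snd (mset_set ?I) = mset_set I"
    using bij(1) by (simp add: bij_betw_def image_mset_mset_set)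
  also have "image_mset (\<lambda>k. (v' k, m' k)) (mset_set ?J) = image_mset (\<lambda>k. (w (snd k), n (snd k))) (mset_set ?J)"
    by (rule image_mset_cong) (use fin in \<open>auto simp: v'_def m'_def\<close>)
  also have "\<dots> = image_mset (\<lambda>i. (w i, n i)) (image_mset snd (mset_set ?J))"
    by (simp add: image_mset.compositionality comp_def)
  also have "image_mset snd (mset_set ?J) = mset_set J"
    using bij(2) by (simp add: bij_betw_def image_mset_mset_set)
  finally show ?thesis using B(2) C(2) by simp
qed

lemma has_type_fg_gr_proj:
  fixes P :: "((('v, 'e) lgen word \<Rightarrow>\<^sub>0 'k) set, 'u) gmodule"
  assumes gP: "graded_module LA P" and "has_type P \<mu>"
  shows "P \<in> fg_gr_proj TYPE('u) LA"
proof -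
  obtain I :: "nat set" and b v m where B: "basis P I b v m" using assms(2) by (auto simp: has_type_def)
  show ?thesis
    using gP spans_imp_fin_gen[OF gP basisD(1,2)[OF B]] basis_imp_gr_projective[OF gP B]
    by (simp add: fg_gr_proj_def)
qed

text \<open>The arcs leaving \<open>v\<close> turn a basis element \<open>b\<close> at \<open>v\<close> into the family of all \<open>b e\<close>, from which
  \<open>b = \<Sum> (b e) e\<^sup>*\<close> is recovered.\<close>

lemma has_type_refine:
  assumes gM: "graded_module LA M" and M: "has_type M {#(v, m)#}"
  shows "has_type M (image_mset (\<lambda>e. (head G e, m + 1)) (mset_set (out_arcs G v)))"
proof -
  note rM = graded_right[OF gM]
  interpret M: abelian_group M by (rule module_abelian_group[OF rM])
  obtain I :: "nat set" and b w n where B: "basis M I b w n" "{#(v, m)#} = image_mset (\<lambda>i. (w i, n i)) (mset_set I)"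
    using M by (auto simp: has_type_def)
  note F = basisD(1)[OF B(1)]
  have "card I = 1" using arg_cong[OF B(2), of size] by simp
  then obtain i where i: "I = {i}" using card_1_singletonE by blast
  then have wn: "w i = v" "n i = m" using B(2) by auto
  have bi: "b i \<in> gcomp M m" "act M (b i) (vx v) = b i" "v \<in> verts G" "b i \<in> carrier M"
    using frameD(2-4)[OF F, of i] i wn frame_closed[OF gM F] by auto
  have cb: "comb M I b p = act M (b i) (p i)" if "p i \<in> carrier FA" for p
    using i bi that act_closed[OF rM] by simp
  let ?O = "out_arcs G v" and ?c = "\<lambda>e. act M (b i) (ed e)"
  have cc: "?c \<in> ?O \<rightarrow> carrier M" using bi by (auto simp: act_closed[OF rM])
  have cmb: "comb M ?O ?c p = act M (b i) (\<Sum>e\<in>?O. ed e * p e)" if p: "p \<in> ?O \<rightarrow> carrier FA" for p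
  proof -
    have "act M (b i) (\<Sum>e\<in>?O. ed e * p e) = (\<Oplus>\<^bsub>M\<^esub>e\<in>?O. act M (b i) (ed e * p e))"
      using p bi by (intro act_sum[OF rM]) (auto simp: Pi_def)
    also have "\<dots> = comb M ?O ?c p"
      using p bi by (intro M.finsum_cong') (auto simp: Pi_def act_mult[OF rM] act_closed[OF rM])
    finally show ?thesis by simp
  qed
  have "frame M ?O ?c (head G) (\<lambda>_. m + 1)"
    unfolding frame_def
  proof (intro conjI ballI)
    fix e assume e: "e \<in> ?O"
    show "?c e \<in> gcomp M (m + 1)"
      using e by (intro gcomp_act[OF gM bi(1), of _ 1]) (auto intro: homog_gen)
    show "act M (?c e) (vx (head G e)) = ?c e"
      using e act_mult[OF rM bi(4), of "ed e" "vx (head G e)"] act_cong[OF rM XV, of e "b i"] by simp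
  qed auto
  moreover have "spans M ?O ?c"
    unfolding spans_def
  proof
    fix x assume "x \<in> carrier M"
    then obtain p where p: "p \<in> I \<rightarrow> carrier FA" "x = comb M I b p" using spansD[OF basisD(2)[OF B(1)]] by blast
    then have pi: "p i \<in> carrier FA" using i by auto
    have "x = act M (act M (b i) (vx v)) (p i)" using p cb pi bi by simp
    also have "\<dots> = act M (b i) (vx v * p i)" using act_mult[OF rM bi(4)] pi bi by simp
    also have "\<dots> = act M (b i) ((\<Sum>e\<in>?O. ed e * gh e) * p i)"
      by (rule act_cong[OF rM]) (intro cong_mult_right cong_sym[OF sum_XY] bi pi)
    also have "\<dots> = act M (b i) (\<Sum>e\<in>?O. ed e * (gh e * p i))" by (simp add: sum_distrib_right mult.assoc)
    also have "\<dots> = comb M ?O ?c (\<lambda>e. gh e * p i)" using pi by (intro cmb[symmetric]) auto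
    finally show "\<exists>p\<in>?O \<rightarrow> carrier FA. x = comb M ?O ?c p"
      using pi by (intro bexI[of _ "\<lambda>e. gh e * p i"]) auto
  qed
  moreover have "vx (head G e) * p e \<in> LI"
    if p: "p \<in> ?O \<rightarrow> carrier FA" and z: "comb M ?O ?c p = \<zero>\<^bsub>M\<^esub>" and e: "e \<in> ?O" for p e
  proof -
    let ?s = "\<Sum>e\<in>?O. ed e * p e"
    have pc: "p f \<in> carrier FA" if "f \<in> ?O" for f using p that by (auto simp: Pi_def)
    have s: "?s \<in> carrier FA" using pc by (intro fa_sum) auto
    have "vx v * ?s \<in> LI"
      using basisD(3)[OF B(1), of "\<lambda>_. ?s" i] cb[of "\<lambda>_. ?s"] cmb[OF p] z s i wn by simp
    \<comment> \<open>Multiplying by the ghost arc of \<open>e\<close> isolates the coefficient at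
      \<open>e\<close>.\<close>
    then have "gh e * (vx v * ?s) \<in> LI" by (rule LI_mult_left) (use e in simp)
    then have "0 \<doteq> gh e * (vx v * ?s)" using s bi e by (simp add: cong_0_iff cong_sym)
    also have "gh e * (vx v * ?s) = (gh e * vx (tail G e)) * ?s" using e by (simp add: mult.assoc)
    also have "\<dots> \<doteq> gh e * ?s" using e s by (intro cong_mult_right YV) auto
    also have "gh e * ?s = (\<Sum>f\<in>?O. (gh e * ed f) * p f)" by (simp add: sum_distrib_left mult.assoc)
    also have "\<dots> \<doteq> (\<Sum>f\<in>?O. (if e = f then vx (head G e) else 0) * p f)"
      using e pc by (intro cong_sum cong_mult_right YX) auto
    also have "\<dots> = (\<Sum>f\<in>?O. if f = e then vx (head G e) * p e else 0)"
      by (intro sum.cong) auto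
    also have "\<dots> = vx (head G e) * p e" using e by (simp add: sum.delta)
    finally show ?thesis using cong_sym cong_0_iff by blast
  qed
  ultimately have "basis M ?O ?c (head G) (\<lambda>_. m + 1)" unfolding basis_def by blast
  from has_typeI[OF gM this] show ?thesis .
qed

lemma finite_leavitt_gens [simp]: "finite (leavitt_gens G)"
  by (simp add: leavitt_gens_def)

definition zero_gmodule :: "'u \<Rightarrow> ('r, 'u) gmodule" where
  "zero_gmodule z = \<lparr>carrier = {z}, monoid.mult = undefined, one = undefined, ring.zero = z, add = (\<lambda>_ _. z),
     ract = (\<lambda>_ _. z), gcomp = (\<lambda>_. {z})\<rparr>"

lemma zero_gmodule:
  fixes z :: 'u
  shows "graded_module LA (zero_gmodule z)" "has_type (zero_gmodule z) {#}"
proof -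
  define Z :: "((('v, 'e) lgen word \<Rightarrow>\<^sub>0 'k) set, 'u) gmodule" where "Z = zero_gmodule z"
  have sel: "carrier Z = {z}" "\<zero>\<^bsub>Z\<^esub> = z" "add Z = (\<lambda>_ _. z)" "ract Z = (\<lambda>_ _. z)" "gcomp Z = (\<lambda>_. {z})"
    by (simp_all add: Z_def zero_gmodule_def)
  have ab: "abelian_group Z" by (rule abelian_groupI) (auto simp: sel)
  interpret abelian_group Z by (rule ab)
  have g: "graded_module LA Z"
  proof (rule graded_moduleI)
    show "right_module LA Z" by (rule right_moduleI[OF ab]) (auto simp: sel)
    show "\<exists>D c. finite D \<and> (\<forall>i. c i \<in> gcomp Z i) \<and> x = (\<Oplus>\<^bsub>Z\<^esub>i\<in>D. c i)" if "x \<in> carrier Z" for x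
      using that by (intro exI[of _ "{}"] exI[of _ "\<lambda>_. z"]) (auto simp: sel)
  qed (auto simp: sel)
  have "basis Z ({} :: nat set) (\<lambda>_. z) v m" for v m
    by (auto simp: basis_def frame_def spans_def sel)
  from has_typeI[OF g this] have "has_type Z {#}" by simp
  then show "graded_module LA (zero_gmodule z)" "has_type (zero_gmodule z) {#}"
    using g by (simp_all add: Z_def)
qed

text \<open>One vertex module is added for each element of the type. Each direct sum is brought back
  into \<open>'u\<close> at once, through a bijection between \<open>'u\<close> and its
  square.\<close>

lemma has_type_exists:
  fixes \<iota> :: "'k \<Rightarrow> 'u"
  assumes inf: "infinite (UNIV :: 'u set)" and \<iota>: "inj \<iota>" and "valid \<mu>"
  shows "\<exists>P :: ((('v, 'e) lgen word \<Rightarrow>\<^sub>0 'k) set, 'u) gmodule. graded_module LA P \<and> has_type P \<mu>"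
  using assms(3)
proof (induction \<mu>)
  case empty
  show ?case by (intro exI conjI) (rule zero_gmodule[of undefined])+
next
  case (add x \<mu>)
  obtain v n where x: "x = (v, n)" by (cases x)
  then have v: "v \<in> verts G" using add.prems by auto
  obtain P :: "((('v, 'e) lgen word \<Rightarrow>\<^sub>0 'k) set, 'u) gmodule" where P: "graded_module LA P" "has_type P \<mu>"
    using add by auto
  obtain j :: "(('v, 'e) lgen word \<Rightarrow>\<^sub>0 'k) \<Rightarrow> 'u" where j: "inj_on j (carrier FA)"
    using free_algebra_inj[OF inf \<iota> finite_leavitt_gens] by blast
  \<comment> \<open>A coset is coded through a chosen representative.\<close>
  define j' where "j' c = j (inv_into (carrier FA) proj c)" for c
  have "inj_on j' (proj ` carrier FA)"
    using j unfolding j'_def by (auto intro!: inj_onI dest!: inj_onD inv_into_injective simp: inv_into_into)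
  then have j': "inj_on j' (carrier (vertex_module v n))"
    by (rule inj_on_subset) (use v in auto)
  let ?Q = "transp j' (vertex_module v n)"
  have gQ: "graded_module LA ?Q" by (rule graded_module_transp[OF graded_module_vertex_module[OF v] j'])
  have "basis ?Q {0 :: nat} (\<lambda>_. j' (proj (vx v))) (\<lambda>_. v) (\<lambda>_. n)"
    by (rule basis_transp[OF graded_module_vertex_module[OF v] j' basis_vertex_module[OF v]])
  from has_typeI[OF gQ this] have Q: "has_type ?Q {#(v, n)#}" by simp
  have "|UNIV \<times> UNIV :: ('u \<times> 'u) set| =o |UNIV :: 'u set|" by (rule card_of_Times_same_infinite[OF inf])
  then obtain pr :: "'u \<times> 'u \<Rightarrow> 'u" where "bij_betw pr (UNIV \<times> UNIV) UNIV" using card_of_ordIso by blast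
  then have pr: "inj_on pr (carrier (gr_dsum ?Q P))" by (auto simp: bij_betw_def intro: inj_on_subset)
  have S: "graded_module LA (gr_dsum ?Q P)" "has_type (gr_dsum ?Q P) ({#(v, n)#} + \<mu>)"
    using graded_module_gr_dsum[OF gQ P(1)] has_type_gr_dsum[OF gQ Q P] .
  obtain I :: "nat set" and b w m where B: "basis (gr_dsum ?Q P) I b w m"
      "{#(v, n)#} + \<mu> = image_mset (\<lambda>i. (w i, m i)) (mset_set I)"
    using S(2) by (auto simp: has_type_def)
  have "has_type (transp pr (gr_dsum ?Q P)) ({#(v, n)#} + \<mu>)"
    unfolding has_type_def using basis_transp[OF S(1) pr B(1)] B(2) by blast
  then show ?case using graded_module_transp[OF S(1) pr] x by auto
qed

end

section \<open>Counting basis elements along an entryless cycle\<close>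

text \<open>Gaussian elimination for more vectors, indexed by \<open>W\<close>, than coordinates,
  indexed by \<open>B\<close>.\<close>

lemma linear_dependence:
  fixes c :: "'a \<Rightarrow> 'b \<Rightarrow> 'k::field"
  assumes "finite B" "finite W" "card B < card W"
  shows "\<exists>l. (\<exists>w\<in>W. l w \<noteq> 0) \<and> (\<forall>b\<in>B. (\<Sum>w\<in>W. l w * c w b) = 0)"
  using assms
proof (induction B arbitrary: W c rule: finite_induct)
  case empty
  then have "W \<noteq> {}" by auto
  then show ?case by (intro exI[of _ "\<lambda>_. 1"]) auto
next
  case (insert b B)
  show ?case
  proof (cases "\<forall>w\<in>W. c w b = 0")
    case True
    then show ?thesis using insert.IH[of W c] insert.prems insert.hyps by auto
  next
    case False
    then obtain w0 where w0: "w0 \<in> W" "c w0 b \<noteq> 0" by blast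
    \<comment> \<open>The pivot \<open>w0\<close> clears coordinate \<open>b\<close> from the other
      vectors; its own coefficient in \<open>l\<close> is then chosen so that the combination of the
      \<open>c\<close> equals that of the \<open>c'\<close>.\<close>
    define c' where "c' w b' = c w b' - c w b / c w0 b * c w0 b'" for w b'
    have "finite (W - {w0})" "card B < card (W - {w0})"
      using insert.prems insert.hyps w0 by (auto simp: card_Diff_singleton)
    from insert.IH[OF this, of c'] obtain m where
      m: "\<exists>w\<in>W - {w0}. m w \<noteq> 0" "\<And>b'. b' \<in> B \<Longrightarrow> (\<Sum>w\<in>W - {w0}. m w * c' w b') = 0" by blast
    define l where "l w = (if w = w0 then - (\<Sum>w\<in>W - {w0}. m w * (c w b / c w0 b)) else m w)" for w
    have split: "(\<Sum>w\<in>W. l w * c w b') = (\<Sum>w\<in>W - {w0}. m w * c' w b')" for b'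
    proof -
      have "(\<Sum>w\<in>W. l w * c w b') = l w0 * c w0 b' + (\<Sum>w\<in>W - {w0}. l w * c w b')"
        using insert.prems w0 by (simp add: sum.remove)
      also have "(\<Sum>w\<in>W - {w0}. l w * c w b') = (\<Sum>w\<in>W - {w0}. m w * c w b')"
        by (intro sum.cong) (auto simp: l_def)
      also have "l w0 * c w0 b' = - (\<Sum>w\<in>W - {w0}. m w * (c w b / c w0 b) * c w0 b')"
        by (simp add: l_def sum_distrib_right)
      finally show ?thesis by (simp add: c'_def algebra_simps sum_subtractf)
    qed
    have "(\<Sum>w\<in>W. l w * c w b') = 0" if "b' \<in> insert b B" for b'
    proof (cases "b' = b")
      case True
      then show ?thesis using split[of b] w0 by (simp add: c'_def)
    next
      case False
      then show ?thesis using split[of b'] m(2)[of b'] that by simp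
    qed
    moreover have "\<exists>w\<in>W. l w \<noteq> 0" using m(1) by (auto simp: l_def)
    ultimately show ?thesis by blast
  qed
qed

section \<open>The module of an unrolled entryless cycle\<close>

context leavitt
begin

text \<open>For \<open>z\<close> on an entryless cycle, this is the action on the graded module that has in each degree \<open>j\<close>
  a one-dimensional component, sitting at the vertex \<open>v\<close> with \<^term>\<open>on_orbit z v j\<close>; its elements are
  written as functions \<open>\<phi>\<close> of the degree.\<close>

fun orbit_gen :: "'v \<Rightarrow> ('v, 'e) lgen \<Rightarrow> (int \<Rightarrow> 'k) \<Rightarrow> int \<Rightarrow> 'k" where
  "orbit_gen z (Vert v) \<phi> j = (if on_orbit z v j then \<phi> j else 0)"
| "orbit_gen z (Edge e) \<phi> j = (if on_orbit z (head G e) j then \<phi> (j - 1) else 0)"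
| "orbit_gen z (Ghost e) \<phi> j = (if on_orbit z (head G e) (j + 1) then \<phi> (j + 1) else 0)"

text \<open>The action is from the right, so the leftmost letter is applied first.\<close>

definition orbit_word :: "'v \<Rightarrow> ('v, 'e) lgen word \<Rightarrow> (int \<Rightarrow> 'k) \<Rightarrow> int \<Rightarrow> 'k" where
  "orbit_word z w \<phi> = foldl (\<lambda>\<psi> g. orbit_gen z g \<psi>) \<phi> (letters w)"

definition orbit :: "'v \<Rightarrow> (('v, 'e) lgen word \<Rightarrow>\<^sub>0 'k) \<Rightarrow> (int \<Rightarrow> 'k) \<Rightarrow> int \<Rightarrow> 'k" where
  "orbit z p \<phi> j = (\<Sum>w\<in>Poly_Mapping.keys p. Poly_Mapping.lookup p w * orbit_word z w \<phi> j)"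

lemma orbit_zero [simp]: "orbit z 0 \<phi> j = 0" by (simp add: orbit_def)

lemma orbit_add: "orbit z (p + q) \<phi> j = orbit z p \<phi> j + orbit z q \<phi> j"
  unfolding orbit_def by (rule setsum_keys_plus_distrib) (auto simp: algebra_simps)

lemma orbit_single: "orbit z (Poly_Mapping.single w c) \<phi> j = c * orbit_word z w \<phi> j"
  by (simp add: orbit_def)

lemma orbit_uminus: "orbit z (- p) \<phi> j = - orbit z p \<phi> j"
  using orbit_add[of z "- p" p \<phi> j] by (simp add: eq_neg_iff_add_eq_0)

lemma orbit_diff: "orbit z (p - q) \<phi> j = orbit z p \<phi> j - orbit z q \<phi> j"
  using orbit_add[of z p "- q" \<phi> j] by (simp add: orbit_uminus)

lemma orbit_sum: "orbit z (sum f S) \<phi> j = (\<Sum>i\<in>S. orbit z (f i) \<phi> j)"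
  by (induction S rule: infinite_finite_induct) (auto simp: orbit_add)

lemma orbit_gen_linear: "orbit_gen z g (\<lambda>i. a * \<phi> i + \<psi> i) j = a * orbit_gen z g \<phi> j + orbit_gen z g \<psi> j"
  by (cases g) auto

lemma orbit_word_linear: "orbit_word z w (\<lambda>i. a * \<phi> i + \<psi> i) = (\<lambda>j. a * orbit_word z w \<phi> j + orbit_word z w \<psi> j)"
proof -
  have "foldl (\<lambda>\<psi> g. orbit_gen z g \<psi>) (\<lambda>i. a * \<phi> i + \<psi> i) gs =
      (\<lambda>j. a * foldl (\<lambda>\<psi> g. orbit_gen z g \<psi>) \<phi> gs j + foldl (\<lambda>\<psi> g. orbit_gen z g \<psi>) \<psi> gs j)" for gs
  proof (induction gs arbitrary: \<phi> \<psi>)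
    case (Cons g gs)
    have "orbit_gen z g (\<lambda>i. a * \<phi> i + \<psi> i) = (\<lambda>j. a * orbit_gen z g \<phi> j + orbit_gen z g \<psi> j)"
      by (rule ext) (rule orbit_gen_linear)
    then show ?case using Cons by simp
  qed simp
  then show ?thesis by (simp add: orbit_word_def)
qed

lemma orbit_linear: "orbit z p (\<lambda>i. a * \<phi> i + \<psi> i) j = a * orbit z p \<phi> j + orbit z p \<psi> j"
  unfolding orbit_def orbit_word_linear by (simp add: sum_distrib_left sum.distrib[symmetric] algebra_simps)

lemma orbit_zero_arg [simp]: "orbit z p (\<lambda>_. 0) j = 0"
  using orbit_linear[of z p "- 1" "\<lambda>_. 0" "\<lambda>_. 0" j] by simp

lemma orbit_add_arg: "orbit z p (\<lambda>i. \<phi> i + \<psi> i) j = orbit z p \<phi> j + orbit z p \<psi> j"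
  using orbit_linear[of z p 1 \<phi> \<psi> j] by simp

lemma orbit_scale_arg: "orbit z p (\<lambda>i. a * \<phi> i) j = a * orbit z p \<phi> j"
  using orbit_linear[of z p a \<phi> "\<lambda>_. 0" j] by simp

lemma orbit_sum_arg: "orbit z p (\<lambda>i. \<Sum>s\<in>S. \<phi> s i) j = (\<Sum>s\<in>S. orbit z p (\<phi> s) j)"
  by (induction S rule: infinite_finite_induct) (auto simp: orbit_add_arg)

lemma orbit_word_plus: "orbit_word z (u + w) \<phi> = orbit_word z w (orbit_word z u \<phi>)"
  by (simp add: orbit_word_def plus_word_def)

lemma orbit_mult: "orbit z (p * q) \<phi> j = orbit z q (orbit z p \<phi>) j"
proof (induction p rule: poly_induct)
  case zero
  have "orbit z 0 \<phi> = (\<lambda>_. 0)" by auto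
  then show ?case by simp
next
  case (add u a p)
  have single: "orbit z (Poly_Mapping.single u a * q) \<phi> j = orbit z q (orbit z (Poly_Mapping.single u a) \<phi>) j"
  proof (induction q rule: poly_induct)
    case (add w b q)
    have "orbit z (Poly_Mapping.single u a) \<phi> = (\<lambda>i. a * orbit_word z u \<phi> i)"
      by (simp add: fun_eq_iff orbit_single)
    then have "orbit z (Poly_Mapping.single w b) (orbit z (Poly_Mapping.single u a) \<phi>) j =
        orbit z (Poly_Mapping.single u a * Poly_Mapping.single w b) \<phi> j"
      using orbit_word_linear[of z w a "orbit_word z u \<phi>" "\<lambda>_. 0"] orbit_scale_arg[of z "Poly_Mapping.single w b" a "orbit_word z u \<phi>" j]
      by (simp add: mult_single orbit_single orbit_word_plus)
    then show ?case using add by (simp add: algebra_simps orbit_add)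
  qed simp
  have "orbit z (Poly_Mapping.single u a + p) \<phi> = (\<lambda>i. orbit z (Poly_Mapping.single u a) \<phi> i + orbit z p \<phi> i)"
    by (simp add: fun_eq_iff orbit_add)
  then show ?case using add single by (simp add: distrib_right orbit_add orbit_add_arg)
qed

lemma orbit_one [simp]: "orbit z 1 \<phi> j = \<phi> j"
  unfolding single_one[symmetric] orbit_single by (simp add: orbit_word_def zero_word_def)

lemma orbit_of_gen [simp]: "orbit z (gen g) \<phi> j = orbit_gen z g \<phi> j"
  by (simp add: gen_def orbit_single orbit_word_def)

lemma orbit_of_gen' : "orbit z (gen g) \<phi> = orbit_gen z g \<phi>" by (simp add: fun_eq_iff)

text \<open>The sum relation at \<open>v\<close> for the orbit action: among the arcs leaving a
  vertex of the line exactly one has its head in the next place of the line, and from other vertices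
  none has.\<close>

lemma orbit_sum_out:
  assumes "v \<in> verts G"
  shows "(\<Sum>e\<in>out_arcs G v. if on_orbit z (head G e) (j + 1) then \<phi> j else 0) = (if on_orbit z v j then \<phi> j else (0 :: 'k))"
proof (cases "on_orbit z v j")
  case True
  obtain e where e: "e \<in> out_arcs G v" "on_orbit z (head G e) (j + 1)" using on_orbit_out[OF True] by blast
  have "(\<Sum>e'\<in>out_arcs G v. if on_orbit z (head G e') (j + 1) then \<phi> j else 0) =
      (\<Sum>e'\<in>out_arcs G v. if e' = e then \<phi> j else 0)"
    using e on_orbit_head_unique[of _ e z "j + 1"] by (intro sum.cong) auto
  then show ?thesis using True e by (simp add: sum.delta)
next
  case False
  then have "\<not> on_orbit z (head G e) (j + 1)" if "e \<in> out_arcs G v" for e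
    using on_orbit_tail[of e z j] that by auto
  then show ?thesis using False by (simp add: sum.neutral)
qed

text \<open>The line has exactly one vertex in each degree and exactly one arc between consecutive
  places; the relations express nothing else on it.\<close>

lemma orbit_relation:
  assumes z: "z \<in> cyc" and p: "p \<in> leavitt_relations G" shows "orbit z p \<phi> j = 0"
proof -
  have sumV: "(\<Sum>v\<in>verts G. if on_orbit z v j then \<phi> j else 0) = \<phi> j"
  proof -
    obtain v where v: "on_orbit z v j" using on_orbit_exists[OF z] by blast
    have "(\<Sum>u\<in>verts G. if on_orbit z u j then \<phi> j else 0) = (\<Sum>u\<in>verts G. if u = v then \<phi> j else 0)"
    proof -
      have "on_orbit z u j \<longleftrightarrow> u = v" for u using on_orbit_unique[of z u j v] v by blast
      then show ?thesis by (intro sum.cong) auto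
    qed
    then show ?thesis using on_orbit_in_verts[OF v] by (simp add: sum.delta)
  qed
  note simps = orbit_diff orbit_mult orbit_of_gen' orbit_sum
  have t: "on_orbit z (head G e) j \<Longrightarrow> on_orbit z (tail G e) (j - 1)"
    "on_orbit z (head G e) (j + 1) \<Longrightarrow> on_orbit z (tail G e) j" if "e \<in> arcs G" for e
    using on_orbit_tail[OF that, of z "j - 1"] on_orbit_tail[OF that, of z j] by auto
  show ?thesis
    using p unfolding leavitt_relations_def
    apply (elim UnE)
           apply (auto simp: simps dest: on_orbit_unique t)[5]
      apply (auto simp: simps dest: on_orbit_head_unique)[1]
     apply (auto simp: simps orbit_sum_out is_regular_iff cong: if_cong)[1]
    apply (auto simp: simps sumV)[1]
    done
qed

lemma orbit_LI: assumes z: "z \<in> cyc" and p: "p \<in> LI" shows "orbit z p \<phi> = (\<lambda>_. 0)"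
proof -
  have "LI \<subseteq> {p \<in> carrier FA. \<forall>\<phi>. orbit z p \<phi> = (\<lambda>_. 0)}"
  proof (rule LI_minimal)
    show "leavitt_relations G \<subseteq> {p \<in> carrier FA. \<forall>\<phi>. orbit z p \<phi> = (\<lambda>_. 0)}"
      using relations_carrier orbit_relation[OF z] by (auto simp: fun_eq_iff)
  next
    fix p a assume p: "p \<in> {p \<in> carrier FA. \<forall>\<phi>. orbit z p \<phi> = (\<lambda>_. 0)}" "a \<in> carrier FA"
    have "orbit z (a * p) \<phi> = (\<lambda>_. 0)" "orbit z (p * a) \<phi> = (\<lambda>_. 0)" for \<phi>
      using p(1) orbit_mult[of z a p \<phi>] orbit_mult[of z p a \<phi>] by auto
    then show "a * p \<in> {p \<in> carrier FA. \<forall>\<phi>. orbit z p \<phi> = (\<lambda>_. 0)}"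
      "p * a \<in> {p \<in> carrier FA. \<forall>\<phi>. orbit z p \<phi> = (\<lambda>_. 0)}" using p by auto
  qed (auto simp: fun_eq_iff orbit_add)
  then show ?thesis using p by auto
qed

lemma orbit_cong: "z \<in> cyc \<Longrightarrow> p \<doteq> q \<Longrightarrow> orbit z p \<phi> j = orbit z q \<phi> j"
  using orbit_LI[of z "p - q" \<phi>] by (auto simp: cong_def orbit_diff fun_eq_iff)

lemma orbit_degree:
  assumes "homog n p" and \<phi>: "\<And>j. j \<noteq> i \<Longrightarrow> \<phi> j = 0" and "j \<noteq> i + n"
  shows "orbit z p \<phi> j = 0"
proof -
  have "foldl (\<lambda>\<psi> g. orbit_gen z g \<psi>) \<phi> gs j = 0"
    if "\<And>j. j \<noteq> i \<Longrightarrow> \<phi> j = 0" "j \<noteq> i + sum_list (map letter_degree gs)" for gs j i \<phi>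
    using that
  proof (induction gs arbitrary: \<phi> i j)
    case (Cons g gs)
    have "orbit_gen z g \<phi> k = 0" if "k \<noteq> i + letter_degree g" for k
      using that Cons.prems(1) by (cases g) auto
    from Cons.IH[OF this] Cons.prems(2) show ?case by (simp add: algebra_simps)
  qed simp
  note fold0 = this
  have "orbit_word z w \<phi> j = 0" if "w \<in> Poly_Mapping.keys p" for w
    unfolding orbit_word_def
    by (rule fold0[of i]) (use assms that in \<open>auto simp: homog_def word_degree_def\<close>)
  then show ?thesis by (simp add: orbit_def)
qed

text \<open>A graded homomorphism from \<open>M\<close> to the orbit module is fixed by the images
  of the \<open>b i\<close>. Such an image must lie in degree \<open>m i\<close> at the vertex
  \<open>v i\<close>, which leaves one dimension if this place is on the line and none otherwise, so
  the left-hand count is the dimension of the space of homomorphisms. Were it larger than the count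
  for \<open>c\<close>, a nonzero homomorphism would kill every \<open>c j\<close>.\<close>

lemma orbit_count_le:
  assumes z: "z \<in> cyc" and gM: "graded_module LA M" and B: "basis M I b v m" and C: "basis M J c w n"
  shows "card {i \<in> I. on_orbit z (v i) (m i)} \<le> card {j \<in> J. on_orbit z (w j) (n j)}"
proof (rule ccontr)
  note rM = graded_right[OF gM] and FB = basisD(1)[OF B] and FC = basisD(1)[OF C]
  note bc = frame_closed[OF gM FB] and cc = frame_closed[OF gM FC]
  let ?I = "{i \<in> I. on_orbit z (v i) (m i)}" and ?J = "{j \<in> J. on_orbit z (w j) (n j)}"
  have fin: "finite I" "finite J" using frameD(1)[OF FB] frameD(1)[OF FC] .
  assume "\<not> card ?I \<le> card ?J"
  then have card: "card ?J < card ?I" by simp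
  \<comment> \<open>The coefficients of \<open>c j\<close> are made homogeneous and end in the
    vertex \<open>w j\<close>, so that the image of \<open>c j\<close> is confined to one degree and
    one vertex.\<close>
  have "\<exists>p. p \<in> I \<rightarrow> carrier FA \<and> (\<forall>i\<in>I. \<exists>q. p i = q * vx (w j) \<and> q \<in> carrier FA \<and> homog (n j - m i) q) \<and> c j = comb M I b p"
    if j: "j \<in> J" for j
  proof -
    have cj: "c j \<in> carrier M" using cc j by auto
    obtain p0 where p0: "p0 \<in> I \<rightarrow> carrier FA" "c j = comb M I b p0" using spansD[OF basisD(2)[OF B] cj] by blast
    define q where "q i = hpart (n j - m i) (p0 i)" for i
    have q: "q \<in> I \<rightarrow> carrier FA" using p0 by (auto simp: q_def Pi_def)
    have "c j = comb M I b q"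
      using homogeneous_coefficients[OF gM fin(1) frameD(3)[OF FB] p0(1), where k = "n j"] p0(2) frameD(3)[OF FC j]
      by (simp add: q_def)
    then have "c j = comb M I b (\<lambda>i. q i * vx (w j))"
      using comb_act[OF rM bc q, of "vx (w j)"] frameD(2,4)[OF FC j] by simp
    then show ?thesis
      using q frameD(2)[OF FC j] by (intro exI[of _ "\<lambda>i. q i * vx (w j)"]) (auto simp: Pi_def q_def)
  qed
  then have "\<forall>j\<in>J. \<exists>p. p \<in> I \<rightarrow> carrier FA \<and>
      (\<forall>i\<in>I. \<exists>q. p i = q * vx (w j) \<and> q \<in> carrier FA \<and> homog (n j - m i) q) \<and> c j = comb M I b p" by blast
  from bchoice[OF this] obtain p where p: "\<And>j. j \<in> J \<Longrightarrow> p j \<in> I \<rightarrow> carrier FA"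
      "\<And>j i. j \<in> J \<Longrightarrow> i \<in> I \<Longrightarrow> \<exists>q. p j i = q * vx (w j) \<and> q \<in> carrier FA \<and> homog (n j - m i) q"
      "\<And>j. j \<in> J \<Longrightarrow> c j = comb M I b (p j)" by blast
  have pFA: "p j i \<in> carrier FA" if "j \<in> J" "i \<in> I" for i j using p(1) that by (auto simp: Pi_def)
  have "\<forall>i\<in>I. \<exists>q. q \<in> J \<rightarrow> carrier FA \<and> b i = comb M J c q"
  proof
    fix i assume "i \<in> I"
    then have "b i \<in> carrier M" using bc by auto
    then show "\<exists>q. q \<in> J \<rightarrow> carrier FA \<and> b i = comb M J c q" by (rule spansD[OF basisD(2)[OF C]])
  qed
  from bchoice[OF this] obtain q where q: "\<And>i. i \<in> I \<Longrightarrow> q i \<in> J \<rightarrow> carrier FA"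
    "\<And>i. i \<in> I \<Longrightarrow> b i = comb M J c (q i)" by blast
  have qFA: "q i j \<in> carrier FA" if "j \<in> J" "i \<in> I" for i j using q(1) that by (auto simp: Pi_def)
  \<comment> \<open>The basis vector of the orbit module in degree \<open>m i\<close>.\<close>
  define \<delta> where "\<delta> i = (\<lambda>j. if j = m i then 1 else (0 :: 'k))" for i
  obtain l where l: "\<exists>i\<in>?I. l i \<noteq> 0" "\<And>j. j \<in> ?J \<Longrightarrow> (\<Sum>i\<in>?I. l i * orbit z (p j i) (\<delta> i) (n j)) = 0"
    using linear_dependence[OF _ _ card, of "\<lambda>i j. orbit z (p j i) (\<delta> i) (n j)"] fin by auto
  \<comment> \<open>The images of the \<open>b i\<close> under the homomorphism with coordinates
    \<open>l\<close>.\<close>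
  define y where "y i = (\<lambda>t. (if i \<in> ?I then l i else 0) * \<delta> i t)" for i
  have y0: "y i t = 0" if "t \<noteq> m i" for i t using that by (simp add: y_def \<delta>_def)
  have vy: "orbit z (vx (v i)) (y i) = y i" if "i \<in> I" for i
    using that by (auto simp: fun_eq_iff y_def \<delta>_def)
  \<comment> \<open>The image of \<open>c j\<close> vanishes: by the choice of \<open>l\<close> if
    its place is on the line, and otherwise for reasons of degree or vertex.\<close>
  have zero: "(\<Sum>i\<in>I. orbit z (p j i) (y i) t) = 0" if j: "j \<in> J" for j t
  proof (cases "j \<in> ?J \<and> t = n j")
    case True
    have "(\<Sum>i\<in>I. orbit z (p j i) (y i) t) = (\<Sum>i\<in>?I. orbit z (p j i) (y i) t)"
      using fin(1) by (intro sum.mono_neutral_right) (auto simp: y_def)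
    also have "\<dots> = (\<Sum>i\<in>?I. l i * orbit z (p j i) (\<delta> i) (n j))"
      using True by (intro sum.cong) (auto simp: y_def orbit_scale_arg)
    finally show ?thesis using l(2) True by simp
  next
    case False
    show ?thesis
    proof (rule sum.neutral, rule ballI)
      fix i assume i: "i \<in> I"
      obtain r where r: "p j i = r * vx (w j)" "r \<in> carrier FA" "homog (n j - m i) r" using p(2)[OF j i] by blast
      show "orbit z (p j i) (y i) t = 0"
      proof (cases "t = n j")
        case True
        then show ?thesis using False j by (simp add: r(1) orbit_mult)
      next
        case ne: False
        have "orbit z r (y i) t = 0" by (rule orbit_degree[OF r(3), of "m i"]) (use y0 ne in auto)
        then show ?thesis by (simp add: r(1) orbit_mult)
      qed
    qed
  qed
  obtain i' where i': "i' \<in> ?I" "l i' \<noteq> 0" using l(1) by blast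
  then have iI: "i' \<in> I" by simp
  have bi: "b i' = comb M I b (\<lambda>i. \<Sum>j\<in>J. p j i * q i' j)"
    unfolding q(2)[OF iI] by (rule comb_comb[OF rM bc fin(1,2) p(3)]) (use pFA qFA iI in auto)
  have b1: "b i' = comb M I b (\<lambda>i. if i = i' then 1 else 0)"
    using comb_single[OF rM bc fin(1) iI, of 1] act_one[OF rM] bc iI by (auto simp: Pi_def)
  \<comment> \<open>Expanding \<open>b i'\<close> in the \<open>c j\<close> and these again in the
    \<open>b i\<close> gives a column of the identity matrix, up to the vertices.\<close>
  have cf: "vx (v i) * (\<Sum>j\<in>J. p j i * q i' j) \<doteq> vx (v i) * (if i = i' then 1 else 0)" if "i \<in> I" for i
    by (rule basis_coefficients[OF gM B _ _ _ that])
      (use bi b1 pFA qFA iI in \<open>auto simp: Pi_def intro!: fa_sum\<close>)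
  have "y i' t = 0" for t
  proof -
    have "y i' t = (\<Sum>i\<in>I. orbit z (vx (v i) * (if i = i' then 1 else 0)) (y i) t)"
    proof -
      have "(\<Sum>i\<in>I. orbit z (vx (v i) * (if i = i' then 1 else 0)) (y i) t) = (\<Sum>i\<in>I. if i = i' then y i' t else 0)"
        using vy by (intro sum.cong) (auto simp: orbit_mult)
      then show ?thesis using fin(1) iI by (simp add: sum.delta)
    qed
    also have "\<dots> = (\<Sum>i\<in>I. orbit z (vx (v i) * (\<Sum>j\<in>J. p j i * q i' j)) (y i) t)"
      using cf by (intro sum.cong refl orbit_cong[OF z, symmetric])
    also have "\<dots> = (\<Sum>i\<in>I. \<Sum>j\<in>J. orbit z (q i' j) (orbit z (p j i) (y i)) t)"
    proof (rule sum.cong[OF refl])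
      fix i assume "i \<in> I"
      then show "orbit z (vx (v i) * (\<Sum>j\<in>J. p j i * q i' j)) (y i) t =
          (\<Sum>j\<in>J. orbit z (q i' j) (orbit z (p j i) (y i)) t)"
        by (simp only: orbit_mult vy orbit_sum)
    qed
    also have "\<dots> = (\<Sum>j\<in>J. \<Sum>i\<in>I. orbit z (q i' j) (orbit z (p j i) (y i)) t)" by (rule sum.swap)
    also have "\<dots> = (\<Sum>j\<in>J. orbit z (q i' j) (\<lambda>t. \<Sum>i\<in>I. orbit z (p j i) (y i) t) t)"
      by (simp add: orbit_sum_arg)
    also have "\<dots> = 0" using zero by simp
    finally show ?thesis .
  qed
  from this[of "m i'"] show False using i' by (simp add: y_def \<delta>_def)
qed

definition orbit_count :: "'v \<Rightarrow> ('v \<times> int) multiset \<Rightarrow> nat" where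
  "orbit_count z \<mu> = size (filter_mset (\<lambda>(v, m). on_orbit z v m) \<mu>)"

lemma orbit_count_plus [simp]: "orbit_count z (\<mu> + \<nu>) = orbit_count z \<mu> + orbit_count z \<nu>"
  by (simp add: orbit_count_def)

lemma orbit_count_empty [simp]: "orbit_count z {#} = 0" by (simp add: orbit_count_def)

lemma orbit_count_single: "orbit_count z {#(v, m)#} = (if on_orbit z v m then 1 else 0)"
  by (simp add: orbit_count_def)

lemma orbit_count_image:
  "finite I \<Longrightarrow> orbit_count z (image_mset (\<lambda>i. (v i, m i)) (mset_set I)) = card {i \<in> I. on_orbit z (v i) (m i)}"
  by (simp add: orbit_count_def filter_mset_image_mset filter_mset_mset_set)

lemma has_type_orbit_count:
  assumes z: "z \<in> cyc" and gM: "graded_module LA M" and "has_type M \<mu>" "has_type M \<nu>"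
  shows "orbit_count z \<mu> = orbit_count z \<nu>"
proof -
  obtain I :: "nat set" and b v m where B: "basis M I b v m" "\<mu> = image_mset (\<lambda>i. (v i, m i)) (mset_set I)"
    using assms(3) by (auto simp: has_type_def)
  obtain J :: "nat set" and c w n where C: "basis M J c w n" "\<nu> = image_mset (\<lambda>i. (w i, n i)) (mset_set J)"
    using assms(4) by (auto simp: has_type_def)
  show ?thesis
    using orbit_count_le[OF z gM B(1) C(1)] orbit_count_le[OF z gM C(1) B(1)]
      frameD(1)[OF basisD(1)[OF B(1)]] frameD(1)[OF basisD(1)[OF C(1)]]
    by (simp add: B(2) C(2) orbit_count_image)
qed

end

section \<open>Paths in the Leavitt path algebra\<close>

lemma single_sum: "(\<Sum>w\<in>W. Poly_Mapping.single k (f w)) = Poly_Mapping.single k (sum f W)"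
  by (induction W rule: infinite_finite_induct) (auto simp: single_add)

context leavitt
begin

primrec pth :: "'v \<Rightarrow> 'e list \<Rightarrow> (('v, 'e) lgen word \<Rightarrow>\<^sub>0 'k)" where
  "pth v [] = vx v"
| "pth v (e # es) = ed e * pth (head G e) es"

text \<open>The ghost arcs of \<open>es\<close> in reverse order, leading from the end point of the
  path back to \<open>v\<close>. Both \<open>pth\<close> and \<open>gst\<close> carry a vertex
  factor at the end point, so that the empty path is covered as well.\<close>

primrec gst :: "'v \<Rightarrow> 'e list \<Rightarrow> (('v, 'e) lgen word \<Rightarrow>\<^sub>0 'k)" where
  "gst v [] = vx v"
| "gst v (e # es) = gst (head G e) es * gh e"

lemma pth_carrier [simp]: "v \<in> verts G \<Longrightarrow> es \<in> paths n v \<Longrightarrow> pth v es \<in> carrier FA"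
  by (induction n arbitrary: v es) auto

lemma gst_carrier [simp]: "v \<in> verts G \<Longrightarrow> es \<in> paths n v \<Longrightarrow> gst v es \<in> carrier FA"
  by (induction n arbitrary: v es) auto

lemma homog_pth: "homog (int (length es)) (pth v es)"
  by (induction es arbitrary: v) (auto intro!: homog_gen homog_mult[OF homog_gen[of _ 1]])

lemma homog_gst: "homog (- int (length es)) (gst v es)"
  by (induction es arbitrary: v) (auto intro!: homog_gen homog_mult[OF _ homog_gen[of _ "- 1"]])

lemma vx_pth: "v \<in> verts G \<Longrightarrow> es \<in> paths n v \<Longrightarrow> vx v * pth v es \<doteq> pth v es"
proof (cases n)
  case 0
  then show "v \<in> verts G \<Longrightarrow> es \<in> paths n v \<Longrightarrow> ?thesis" by (simp add: VV')
next
  case (Suc k)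
  assume "v \<in> verts G" "es \<in> paths n v"
  then obtain e fs where e: "es = e # fs" "e \<in> arcs G" "tail G e = v" "fs \<in> paths k (head G e)" using Suc by auto
  have "vx (tail G e) * ed e * pth (head G e) fs \<doteq> ed e * pth (head G e) fs"
    using e by (intro cong_mult_right VX) auto
  then show ?thesis using e by (simp add: mult.assoc)
qed

lemma pth_vx: "v \<in> verts G \<Longrightarrow> es \<in> paths n v \<Longrightarrow> pth v es * vx (endpt v es) \<doteq> pth v es"
proof (induction n arbitrary: v es)
  case 0
  then show ?case by (simp add: VV')
next
  case (Suc n)
  then obtain e fs where e: "es = e # fs" "e \<in> arcs G" "tail G e = v" "fs \<in> paths n (head G e)" by auto
  then show ?case
    using cong_mult_left[OF Suc.IH[of "head G e" fs], of "ed e"] by (simp add: mult.assoc)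
qed

lemma pth_snoc: "v \<in> verts G \<Longrightarrow> es @ [e] \<in> paths (Suc n) v \<Longrightarrow> pth v (es @ [e]) \<doteq> pth v es * ed e"
proof (induction es arbitrary: v n)
  case Nil
  then have "e \<in> arcs G" "tail G e = v" by auto
  then show ?case using cong_trans[OF XV cong_sym[OF VX], of e] by simp
next
  case (Cons f es)
  then obtain k where k: "n = Suc k" "f \<in> arcs G" "es @ [e] \<in> paths (Suc k) (head G f)"
    by (cases n) auto
  then show ?case
    using cong_mult_left[OF Cons.IH[of "head G f" k], of "ed f"] by (simp add: mult.assoc)
qed

text \<open>Equal lengths matter: of two different paths of the same length neither extends the
  other, so cancelling from the front meets a mismatch of arcs or of starting vertices.\<close>

lemma gst_pth:
  "u \<in> verts G \<Longrightarrow> u' \<in> verts G \<Longrightarrow> es \<in> paths n u \<Longrightarrow> fs \<in> paths n u' \<Longrightarrow>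
    gst u es * pth u' fs \<doteq> (if u = u' \<and> es = fs then vx (endpt u es) else 0)"
proof (induction n arbitrary: u u' es fs)
  case 0
  then show ?case using VV[of u u'] by (cases "u = u'") auto
next
  case (Suc n)
  obtain e es' where e: "es = e # es'" "e \<in> arcs G" "tail G e = u" "es' \<in> paths n (head G e)" using Suc.prems by auto
  obtain f fs' where f: "fs = f # fs'" "f \<in> arcs G" "tail G f = u'" "fs' \<in> paths n (head G f)" using Suc.prems by auto
  have c: "gst (head G e) es' \<in> carrier FA" "pth (head G f) fs' \<in> carrier FA"
    using e f by (auto intro: gst_carrier pth_carrier)
  have "gst u es * pth u' fs = gst (head G e) es' * ((gh e * ed f) * pth (head G f) fs')"
    by (simp add: e f mult.assoc)
  also have "\<dots> \<doteq> gst (head G e) es' * ((if e = f then vx (head G e) else 0) * pth (head G f) fs')"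
    using c e f by (intro cong_mult_left cong_mult_right YX) auto
  finally have *: "gst u es * pth u' fs \<doteq> gst (head G e) es' * ((if e = f then vx (head G e) else 0) * pth (head G f) fs')" .
  show ?case
  proof (cases "e = f")
    case True
    have "gst u es * pth u' fs \<doteq> gst (head G e) es' * (vx (head G e) * pth (head G e) fs')" using * True by simp
    also have "\<dots> \<doteq> gst (head G e) es' * pth (head G e) fs'"
      using c e f True by (intro cong_mult_left vx_pth) auto
    also have "\<dots> \<doteq> (if es' = fs' then vx (endpt (head G e) es') else 0)"
      using Suc.IH[of "head G e" "head G e" es' fs'] e f True by simp
    finally show ?thesis using e f True by auto
  next
    case False
    then show ?thesis using * e f by simp
  qed
qed

text \<open>The sum relation at a vertex, iterated \<open>n\<close> times.\<close>

lemma sum_pth_gst: "v \<in> verts G \<Longrightarrow> (\<Sum>es\<in>paths n v. pth v es * gst v es) \<doteq> vx v"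
proof (induction n arbitrary: v)
  case 0
  then show ?case by (simp add: VV')
next
  case (Suc n)
  have "(\<Sum>es\<in>paths (Suc n) v. pth v es * gst v es) =
      (\<Sum>e\<in>out_arcs G v. \<Sum>es\<in>(#) e ` paths n (head G e). pth v es * gst v es)"
    unfolding paths_Suc_eq by (rule sum.UNION_disjoint) auto
  also have "\<dots> = (\<Sum>e\<in>out_arcs G v. ed e * (\<Sum>es\<in>paths n (head G e). pth (head G e) es * gst (head G e) es) * gh e)"
    by (intro sum.cong refl, subst sum.reindex) (auto simp: sum_distrib_left sum_distrib_right mult.assoc)
  also have "\<dots> \<doteq> (\<Sum>e\<in>out_arcs G v. ed e * vx (head G e) * gh e)"
    by (intro cong_sum cong_mult_right cong_mult_left Suc.IH) auto
  also have "\<dots> \<doteq> (\<Sum>e\<in>out_arcs G v. ed e * gh e)"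
    by (intro cong_sum cong_mult_right XV) auto
  also have "\<dots> \<doteq> vx v" using Suc.prems by (rule sum_XY)
  finally show ?case .
qed

section \<open>Finite-dimensional modules live on the entryless cycles\<close>

lemma scal_LA: "scal LA M c x = act M x (scl c)"
  by (simp add: scal_def smult_one)

text \<open>A nonzero element at \<open>v\<close> survives along some arc at each step, which gives
  an infinite walk. Multiplied by the ghosts of all walks of length \<open>n\<close> with the end
  point reached so far, the surviving element yields as many independent elements, so their number
  is at most the size of \<open>B\<close> and \<open>walk_in_cyc\<close> applies. The bound is
  assumed for these products alone because in a graded module they have degree zero and remain in
  one finite-dimensional component.\<close>

lemma cyc_if_bounded:
  assumes rM: "right_module LA M" and y: "y \<in> carrier M" "act M y (vx v) = y" "y \<noteq> \<zero>\<^bsub>M\<^esub>" and v: "v \<in> verts G"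
    and B: "finite B" "B \<subseteq> carrier M"
    and bounded: "\<And>n es u fs. es \<in> paths n v \<Longrightarrow> (u, fs) \<in> walks_to n (endpt v es) \<Longrightarrow>
      \<exists>c :: 'm \<Rightarrow> 'k. act M y (pth v es * gst u fs) = (\<Oplus>\<^bsub>M\<^esub>b\<in>B. act M b (scl (c b)))"
  shows "v \<in> cyc"
proof -
  interpret M: abelian_group M by (rule module_abelian_group[OF rM])
  define P where "P n es \<longleftrightarrow> es \<in> paths n v \<and> act M y (pth v es) \<noteq> \<zero>\<^bsub>M\<^esub>" for n es
  have "P 0 []" using y by (simp add: P_def)
  then have 0: "\<exists>es. P 0 es" by blast
  \<comment> \<open>By the sum relation at its end point, \<open>?x\<close> is a sum of multiples of
    the elements \<open>act M ?x (ed e)\<close>, so not all of these vanish.\<close>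
  have step: "\<exists>es'. P (Suc n) es' \<and> (\<exists>e. es' = es @ [e])" if P: "P n es" for n es
  proof -
    let ?x = "act M y (pth v es)" and ?u = "endpt v es"
    have es: "es \<in> paths n v" using P by (simp add: P_def)
    have x: "?x \<in> carrier M" using y es v by (simp add: act_closed[OF rM])
    have u: "?u \<in> verts G" by (rule endpt_in_verts[OF v es])
    have "?x = act M ?x (vx ?u)"
      using act_mult[OF rM y(1), of "pth v es" "vx ?u"] act_cong[OF rM pth_vx[OF v es]] es v u by simp
    also have "\<dots> = act M ?x (\<Sum>e\<in>out_arcs G ?u. ed e * gh e)"
      by (rule act_cong[OF rM cong_sym[OF sum_XY[OF u]]])
    also have "\<dots> = (\<Oplus>\<^bsub>M\<^esub>e\<in>out_arcs G ?u. act M ?x (ed e * gh e))"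
      by (rule act_sum[OF rM x]) auto
    finally have eq: "?x = (\<Oplus>\<^bsub>M\<^esub>e\<in>out_arcs G ?u. act M ?x (ed e * gh e))" .
    have "\<exists>e\<in>out_arcs G ?u. act M ?x (ed e) \<noteq> \<zero>\<^bsub>M\<^esub>"
    proof (rule ccontr)
      assume "\<not> ?thesis"
      then have "act M ?x (ed e * gh e) = \<zero>\<^bsub>M\<^esub>" if "e \<in> out_arcs G ?u" for e
        using that act_mult[OF rM x, of "ed e" "gh e"] act_zero_left[OF rM] by auto
      then have "(\<Oplus>\<^bsub>M\<^esub>e\<in>out_arcs G ?u. act M ?x (ed e * gh e)) = \<zero>\<^bsub>M\<^esub>" by (rule M.finsum_all_zero)
      then have "?x = \<zero>\<^bsub>M\<^esub>" using eq by simp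
      then show False using P by (simp add: P_def)
    qed
    then obtain e where e: "e \<in> out_arcs G ?u" "act M ?x (ed e) \<noteq> \<zero>\<^bsub>M\<^esub>" by blast
    have s: "es @ [e] \<in> paths (Suc n) v" using es e(1) paths_snoc by blast
    have "act M y (pth v (es @ [e])) = act M ?x (ed e)"
      using act_cong[OF rM pth_snoc[OF v s]] act_mult[OF rM y(1), of "pth v es" "ed e"] es v e(1) by simp
    then show ?thesis using s e(2) by (auto simp: P_def simp del: paths.simps)
  qed
  obtain es where es: "\<And>n. P n (es n)" "\<And>n. \<exists>e. es (Suc n) = es n @ [e]"
    using dependent_nat_choice[of P "\<lambda>n es es'. \<exists>e. es' = es @ [e]", OF 0 step] by blast
  have p: "es n \<in> paths n v" for n using es(1) by (simp add: P_def)
  define a where "a n = endpt v (es n)" for n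
  have "nwalks n (a n) \<le> card B" for n
  proof (rule ccontr)
    assume "\<not> nwalks n (a n) \<le> card B"
    have an: "a n \<in> verts G" unfolding a_def by (rule endpt_in_verts[OF v p])
    let ?W = "walks_to n (a n)" and ?x = "act M y (pth v (es n))"
    have W: "u \<in> verts G" "fs \<in> paths n u" "endpt u fs = a n" if "(u, fs) \<in> ?W" for u fs
      using that by (auto simp: walks_to_def)
    have x: "?x \<in> carrier M" by (rule act_closed[OF rM y(1) pth_carrier[OF v p]])
    have "\<forall>w\<in>?W. \<exists>c :: 'm \<Rightarrow> 'k. act M y (pth v (es n) * gst (fst w) (snd w)) = (\<Oplus>\<^bsub>M\<^esub>b\<in>B. act M b (scl (c b)))"
      using bounded[OF p] by (auto simp: a_def)
    from bchoice[OF this] obtain c :: "'v \<times> 'e list \<Rightarrow> 'm \<Rightarrow> 'k" where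
      c: "\<And>w. w \<in> ?W \<Longrightarrow> act M y (pth v (es n) * gst (fst w) (snd w)) = (\<Oplus>\<^bsub>M\<^esub>b\<in>B. act M b (scl (c w b)))" by blast
    have card: "card B < card ?W" using \<open>\<not> nwalks n (a n) \<le> card B\<close> card_walks_to[OF an, of n] by simp
    obtain l where l: "\<exists>w\<in>?W. l w \<noteq> 0" "\<And>b. b \<in> B \<Longrightarrow> (\<Sum>w\<in>?W. l w * c w b) = 0"
      using linear_dependence[OF B(1) finite_walks_to card, of c] by blast
    have g: "gst (fst w) (snd w) \<in> carrier FA" if "w \<in> ?W" for w
      using W[of "fst w" "snd w"] that by (auto intro: gst_carrier)
    \<comment> \<open>The linear dependence between the ghost multiples of \<open>?x\<close>,
      written as one element of the algebra that kills \<open>?x\<close>.\<close>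
    let ?q = "\<Sum>w\<in>?W. gst (fst w) (snd w) * scl (l w)"
    have q: "?q \<in> carrier FA" using g by (intro fa_sum) auto
    have bM: "b \<in> carrier M" if "b \<in> B" for b using B(2) that by auto
    have "act M ?x ?q = (\<Oplus>\<^bsub>M\<^esub>w\<in>?W. act M ?x (gst (fst w) (snd w) * scl (l w)))"
      using g by (intro act_sum[OF rM x]) auto
    also have "\<dots> = (\<Oplus>\<^bsub>M\<^esub>w\<in>?W. \<Oplus>\<^bsub>M\<^esub>b\<in>B. act M b (scl (l w * c w b)))"
    proof (rule M.finsum_cong'[OF refl])
      fix w assume w: "w \<in> ?W"
      have "act M ?x (gst (fst w) (snd w) * scl (l w)) = act M (act M y (pth v (es n) * gst (fst w) (snd w))) (scl (l w))"
        using act_mult[OF rM x g[OF w], of "scl (l w)"] act_mult[OF rM y(1) pth_carrier[OF v p] g[OF w]] by simp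
      also have "\<dots> = (\<Oplus>\<^bsub>M\<^esub>b\<in>B. act M (act M b (scl (c w b))) (scl (l w)))"
        unfolding c[OF w] using bM by (intro act_finsum[OF rM]) (auto simp: act_closed[OF rM])
      also have "\<dots> = (\<Oplus>\<^bsub>M\<^esub>b\<in>B. act M b (scl (l w * c w b)))"
      proof (rule M.finsum_cong'[OF refl])
        fix b assume b: "b \<in> B"
        show "act M (act M b (scl (c w b))) (scl (l w)) = act M b (scl (l w * c w b))"
          using act_mult[OF rM bM[OF b], of "scl (c w b)" "scl (l w)"] by (simp add: mult_single mult.commute)
      qed (use bM in \<open>auto simp: act_closed[OF rM]\<close>)
      finally show "act M ?x (gst (fst w) (snd w) * scl (l w)) = (\<Oplus>\<^bsub>M\<^esub>b\<in>B. act M b (scl (l w * c w b)))" .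
    qed (use bM in \<open>auto simp: act_closed[OF rM] intro!: M.finsum_closed\<close>)
    also have "\<dots> = (\<Oplus>\<^bsub>M\<^esub>b\<in>B. \<Oplus>\<^bsub>M\<^esub>w\<in>?W. act M b (scl (l w * c w b)))"
      using B(1) bM by (intro M.finsum_swap) (auto simp: act_closed[OF rM])
    also have "\<dots> = \<zero>\<^bsub>M\<^esub>"
    proof (rule M.finsum_all_zero)
      fix b assume b: "b \<in> B"
      have "(\<Oplus>\<^bsub>M\<^esub>w\<in>?W. act M b (scl (l w * c w b))) = act M b (\<Sum>w\<in>?W. scl (l w * c w b))"
        using bM[OF b] by (intro act_sum[OF rM, symmetric]) auto
      also have "(\<Sum>w\<in>?W. scl (l w * c w b)) = scl (\<Sum>w\<in>?W. l w * c w b)"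
        by (rule single_sum)
      also have "\<dots> = 0" using l(2)[OF b] by simp
      finally show "(\<Oplus>\<^bsub>M\<^esub>w\<in>?W. act M b (scl (l w * c w b))) = \<zero>\<^bsub>M\<^esub>" using act_zero[OF rM bM[OF b]] by simp
    qed
    finally have zero: "act M ?x ?q = \<zero>\<^bsub>M\<^esub>" .
    obtain u fs where w: "(u, fs) \<in> ?W" "l (u, fs) \<noteq> 0" using l(1) by auto
    note wu = W[OF w(1)]
    have pc: "pth u fs \<in> carrier FA" using wu by (auto intro: pth_carrier)
    \<comment> \<open>By \<open>gst_pth\<close> the path \<open>fs\<close> leaves only the summand
      of its own ghost; hence a nonzero scalar would kill \<open>?x\<close>.\<close>
    have "?q * pth u fs = (\<Sum>w\<in>?W. scl (l w) * (gst (fst w) (snd w) * pth u fs))"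
      by (simp add: sum_distrib_right mult.assoc scalar_commute[symmetric] flip: scalar_left_commute)
    also have "\<dots> \<doteq> (\<Sum>w\<in>?W. scl (l w) * (if w = (u, fs) then vx (a n) else 0))"
    proof (intro cong_sum cong_mult_left)
      fix w' assume "w' \<in> ?W"
      then show "gst (fst w') (snd w') * pth u fs \<doteq> (if w' = (u, fs) then vx (a n) else 0)"
        using W[of "fst w'" "snd w'"] gst_pth[of "fst w'" u "snd w'" n fs] wu by (auto simp: prod_eq_iff)
    qed simp
    also have "\<dots> = (\<Sum>w\<in>?W. if w = (u, fs) then scl (l (u, fs)) * vx (a n) else 0)"
      by (intro sum.cong) auto
    also have "\<dots> = scl (l (u, fs)) * vx (a n)" using w(1) by (simp add: sum.delta)
    finally have e: "?q * pth u fs \<doteq> vx (a n) * scl (l (u, fs))" by (simp add: scalar_commute)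
    have "act M ?x (vx (a n)) = ?x"
      unfolding a_def
      by (rule trans[OF act_mult[OF rM y(1) pth_carrier[OF v p[of n]], symmetric] act_cong[OF rM pth_vx[OF v p[of n]]]])
        (use an in \<open>simp add: a_def\<close>)
    then have "act M ?x (scl (l (u, fs))) = act M ?x (vx (a n) * scl (l (u, fs)))"
      using act_mult[OF rM x, of "vx (a n)"] an by simp
    also have "\<dots> = act M ?x (?q * pth u fs)" by (rule act_cong[OF rM cong_sym[OF e]])
    also have "\<dots> = act M (act M ?x ?q) (pth u fs)" by (rule act_mult[OF rM x q pc])
    also have "\<dots> = \<zero>\<^bsub>M\<^esub>" unfolding zero by (rule act_zero_left[OF rM pc])
    finally have "act M (act M ?x (scl (l (u, fs)))) (scl (inverse (l (u, fs)))) = \<zero>\<^bsub>M\<^esub>"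
      by (simp add: act_zero_left[OF rM])
    then have "act M ?x (scl (l (u, fs)) * scl (inverse (l (u, fs)))) = \<zero>\<^bsub>M\<^esub>"
      using act_mult[OF rM x, of "scl (l (u, fs))"] by simp
    then have "?x = \<zero>\<^bsub>M\<^esub>" using w(2) x act_one[OF rM x] by (simp add: mult_single)
    then show False using es(1)[of n] by (simp add: P_def)
  qed
  moreover have "\<exists>e\<in>arcs G. tail G e = a n \<and> head G e = a (Suc n)" for n
  proof -
    obtain e where e: "es (Suc n) = es n @ [e]" using es(2) by blast
    then have "e \<in> out_arcs G (a n)" using p[of "Suc n"] paths_snoc[of "es n" e n v] by (simp add: a_def)
    then show ?thesis using e by (auto simp: a_def intro!: bexI[of _ e])
  qed
  ultimately have "a 0 \<in> cyc" by (intro walk_in_cyc[of a "card B"])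
  then show ?thesis using p[of 0] by (simp add: a_def)
qed

lemma fin_dim_vertex_zero:
  assumes rM: "right_module LA M" and fd: "fin_dim LA M (carrier M)"
    and x: "x \<in> carrier M" and v: "v \<in> verts G" "v \<notin> cyc"
  shows "act M x (vx v) = \<zero>\<^bsub>M\<^esub>"
proof (rule ccontr)
  assume ne: "act M x (vx v) \<noteq> \<zero>\<^bsub>M\<^esub>"
  obtain B where B: "finite B" "B \<subseteq> carrier M"
    "\<And>x. x \<in> carrier M \<Longrightarrow> \<exists>c :: _ \<Rightarrow> 'k. x = (\<Oplus>\<^bsub>M\<^esub>b\<in>B. act M b (scl (c b)))"
    using fd unfolding fin_dim_def scal_LA by blast
  have y: "act M x (vx v) \<in> carrier M" using x v by (simp add: act_closed[OF rM])
  have "v \<in> cyc"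
  proof (rule cyc_if_bounded[OF rM y _ ne v(1) B(1,2)])
    show "act M (act M x (vx v)) (vx v) = act M x (vx v)"
      using act_mult[OF rM x, of "vx v" "vx v"] act_cong[OF rM VV'[OF v(1)], of x] v by simp
    fix n es u fs assume es: "es \<in> paths n v" and w: "(u, fs) \<in> walks_to n (endpt v es)"
    have "pth v es * gst u fs \<in> carrier FA"
      using pth_carrier[OF v(1) es] w gst_carrier[of u fs n] by (auto simp: walks_to_def)
    then show "\<exists>c :: _ \<Rightarrow> 'k. act M (act M x (vx v)) (pth v es * gst u fs) = (\<Oplus>\<^bsub>M\<^esub>b\<in>B. act M b (scl (c b)))"
      by (intro B(3) act_closed[OF rM y])
  qed
  then show False using v by simp
qed

text \<open>Only the components are finite dimensional, so the bound is applied to homogeneous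
  elements, and \<open>x\<close> is reached through its decomposition. Path and ghost have equal
  lengths, so their product has degree zero and does not leave the component.\<close>

lemma fin_dim_gcomp_vertex_zero:
  assumes gM: "graded_module LA M" and fd: "\<And>i. fin_dim LA M (gcomp M i)"
    and x: "x \<in> carrier M" and v: "v \<in> verts G" "v \<notin> cyc"
  shows "act M x (vx v) = \<zero>\<^bsub>M\<^esub>"
proof -
  note rM = graded_right[OF gM]
  interpret M: abelian_group M by (rule module_abelian_group[OF rM])
  have hom: "act M x (vx v) = \<zero>\<^bsub>M\<^esub>" if x: "x \<in> gcomp M i" for x i
  proof (rule ccontr)
    assume ne: "act M x (vx v) \<noteq> \<zero>\<^bsub>M\<^esub>"
    have xc: "x \<in> carrier M" by (rule gcomp_carrier[OF gM x])
    obtain B where B: "finite B" "B \<subseteq> gcomp M i"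
      "\<And>x. x \<in> gcomp M i \<Longrightarrow> \<exists>c :: _ \<Rightarrow> 'k. x = (\<Oplus>\<^bsub>M\<^esub>b\<in>B. act M b (scl (c b)))"
      using fd[of i] unfolding fin_dim_def scal_LA by blast
    have B': "B \<subseteq> carrier M" using B(2) gcomp_carrier[OF gM] by blast
    have yg: "act M x (vx v) \<in> gcomp M i" using v by (intro gcomp_act[OF gM x, of _ 0]) (auto intro: homog_gen)
    have y: "act M x (vx v) \<in> carrier M" by (rule gcomp_carrier[OF gM yg])
    have "v \<in> cyc"
    proof (rule cyc_if_bounded[OF rM y _ ne v(1) B(1) B'])
      show "act M (act M x (vx v)) (vx v) = act M x (vx v)"
        using act_mult[OF rM xc, of "vx v" "vx v"] act_cong[OF rM VV'[OF v(1)], of x] v by simp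
      fix n es u fs assume es: "es \<in> paths n v" and w: "(u, fs) \<in> walks_to n (endpt v es)"
      have p: "pth v es * gst u fs \<in> carrier FA"
        using pth_carrier[OF v(1) es] w gst_carrier[of u fs n] by (auto simp: walks_to_def)
      have "homog 0 (pth v es * gst u fs)"
        by (rule homog_mult[OF homog_pth homog_gst])
          (use w length_paths[OF es] length_paths in \<open>auto simp: walks_to_def\<close>)
      then show "\<exists>c :: _ \<Rightarrow> 'k. act M (act M x (vx v)) (pth v es * gst u fs) = (\<Oplus>\<^bsub>M\<^esub>b\<in>B. act M b (scl (c b)))"
        by (intro B(3) gcomp_act[OF gM yg p]) auto
    qed
    then show False using v by simp
  qed
  obtain D c where c: "finite D" "\<And>i. c i \<in> gcomp M i" "x = (\<Oplus>\<^bsub>M\<^esub>i\<in>D. c i)"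
    using gcomp_decomposition[OF gM x] by blast
  have "act M x (vx v) = (\<Oplus>\<^bsub>M\<^esub>i\<in>D. act M (c i) (vx v))"
    unfolding c(3) using v gcomp_carrier[OF gM c(2)] by (intro act_finsum[OF rM]) auto
  also have "\<dots> = \<zero>\<^bsub>M\<^esub>" using hom[OF c(2)] by (intro M.finsum_all_zero)
  finally show ?thesis .
qed

end

section \<open>Graded projective modules have graded bases\<close>

context leavitt
begin

lemma comb_split:
  assumes rM: "right_module LA M" and b: "b \<in> I \<rightarrow> carrier M" and p: "p \<in> I \<rightarrow> carrier FA"
    and I: "finite I" "k \<in> I"
  shows "comb M I b p = act M (b k) (p k) \<oplus>\<^bsub>M\<^esub> comb M (I - {k}) b p"
proof -
  interpret M: abelian_group M by (rule module_abelian_group[OF rM])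
  have "comb M (insert k (I - {k})) b p = act M (b k) (p k) \<oplus>\<^bsub>M\<^esub> comb M (I - {k}) b p"
    using b p I by (intro M.finsum_insert) (auto simp: Pi_def act_closed[OF rM])
  then show ?thesis using I by (simp add: insert_absorb)
qed

text \<open>A family of generators that is related to a free module by a scalar idempotent matrix \<open>\<kappa>\<close> contains a
  basis: as long as \<open>\<kappa>\<close> is not the identity, it provides a linear relation between the generators, and
  one of them can be removed.\<close>

lemma scalar_coordinates_basis:
  assumes gM: "graded_module LA M" and F: "frame M I s v m" and S: "spans M I s"
    and K1: "\<And>i. i \<in> I \<Longrightarrow> s i = comb M I s (\<lambda>j. scl (\<kappa> j i))"
    and K2: "\<And>q j. q \<in> I \<rightarrow> carrier FA \<Longrightarrow> comb M I s q = \<zero>\<^bsub>M\<^esub> \<Longrightarrow> j \<in> I \<Longrightarrow>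
      (\<Sum>i\<in>I. scl (\<kappa> j i) * (vx (v i) * q i)) \<in> LI"
  shows "\<exists>J. basis M J s v m"
  using frameD(1)[OF F] F S K1 K2
proof (induction I arbitrary: \<kappa> rule: finite_psubset_induct)
  case (psubset I)
  note rM = graded_right[OF gM] and F = psubset.prems(1) and S = psubset.prems(2)
  note K1 = psubset.prems(3) and K2 = psubset.prems(4)
  interpret M: abelian_group M by (rule module_abelian_group[OF rM])
  have fin: "finite I" by (rule psubset.hyps)
  note sc = frame_closed[OF gM F]
  show ?case
  proof (cases "\<forall>i\<in>I. \<forall>j\<in>I. \<kappa> j i = (if j = i then 1 else 0)")
    case True
    have "vx (v j) * q j \<in> LI" if q: "q \<in> I \<rightarrow> carrier FA" "comb M I s q = \<zero>\<^bsub>M\<^esub>" and j: "j \<in> I" for q j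
    proof -
      have "(\<Sum>i\<in>I. scl (\<kappa> j i) * (vx (v i) * q i)) = (\<Sum>i\<in>I. if i = j then vx (v j) * q j else 0)"
        using True j by (intro sum.cong) auto
      then show ?thesis using K2[OF q j] fin j by (simp add: sum.delta)
    qed
    then have "basis M I s v m" using F S by (simp add: basis_def)
    then show ?thesis by blast
  next
    case False
    then obtain i0 k where ik: "i0 \<in> I" "k \<in> I" "\<kappa> k i0 \<noteq> (if k = i0 then 1 else 0)" by blast
    \<comment> \<open>Column \<open>i0\<close> of \<kappa> minus the identity is a scalar relation
      between the generators, by the first condition on \<kappa>. Scaled to have \<open>- 1\<close>
      at \<open>k\<close>, it expresses \<open>s k\<close> through the other generators with
      coefficients \<mu>.\<close>
    define l where "l j = \<kappa> j i0 - (if j = i0 then 1 else 0)" for j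
    define \<mu> where "\<mu> j = - l j / l k" for j
    have lk: "l k \<noteq> 0" using ik by (simp add: l_def)
    let ?I = "I - {k}"
    have sc': "s \<in> ?I \<rightarrow> carrier M" using sc by auto
    have s: "s i \<in> carrier M" if "i \<in> I" for i using sc that by auto
    have "comb M I s (\<lambda>j. if j = i0 then 1 else 0) = s i0"
      using comb_single[OF rM sc fin ik(1), of 1] act_one[OF rM s[OF ik(1)]] by simp
    then have "comb M I s (\<lambda>j. scl (\<kappa> j i0) - (if j = i0 then 1 else 0)) = s i0 \<ominus>\<^bsub>M\<^esub> s i0"
      using K1[OF ik(1)] by (subst comb_diff[OF rM sc]) auto
    also have "\<dots> = \<zero>\<^bsub>M\<^esub>" using s[OF ik(1)] by (simp add: a_minus_def M.r_neg)
    also have "(\<lambda>j. scl (\<kappa> j i0) - (if j = i0 then 1 else 0)) = (\<lambda>j. scl (l j))"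
      by (auto simp: l_def single_diff single_one[symmetric] simp del: single_one)
    finally have "comb M I s (\<lambda>j. scl (l j)) = \<zero>\<^bsub>M\<^esub>" .
    then have "act M (comb M I s (\<lambda>j. scl (l j))) (scl (- 1 / l k)) = \<zero>\<^bsub>M\<^esub>" by (simp add: act_zero_left[OF rM])
    then have z: "comb M I s (\<lambda>j. scl (\<mu> j)) = \<zero>\<^bsub>M\<^esub>"
      by (subst (asm) comb_act[OF rM sc]) (auto simp: mult_single \<mu>_def)
    have mk: "\<mu> k = - 1" using lk by (simp add: \<mu>_def)
    have "act M (s k) (scl (\<mu> k)) \<oplus>\<^bsub>M\<^esub> comb M ?I s (\<lambda>j. scl (\<mu> j)) = \<zero>\<^bsub>M\<^esub>"
      using comb_split[OF rM sc _ fin ik(2), of "\<lambda>j. scl (\<mu> j)"] z by simp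
    moreover have "act M (s k) (scl (\<mu> k)) = \<ominus>\<^bsub>M\<^esub> s k"
      using act_uminus[OF rM s[OF ik(2)], of 1] act_one[OF rM s[OF ik(2)]] by (simp add: mk single_uminus)
    ultimately have "comb M ?I s (\<lambda>j. scl (\<mu> j)) \<oplus>\<^bsub>M\<^esub> \<ominus>\<^bsub>M\<^esub> s k = \<zero>\<^bsub>M\<^esub>"
      using M.a_comm[of "comb M ?I s (\<lambda>j. scl (\<mu> j))" "\<ominus>\<^bsub>M\<^esub> s k"] s[OF ik(2)]
        comb_closed[OF rM sc', of "\<lambda>j. scl (\<mu> j)"] by simp
    then have sk: "s k = comb M ?I s (\<lambda>j. scl (\<mu> j))"
      using M.minus_equality[of "comb M ?I s (\<lambda>j. scl (\<mu> j))" "\<ominus>\<^bsub>M\<^esub> s k"] s[OF ik(2)]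
        comb_closed[OF rM sc', of "\<lambda>j. scl (\<mu> j)"] by simp
    have red: "comb M I s p = comb M ?I s (\<lambda>j. p j + scl (\<mu> j) * p k)" if p: "p \<in> I \<rightarrow> carrier FA" for p
    proof -
      have pk: "p k \<in> carrier FA" using p ik by auto
      have p': "p \<in> ?I \<rightarrow> carrier FA" using p by auto
      have "act M (s k) (p k) = comb M ?I s (\<lambda>j. scl (\<mu> j) * p k)"
        using comb_act[OF rM sc' _ pk, of "\<lambda>j. scl (\<mu> j)"] sk by simp
      then have "comb M I s p = comb M ?I s p \<oplus>\<^bsub>M\<^esub> comb M ?I s (\<lambda>j. scl (\<mu> j) * p k)"
        using comb_split[OF rM sc p fin ik(2)] comb_closed[OF rM sc' p'] comb_closed[OF rM sc', of "\<lambda>j. scl (\<mu> j) * p k"] pk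
        by (simp add: M.a_comm)
      then show ?thesis using comb_add[OF rM sc' p', of "\<lambda>j. scl (\<mu> j) * p k"] pk by simp
    qed
    show ?thesis
    \<comment> \<open>Substituting for \<open>s k\<close> adds \<mu> \<open>j\<close> times row
      \<open>k\<close> to row \<open>j\<close>. The second condition survives because it holds for
      the rows \<open>j\<close> and \<open>k\<close> separately.\<close>
    proof (rule psubset.IH[of ?I "\<lambda>j i. \<kappa> j i + \<mu> j * \<kappa> k i"])
      show "?I \<subset> I" using ik by auto
      show "frame M ?I s v m" using F by (auto simp: frame_def)
      show "spans M ?I s"
        unfolding spans_def
      proof
        fix x assume "x \<in> carrier M"
        then obtain p where p: "p \<in> I \<rightarrow> carrier FA" "x = comb M I s p" using spansD[OF S] by blast
        show "\<exists>p\<in>?I \<rightarrow> carrier FA. x = comb M ?I s p"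
          using trans[OF p(2) red[OF p(1)]] p(1) ik by (intro bexI[of _ "\<lambda>j. p j + scl (\<mu> j) * p k"]) (auto simp: Pi_def)
      qed
      show "s i = comb M ?I s (\<lambda>j. scl (\<kappa> j i + \<mu> j * \<kappa> k i))" if "i \<in> ?I" for i
      proof -
        have i: "i \<in> I" using that by simp
        show ?thesis using trans[OF K1[OF i] red[of "\<lambda>j. scl (\<kappa> j i)"]] by (simp add: single_add mult_single)
      qed
      fix q j assume q: "q \<in> ?I \<rightarrow> carrier FA" "comb M ?I s q = \<zero>\<^bsub>M\<^esub>" and j: "j \<in> ?I"
      define q' where "q' i = (if i = k then 0 else q i)" for i
      have q'c: "q' \<in> I \<rightarrow> carrier FA" using q by (auto simp: q'_def)
      have "comb M I s q' = comb M ?I s (\<lambda>j. q' j + scl (\<mu> j) * q' k)" by (rule red[OF q'c])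
      also have "\<dots> = comb M ?I s q"
        using q(1) sc' by (intro M.finsum_cong') (auto simp: q'_def Pi_def act_closed[OF rM])
      finally have z': "comb M I s q' = \<zero>\<^bsub>M\<^esub>" using q(2) by simp
      have sumI: "(\<Sum>i\<in>I. scl (\<kappa> j' i) * (vx (v i) * q' i)) = (\<Sum>i\<in>?I. scl (\<kappa> j' i) * (vx (v i) * q i))" for j'
        using fin ik by (subst sum.remove[of _ k]) (auto simp: q'_def intro!: sum.cong)
      have "(\<Sum>i\<in>?I. scl (\<kappa> j i) * (vx (v i) * q i)) \<in> LI" "(\<Sum>i\<in>?I. scl (\<kappa> k i) * (vx (v i) * q i)) \<in> LI"
        using K2[OF q'c z'] j ik sumI by auto
      then have "(\<Sum>i\<in>?I. scl (\<kappa> j i) * (vx (v i) * q i)) + scl (\<mu> j) * (\<Sum>i\<in>?I. scl (\<kappa> k i) * (vx (v i) * q i)) \<in> LI"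
        by (intro LI_add LI_mult_left) auto
      then show "(\<Sum>i\<in>?I. scl (\<kappa> j i + \<mu> j * \<kappa> k i) * (vx (v i) * q i)) \<in> LI"
        by (simp add: single_add sum_distrib_left sum.distrib distrib_right mult_single flip: mult.assoc)
    qed
  qed
qed

lemma word_times_path:
  assumes "set gs \<subseteq> leavitt_gens G" "length gs \<le> n" "u \<in> verts G" "\<beta> \<in> paths n u"
  shows "Poly_Mapping.single (Word gs) 1 * pth u \<beta> \<doteq> 0 \<or>
    (\<exists>u'\<in>verts G. \<exists>\<alpha>\<in>paths (nat (int n + word_degree (Word gs))) u'. endpt u' \<alpha> = endpt u \<beta> \<and>
      Poly_Mapping.single (Word gs) 1 * pth u \<beta> \<doteq> pth u' \<alpha>)"
  using assms(1,2)
proof (induction gs)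
  case Nil
  have "Poly_Mapping.single (Word []) 1 * pth u \<beta> = pth u \<beta>" by (simp flip: zero_word_def)
  then show ?case using assms(3,4)
    by (intro disjI2 bexI[of _ u] bexI[of _ \<beta>]) (auto simp flip: zero_word_def)
next
  case (Cons g gs)
  let ?p = "Poly_Mapping.single (Word gs) 1 * pth u \<beta>"
  have g: "g \<in> leavitt_gens G" and gs: "set gs \<subseteq> leavitt_gens G" using Cons.prems by auto
  have eq: "Poly_Mapping.single (Word (g # gs)) 1 * pth u \<beta> = gen g * ?p"
    by (simp add: gen_def mult_single plus_word_def flip: mult.assoc)
  have deg: "word_degree (Word (g # gs)) = letter_degree g + word_degree (Word gs)"
    by (simp add: word_degree_def)
  have lower: "- int (length gs) \<le> word_degree (Word gs)"
  proof -
    have "- int (length hs) \<le> sum_list (map letter_degree hs)" for hs :: "('v, 'e) lgen list"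
    proof (induction hs)
      case (Cons h hs)
      then show ?case by (cases h) auto
    qed simp
    then show ?thesis by (simp add: word_degree_def)
  qed
  have gc: "gen g \<in> carrier FA" using g by simp
  consider "?p \<doteq> 0" | u' \<alpha> where "u' \<in> verts G" "\<alpha> \<in> paths (nat (int n + word_degree (Word gs))) u'"
    "endpt u' \<alpha> = endpt u \<beta>" "?p \<doteq> pth u' \<alpha>"
    using Cons.IH[OF gs] Cons.prems by auto
  then show ?case
  proof cases
    case 1
    then have "gen g * ?p \<doteq> gen g * 0" using gc by (rule cong_mult_left)
    then show ?thesis unfolding eq by simp
  next
    case 2
    define k where "k = nat (int n + word_degree (Word gs)) - 1"
    \<comment> \<open>Each letter costs at most one arc, and \<open>g\<close> has not acted yet, so
      at least one arc is left.\<close>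
    have k: "nat (int n + word_degree (Word gs)) = Suc k" using lower Cons.prems(2) by (simp add: k_def)
    have nk: "int n + word_degree (Word gs) = int (Suc k)" using k by linarith
    have ac: "pth u' \<alpha> \<in> carrier FA" using 2 by (auto intro: pth_carrier)
    have gp: "gen g * ?p \<doteq> gen g * pth u' \<alpha>" using 2(4) gc by (rule cong_mult_left)
    show ?thesis
    proof (cases g)
      case (Vert x)
      then have x: "x \<in> verts G" using g by simp
      show ?thesis
      proof (cases "x = u'")
        case True
        have "gen g * ?p \<doteq> pth u' \<alpha>"
          using cong_trans[OF gp] vx_pth[OF 2(1,2)] Vert True by simp
        then show ?thesis unfolding eq deg using 2 Vert by auto
      next
        case False
        have "vx x * pth u' \<alpha> \<doteq> vx x * (vx u' * pth u' \<alpha>)"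
          by (intro cong_mult_left cong_sym[OF vx_pth[OF 2(1,2)]]) (use x in auto)
        also have "vx x * (vx u' * pth u' \<alpha>) = vx x * vx u' * pth u' \<alpha>" by (simp add: mult.assoc)
        also have "\<dots> \<doteq> 0 * pth u' \<alpha>" using VV_ne[OF x 2(1) False] ac by (rule cong_mult_right)
        finally show ?thesis unfolding eq using cong_trans[OF gp] Vert by simp
      qed
    next
      case (Edge e)
      then have e: "e \<in> arcs G" using g by simp
      show ?thesis
      proof (cases "head G e = u'")
        case True
        have "gen g * ?p \<doteq> pth (tail G e) (e # \<alpha>)" using gp Edge True by simp
        moreover have "e # \<alpha> \<in> paths (nat (int n + word_degree (Word (g # gs)))) (tail G e)"
        proof -
          have "int n + word_degree (Word (g # gs)) = int (Suc (Suc k))" using nk deg Edge by simp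
          then show ?thesis using 2(2) k e True by (simp only: nat_int) auto
        qed
        ultimately show ?thesis unfolding eq using 2 e True
          by (intro disjI2 bexI[of _ "tail G e"] bexI[of _ "e # \<alpha>"]) auto
      next
        case False
        have "ed e * pth u' \<alpha> \<doteq> (ed e * vx (head G e)) * (vx u' * pth u' \<alpha>)"
          by (rule cong_mult[OF cong_sym[OF XV[OF e]] cong_sym[OF vx_pth[OF 2(1,2)]]])
        also have "\<dots> = ed e * (vx (head G e) * vx u') * pth u' \<alpha>" by (simp add: mult.assoc)
        also have "\<dots> \<doteq> ed e * 0 * pth u' \<alpha>"
          using ac e VV_ne[OF _ 2(1) False] by (intro cong_mult_right cong_mult_left) auto
        finally show ?thesis unfolding eq using cong_trans[OF gp] Edge by simp
      qed
    next
      case (Ghost e)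
      then have e: "e \<in> arcs G" using g by simp
      obtain f \<alpha>' where f: "\<alpha> = f # \<alpha>'" "f \<in> arcs G" "tail G f = u'" "\<alpha>' \<in> paths k (head G f)"
        using 2(2) k by auto
      have ac': "pth (head G f) \<alpha>' \<in> carrier FA" using f by (auto intro: pth_carrier)
      have "gh e * pth u' \<alpha> = gh e * ed f * pth (head G f) \<alpha>'" by (simp add: f mult.assoc)
      also have "\<dots> \<doteq> (if e = f then vx (head G e) else 0) * pth (head G f) \<alpha>'"
        using YX[OF e f(2)] ac' by (rule cong_mult_right)
      finally have gf: "gen g * ?p \<doteq> (if e = f then vx (head G e) else 0) * pth (head G f) \<alpha>'"
        using cong_trans[OF gp] Ghost by simp
      show ?thesis
      proof (cases "e = f")
        case True
        have "gen g * ?p \<doteq> pth (head G f) \<alpha>'"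
          using cong_trans[OF gf] vx_pth[OF _ f(4)] f True by simp
        moreover have "nat (int n + word_degree (Word (g # gs))) = k" using nk deg Ghost by simp
        ultimately show ?thesis unfolding eq using 2 f
          by (intro disjI2 bexI[of _ "head G f"] bexI[of _ \<alpha>']) auto
      next
        case False
        then show ?thesis unfolding eq using gf by simp
      qed
    qed
  qed
qed

lemma poly_as_sum:
  fixes p :: "'g word \<Rightarrow>\<^sub>0 'k"
  shows "(\<Sum>w\<in>Poly_Mapping.keys p. Poly_Mapping.single w (Poly_Mapping.lookup p w)) = p"
  by (rule poly_mapping_eqI) (simp add: lookup_sum lookup_single when_def sum.delta in_keys_iff)

text \<open>All words of \<open>p\<close> have degree \<open>d\<close>, so multiplication by a long
  path turns each of them into zero or a path of the same length; a homogeneous element becomes a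
  row of scalars. The words act at the front only, hence the end point is preserved and coefficients
  vanish at paths with another one.\<close>

lemma element_times_path:
  assumes p: "p \<in> carrier FA" "homog d p" and n: "\<And>w. w \<in> Poly_Mapping.keys p \<Longrightarrow> length (letters w) \<le> n"
    and u: "u \<in> verts G" "\<beta> \<in> paths n u" and x: "x \<in> verts G"
  shows "\<exists>\<kappa>. (\<forall>\<alpha>. \<kappa> \<alpha> \<noteq> 0 \<longrightarrow> endpt x \<alpha> = endpt u \<beta>) \<and>
    vx x * (p * pth u \<beta>) \<doteq> (\<Sum>\<alpha>\<in>paths (nat (int n + d)) x. scl (\<kappa> \<alpha>) * pth x \<alpha>)"
proof -
  let ?N = "nat (int n + d)"
  have ub: "pth u \<beta> \<in> carrier FA" using u by (auto intro: pth_carrier)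
  have "\<exists>\<kappa>. (\<forall>\<alpha>. \<kappa> \<alpha> \<noteq> 0 \<longrightarrow> endpt x \<alpha> = endpt u \<beta>) \<and>
      vx x * (Poly_Mapping.single w 1 * pth u \<beta>) \<doteq> (\<Sum>\<alpha>\<in>paths ?N x. scl (\<kappa> \<alpha>) * pth x \<alpha>)"
    if w: "w \<in> Poly_Mapping.keys p" for w
  proof -
    have gs: "set (letters w) \<subseteq> leavitt_gens G" using p w by (auto simp: fa_carrier_iff)
    have d: "word_degree w = d" using p w by (auto simp: homog_def)
    have W: "Word (letters w) = w" by (cases w) simp
    let ?q = "Poly_Mapping.single w 1 * pth u \<beta>"
    consider "?q \<doteq> 0" | u' \<alpha> where "u' \<in> verts G" "\<alpha> \<in> paths ?N u'" "endpt u' \<alpha> = endpt u \<beta>" "?q \<doteq> pth u' \<alpha>"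
      using word_times_path[OF gs n[OF w] u] unfolding W d by blast
    then show ?thesis
    proof cases
      case 1
      have "vx x * ?q \<doteq> vx x * 0" using 1 x by (intro cong_mult_left) auto
      then show ?thesis by (intro exI[of _ "\<lambda>_. 0"]) simp
    next
      case 2
      have a: "pth u' \<alpha> \<in> carrier FA" using 2 by (auto intro: pth_carrier)
      have q: "vx x * ?q \<doteq> vx x * pth u' \<alpha>" using 2(4) x by (intro cong_mult_left) auto
      show ?thesis
      proof (cases "x = u'")
        case True
        have "(\<Sum>\<gamma>\<in>paths ?N x. scl (if \<gamma> = \<alpha> then 1 else 0) * pth x \<gamma>) = (\<Sum>\<gamma>\<in>paths ?N x. if \<gamma> = \<alpha> then pth x \<alpha> else 0)"
          by (intro sum.cong) auto
        also have "\<dots> = pth u' \<alpha>" using 2(2) True by (simp add: sum.delta)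
        finally have "vx x * ?q \<doteq> (\<Sum>\<gamma>\<in>paths ?N x. scl (if \<gamma> = \<alpha> then 1 else 0) * pth x \<gamma>)"
          using cong_trans[OF q] vx_pth[OF 2(1,2)] True by simp
        then show ?thesis using 2(3) True by (intro exI[of _ "\<lambda>\<gamma>. if \<gamma> = \<alpha> then 1 else 0"]) auto
      next
        case False
        have "vx x * pth u' \<alpha> \<doteq> vx x * (vx u' * pth u' \<alpha>)"
          by (intro cong_mult_left cong_sym[OF vx_pth[OF 2(1,2)]]) (use x in auto)
        also have "vx x * (vx u' * pth u' \<alpha>) = vx x * vx u' * pth u' \<alpha>" by (simp add: mult.assoc)
        also have "\<dots> \<doteq> 0 * pth u' \<alpha>" using VV_ne[OF x 2(1) False] a by (rule cong_mult_right)
        finally have "vx x * ?q \<doteq> 0" using cong_trans[OF q] by simp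
        then show ?thesis by (intro exI[of _ "\<lambda>_. 0"]) simp
      qed
    qed
  qed
  then have "\<forall>w\<in>Poly_Mapping.keys p. \<exists>\<kappa>. (\<forall>\<alpha>. \<kappa> \<alpha> \<noteq> 0 \<longrightarrow> endpt x \<alpha> = endpt u \<beta>) \<and>
      vx x * (Poly_Mapping.single w 1 * pth u \<beta>) \<doteq> (\<Sum>\<alpha>\<in>paths ?N x. scl (\<kappa> \<alpha>) * pth x \<alpha>)" by blast
  from bchoice[OF this] obtain \<kappa> where k: "\<And>w \<alpha>. w \<in> Poly_Mapping.keys p \<Longrightarrow> \<kappa> w \<alpha> \<noteq> 0 \<Longrightarrow> endpt x \<alpha> = endpt u \<beta>"
    "\<And>w. w \<in> Poly_Mapping.keys p \<Longrightarrow> vx x * (Poly_Mapping.single w 1 * pth u \<beta>) \<doteq> (\<Sum>\<alpha>\<in>paths ?N x. scl (\<kappa> w \<alpha>) * pth x \<alpha>)"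
    by blast
  define K where "K \<alpha> = (\<Sum>w\<in>Poly_Mapping.keys p. Poly_Mapping.lookup p w * \<kappa> w \<alpha>)" for \<alpha>
  have K: "endpt x \<alpha> = endpt u \<beta>" if "K \<alpha> \<noteq> 0" for \<alpha>
  proof -
    obtain w where "w \<in> Poly_Mapping.keys p" "Poly_Mapping.lookup p w * \<kappa> w \<alpha> \<noteq> 0"
      by (rule sum.not_neutral_contains_not_neutral[OF \<open>K \<alpha> \<noteq> 0\<close>[unfolded K_def]])
    then show ?thesis using k(1)[of w \<alpha>] by auto
  qed
  have "vx x * (p * pth u \<beta>) = (\<Sum>w\<in>Poly_Mapping.keys p. scl (Poly_Mapping.lookup p w) * (vx x * (Poly_Mapping.single w 1 * pth u \<beta>)))"
  proof -
    have "vx x * (p * pth u \<beta>) = (\<Sum>w\<in>Poly_Mapping.keys p. vx x * (Poly_Mapping.single w (Poly_Mapping.lookup p w) * pth u \<beta>))"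
      by (subst poly_as_sum[of p, symmetric]) (simp add: sum_distrib_left sum_distrib_right)
    also have "\<dots> = (\<Sum>w\<in>Poly_Mapping.keys p. scl (Poly_Mapping.lookup p w) * (vx x * (Poly_Mapping.single w 1 * pth u \<beta>)))"
    proof (rule sum.cong[OF refl])
      fix w
      have "vx x * (Poly_Mapping.single w (Poly_Mapping.lookup p w) * pth u \<beta>) =
          vx x * (scl (Poly_Mapping.lookup p w) * (Poly_Mapping.single w 1 * pth u \<beta>))"
        by (subst single_scalar) (simp add: mult.assoc)
      then show "vx x * (Poly_Mapping.single w (Poly_Mapping.lookup p w) * pth u \<beta>) =
          scl (Poly_Mapping.lookup p w) * (vx x * (Poly_Mapping.single w 1 * pth u \<beta>))"
        by (simp only: scalar_left_commute)
    qed
    finally show ?thesis .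
  qed
  also have "\<dots> \<doteq> (\<Sum>w\<in>Poly_Mapping.keys p. scl (Poly_Mapping.lookup p w) * (\<Sum>\<alpha>\<in>paths ?N x. scl (\<kappa> w \<alpha>) * pth x \<alpha>))"
    by (intro cong_sum cong_mult_left k(2)) auto
  also have "\<dots> = (\<Sum>w\<in>Poly_Mapping.keys p. \<Sum>\<alpha>\<in>paths ?N x. scl (Poly_Mapping.lookup p w * \<kappa> w \<alpha>) * pth x \<alpha>)"
    by (simp add: sum_distrib_left mult_single flip: mult.assoc)
  also have "\<dots> = (\<Sum>\<alpha>\<in>paths ?N x. \<Sum>w\<in>Poly_Mapping.keys p. scl (Poly_Mapping.lookup p w * \<kappa> w \<alpha>) * pth x \<alpha>)"
    by (rule sum.swap)
  also have "\<dots> = (\<Sum>\<alpha>\<in>paths ?N x. scl (K \<alpha>) * pth x \<alpha>)"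
  proof -
    have "scl (K \<alpha>) = (\<Sum>w\<in>Poly_Mapping.keys p. scl (Poly_Mapping.lookup p w * \<kappa> w \<alpha>))" for \<alpha>
      unfolding K_def by (rule single_sum[symmetric])
    then show ?thesis by (simp add: sum_distrib_right)
  qed
  finally show ?thesis using K by blast
qed

end

section \<open>Homogeneous generators and splittings\<close>

context leavitt
begin

definition combs :: "((('v, 'e) lgen word \<Rightarrow>\<^sub>0 'k) set, 'm) gmodule \<Rightarrow> 'i set \<Rightarrow> ('i \<Rightarrow> 'm) \<Rightarrow> 'm set" where
  "combs M I s = comb M I s ` (I \<rightarrow> carrier FA)"

context
  fixes M :: "((('v, 'e) lgen word \<Rightarrow>\<^sub>0 'k) set, 'm) gmodule" and I :: "'i set" and s :: "'i \<Rightarrow> 'm"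
  assumes rM: "right_module LA M" and s: "s \<in> I \<rightarrow> carrier M" and I: "finite I"
begin

interpretation M: abelian_group M by (rule module_abelian_group[OF rM])

lemma combs_carrier: "x \<in> combs M I s \<Longrightarrow> x \<in> carrier M"
  unfolding combs_def using comb_closed[OF rM s] by blast

lemma combs_zero: "\<zero>\<^bsub>M\<^esub> \<in> combs M I s"
proof -
  have "comb M I s (\<lambda>_. 0) = \<zero>\<^bsub>M\<^esub>" using s by (intro M.finsum_all_zero act_zero[OF rM]) auto
  then show ?thesis unfolding combs_def by (intro image_eqI[of _ _ "\<lambda>_. 0"]) auto
qed

lemma combs_add: assumes "x \<in> combs M I s" "y \<in> combs M I s" shows "x \<oplus>\<^bsub>M\<^esub> y \<in> combs M I s"
proof -
  obtain p q where "p \<in> I \<rightarrow> carrier FA" "x = comb M I s p" "q \<in> I \<rightarrow> carrier FA" "y = comb M I s q"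
    using assms by (auto simp: combs_def)
  then show ?thesis
    using comb_add[OF rM s, of p q] unfolding combs_def by (intro image_eqI[of _ _ "\<lambda>i. p i + q i"]) (auto simp: Pi_def)
qed

lemma combs_act: assumes "x \<in> combs M I s" "q \<in> carrier FA" shows "act M x q \<in> combs M I s"
proof -
  obtain p where "p \<in> I \<rightarrow> carrier FA" "x = comb M I s p" using assms by (auto simp: combs_def)
  then show ?thesis
    using comb_act[OF rM s, of p q] assms(2) unfolding combs_def by (intro image_eqI[of _ _ "\<lambda>i. p i * q"]) (auto simp: Pi_def)
qed

lemma combs_finsum: "(\<And>j. j \<in> J \<Longrightarrow> f j \<in> combs M I s) \<Longrightarrow> finsum M f J \<in> combs M I s"
proof (induction J rule: infinite_finite_induct)
  case (insert x F)
  have "f \<in> F \<rightarrow> carrier M" "f x \<in> carrier M" using insert combs_carrier by blast+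
  then show ?case using insert by (simp add: combs_add)
qed (simp_all add: combs_zero)

lemma combs_member: assumes "i \<in> I" shows "s i \<in> combs M I s"
proof -
  have "comb M I s (\<lambda>j. if j = i then 1 else 0) = s i"
    using comb_single[OF rM s I assms, of 1] act_one[OF rM] s assms by (auto simp: Pi_def)
  then show ?thesis unfolding combs_def by (intro image_eqI[of _ _ "\<lambda>j. if j = i then 1 else 0"]) auto
qed

end

lemma fin_gen_frame:
  fixes M :: "((('v, 'e) lgen word \<Rightarrow>\<^sub>0 'k) set, 'm) gmodule"
  assumes gM: "graded_module LA M" and fg: "fin_gen LA M"
  shows "\<exists>(I :: ('m \<times> int \<times> 'v) set) s v m. frame M I s v m \<and> spans M I s"
proof -
  note rM = graded_right[OF gM]
  interpret M: abelian_group M by (rule module_abelian_group[OF rM])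
  obtain B where B: "finite B" "B \<subseteq> carrier M"
    "\<And>x. x \<in> carrier M \<Longrightarrow> \<exists>a\<in>B \<rightarrow> carrier LA. x = (\<Oplus>\<^bsub>M\<^esub>b\<in>B. ract M b (a b))"
    using fg unfolding fin_gen_def by blast
  have "\<forall>b\<in>B. \<exists>Dc. finite (fst Dc) \<and> (\<forall>i. snd Dc i \<in> gcomp M i) \<and> b = finsum M (snd Dc) (fst Dc)"
  proof
    fix b assume "b \<in> B"
    then have b: "b \<in> carrier M" using B(2) by auto
    obtain D c where "finite D" "\<And>i. c i \<in> gcomp M i" "b = finsum M c D"
      using gcomp_decomposition[OF gM b] by blast
    then show "\<exists>Dc. finite (fst Dc) \<and> (\<forall>i. snd Dc i \<in> gcomp M i) \<and> b = finsum M (snd Dc) (fst Dc)"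
      by (intro exI[of _ "(D, c)"]) simp
  qed
  from bchoice[OF this] obtain Dc where Dc: "\<And>b. b \<in> B \<Longrightarrow> finite (fst (Dc b))"
    "\<And>b i. b \<in> B \<Longrightarrow> snd (Dc b) i \<in> gcomp M i" "\<And>b. b \<in> B \<Longrightarrow> b = finsum M (snd (Dc b)) (fst (Dc b))" by blast
  \<comment> \<open>One generator for each homogeneous component of each original generator and each
    vertex.\<close>
  define I where "I = (SIGMA b:B. fst (Dc b) \<times> verts G)"
  define s where "s = (\<lambda>(b, d, u). act M (snd (Dc b) d) (vx u))"
  have c: "snd (Dc b) d \<in> carrier M" if "b \<in> B" for b d using gcomp_carrier[OF gM Dc(2)[OF that]] .
  have I: "finite I" unfolding I_def using B(1) Dc(1) by (intro finite_SigmaI finite_cartesian_product) auto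
  have "frame M I s (\<lambda>(b, d, u). u) (\<lambda>(b, d, u). d)"
    unfolding frame_def
  proof (intro conjI ballI I)
    fix i assume "i \<in> I"
    then obtain b d u where i: "i = (b, d, u)" "b \<in> B" "d \<in> fst (Dc b)" "u \<in> verts G" by (auto simp: I_def)
    show "(case i of (b, d, u) \<Rightarrow> u) \<in> verts G" using i by simp
    have "act M (snd (Dc b) d) (vx u) \<in> gcomp M d"
      by (rule gcomp_act[OF gM Dc(2)[OF i(2)], of _ 0]) (use i in \<open>auto intro: homog_gen\<close>)
    then show "s i \<in> gcomp M (case i of (b, d, u) \<Rightarrow> d)" using i(1) by (simp add: s_def)
    show "act M (s i) (vx (case i of (b, d, u) \<Rightarrow> u)) = s i"
      using i act_mult[OF rM c[OF i(2)], of "vx u" "vx u" d] act_cong[OF rM VV'[OF i(4)]] by (simp add: s_def)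
  qed
  moreover have "spans M I s"
    unfolding spans_def
  proof
    fix x assume "x \<in> carrier M"
    then obtain a where a: "a \<in> B \<rightarrow> carrier LA" "x = (\<Oplus>\<^bsub>M\<^esub>b\<in>B. ract M b (a b))" using B(3) by blast
    have sM: "s \<in> I \<rightarrow> carrier M" by (rule frame_closed[OF gM calculation])
    note cs = combs_member[OF rM sM I] combs_act[OF rM sM I] combs_finsum[OF rM sM I]
    have cm: "snd (Dc b) d \<in> combs M I s" if "b \<in> B" "d \<in> fst (Dc b)" for b d
    proof -
      have "act M (snd (Dc b) d) (vx u) \<in> combs M I s" if "u \<in> verts G" for u
        using cs(1)[of "(b, d, u)"] \<open>b \<in> B\<close> \<open>d \<in> fst (Dc b)\<close> that by (simp add: I_def s_def)
      then have "(\<Oplus>\<^bsub>M\<^esub>u\<in>verts G. act M (snd (Dc b) d) (vx u)) \<in> combs M I s" by (rule cs(3))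
      then show ?thesis using vertex_decomposition[OF rM c[OF that(1)], of d] by simp
    qed
    have bm: "b \<in> combs M I s" if "b \<in> B" for b
    proof -
      have "finsum M (snd (Dc b)) (fst (Dc b)) \<in> combs M I s" using cm[OF that] by (rule cs(3))
      then show ?thesis using Dc(3)[OF that] by simp
    qed
    have "ract M b (a b) \<in> combs M I s" if "b \<in> B" for b
    proof -
      obtain p where "p \<in> carrier FA" "a b = proj p" using a(1) \<open>b \<in> B\<close> by (auto simp: carrier_LA Pi_def)
      then show ?thesis using cs(2)[OF bm[OF that]] by simp
    qed
    then have "x \<in> combs M I s" unfolding a(2) by (rule cs(3))
    then show "\<exists>p\<in>I \<rightarrow> carrier FA. x = comb M I s p" by (auto simp: combs_def)
  qed
  ultimately show ?thesis by blast
qed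

text \<open>A module having a basis with the same degrees and vertices maps onto \<open>P\<close>,
  and projectivity splits this map. The matrix \<open>p\<close> describes the splitting in
  coordinates: it reproduces the generators, and it annihilates every relation between them up to
  the vertices.\<close>

lemma projective_coordinates:
  fixes P :: "((('v, 'e) lgen word \<Rightarrow>\<^sub>0 'k) set, 'u) gmodule" and \<iota> :: "'k \<Rightarrow> 'u"
  assumes inf: "infinite (UNIV :: 'u set)" and \<iota>: "inj \<iota>"
    and gP: "graded_module LA P" and proj: "gr_projective LA P" and F: "frame P I s v m" and S: "spans P I s"
  shows "\<exists>p. (\<forall>j\<in>I. \<forall>i\<in>I. p j i \<in> carrier FA \<and> homog (m i - m j) (p j i)) \<and>
    (\<forall>i\<in>I. s i = comb P I s (\<lambda>j. p j i)) \<and>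
    (\<forall>q\<in>I \<rightarrow> carrier FA. comb P I s q = \<zero>\<^bsub>P\<^esub> \<longrightarrow> (\<forall>j\<in>I. vx (v j) * (\<Sum>i\<in>I. p j i * q i) \<in> LI))"
proof -
  note rP = graded_right[OF gP]
  have I: "finite I" by (rule frameD(1)[OF F])
  let ?\<mu> = "image_mset (\<lambda>i. (v i, m i)) (mset_set I)"
  have "valid ?\<mu>" using I frameD(2)[OF F] by auto
  then obtain N :: "((('v, 'e) lgen word \<Rightarrow>\<^sub>0 'k) set, 'u) gmodule" where gN: "graded_module LA N" and "has_type N ?\<mu>"
    using has_type_exists[OF inf \<iota>] by blast
  then obtain J :: "nat set" and c w n where C: "basis N J c w n" "?\<mu> = image_mset (\<lambda>i. (w i, n i)) (mset_set J)"
    by (auto simp: has_type_def)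
  have J: "finite J" by (rule frameD(1)[OF basisD(1)[OF C(1)]])
  obtain h where h: "bij_betw h I J" "\<forall>i\<in>I. (v i, m i) = (w (h i), n (h i))"
    using image_mset_eq_bij[OF I J C(2)] by blast
  define e where "e i = c (h i)" for i
  have B: "basis N I e v m"
    unfolding e_def by (rule basis_vm_cong[OF basis_reindex[OF gN C(1) h(1)]]) (use h(2) in auto)
  note rN = graded_right[OF gN] and FN = basisD(1)[OF B]
  note eN = frame_closed[OF gN FN] and sP = frame_closed[OF gP F]
  have sc: "s i \<in> carrier P" if "i \<in> I" for i using sP that by auto
  obtain g where g: "g \<in> gr_hom LA N P" "\<And>p. p \<in> I \<rightarrow> carrier FA \<Longrightarrow> g (comb N I e p) = comb P I s p"
    using basis_hom[OF gN B gP F] by blast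
  note gh = gr_homD(1)[OF g(1)]
  have "g ` carrier N = carrier P"
  proof
    show "g ` carrier N \<subseteq> carrier P" using hom_closed[OF gh] by auto
    show "carrier P \<subseteq> g ` carrier N"
    proof
      fix x assume "x \<in> carrier P"
      then obtain p where p: "p \<in> I \<rightarrow> carrier FA" "x = comb P I s p" using spansD[OF S] by blast
      show "x \<in> g ` carrier N"
        by (rule image_eqI[of _ _ "comb N I e p"]) (use g(2)[OF p(1)] p comb_closed[OF rN eN p(1)] in auto)
    qed
  qed
  moreover have "(\<lambda>x\<in>carrier P. x) \<in> gr_hom LA P P"
  proof (rule gr_homI)
    interpret P: abelian_group P by (rule module_abelian_group[OF rP])
    show "(\<lambda>x\<in>carrier P. x) \<in> rmod_hom LA P P"
      by (rule rmod_homI) (auto simp: act_closed[OF rP])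
  qed (use gcomp_carrier[OF gP] in auto)
  \<comment> \<open>Lifting the identity of \<open>P\<close> gives the splitting.\<close>
  ultimately have "\<exists>h\<in>gr_hom LA P N. \<forall>x\<in>carrier P. g (h x) = (\<lambda>x\<in>carrier P. x) x"
    using proj[unfolded gr_projective_def] gN gP g(1) by blast
  then obtain k where k: "k \<in> gr_hom LA P N" "\<And>x. x \<in> carrier P \<Longrightarrow> g (k x) = x" by auto
  note kh = gr_homD(1)[OF k(1)]
  have "\<forall>i\<in>I. \<exists>p. p \<in> I \<rightarrow> carrier FA \<and> (\<forall>j\<in>I. homog (m i - m j) (p j)) \<and> k (s i) = comb N I e p"
  proof
    fix i assume i: "i \<in> I"
    obtain p where p: "p \<in> I \<rightarrow> carrier FA" "k (s i) = comb N I e p"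
      using spansD[OF basisD(2)[OF B] hom_closed[OF kh sc[OF i]]] by blast
    have "comb N I e p \<in> gcomp N (m i)" using gr_homD(2)[OF k(1) frameD(3)[OF F i]] p(2) by simp
    from homogeneous_coefficients[OF gN I frameD(3)[OF FN] p(1) this]
    show "\<exists>p. p \<in> I \<rightarrow> carrier FA \<and> (\<forall>j\<in>I. homog (m i - m j) (p j)) \<and> k (s i) = comb N I e p"
      using p by (intro exI[of _ "\<lambda>j. hpart (m i - m j) (p j)"]) (auto simp: Pi_def)
  qed
  from bchoice[OF this] obtain p where p: "\<And>i. i \<in> I \<Longrightarrow> p i \<in> I \<rightarrow> carrier FA"
    "\<And>i j. i \<in> I \<Longrightarrow> j \<in> I \<Longrightarrow> homog (m i - m j) (p i j)" "\<And>i. i \<in> I \<Longrightarrow> k (s i) = comb N I e (p i)" by blast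
  have pFA: "p i j \<in> carrier FA" if "i \<in> I" "j \<in> I" for i j using p(1) that by (auto simp: Pi_def)
  show ?thesis
  proof (intro exI[of _ "\<lambda>j i. p i j"] conjI ballI impI)
    fix i assume i: "i \<in> I"
    show "s i = comb P I s (\<lambda>j. p i j)" using k(2)[OF sc[OF i]] g(2)[OF p(1)[OF i]] p(3)[OF i] by simp
  next
    fix q j assume q: "q \<in> I \<rightarrow> carrier FA" "comb P I s q = \<zero>\<^bsub>P\<^esub>" and j: "j \<in> I"
    have qFA: "q i \<in> carrier FA" if "i \<in> I" for i using q(1) that by auto
    have "k (comb P I s q) = comb N I (\<lambda>i. k (s i)) q" by (rule hom_comb[OF rP rN kh sP q(1)])
    also have "\<dots> = comb N I e (\<lambda>j. \<Sum>i\<in>I. p i j * q i)"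
      by (rule comb_comb[OF rN eN I I p(3)]) (use pFA qFA in auto)
    finally have "comb N I e (\<lambda>j. \<Sum>i\<in>I. p i j * q i) = \<zero>\<^bsub>N\<^esub>" using hom_zero[OF rP rN kh] q(2) by simp
    then show "vx (v j) * (\<Sum>i\<in>I. p i j * q i) \<in> LI"
      using basisD(3)[OF B _ _ j, of "\<lambda>j. \<Sum>i\<in>I. p i j * q i"] pFA qFA by (auto simp: Pi_def intro!: fa_sum)
  qed (use p pFA in auto)
qed

text \<open>The matrix of \<open>projective_coordinates\<close> has entries in the algebra.
  Replacing \<open>s i\<close> by its products with all paths of length \<open>N - m i\<close> puts
  every generator in degree \<open>N\<close>, and for large \<open>N\<close> the paths absorb the
  entries by \<open>element_times_path\<close>. The matrix becomes scalar, so
  \<open>scalar_coordinates_basis\<close> applies.\<close>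

theorem fg_gr_proj_has_type:
  fixes P :: "((('v, 'e) lgen word \<Rightarrow>\<^sub>0 'k) set, 'u) gmodule" and \<iota> :: "'k \<Rightarrow> 'u"
  assumes inf: "infinite (UNIV :: 'u set)" and \<iota>: "inj \<iota>" and P: "P \<in> fg_gr_proj TYPE('u) LA"
  shows "\<exists>\<mu>. has_type P \<mu>"
proof -
  have gP: "graded_module LA P" and fg: "fin_gen LA P" and prj: "gr_projective LA P"
    using P by (auto simp: fg_gr_proj_def)
  note rP = graded_right[OF gP]
  interpret P: abelian_group P by (rule module_abelian_group[OF rP])
  obtain I :: "('u \<times> int \<times> 'v) set" and s v m where F: "frame P I s v m" and S: "spans P I s"
    using fin_gen_frame[OF gP fg] by blast
  have I: "finite I" by (rule frameD(1)[OF F])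
  note sP = frame_closed[OF gP F]
  have sc: "s i \<in> carrier P" if "i \<in> I" for i using sP that by auto
  have vG: "v i \<in> verts G" if "i \<in> I" for i by (rule frameD(2)[OF F that])
  obtain p where p0: "(\<forall>j\<in>I. \<forall>i\<in>I. p j i \<in> carrier FA \<and> homog (m i - m j) (p j i)) \<and>
    (\<forall>i\<in>I. s i = comb P I s (\<lambda>j. p j i)) \<and>
    (\<forall>q\<in>I \<rightarrow> carrier FA. comb P I s q = \<zero>\<^bsub>P\<^esub> \<longrightarrow> (\<forall>j\<in>I. vx (v j) * (\<Sum>i\<in>I. p j i * q i) \<in> LI))"
    using projective_coordinates[OF inf \<iota> gP prj F S] by (rule exE)
  have p: "p j i \<in> carrier FA \<and> homog (m i - m j) (p j i)" if "j \<in> I" "i \<in> I" for j i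
    using p0 that by simp
  have sp: "s i = comb P I s (\<lambda>j. p j i)" if "i \<in> I" for i
    using p0[THEN conjunct2, THEN conjunct1, rule_format, OF that] .
  have ker: "vx (v j) * (\<Sum>i\<in>I. p j i * q i) \<in> LI"
    if "q \<in> I \<rightarrow> carrier FA" "comb P I s q = \<zero>\<^bsub>P\<^esub>" "j \<in> I" for q j
    using p0[THEN conjunct2, THEN conjunct2, rule_format, OF that] .
  have pFA: "p j i \<in> carrier FA" if "j \<in> I" "i \<in> I" for j i using p[OF that] by simp
  define W where "W = (\<Union>j\<in>I. \<Union>i\<in>I. Poly_Mapping.keys (p j i))"
  have fW: "finite W" using I by (auto simp: W_def)
  define L where "L = (\<Sum>w\<in>W. length (letters w))"
  \<comment> \<open>Chosen so that \<open>N - m i\<close> is at least \<open>L\<close> for every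
    \<open>i\<close>; and \<open>L\<close> bounds the length of every word that occurs in the
    matrix.\<close>
  define N where "N = int L + (\<Sum>i\<in>I. \<bar>m i\<bar>)"
  have NL: "int L \<le> N - m i" if "i \<in> I" for i
  proof -
    have "\<bar>m i\<bar> \<le> (\<Sum>i\<in>I. \<bar>m i\<bar>)" using I that by (intro member_le_sum) auto
    then show ?thesis by (simp add: N_def)
  qed
  define r where "r i = nat (N - m i)" for i
  have r: "int (r i) = N - m i" if "i \<in> I" for i using NL[OF that] by (simp add: r_def)
  have len: "length (letters w) \<le> r i" if "i \<in> I" "j \<in> I" "w \<in> Poly_Mapping.keys (p j i)" for w i j
  proof -
    have "length (letters w) \<le> L" unfolding L_def using fW that by (intro member_le_sum) (auto simp: W_def)
    then show ?thesis using NL[OF that(1)] r[OF that(1)] by linarith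
  qed
  define I' where "I' = (SIGMA i:I. paths (r i) (v i))"
  define s' where "s' = (\<lambda>(i, \<beta>). act P (s i) (pth (v i) \<beta>))"
  define v' where "v' = (\<lambda>(i, \<beta>). endpt (v i) \<beta>)"
  have I': "finite I'" unfolding I'_def using I by (intro finite_SigmaI) auto
  have pth: "pth (v i) \<beta> \<in> carrier FA" "gst (v i) \<beta> \<in> carrier FA" if "i \<in> I" "\<beta> \<in> paths (r i) (v i)" for i \<beta>
    using pth_carrier[OF vG[OF that(1)] that(2)] gst_carrier[OF vG[OF that(1)] that(2)] .
  have F': "frame P I' s' v' (\<lambda>_. N)"
    unfolding frame_def
  proof (intro conjI ballI I')
    fix x assume "x \<in> I'"
    then obtain i \<beta> where x: "x = (i, \<beta>)" "i \<in> I" "\<beta> \<in> paths (r i) (v i)" by (auto simp: I'_def)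
    show "v' x \<in> verts G" using x endpt_in_verts[OF vG[OF x(2)] x(3)] by (simp add: v'_def)
    show "s' x \<in> gcomp P N"
      using x r[OF x(2)] length_paths[OF x(3)] pth[OF x(2,3)] homog_pth[of \<beta> "v i"]
      by (auto simp: s'_def intro!: gcomp_act[OF gP frameD(3)[OF F x(2)], of _ "int (length \<beta>)"])
    have "act P (s i) (pth (v i) \<beta> * vx (endpt (v i) \<beta>)) = act P (s i) (pth (v i) \<beta>)"
      by (rule act_cong[OF rP pth_vx[OF vG[OF x(2)] x(3)]])
    then show "act P (s' x) (vx (v' x)) = s' x"
      using act_mult[OF rP sc[OF x(2)] pth(1)[OF x(2,3)], of "vx (endpt (v i) \<beta>)"]
        endpt_in_verts[OF vG[OF x(2)] x(3)] x by (simp add: s'_def v'_def)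
  qed
  have s'P: "s' \<in> I' \<rightarrow> carrier P" by (rule frame_closed[OF gP F'])
  have expand: "comb P I' s' q = comb P I s (\<lambda>i. \<Sum>\<beta>\<in>paths (r i) (v i). pth (v i) \<beta> * q (i, \<beta>))"
    if q: "q \<in> I' \<rightarrow> carrier FA" for q
  proof -
    let ?c = "\<lambda>j x. if j = fst x then pth (v (fst x)) (snd x) else 0"
    have sx: "s' x = comb P I s (\<lambda>j. ?c j x)" if "x \<in> I'" for x
      using comb_single[OF rP sP I, of "fst x" "pth (v (fst x)) (snd x)"] pth(1)[of "fst x" "snd x"] that
      by (auto simp: s'_def I'_def)
    have "comb P I' s' q = comb P I s (\<lambda>j. \<Sum>x\<in>I'. ?c j x * q x)"
      by (rule comb_comb[OF rP sP I I' sx]) (use q pth in \<open>auto simp: I'_def\<close>)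
    also have "\<dots> = comb P I s (\<lambda>i. \<Sum>\<beta>\<in>paths (r i) (v i). pth (v i) \<beta> * q (i, \<beta>))"
    proof (rule comb_cong[OF rP sP])
      fix i assume i: "i \<in> I"
      have "(\<Sum>x\<in>I'. ?c i x * q x) = (\<Sum>j\<in>I. \<Sum>\<beta>\<in>paths (r j) (v j). ?c i (j, \<beta>) * q (j, \<beta>))"
        unfolding I'_def using I by (subst sum.Sigma) (auto intro!: sum.cong)
      also have "\<dots> = (\<Sum>j\<in>I. if j = i then (\<Sum>\<beta>\<in>paths (r i) (v i). pth (v i) \<beta> * q (i, \<beta>)) else 0)"
        by (intro sum.cong) auto
      also have "\<dots> = (\<Sum>\<beta>\<in>paths (r i) (v i). pth (v i) \<beta> * q (i, \<beta>))" using I i by (simp add: sum.delta)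
      finally have eq: "(\<Sum>x\<in>I'. ?c i x * q x) = (\<Sum>\<beta>\<in>paths (r i) (v i). pth (v i) \<beta> * q (i, \<beta>))" .
      have "(\<Sum>\<beta>\<in>paths (r i) (v i). pth (v i) \<beta> * q (i, \<beta>)) \<in> carrier FA"
      proof (intro fa_sum fa_mult)
        fix \<beta> assume b: "\<beta> \<in> paths (r i) (v i)"
        then have "(i, \<beta>) \<in> I'" using i by (simp add: I'_def)
        then show "q (i, \<beta>) \<in> carrier FA" by (rule funcset_mem[OF q])
        show "pth (v i) \<beta> \<in> carrier FA" by (rule pth(1)[OF i b])
      qed
      then show "(\<Sum>x\<in>I'. ?c i x * q x) \<doteq> (\<Sum>\<beta>\<in>paths (r i) (v i). pth (v i) \<beta> * q (i, \<beta>))" using eq by simp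
    qed
    finally show ?thesis .
  qed
  have S': "spans P I' s'"
    unfolding spans_def
  proof
    fix x assume "x \<in> carrier P"
    then obtain q where q: "q \<in> I \<rightarrow> carrier FA" "x = comb P I s q" using spansD[OF S] by blast
    define q' where "q' = (\<lambda>(i, \<beta>). gst (v i) \<beta> * q i)"
    have q': "q' \<in> I' \<rightarrow> carrier FA" using q pth by (auto simp: q'_def I'_def Pi_def)
    have "x = comb P I s (\<lambda>i. vx (v i) * q i)" using comb_vx[OF gP F q(1)] q(2) by simp
    also have "\<dots> = comb P I s (\<lambda>i. \<Sum>\<beta>\<in>paths (r i) (v i). pth (v i) \<beta> * q' (i, \<beta>))"
    proof (rule comb_cong[OF rP sP])
      fix i assume i: "i \<in> I"
      have "vx (v i) * q i \<doteq> (\<Sum>\<beta>\<in>paths (r i) (v i). pth (v i) \<beta> * gst (v i) \<beta>) * q i"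
        using q(1) i by (intro cong_mult_right cong_sym[OF sum_pth_gst[OF vG[OF i]]]) auto
      then show "vx (v i) * q i \<doteq> (\<Sum>\<beta>\<in>paths (r i) (v i). pth (v i) \<beta> * q' (i, \<beta>))"
        by (simp add: q'_def sum_distrib_right mult.assoc)
    qed
    also have "\<dots> = comb P I' s' q'" by (rule expand[OF q', symmetric])
    finally show "\<exists>p\<in>I' \<rightarrow> carrier FA. x = comb P I' s' p" using q' by (rule bexI)
  qed
  have "\<forall>jx\<in>I \<times> I'. \<exists>\<kappa>. (\<forall>\<alpha>. \<kappa> \<alpha> \<noteq> 0 \<longrightarrow> endpt (v (fst jx)) \<alpha> = v' (snd jx)) \<and>
      vx (v (fst jx)) * (p (fst jx) (fst (snd jx)) * pth (v (fst (snd jx))) (snd (snd jx))) \<doteq>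
        (\<Sum>\<alpha>\<in>paths (r (fst jx)) (v (fst jx)). scl (\<kappa> \<alpha>) * pth (v (fst jx)) \<alpha>)"
  proof
    fix jx assume "jx \<in> I \<times> I'"
    then obtain j i \<beta> where x: "jx = (j, i, \<beta>)" "j \<in> I" "i \<in> I" "\<beta> \<in> paths (r i) (v i)" by (auto simp: I'_def)
    have n: "nat (int (r i) + (m i - m j)) = r j" using r[OF x(2)] r[OF x(3)] by simp
    show "\<exists>\<kappa>. (\<forall>\<alpha>. \<kappa> \<alpha> \<noteq> 0 \<longrightarrow> endpt (v (fst jx)) \<alpha> = v' (snd jx)) \<and>
      vx (v (fst jx)) * (p (fst jx) (fst (snd jx)) * pth (v (fst (snd jx))) (snd (snd jx))) \<doteq>
        (\<Sum>\<alpha>\<in>paths (r (fst jx)) (v (fst jx)). scl (\<kappa> \<alpha>) * pth (v (fst jx)) \<alpha>)"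
      using element_times_path[of "p j i" "m i - m j" "r i" "v i" \<beta> "v j"] p[OF x(2,3)] len[OF x(3,2)]
        vG[OF x(2)] vG[OF x(3)] x(4) unfolding n by (simp add: x(1) v'_def)
  qed
  from bchoice[OF this] obtain K where K0: "\<forall>jx\<in>I \<times> I'. (\<forall>\<alpha>. K jx \<alpha> \<noteq> 0 \<longrightarrow> endpt (v (fst jx)) \<alpha> = v' (snd jx)) \<and>
      vx (v (fst jx)) * (p (fst jx) (fst (snd jx)) * pth (v (fst (snd jx))) (snd (snd jx))) \<doteq>
        (\<Sum>\<alpha>\<in>paths (r (fst jx)) (v (fst jx)). scl (K jx \<alpha>) * pth (v (fst jx)) \<alpha>)" by blast
  have K: "K (j, i, \<beta>) \<alpha> \<noteq> 0 \<Longrightarrow> endpt (v j) \<alpha> = v' (i, \<beta>)"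
    "vx (v j) * (p j i * pth (v i) \<beta>) \<doteq> (\<Sum>\<alpha>\<in>paths (r j) (v j). scl (K (j, i, \<beta>) \<alpha>) * pth (v j) \<alpha>)"
    if "j \<in> I" "(i, \<beta>) \<in> I'" for j i \<beta> \<alpha>
    using K0[rule_format, of "(j, i, \<beta>)"] that by auto
  \<comment> \<open>The scalar matrix: the entry in row \<open>(j, \<alpha>)\<close> and column
    \<open>(i, \<beta>)\<close> is the coefficient of the path \<alpha> in \<open>p j i\<close>
    times the path \<beta>.\<close>
  define \<kappa> where "\<kappa> y x = K (fst y, x) (snd y)" for y x
  have "\<exists>J. basis P J s' v' (\<lambda>_. N)"
  proof (rule scalar_coordinates_basis[OF gP F' S', of \<kappa>])
    fix x assume "x \<in> I'"
    then obtain i \<beta> where x: "x = (i, \<beta>)" "(i, \<beta>) \<in> I'" "i \<in> I" "\<beta> \<in> paths (r i) (v i)" by (auto simp: I'_def)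
    have c1: "(\<lambda>j. p j i) \<in> I \<rightarrow> carrier FA" using pFA x(3) by auto
    have c2: "(\<lambda>j. p j i * pth (v i) \<beta>) \<in> I \<rightarrow> carrier FA" using pFA x(3) pth(1)[OF x(3,4)] by auto
    have "s' x = act P (comb P I s (\<lambda>j. p j i)) (pth (v i) \<beta>)" using sp[OF x(3)] x(1) by (simp add: s'_def)
    also have "\<dots> = comb P I s (\<lambda>j. p j i * pth (v i) \<beta>)" by (rule comb_act[OF rP sP c1 pth(1)[OF x(3,4)]])
    also have "\<dots> = comb P I s (\<lambda>j. vx (v j) * (p j i * pth (v i) \<beta>))" by (rule comb_vx[OF gP F c2, symmetric])
    also have "\<dots> = comb P I s (\<lambda>j. \<Sum>\<alpha>\<in>paths (r j) (v j). pth (v j) \<alpha> * scl (\<kappa> (j, \<alpha>) x))"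
    proof (rule comb_cong[OF rP sP])
      fix j assume "j \<in> I"
      from K(2)[OF this x(2)] show "vx (v j) * (p j i * pth (v i) \<beta>) \<doteq> (\<Sum>\<alpha>\<in>paths (r j) (v j). pth (v j) \<alpha> * scl (\<kappa> (j, \<alpha>) x))"
        by (simp add: \<kappa>_def x(1) scalar_commute)
    qed
    also have "\<dots> = comb P I' s' (\<lambda>y. scl (\<kappa> y x))" by (rule expand[symmetric]) auto
    finally show "s' x = comb P I' s' (\<lambda>y. scl (\<kappa> y x))" .
  next
    fix q y assume q: "q \<in> I' \<rightarrow> carrier FA" "comb P I' s' q = \<zero>\<^bsub>P\<^esub>" and y: "y \<in> I'"
    obtain j \<alpha> where yj: "y = (j, \<alpha>)" "j \<in> I" "\<alpha> \<in> paths (r j) (v j)" using y by (auto simp: I'_def)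
    \<comment> \<open>The vertex factor does not change the combination, and the conclusion is about
      these products.\<close>
    define a where "a x = vx (v' x) * q x" for x
    have aFA: "a x \<in> carrier FA" if "x \<in> I'" for x
      using funcset_mem[OF q(1) that] frameD(2)[OF F' that] by (simp add: a_def)
    have aI: "a \<in> I' \<rightarrow> carrier FA" using aFA by auto
    have "comb P I' s' a = \<zero>\<^bsub>P\<^esub>" using comb_vx[OF gP F' q(1)] q(2) by (simp add: a_def)
    then have z: "comb P I s (\<lambda>i. \<Sum>\<beta>\<in>paths (r i) (v i). pth (v i) \<beta> * a (i, \<beta>)) = \<zero>\<^bsub>P\<^esub>"
      using expand[OF aI] by simp
    have qI: "(\<lambda>i. \<Sum>\<beta>\<in>paths (r i) (v i). pth (v i) \<beta> * a (i, \<beta>)) \<in> I \<rightarrow> carrier FA"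
      using pth(1) aFA by (auto simp: I'_def intro!: fa_sum fa_mult)
    define T where "T \<gamma> = (\<Sum>x\<in>I'. scl (\<kappa> (j, \<gamma>) x) * a x)" for \<gamma>
    have TFA: "T \<gamma> \<in> carrier FA" for \<gamma> unfolding T_def using aFA by (intro fa_sum fa_mult) auto
    have "0 \<doteq> vx (v j) * (\<Sum>i\<in>I. p j i * (\<Sum>\<beta>\<in>paths (r i) (v i). pth (v i) \<beta> * a (i, \<beta>)))"
      using ker[OF qI z yj(2)] cong_0_iff cong_sym by blast
    also have "\<dots> = (\<Sum>i\<in>I. \<Sum>\<beta>\<in>paths (r i) (v i). vx (v j) * (p j i * pth (v i) \<beta>) * a (i, \<beta>))"
      by (simp add: sum_distrib_left mult.assoc)
    also have "\<dots> = (\<Sum>(i, \<beta>)\<in>I'. vx (v j) * (p j i * pth (v i) \<beta>) * a (i, \<beta>))"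
      unfolding I'_def using I by (intro sum.Sigma) auto
    also have "\<dots> \<doteq> (\<Sum>(i, \<beta>)\<in>I'. (\<Sum>\<gamma>\<in>paths (r j) (v j). scl (K (j, i, \<beta>) \<gamma>) * pth (v j) \<gamma>) * a (i, \<beta>))"
    proof (rule cong_sum)
      fix x assume x: "x \<in> I'"
      obtain i \<beta> where "x = (i, \<beta>)" by (cases x)
      then show "(case x of (i, \<beta>) \<Rightarrow> vx (v j) * (p j i * pth (v i) \<beta>) * a (i, \<beta>)) \<doteq>
          (case x of (i, \<beta>) \<Rightarrow> (\<Sum>\<gamma>\<in>paths (r j) (v j). scl (K (j, i, \<beta>) \<gamma>) * pth (v j) \<gamma>) * a (i, \<beta>))"
        using cong_mult_right[OF K(2)[OF yj(2)] aFA] x by simp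
    qed
    also have "\<dots> = (\<Sum>x\<in>I'. \<Sum>\<gamma>\<in>paths (r j) (v j). pth (v j) \<gamma> * (scl (\<kappa> (j, \<gamma>) x) * a x))"
      by (intro sum.cong refl) (auto simp: sum_distrib_right \<kappa>_def scalar_left_commute mult.assoc)
    also have "\<dots> = (\<Sum>\<gamma>\<in>paths (r j) (v j). \<Sum>x\<in>I'. pth (v j) \<gamma> * (scl (\<kappa> (j, \<gamma>) x) * a x))"
      by (rule sum.swap)
    also have "\<dots> = (\<Sum>\<gamma>\<in>paths (r j) (v j). pth (v j) \<gamma> * T \<gamma>)"
      unfolding T_def by (simp only: sum_distrib_left)
    \<comment> \<open>The ghost of \<alpha> singles out the row of \<open>y\<close>.\<close>
    finally have "gst (v j) \<alpha> * 0 \<doteq> gst (v j) \<alpha> * (\<Sum>\<gamma>\<in>paths (r j) (v j). pth (v j) \<gamma> * T \<gamma>)"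
      by (rule cong_mult_left) (rule pth(2)[OF yj(2,3)])
    then have "0 \<doteq> gst (v j) \<alpha> * (\<Sum>\<gamma>\<in>paths (r j) (v j). pth (v j) \<gamma> * T \<gamma>)" by simp
    also have "\<dots> = (\<Sum>\<gamma>\<in>paths (r j) (v j). gst (v j) \<alpha> * pth (v j) \<gamma> * T \<gamma>)"
      by (simp add: sum_distrib_left mult.assoc)
    also have "\<dots> \<doteq> (\<Sum>\<gamma>\<in>paths (r j) (v j). (if v j = v j \<and> \<alpha> = \<gamma> then vx (endpt (v j) \<alpha>) else 0) * T \<gamma>)"
      by (intro cong_sum cong_mult_right gst_pth[OF vG[OF yj(2)] vG[OF yj(2)] yj(3)] TFA)
    also have "\<dots> = (\<Sum>\<gamma>\<in>paths (r j) (v j). if \<gamma> = \<alpha> then vx (endpt (v j) \<alpha>) * T \<alpha> else 0)"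
      by (intro sum.cong) auto
    also have "\<dots> = vx (endpt (v j) \<alpha>) * T \<alpha>" using yj(3) by (simp add: sum.delta)
    also have "\<dots> = (\<Sum>x\<in>I'. scl (\<kappa> y x) * (vx (endpt (v j) \<alpha>) * a x))"
      unfolding T_def yj(1) by (simp only: sum_distrib_left scalar_left_commute)
    also have "\<dots> \<doteq> (\<Sum>x\<in>I'. scl (\<kappa> y x) * a x)"
    proof (rule cong_sum)
      fix x assume x: "x \<in> I'"
      show "scl (\<kappa> y x) * (vx (endpt (v j) \<alpha>) * a x) \<doteq> scl (\<kappa> y x) * a x"
      \<comment> \<open>A nonzero entry links only paths with the same end point, so the vertex left
        over from \<alpha> is absorbed by \<open>a x\<close>.\<close>
      proof (cases "\<kappa> y x = 0")
        case False
        then have e: "endpt (v j) \<alpha> = v' x" using K(1)[OF yj(2), of "fst x" "snd x" \<alpha>] x by (simp add: \<kappa>_def yj(1))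
        have "vx (v' x) * vx (v' x) * q x \<doteq> vx (v' x) * q x"
          by (intro cong_mult_right VV' frameD(2)[OF F' x] funcset_mem[OF q(1) x])
        then have "vx (endpt (v j) \<alpha>) * a x \<doteq> a x" by (simp add: e a_def mult.assoc)
        then show ?thesis by (rule cong_mult_left) simp
      qed simp
    qed
    finally show "(\<Sum>x\<in>I'. scl (\<kappa> y x) * (vx (v' x) * q x)) \<in> LI"
      using cong_0_iff cong_sym by (simp add: a_def) blast
  qed
  then obtain J where "basis P J s' v' (\<lambda>_. N)" by blast
  from has_typeI[OF gP this] show ?thesis by blast
qed

end

section \<open>Group completions\<close>

context comm_monoid
begin

lemma gc_rel_iff:
  "((a, b), (c, d)) \<in> gc_rel G \<longleftrightarrow> a \<in> carrier G \<and> b \<in> carrier G \<and> c \<in> carrier G \<and> d \<in> carrier G \<and>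
    (\<exists>t\<in>carrier G. (a \<otimes> d) \<otimes> t = (c \<otimes> b) \<otimes> t)"
  by (simp add: gc_rel_def)

lemma gc_rel_trans:
  assumes "((a, b), (c, d)) \<in> gc_rel G" "((c, d), (e, f)) \<in> gc_rel G" shows "((a, b), (e, f)) \<in> gc_rel G"
proof -
  obtain t u where tu: "t \<in> carrier G" "u \<in> carrier G" "(a \<otimes> d) \<otimes> t = (c \<otimes> b) \<otimes> t" "(c \<otimes> f) \<otimes> u = (e \<otimes> d) \<otimes> u"
    and cl: "a \<in> carrier G" "b \<in> carrier G" "c \<in> carrier G" "d \<in> carrier G" "e \<in> carrier G" "f \<in> carrier G"
    using assms by (auto simp: gc_rel_iff)
  have "(a \<otimes> f) \<otimes> (d \<otimes> t \<otimes> u) = ((a \<otimes> d) \<otimes> t) \<otimes> (f \<otimes> u)" using tu(1,2) cl by (simp add: m_ac)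
  also have "\<dots> = ((c \<otimes> f) \<otimes> u) \<otimes> (b \<otimes> t)" unfolding tu(3) using tu(1,2) cl by (simp add: m_ac)
  also have "\<dots> = (e \<otimes> b) \<otimes> (d \<otimes> t \<otimes> u)" unfolding tu(4) using tu(1,2) cl by (simp add: m_ac)
  finally show ?thesis using tu cl by (auto simp: gc_rel_iff intro!: bexI[of _ "d \<otimes> t \<otimes> u"])
qed

lemma equiv_gc_rel: "equiv (carrier G \<times> carrier G) (gc_rel G)"
proof (rule equivI)
  show "gc_rel G \<subseteq> (carrier G \<times> carrier G) \<times> (carrier G \<times> carrier G)" by (auto simp: gc_rel_def)
  show "refl_on (carrier G \<times> carrier G) (gc_rel G)"
    by (rule refl_onI) (auto simp: gc_rel_iff)
  show "sym (gc_rel G)" by (rule symI) (auto simp: gc_rel_def intro: sym)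
  show "trans (gc_rel G)" by (rule transI) (auto intro: gc_rel_trans)
qed

lemma gc_diff_eq_iff:
  assumes "a \<in> carrier G" "b \<in> carrier G" "c \<in> carrier G" "d \<in> carrier G"
  shows "gc_diff G a b = gc_diff G c d \<longleftrightarrow> (\<exists>t\<in>carrier G. (a \<otimes> d) \<otimes> t = (c \<otimes> b) \<otimes> t)"
  unfolding gc_diff_def using eq_equiv_class_iff[OF equiv_gc_rel, of "(a, b)" "(c, d)"] assms by (simp add: gc_rel_iff)

lemma gc_diff_self: "a \<in> carrier G \<Longrightarrow> b \<in> carrier G \<Longrightarrow> (a, b) \<in> gc_diff G a b"
  by (auto simp: gc_diff_def gc_rel_iff)

lemma gc_diff_memD:
  assumes "(c, d) \<in> gc_diff G a b"
  shows "c \<in> carrier G" "d \<in> carrier G" "\<exists>t\<in>carrier G. (a \<otimes> d) \<otimes> t = (c \<otimes> b) \<otimes> t"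
  using assms by (auto simp: gc_diff_def gc_rel_iff)

lemma group_completion_sel [simp]:
  "carrier (group_completion G) = (carrier G \<times> carrier G) // gc_rel G"
  "\<zero>\<^bsub>group_completion G\<^esub> = gc_diff G \<one> \<one>"
  by (simp_all add: group_completion_def)

lemma gc_diff_closed: "a \<in> carrier G \<Longrightarrow> b \<in> carrier G \<Longrightarrow> gc_diff G a b \<in> carrier (group_completion G)"
  by (auto simp: gc_diff_def intro!: quotientI)

lemma group_completionE:
  assumes "x \<in> carrier (group_completion G)"
  obtains a b where "a \<in> carrier G" "b \<in> carrier G" "x = gc_diff G a b"
  using assms by (auto simp: gc_diff_def elim!: quotientE)

text \<open>The union that defines addition runs over all representatives, and they all give the
  same class.\<close>

lemma gc_diff_add:
  assumes cl: "a \<in> carrier G" "b \<in> carrier G" "c \<in> carrier G" "d \<in> carrier G"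
  shows "gc_diff G a b \<oplus>\<^bsub>group_completion G\<^esub> gc_diff G c d = gc_diff G (a \<otimes> c) (b \<otimes> d)"
proof -
  have "gc_diff G (a' \<otimes> c') (b' \<otimes> d') = gc_diff G (a \<otimes> c) (b \<otimes> d)"
    if m: "(a', b') \<in> gc_diff G a b" "(c', d') \<in> gc_diff G c d" for a' b' c' d'
  proof -
    note cl' = gc_diff_memD(1,2)[OF m(1)] gc_diff_memD(1,2)[OF m(2)]
    obtain t where t: "t \<in> carrier G" "(a \<otimes> b') \<otimes> t = (a' \<otimes> b) \<otimes> t" using gc_diff_memD(3)[OF m(1)] by blast
    obtain u where u: "u \<in> carrier G" "(c \<otimes> d') \<otimes> u = (c' \<otimes> d) \<otimes> u" using gc_diff_memD(3)[OF m(2)] by blast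
    have "((a' \<otimes> c') \<otimes> (b \<otimes> d)) \<otimes> (t \<otimes> u) = ((a' \<otimes> b) \<otimes> t) \<otimes> ((c' \<otimes> d) \<otimes> u)"
      using cl cl' t(1) u(1) by (simp add: m_ac)
    also have "\<dots> = ((a \<otimes> c) \<otimes> (b' \<otimes> d')) \<otimes> (t \<otimes> u)"
      unfolding t(2)[symmetric] u(2)[symmetric] using cl cl' t(1) u(1) by (simp add: m_ac)
    finally show ?thesis
      using cl cl' t(1) u(1) by (subst gc_diff_eq_iff) (auto intro!: bexI[of _ "t \<otimes> u"])
  qed
  then have "(\<Union>(a', b')\<in>gc_diff G a b. \<Union>(c', d')\<in>gc_diff G c d. gc_diff G (a' \<otimes> c') (b' \<otimes> d')) =
      (\<Union>(a', b')\<in>gc_diff G a b. \<Union>(c', d')\<in>gc_diff G c d. gc_diff G (a \<otimes> c) (b \<otimes> d))"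
    by (intro SUP_cong refl) (auto intro!: SUP_cong)
  also have "\<dots> = gc_diff G (a \<otimes> c) (b \<otimes> d)"
    using gc_diff_self[OF cl(1,2)] gc_diff_self[OF cl(3,4)] by auto
  finally show ?thesis by (simp add: group_completion_def)
qed

lemma abelian_group_group_completion: "abelian_group (group_completion G)"
proof (rule abelian_groupI)
  fix x y assume "x \<in> carrier (group_completion G)" "y \<in> carrier (group_completion G)"
  then obtain a b c d where *: "a \<in> carrier G" "b \<in> carrier G" "x = gc_diff G a b" "c \<in> carrier G" "d \<in> carrier G" "y = gc_diff G c d"
    by (metis group_completionE)
  then show "x \<oplus>\<^bsub>group_completion G\<^esub> y \<in> carrier (group_completion G)"
    "x \<oplus>\<^bsub>group_completion G\<^esub> y = y \<oplus>\<^bsub>group_completion G\<^esub> x"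
    using gc_diff_closed[of "a \<otimes> c" "b \<otimes> d"] by (simp_all add: gc_diff_add m_comm)
  fix z assume "z \<in> carrier (group_completion G)"
  then obtain e f where "e \<in> carrier G" "f \<in> carrier G" "z = gc_diff G e f" by (rule group_completionE)
  then show "x \<oplus>\<^bsub>group_completion G\<^esub> y \<oplus>\<^bsub>group_completion G\<^esub> z = x \<oplus>\<^bsub>group_completion G\<^esub> (y \<oplus>\<^bsub>group_completion G\<^esub> z)"
    using * by (simp add: gc_diff_add m_assoc)
next
  fix x assume "x \<in> carrier (group_completion G)"
  then obtain a b where *: "a \<in> carrier G" "b \<in> carrier G" "x = gc_diff G a b" by (rule group_completionE)
  then show "\<zero>\<^bsub>group_completion G\<^esub> \<oplus>\<^bsub>group_completion G\<^esub> x = x" by (simp add: gc_diff_add)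
  have "gc_diff G (b \<otimes> a) (a \<otimes> b) = gc_diff G \<one> \<one>"
    using *(1,2) by (subst gc_diff_eq_iff) (auto simp: m_comm intro!: bexI[of _ \<one>])
  then show "\<exists>y\<in>carrier (group_completion G). y \<oplus>\<^bsub>group_completion G\<^esub> x = \<zero>\<^bsub>group_completion G\<^esub>"
    using * gc_diff_closed[of b a] by (intro bexI[of _ "gc_diff G b a"]) (simp_all add: gc_diff_add)
next
  show "\<zero>\<^bsub>group_completion G\<^esub> \<in> carrier (group_completion G)" using gc_diff_closed[of \<one> \<one>] by simp
qed

end

section \<open>The graded Grothendieck group in terms of types\<close>

context leavitt
begin

abbreviation shift_type :: "int \<Rightarrow> ('v \<times> int) multiset \<Rightarrow> ('v \<times> int) multiset" where
  "shift_type n \<equiv> image_mset (\<lambda>(v, m). (v, m - n))"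

abbreviation refined :: "'v \<Rightarrow> int \<Rightarrow> ('v \<times> int) multiset" where
  "refined v m \<equiv> image_mset (\<lambda>e. (head G e, m + 1)) (mset_set (out_arcs G v))"

lemma image_fst_Un [simp]: "fst ` (A \<union> B) = fst ` A \<union> fst ` B" by blast

lemma valid_shift_type: "valid \<mu> \<Longrightarrow> valid (shift_type n \<mu>)" by force

lemma valid_refined: "valid (refined v m)" by auto

lemma shift_type_shift_type: "shift_type n (shift_type k \<mu>) = shift_type (n + k) \<mu>"
  by (simp add: image_mset.compositionality comp_def case_prod_unfold algebra_simps)

lemma orbit_count_pre: "z \<in> cyc \<Longrightarrow> orbit_count (pre z) \<mu> = orbit_count z (shift_type 1 \<mu>)"
  by (simp add: orbit_count_def filter_mset_image_mset on_orbit_pre case_prod_unfold)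

text \<open>Modules of one type are isomorphic, so this is the isomorphism class belonging to the
  type; different types may give the same class.\<close>

definition cls :: "('v \<times> int) multiset \<Rightarrow> ((('v, 'e) lgen word \<Rightarrow>\<^sub>0 'k) set, 'u) gmodule set" where
  "cls \<mu> = {Q \<in> fg_gr_proj TYPE('u) LA. has_type Q \<mu>}"

lemma fg_gr_proj_graded: "Q \<in> fg_gr_proj TYPE('u) LA \<Longrightarrow> graded_module LA Q"
  by (simp add: fg_gr_proj_def)

lemma mem_cls_iff: "Q \<in> cls \<mu> \<longleftrightarrow> graded_module LA Q \<and> has_type Q \<mu>"
  using has_type_fg_gr_proj[of Q \<mu>] by (auto simp: cls_def fg_gr_proj_graded)

lemma gr_iso_class_eq_cls:
  assumes "graded_module LA P" "has_type P \<mu>" shows "gr_iso_class LA P = cls \<mu>"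
  unfolding gr_iso_class_def cls_def
  using assms has_type_transport[of _ P \<mu>] has_type_iso[of _ \<mu> P] fg_gr_proj_graded by blast

lemma cls_eqI:
  fixes P :: "((('v, 'e) lgen word \<Rightarrow>\<^sub>0 'k) set, 'u) gmodule"
  assumes "graded_module LA P" "has_type P \<mu>" "has_type P \<nu>"
  shows "(cls \<mu> :: ((('v, 'e) lgen word \<Rightarrow>\<^sub>0 'k) set, 'u) gmodule set) = cls \<nu>"
  using assms gr_iso_class_eq_cls[of P \<mu>] gr_iso_class_eq_cls[of P \<nu>] by simp

context
  fixes \<iota> :: "'k \<Rightarrow> 'u"
  assumes inf: "infinite (UNIV :: 'u set)" and \<iota>: "inj \<iota>"
begin

abbreviation VG :: "((('v, 'e) lgen word \<Rightarrow>\<^sub>0 'k) set, 'u) gmodule set monoid" where "VG \<equiv> Vgr TYPE('u) LA"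
abbreviation clsu :: "('v \<times> int) multiset \<Rightarrow> ((('v, 'e) lgen word \<Rightarrow>\<^sub>0 'k) set, 'u) gmodule set" where "clsu \<equiv> cls"

lemma cls_nonempty: assumes "valid \<mu>" obtains P where "P \<in> clsu \<mu>" "graded_module LA P" "has_type P \<mu>"
  using has_type_exists[OF inf \<iota> assms] by (auto simp: mem_cls_iff)

lemma carrier_VG: "carrier VG = clsu ` {\<mu>. valid \<mu>}"
proof
  show "carrier VG \<subseteq> clsu ` {\<mu>. valid \<mu>}"
  proof
    fix x assume "x \<in> carrier VG"
    then obtain P where P: "P \<in> fg_gr_proj TYPE('u) LA" "x = gr_iso_class LA P" by (auto simp: Vgr_def)
    obtain \<mu> where "has_type P \<mu>" using fg_gr_proj_has_type[OF inf \<iota> P(1)] by blast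
    then show "x \<in> clsu ` {\<mu>. valid \<mu>}"
      using gr_iso_class_eq_cls[OF fg_gr_proj_graded[OF P(1)]] has_type_valid P(2) by blast
  qed
  show "clsu ` {\<mu>. valid \<mu>} \<subseteq> carrier VG"
  proof
    fix x assume "x \<in> clsu ` {\<mu>. valid \<mu>}"
    then obtain \<mu> where m: "valid \<mu>" "x = clsu \<mu>" by blast
    obtain P where P: "P \<in> clsu \<mu>" "graded_module LA P" "has_type P \<mu>" using cls_nonempty[OF m(1)] by blast
    then have "P \<in> fg_gr_proj TYPE('u) LA" by (simp add: cls_def)
    then show "x \<in> carrier VG" using gr_iso_class_eq_cls[OF P(2,3)] m(2) by (auto simp: Vgr_def)
  qed
qed

lemma cls_closed: "valid \<mu> \<Longrightarrow> clsu \<mu> \<in> carrier VG"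
  by (auto simp: carrier_VG)

lemma cls_mult: assumes "valid \<mu>" "valid \<nu>" shows "clsu \<mu> \<otimes>\<^bsub>VG\<^esub> clsu \<nu> = clsu (\<mu> + \<nu>)"
proof -
  obtain P where P: "P \<in> clsu \<mu>" "graded_module LA P" "has_type P \<mu>" using cls_nonempty[OF assms(1)] by blast
  obtain Q where Q: "Q \<in> clsu \<nu>" "graded_module LA Q" "has_type Q \<nu>" using cls_nonempty[OF assms(2)] by blast
  have "S \<in> clsu \<mu> \<otimes>\<^bsub>VG\<^esub> clsu \<nu> \<longleftrightarrow> S \<in> clsu (\<mu> + \<nu>)" for S
  proof
    assume "S \<in> clsu \<mu> \<otimes>\<^bsub>VG\<^esub> clsu \<nu>"
    then obtain P' Q' where *: "S \<in> fg_gr_proj TYPE('u) LA" "P' \<in> clsu \<mu>" "Q' \<in> clsu \<nu>" "gr_isomorphic LA S (gr_dsum P' Q')"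
      by (auto simp: Vgr_def)
    then have g: "graded_module LA P'" "has_type P' \<mu>" "graded_module LA Q'" "has_type Q' \<nu>" by (auto simp: mem_cls_iff)
    have gS: "graded_module LA S" by (rule fg_gr_proj_graded[OF *(1)])
    have "has_type S (\<mu> + \<nu>)"
      by (rule has_type_transport[OF gS graded_module_gr_dsum[OF g(1,3)] *(4) has_type_gr_dsum[OF g]])
    then show "S \<in> clsu (\<mu> + \<nu>)" using gS by (simp add: mem_cls_iff)
  next
    assume S: "S \<in> clsu (\<mu> + \<nu>)"
    then have "graded_module LA S" "has_type S (\<mu> + \<nu>)" by (auto simp: mem_cls_iff)
    then have "gr_isomorphic LA S (gr_dsum P Q)"
      by (rule has_type_iso[OF _ _ graded_module_gr_dsum[OF P(2) Q(2)] has_type_gr_dsum[OF P(2,3) Q(2,3)]])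
    then show "S \<in> clsu \<mu> \<otimes>\<^bsub>VG\<^esub> clsu \<nu>" using S P(1) Q(1) by (auto simp: Vgr_def cls_def)
  qed
  then show ?thesis by blast
qed

lemma one_VG: "\<one>\<^bsub>VG\<^esub> = clsu {#}"
proof -
  have eq: "carrier P = {\<zero>\<^bsub>P\<^esub>} \<longleftrightarrow> has_type P {#}" if gP: "graded_module LA P"
    for P :: "((('v, 'e) lgen word \<Rightarrow>\<^sub>0 'k) set, 'u) gmodule"
  proof -
    interpret P: abelian_group P by (rule module_abelian_group[OF graded_right[OF gP]])
    show ?thesis
    proof
      assume c: "carrier P = {\<zero>\<^bsub>P\<^esub>}"
      have "basis P ({} :: nat set) (\<lambda>_. \<zero>\<^bsub>P\<^esub>) v m" for v m
        by (auto simp: basis_def frame_def spans_def c)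
      from has_typeI[OF gP this] show "has_type P {#}" by simp
    next
      assume "has_type P {#}"
      then obtain I :: "nat set" and b v m where B: "basis P I b v m" "{#} = image_mset (\<lambda>i. (v i, m i)) (mset_set I)"
        by (auto simp: has_type_def)
      then have I: "I = {}" using frameD(1)[OF basisD(1)[OF B(1)]] by (metis image_mset_is_empty_iff mset_set_empty_iff)
      have "x = \<zero>\<^bsub>P\<^esub>" if "x \<in> carrier P" for x using spansD[OF basisD(2)[OF B(1)] that] by (auto simp: I)
      then show "carrier P = {\<zero>\<^bsub>P\<^esub>}" by auto
    qed
  qed
  have "{P \<in> fg_gr_proj TYPE('u) LA. carrier P = {\<zero>\<^bsub>P\<^esub>}} = clsu {#}"
    unfolding cls_def by (rule Collect_cong) (use eq fg_gr_proj_graded in blast)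
  then show ?thesis by (simp add: Vgr_def)
qed

lemma comm_monoid_VG: "comm_monoid VG"
proof (rule comm_monoidI)
  fix x y assume "x \<in> carrier VG" "y \<in> carrier VG"
  then obtain \<mu> \<nu> where *: "valid \<mu>" "valid \<nu>" "x = clsu \<mu>" "y = clsu \<nu>" by (auto simp: carrier_VG)
  then show "x \<otimes>\<^bsub>VG\<^esub> y \<in> carrier VG" "x \<otimes>\<^bsub>VG\<^esub> y = y \<otimes>\<^bsub>VG\<^esub> x"
    by (simp_all add: cls_mult cls_closed add.commute)
  fix z assume "z \<in> carrier VG"
  then obtain \<rho> where "valid \<rho>" "z = clsu \<rho>" by (auto simp: carrier_VG)
  then show "x \<otimes>\<^bsub>VG\<^esub> y \<otimes>\<^bsub>VG\<^esub> z = x \<otimes>\<^bsub>VG\<^esub> (y \<otimes>\<^bsub>VG\<^esub> z)" using * by (simp add: cls_mult add.assoc)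
next
  show "\<one>\<^bsub>VG\<^esub> \<in> carrier VG" by (simp add: one_VG cls_closed)
  fix x assume "x \<in> carrier VG"
  then obtain \<mu> where "valid \<mu>" "x = clsu \<mu>" by (auto simp: carrier_VG)
  then show "\<one>\<^bsub>VG\<^esub> \<otimes>\<^bsub>VG\<^esub> x = x" by (simp add: one_VG cls_mult)
qed

interpretation VG: comm_monoid VG by (rule comm_monoid_VG)

text \<open>One inclusion holds for all shifts, and the other follows by shifting back.\<close>

lemma shift_cls: "shift n ` clsu \<mu> = clsu (shift_type n \<mu>)"
proof
  have sub: "shift n ` clsu \<mu> \<subseteq> clsu (shift_type n \<mu>)" for n \<mu>
    by (auto simp: mem_cls_iff graded_module_shift has_type_shift)
  show "shift n ` clsu \<mu> \<subseteq> clsu (shift_type n \<mu>)" by (rule sub)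
  show "clsu (shift_type n \<mu>) \<subseteq> shift n ` clsu \<mu>"
  proof
    fix P assume P: "P \<in> clsu (shift_type n \<mu>)"
    have "shift (- n) P \<in> clsu (shift_type (- n) (shift_type n \<mu>))" using sub P by blast
    then have "shift (- n) P \<in> clsu \<mu>" unfolding shift_type_shift_type by simp
    then show "P \<in> shift n ` clsu \<mu>" by (intro image_eqI[of _ _ "shift (- n) P"]) simp_all
  qed
qed

abbreviation K0 where "K0 \<equiv> K0gr TYPE('u) LA"
abbreviation pcls :: "('v \<times> int) multiset \<Rightarrow>
    (((('v, 'e) lgen word \<Rightarrow>\<^sub>0 'k) set, 'u) gmodule set \<times> ((('v, 'e) lgen word \<Rightarrow>\<^sub>0 'k) set, 'u) gmodule set) set" where
  "pcls \<mu> \<equiv> gc_diff VG (clsu \<mu>) \<one>\<^bsub>VG\<^esub>"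

lemma K0_sel:
  "carrier K0 = carrier (group_completion VG)" "\<zero>\<^bsub>K0\<^esub> = \<zero>\<^bsub>group_completion VG\<^esub>" "add K0 = add (group_completion VG)"
  by (simp_all add: K0gr_def Let_def)

lemma pcls_closed: "valid \<mu> \<Longrightarrow> pcls \<mu> \<in> carrier K0"
  unfolding K0_sel by (intro VG.gc_diff_closed cls_closed VG.one_closed)

lemma pcls_add: "valid \<mu> \<Longrightarrow> valid \<nu> \<Longrightarrow> pcls \<mu> \<oplus>\<^bsub>K0\<^esub> pcls \<nu> = pcls (\<mu> + \<nu>)"
  unfolding K0_sel by (simp add: VG.gc_diff_add cls_closed cls_mult)

lemma K0gr_pos_eq: "K0gr_pos TYPE('u) LA = pcls ` {\<mu>. valid \<mu>}"
  by (simp add: K0gr_pos_def carrier_VG image_image)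

lemma pcls_refined: assumes "v \<in> verts G" shows "pcls {#(v, m)#} = pcls (refined v m)"
proof -
  have "valid {#(v, m)#}" using assms by simp
  then obtain P where "P \<in> clsu {#(v, m)#}" "graded_module LA P" "has_type P {#(v, m)#}" using cls_nonempty by blast
  then have "clsu {#(v, m)#} = clsu (refined v m)" by (intro cls_eqI[of P] has_type_refine)
  then show ?thesis by simp
qed

text \<open>Equality in the group completion means equality of classes after adding a common type.
  The counts are invariants of the class and additive, so the added type cancels in them.\<close>

lemma orbit_count_cong_pcls:
  assumes v: "valid \<mu>" "valid \<nu>" and eq: "pcls \<mu> = pcls \<nu>" and z: "z \<in> cyc"
  shows "orbit_count z \<mu> = orbit_count z \<nu>"
proof -
  obtain t where "t \<in> carrier VG" "(clsu \<mu> \<otimes>\<^bsub>VG\<^esub> \<one>\<^bsub>VG\<^esub>) \<otimes>\<^bsub>VG\<^esub> t = (clsu \<nu> \<otimes>\<^bsub>VG\<^esub> \<one>\<^bsub>VG\<^esub>) \<otimes>\<^bsub>VG\<^esub> t"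
    using eq VG.gc_diff_eq_iff[of "clsu \<mu>" "\<one>\<^bsub>VG\<^esub>" "clsu \<nu>" "\<one>\<^bsub>VG\<^esub>"] v cls_closed by auto
  moreover from this(1) obtain \<rho> where "valid \<rho>" "t = clsu \<rho>" by (auto simp: carrier_VG)
  ultimately have r: "valid \<rho>" "clsu (\<mu> + \<rho>) = clsu (\<nu> + \<rho>)"
    using v by (simp_all add: cls_closed cls_mult)
  have "valid (\<mu> + \<rho>)" using v r by auto
  then obtain P where P: "P \<in> clsu (\<mu> + \<rho>)" "graded_module LA P" "has_type P (\<mu> + \<rho>)" using cls_nonempty by blast
  then have "has_type P (\<nu> + \<rho>)" using r(2) mem_cls_iff by blast
  then have "orbit_count z (\<mu> + \<rho>) = orbit_count z (\<nu> + \<rho>)" by (rule has_type_orbit_count[OF z P(2,3)])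
  then show ?thesis by simp
qed

text \<open>Shifting acts on types and is additive there, so it respects the relation of the group
  completion, and the union over representatives is constant.\<close>

lemma K0gr_shift_gc_diff:
  assumes v: "valid \<mu>" "valid \<nu>"
  shows "K0gr_shift TYPE('u) LA n (gc_diff VG (clsu \<mu>) (clsu \<nu>)) =
    gc_diff VG (clsu (shift_type n \<mu>)) (clsu (shift_type n \<nu>))"
proof -
  have "gc_diff VG (shift n ` a) (shift n ` b) = gc_diff VG (clsu (shift_type n \<mu>)) (clsu (shift_type n \<nu>))"
    if m: "(a, b) \<in> gc_diff VG (clsu \<mu>) (clsu \<nu>)" for a b
  proof -
    obtain \<mu>' \<nu>' where ab: "valid \<mu>'" "valid \<nu>'" "a = clsu \<mu>'" "b = clsu \<nu>'"
      using VG.gc_diff_memD(1,2)[OF m] by (auto simp: carrier_VG)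
    obtain \<rho> where r: "valid \<rho>" "clsu (\<mu> + \<nu>' + \<rho>) = clsu (\<mu>' + \<nu> + \<rho>)"
    proof -
      obtain t where t: "t \<in> carrier VG" "(clsu \<mu> \<otimes>\<^bsub>VG\<^esub> b) \<otimes>\<^bsub>VG\<^esub> t = (a \<otimes>\<^bsub>VG\<^esub> clsu \<nu>) \<otimes>\<^bsub>VG\<^esub> t"
        using VG.gc_diff_memD(3)[OF m] by blast
      obtain \<rho> where r: "valid \<rho>" "t = clsu \<rho>" using t(1) by (auto simp: carrier_VG)
      have "valid (\<mu> + \<nu>')" "valid (\<mu>' + \<nu>)" using v ab by auto
      then show ?thesis using that[OF r(1)] t(2) v ab r by (simp add: cls_mult)
    qed
    have "clsu (shift_type n (\<mu> + \<nu>' + \<rho>)) = clsu (shift_type n (\<mu>' + \<nu> + \<rho>))"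
      using arg_cong[OF r(2), of "\<lambda>x. shift n ` x"] unfolding shift_cls .
    then have "(clsu (shift_type n \<mu>') \<otimes>\<^bsub>VG\<^esub> clsu (shift_type n \<nu>)) \<otimes>\<^bsub>VG\<^esub> clsu (shift_type n \<rho>) =
        (clsu (shift_type n \<mu>) \<otimes>\<^bsub>VG\<^esub> clsu (shift_type n \<nu>')) \<otimes>\<^bsub>VG\<^esub> clsu (shift_type n \<rho>)"
      using valid_shift_type[OF v(1), of n] valid_shift_type[OF v(2), of n] valid_shift_type[OF ab(1), of n]
        valid_shift_type[OF ab(2), of n] valid_shift_type[OF r(1), of n] by (simp add: cls_mult)
    then show ?thesis
      unfolding ab(3,4) shift_cls
      using v ab r(1) by (subst VG.gc_diff_eq_iff)
        (auto intro!: cls_closed valid_shift_type bexI[of _ "clsu (shift_type n \<rho>)"])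
  qed
  then show ?thesis
    unfolding K0gr_shift_def using VG.gc_diff_self[OF cls_closed[OF v(1)] cls_closed[OF v(2)]] by blast
qed

lemma shift_pcls:
  assumes v: "valid \<mu>"
  shows "Poly_Mapping.single n 1 \<odot>\<^bsub>K0\<^esub> pcls \<mu> = pcls (shift_type n \<mu>)"
proof -
  interpret K: abelian_group "group_completion VG" by (rule VG.abelian_group_group_completion)
  have one: "\<one>\<^bsub>VG\<^esub> = clsu (shift_type n {#})" by (simp add: one_VG)
  have s: "K0gr_shift TYPE('u) LA n (pcls \<mu>) = pcls (shift_type n \<mu>)"
    using K0gr_shift_gc_diff[OF v, of "{#}" n] by (simp add: one_VG)
  have c: "pcls (shift_type n \<mu>) \<in> carrier (group_completion VG)"
    using pcls_closed[OF valid_shift_type[OF v]] by (simp add: K0_sel)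
  have "[(1 :: int)] \<cdot>\<^bsub>group_completion VG\<^esub> pcls (shift_type n \<mu>) = pcls (shift_type n \<mu>)"
    unfolding add_pow_def by (rule group.int_pow_1[OF K.a_group]) (use c in simp)
  then show ?thesis
    using c by (simp add: K0gr_def Let_def s del: VG.group_completion_sel)
qed

end

end

section \<open>An isomorphism of graded Grothendieck groups matches the entryless cycles\<close>

text \<open>In the naturals nothing cancels: a sum that is zero has only zero terms, and a sum that
  is one has a single nonzero term. So each row of \<open>N\<close> has exactly one nonzero
  entry.\<close>

lemma nat_matrix_permutation:
  fixes N :: "'a \<Rightarrow> 'b \<Rightarrow> nat" and M :: "'b \<Rightarrow> 'a \<Rightarrow> nat"
  assumes fin: "finite A" "finite B"
    and NM: "\<And>a a'. a \<in> A \<Longrightarrow> a' \<in> A \<Longrightarrow> (\<Sum>b\<in>B. N a b * M b a') = (if a = a' then 1 else 0)"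
    and MN: "\<And>b b'. b \<in> B \<Longrightarrow> b' \<in> B \<Longrightarrow> (\<Sum>a\<in>A. M b a * N a b') = (if b = b' then 1 else 0)"
  obtains h where "bij_betw h A B" "\<And>a b. a \<in> A \<Longrightarrow> b \<in> B \<Longrightarrow> N a b = (if b = h a then 1 else 0)"
proof -
  have zero: "a = a'" if "a \<in> A" "a' \<in> A" "b \<in> B" "N a b > 0" "M b a' > 0" for a a' b
  proof (rule ccontr)
    assume "a \<noteq> a'"
    then have "(\<Sum>b\<in>B. N a b * M b a') = 0" using NM that by simp
    then have "N a b * M b a' = 0" using sum_eq_0_iff[OF fin(2), of "\<lambda>b. N a b * M b a'"] that(3) by simp
    then show False using that by simp
  qed
  have "\<forall>a\<in>A. \<exists>b. b \<in> B \<and> N a b = 1 \<and> M b a = 1"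
  proof
    fix a assume "a \<in> A"
    then have "(\<Sum>b\<in>B. N a b * M b a) = 1" using NM by simp
    then obtain b where "b \<in> B" "N a b * M b a = 1" using sum_eq_1_iff[OF fin(2), of "\<lambda>b. N a b * M b a"] by blast
    then show "\<exists>b. b \<in> B \<and> N a b = 1 \<and> M b a = 1" by (auto simp: nat_mult_eq_1_iff)
  qed
  from bchoice[OF this] obtain h where h: "\<And>a. a \<in> A \<Longrightarrow> h a \<in> B \<and> N a (h a) = 1 \<and> M (h a) a = 1" by blast
  have other: "N a b = 0" if ab: "a \<in> A" "b \<in> B" "b \<noteq> h a" for a b
  proof (rule ccontr)
    assume "N a b \<noteq> 0"
    have "(\<Sum>a\<in>A. M b a * N a b) = 1" using MN ab by simp
    then obtain a' where a': "a' \<in> A" "M b a' * N a' b = 1" using sum_eq_1_iff[OF fin(1), of "\<lambda>a. M b a * N a b"] by blast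
    then have "a = a'" using zero[of a a' b] ab \<open>N a b \<noteq> 0\<close> by simp
    then have "M b a = 1" using a' by simp
    \<comment> \<open>A second nonzero entry in row \<open>a\<close> would make the diagonal sum at
      least two.\<close>
    have "(\<Sum>b\<in>{h a, b}. N a b * M b a) \<le> (\<Sum>b\<in>B. N a b * M b a)"
      using fin ab h by (intro sum_mono2) auto
    also have "\<dots> = 1" using NM ab by simp
    finally show False using ab h[OF ab(1)] \<open>M b a = 1\<close> \<open>N a b \<noteq> 0\<close> by simp
  qed
  have "inj_on h A"
  proof (rule inj_onI)
    fix a a' assume "a \<in> A" "a' \<in> A" "h a = h a'"
    then show "a = a'" using zero[of a a' "h a"] h[of a] h[of a'] by simp
  qed
  moreover have "h ` A = B"
  proof
    show "B \<subseteq> h ` A"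
    proof
      fix b assume b: "b \<in> B"
      then have "(\<Sum>a\<in>A. M b a * N a b) = 1" using MN by simp
      then obtain a where "a \<in> A" "M b a * N a b = 1" using sum_eq_1_iff[OF fin(1), of "\<lambda>a. M b a * N a b"] by blast
      then show "b \<in> h ` A" using other[of a b] b by fastforce
    qed
  qed (use h in auto)
  ultimately show ?thesis using that[of h] h other by (simp add: bij_betw_def)
qed

section \<open>Additive functions of types\<close>

context leavitt
begin

text \<open>On single pairs \<open>f\<close> satisfies the arc relation, since refining a pair does
  not change its value. By \<open>d_eq_phase\<close> these values are determined by those in degree
  zero on \<open>cyc\<close>, which become the coefficients.\<close>

lemma functional_decomposition:
  fixes f :: "('v \<times> int) multiset \<Rightarrow> nat"
  assumes zero: "f {#} = 0" and add: "\<And>\<mu> \<nu>. valid \<mu> \<Longrightarrow> valid \<nu> \<Longrightarrow> f (\<mu> + \<nu>) = f \<mu> + f \<nu>"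
    and ref: "\<And>v m. v \<in> verts G \<Longrightarrow> f {#(v, m)#} = f (refined v m)"
    and "valid \<mu>"
  shows "f \<mu> = (\<Sum>z\<in>cyc. f {#(z, 0)#} * orbit_count z \<mu>)"
  using assms(4)
proof (induction \<mu>)
  case empty
  then show ?case by (simp add: zero)
next
  case (add x \<mu>)
  obtain v m where x: "x = (v, m)" by (cases x)
  have v: "v \<in> verts G" using add.prems x by simp
  define d where "d v m = f {#(v, m)#}" for v m
  have img: "f (image_mset (\<lambda>e. (head G e, m + 1)) (mset_set S)) = (\<Sum>e\<in>S. d (head G e) (m + 1))"
    if "finite S" "S \<subseteq> arcs G" for S m
    using that
  proof (induction S rule: finite_induct)
    case (insert e S)
    have "f ({#(head G e, m + 1)#} + image_mset (\<lambda>e. (head G e, m + 1)) (mset_set S)) =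
        f {#(head G e, m + 1)#} + f (image_mset (\<lambda>e. (head G e, m + 1)) (mset_set S))"
      using insert by (intro assms(2)) auto
    then show ?case using insert by (simp add: d_def)
  qed (simp add: zero)
  have d: "d v m = (\<Sum>e\<in>out_arcs G v. d (head G e) (m + 1))" if "v \<in> verts G" for v m
  proof -
    have "out_arcs G v \<subseteq> arcs G" by auto
    then show ?thesis using ref[OF that, of m] img[of "out_arcs G v" m] by (simp add: d_def)
  qed
  have "f {#x#} = (\<Sum>z\<in>cyc. f {#(z, 0)#} * orbit_count z {#x#})"
  proof -
    \<comment> \<open>The pair \<open>(v, m)\<close> lies on one unrolled cycle only, the one
      through \<open>phase v m\<close>, and on none if \<open>v\<close> is not entryless.\<close>
    have "(\<Sum>z\<in>cyc. f {#(z, 0)#} * orbit_count z {#x#}) = (\<Sum>z\<in>cyc. if v \<in> cyc \<and> z = phase v m then d z 0 else 0)"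
      by (intro sum.cong) (auto simp: x orbit_count_single on_orbit_def d_def)
    also have "\<dots> = (if v \<in> cyc then d (phase v m) 0 else 0)"
      using phase_in_cyc[of v m] by (simp add: sum.delta')
    also have "\<dots> = d v m" using d_eq_phase[of d, OF d v] by simp
    finally show ?thesis by (simp add: d_def x)
  qed
  moreover have "f (add_mset x \<mu>) = f {#x#} + f \<mu>"
    using assms(2)[of "{#x#}" \<mu>] add.prems by simp
  moreover have "orbit_count z (add_mset x \<mu>) = orbit_count z {#x#} + orbit_count z \<mu>" for z
    using orbit_count_plus[of z "{#x#}" \<mu>] by simp
  ultimately show ?case using add by (simp add: algebra_simps sum.distrib)
qed

text \<open>Since a class has many types, an isomorphism gives only a relation between the types of
  the two graphs. A count that is constant on the objects related to a given type becomes an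
  additive function of that type, hence a combination of the orbit counts of this graph.\<close>

lemma count_transfer:
  fixes \<Psi> :: "'x \<Rightarrow> ('v \<times> int) multiset \<Rightarrow> bool" and c :: "'x \<Rightarrow> nat"
  assumes total: "\<And>\<nu>. valid \<nu> \<Longrightarrow> \<exists>x. \<Psi> x \<nu>"
    and uniq: "\<And>x y \<nu>. \<Psi> x \<nu> \<Longrightarrow> \<Psi> y \<nu> \<Longrightarrow> c x = c y"
    and zero: "\<And>x. \<Psi> x {#} \<Longrightarrow> c x = 0"
    and add: "\<And>x y \<mu> \<nu>. \<Psi> x \<mu> \<Longrightarrow> \<Psi> y \<nu> \<Longrightarrow> \<exists>w. \<Psi> w (\<mu> + \<nu>) \<and> c w = c x + c y"
    and ref: "\<And>x v m. v \<in> verts G \<Longrightarrow> \<Psi> x {#(v, m)#} \<Longrightarrow> \<Psi> x (refined v m)"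
  shows "\<exists>N. \<forall>x \<nu>. valid \<nu> \<longrightarrow> \<Psi> x \<nu> \<longrightarrow> c x = (\<Sum>z\<in>cyc. N z * orbit_count z \<nu>)"
proof -
  define f where "f \<nu> = c (SOME x. \<Psi> x \<nu>)" for \<nu>
  have f: "f \<nu> = c x" if "\<Psi> x \<nu>" for x \<nu>
    unfolding f_def by (rule uniq[OF someI[of "\<lambda>x. \<Psi> x \<nu>", OF that] that])
  have "f \<nu> = (\<Sum>z\<in>cyc. f {#(z, 0)#} * orbit_count z \<nu>)" if "valid \<nu>" for \<nu>
  proof (rule functional_decomposition[OF _ _ _ that])
    show "f {#} = 0" using total[of "{#}"] f zero by auto
    show "f (\<mu> + \<nu>) = f \<mu> + f \<nu>" if mn: "valid \<mu>" "valid \<nu>" for \<mu> \<nu>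
    proof -
      obtain x where x: "\<Psi> x \<mu>" using total[OF mn(1)] by blast
      obtain y where y: "\<Psi> y \<nu>" using total[OF mn(2)] by blast
      obtain w where w: "\<Psi> w (\<mu> + \<nu>)" "c w = c x + c y" using add[OF x y] by blast
      show ?thesis using f[OF x] f[OF y] f[OF w(1)] w(2) by simp
    qed
    show "f {#(v, m)#} = f (refined v m)" if v: "v \<in> verts G" for v m
    proof -
      obtain x where "\<Psi> x {#(v, m)#}" using total[of "{#(v, m)#}"] v by auto
      then show ?thesis using f[of x "{#(v, m)#}"] f[OF ref[OF v, of x m]] by simp
    qed
  qed
  note dec = this
  have "c x = (\<Sum>z\<in>cyc. f {#(z, 0)#} * orbit_count z \<nu>)" if "valid \<nu>" "\<Psi> x \<nu>" for x \<nu>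
    by (rule trans[OF f[OF that(2), symmetric] dec[OF that(1)]])
  then show ?thesis by (intro exI[of _ "\<lambda>z. f {#(z, 0)#}"] allI impI)
qed

lemma sum_orbit_count_base:
  fixes N :: "'v \<Rightarrow> nat"
  assumes "z \<in> cyc" shows "(\<Sum>z'\<in>cyc. N z' * orbit_count z' {#(z, 0)#}) = N z"
proof -
  have "(\<Sum>z'\<in>cyc. N z' * orbit_count z' {#(z, 0)#}) = (\<Sum>z'\<in>cyc. if z = z' then N z' else 0)"
    using assms by (intro sum.cong) (auto simp: orbit_count_single on_orbit_def)
  then show ?thesis using assms finite_cyc by (simp add: sum.delta')
qed

lemma orbit_count_base: "z \<in> cyc \<Longrightarrow> orbit_count z' {#(z, 0)#} = (if z = z' then 1 else 0)"
  by (auto simp: orbit_count_single on_orbit_def)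

end

text \<open>The orbit counts of each graph are combinations of those of the other, with natural
  coefficients \<open>N\<close> and \<open>M\<close>. At a pair \<open>(z, 0)\<close> with
  \<open>z\<close> entryless the counts form a unit vector, and evaluating there shows that the
  matrices are inverse to each other.\<close>

theorem entryless_cycles_match:
  fixes E :: "('v, 'e) pre_digraph" and F :: "('w, 'f) pre_digraph" and \<iota> :: "'k::field \<Rightarrow> 'u"
  assumes gE: "leavitt_graph E" and gF: "leavitt_graph F"
    and inf: "infinite (UNIV :: 'u set)" and \<iota>: "inj \<iota>"
    and \<phi>: "\<phi> \<in> K0gr_order_iso TYPE('u) (leavitt_algebra TYPE('k) E) (leavitt_algebra TYPE('k) F)"
  obtains h where "bij_betw h (leavitt_graph.cyc E) (leavitt_graph.cyc F)"
    "\<And>z. z \<in> leavitt_graph.cyc E \<Longrightarrow> h (leavitt_graph.pre E z) = leavitt_graph.pre F (h z)"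
proof -
  interpret E: leavitt E "TYPE('k)" by (rule leavitt.intro[OF gE])
  interpret F: leavitt F "TYPE('k)" by (rule leavitt.intro[OF gF])
  let ?RE = "leavitt_algebra TYPE('k) E" and ?RF = "leavitt_algebra TYPE('k) F"
  let ?KE = "K0gr TYPE('u) ?RE" and ?KF = "K0gr TYPE('u) ?RF"
  define p where "p \<mu> = gc_diff (Vgr TYPE('u) ?RE) (E.cls \<mu>) \<one>\<^bsub>Vgr TYPE('u) ?RE\<^esub>" for \<mu>
  define q where "q \<nu> = gc_diff (Vgr TYPE('u) ?RF) (F.cls \<nu>) \<one>\<^bsub>Vgr TYPE('u) ?RF\<^esub>" for \<nu>
  note pE = E.pcls_closed[OF inf \<iota>, folded p_def] E.pcls_add[OF inf \<iota>, folded p_def] E.K0gr_pos_eq[OF inf \<iota>, folded p_def]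
    E.pcls_refined[OF inf \<iota>, folded p_def] E.orbit_count_cong_pcls[OF inf \<iota>, folded p_def] E.shift_pcls[OF inf \<iota>, folded p_def]
  note qF = F.pcls_closed[OF inf \<iota>, folded q_def] F.pcls_add[OF inf \<iota>, folded q_def] F.K0gr_pos_eq[OF inf \<iota>, folded q_def]
    F.pcls_refined[OF inf \<iota>, folded q_def] F.orbit_count_cong_pcls[OF inf \<iota>, folded q_def] F.shift_pcls[OF inf \<iota>, folded q_def]
  have add: "\<phi> (x \<oplus>\<^bsub>?KE\<^esub> y) = \<phi> x \<oplus>\<^bsub>?KF\<^esub> \<phi> y" if "x \<in> carrier ?KE" "y \<in> carrier ?KE" for x y
    using \<phi> that by (auto simp: K0gr_order_iso_def iso_def hom_def)
  have inj: "inj_on \<phi> (carrier ?KE)" using \<phi> by (auto simp: K0gr_order_iso_def iso_def bij_betw_def)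
  have lin: "\<phi> (Poly_Mapping.single 1 1 \<odot>\<^bsub>?KE\<^esub> x) = Poly_Mapping.single 1 1 \<odot>\<^bsub>?KF\<^esub> \<phi> x" if "x \<in> carrier ?KE" for x
    using \<phi> that by (simp add: K0gr_order_iso_def)
  have pos: "\<phi> ` K0gr_pos TYPE('u) ?RE = K0gr_pos TYPE('u) ?RF" using \<phi> by (simp add: K0gr_order_iso_def)
  define \<Psi> where "\<Psi> \<mu> \<nu> \<longleftrightarrow> E.valid \<mu> \<and> F.valid \<nu> \<and> \<phi> (p \<mu>) = q \<nu>" for \<mu> \<nu>
  have PE: "E.valid \<mu>" and PF: "F.valid \<nu>" if "\<Psi> \<mu> \<nu>" for \<mu> \<nu> using that by (simp_all add: \<Psi>_def)
  have tF: "\<exists>\<mu>. \<Psi> \<mu> \<nu>" if n: "F.valid \<nu>" for \<nu>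
  proof -
    have "q \<nu> \<in> \<phi> ` (p ` {\<mu>. E.valid \<mu>})" using pos n unfolding pE(3) qF(3) by blast
    then show ?thesis using n by (auto simp: \<Psi>_def)
  qed
  have tE: "\<exists>\<nu>. \<Psi> \<mu> \<nu>" if m: "E.valid \<mu>" for \<mu>
  proof -
    have "\<phi> (p \<mu>) \<in> q ` {\<nu>. F.valid \<nu>}" using pos m unfolding pE(3) qF(3) by blast
    then show ?thesis using m by (auto simp: \<Psi>_def)
  qed
  have Padd: "\<Psi> (\<mu> + \<mu>') (\<nu> + \<nu>')" if "\<Psi> \<mu> \<nu>" "\<Psi> \<mu>' \<nu>'" for \<mu> \<mu>' \<nu> \<nu>'
  proof -
    have v: "E.valid \<mu>" "E.valid \<mu>'" "F.valid \<nu>" "F.valid \<nu>'" "\<phi> (p \<mu>) = q \<nu>" "\<phi> (p \<mu>') = q \<nu>'"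
      using that by (auto simp: \<Psi>_def)
    have "\<phi> (p (\<mu> + \<mu>')) = q (\<nu> + \<nu>')"
      using add[OF pE(1)[OF v(1)] pE(1)[OF v(2)]] pE(2)[OF v(1,2)] qF(2)[OF v(3,4)] v(5,6) by simp
    then show ?thesis using v by (auto simp: \<Psi>_def)
  qed
  have uE: "E.orbit_count z \<mu> = E.orbit_count z \<mu>'" if "\<Psi> \<mu> \<nu>" "\<Psi> \<mu>' \<nu>" "z \<in> E.cyc" for \<mu> \<mu>' \<nu> z
  proof -
    have v: "E.valid \<mu>" "E.valid \<mu>'" "\<phi> (p \<mu>) = \<phi> (p \<mu>')" using that by (auto simp: \<Psi>_def)
    have "p \<mu> = p \<mu>'" by (rule inj_onD[OF inj v(3) pE(1)[OF v(1)] pE(1)[OF v(2)]])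
    then show ?thesis by (rule pE(5)[OF v(1,2) _ that(3)])
  qed
  have uF: "F.orbit_count z \<nu> = F.orbit_count z \<nu>'" if "\<Psi> \<mu> \<nu>" "\<Psi> \<mu> \<nu>'" "z \<in> F.cyc" for \<mu> \<nu> \<nu>' z
  proof -
    have v: "F.valid \<nu>" "F.valid \<nu>'" "q \<nu> = q \<nu>'" using that by (auto simp: \<Psi>_def)
    then show ?thesis by (intro qF(5)[OF v(1,2) v(3) that(3)])
  qed
  \<comment> \<open>Partners of the two empty types are, by additivity, partners of each other; this
    forces \<phi> to map the zero class to the zero class.\<close>
  have zero: "\<Psi> {#} {#}"
  proof -
    obtain \<mu> where m: "\<Psi> \<mu> {#}" using tF[of "{#}"] by auto
    obtain \<nu> where n: "\<Psi> {#} \<nu>" using tE[of "{#}"] by auto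
    have "\<Psi> \<mu> \<nu>" using Padd[OF m n] by simp
    then have "q \<nu> = q {#}" using m by (auto simp: \<Psi>_def)
    then show ?thesis using n by (auto simp: \<Psi>_def)
  qed
  have shift: "\<Psi> (E.shift_type 1 \<mu>) (F.shift_type 1 \<nu>)" if "\<Psi> \<mu> \<nu>" for \<mu> \<nu>
  proof -
    have v: "E.valid \<mu>" "F.valid \<nu>" "\<phi> (p \<mu>) = q \<nu>" using that by (auto simp: \<Psi>_def)
    have "\<phi> (p (E.shift_type 1 \<mu>)) = q (F.shift_type 1 \<nu>)"
      using lin[OF pE(1)[OF v(1)]] pE(6)[OF v(1), of 1] qF(6)[OF v(2), of 1] v(3) by simp
    then show ?thesis using E.valid_shift_type[OF v(1)] F.valid_shift_type[OF v(2)] by (simp only: \<Psi>_def)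
  qed
  have "\<forall>z\<in>E.cyc. \<exists>N. \<forall>\<mu> \<nu>. F.valid \<nu> \<longrightarrow> \<Psi> \<mu> \<nu> \<longrightarrow> E.orbit_count z \<mu> = (\<Sum>z'\<in>F.cyc. N z' * F.orbit_count z' \<nu>)"
  proof
    fix z assume z: "z \<in> E.cyc"
    show "\<exists>N. \<forall>\<mu> \<nu>. F.valid \<nu> \<longrightarrow> \<Psi> \<mu> \<nu> \<longrightarrow> E.orbit_count z \<mu> = (\<Sum>z'\<in>F.cyc. N z' * F.orbit_count z' \<nu>)"
    proof (rule F.count_transfer)
      show "\<exists>w. \<Psi> w (\<mu> + \<nu>) \<and> E.orbit_count z w = E.orbit_count z x + E.orbit_count z y"
        if "\<Psi> x \<mu>" "\<Psi> y \<nu>" for x y \<mu> \<nu>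
        using Padd[OF that] by (intro exI[of _ "x + y"]) simp
      show "\<Psi> x (F.refined v m)" if "v \<in> verts F" "\<Psi> x {#(v, m)#}" for x v m
        using that qF(4)[OF that(1), of m] F.valid_refined by (simp only: \<Psi>_def)
      show "E.orbit_count z x = 0" if "\<Psi> x {#}" for x using uE[OF that zero z] by (rule trans) simp
      show "\<exists>x. \<Psi> x \<nu>" if "F.valid \<nu>" for \<nu> by (rule tF[OF that])
      show "E.orbit_count z x = E.orbit_count z y" if "\<Psi> x \<nu>" "\<Psi> y \<nu>" for x y \<nu> by (rule uE[OF that z])
    qed
  qed
  then obtain N where N0: "\<forall>z\<in>E.cyc. \<forall>\<mu> \<nu>. F.valid \<nu> \<longrightarrow> \<Psi> \<mu> \<nu> \<longrightarrow>
      E.orbit_count z \<mu> = (\<Sum>z'\<in>F.cyc. N z z' * F.orbit_count z' \<nu>)" by (rule bchoice[THEN exE])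
  have N: "E.orbit_count z \<mu> = (\<Sum>z'\<in>F.cyc. N z z' * F.orbit_count z' \<nu>)"
    if "z \<in> E.cyc" "\<Psi> \<mu> \<nu>" for z \<mu> \<nu>
    by (rule N0[rule_format, OF that(1) PF[OF that(2)] that(2)])
  have "\<forall>z\<in>F.cyc. \<exists>M. \<forall>\<nu> \<mu>. E.valid \<mu> \<longrightarrow> \<Psi> \<mu> \<nu> \<longrightarrow> F.orbit_count z \<nu> = (\<Sum>z'\<in>E.cyc. M z' * E.orbit_count z' \<mu>)"
  proof
    fix z assume z: "z \<in> F.cyc"
    show "\<exists>M. \<forall>\<nu> \<mu>. E.valid \<mu> \<longrightarrow> \<Psi> \<mu> \<nu> \<longrightarrow> F.orbit_count z \<nu> = (\<Sum>z'\<in>E.cyc. M z' * E.orbit_count z' \<mu>)"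
    proof (rule E.count_transfer[where \<Psi> = "\<lambda>\<nu> \<mu>. \<Psi> \<mu> \<nu>"])
      show "\<exists>w. \<Psi> (\<mu> + \<nu>) w \<and> F.orbit_count z w = F.orbit_count z x + F.orbit_count z y"
        if "\<Psi> \<mu> x" "\<Psi> \<nu> y" for x y \<mu> \<nu>
        using Padd[OF that] by (intro exI[of _ "x + y"]) simp
      show "\<Psi> (E.refined v m) x" if "v \<in> verts E" "\<Psi> {#(v, m)#} x" for x v m
        using that pE(4)[OF that(1), of m] E.valid_refined by (simp only: \<Psi>_def)
      show "F.orbit_count z x = 0" if "\<Psi> {#} x" for x using uF[OF that zero z] by (rule trans) simp
      show "\<exists>x. \<Psi> \<mu> x" if "E.valid \<mu>" for \<mu> by (rule tE[OF that])
      show "F.orbit_count z x = F.orbit_count z y" if "\<Psi> \<mu> x" "\<Psi> \<mu> y" for x y \<mu> by (rule uF[OF that z])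
    qed
  qed
  then obtain M where M0: "\<forall>z\<in>F.cyc. \<forall>\<nu> \<mu>. E.valid \<mu> \<longrightarrow> \<Psi> \<mu> \<nu> \<longrightarrow>
      F.orbit_count z \<nu> = (\<Sum>z'\<in>E.cyc. M z z' * E.orbit_count z' \<mu>)" by (rule bchoice[THEN exE])
  have M: "F.orbit_count z \<nu> = (\<Sum>z'\<in>E.cyc. M z z' * E.orbit_count z' \<mu>)"
    if "z \<in> F.cyc" "\<Psi> \<mu> \<nu>" for z \<mu> \<nu>
    by (rule M0[rule_format, OF that(1) PE[OF that(2)] that(2)])
  have NM: "(\<Sum>b\<in>F.cyc. N a b * M b a') = (if a = a' then 1 else 0)" if a: "a \<in> E.cyc" "a' \<in> E.cyc" for a a'
  proof -
    obtain \<nu> where n: "\<Psi> {#(a', 0)#} \<nu>" using tE[of "{#(a', 0)#}"] a E.cyc_in_verts by auto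
    have "F.orbit_count b \<nu> = M b a'" if "b \<in> F.cyc" for b
      using M[OF that n] E.sum_orbit_count_base[OF a(2), of "M b"] by simp
    then show ?thesis using N[OF a(1) n] a by (simp add: E.orbit_count_base eq_commute[of a])
  qed
  have MN: "(\<Sum>a\<in>E.cyc. M b a * N a b') = (if b = b' then 1 else 0)" if b: "b \<in> F.cyc" "b' \<in> F.cyc" for b b'
  proof -
    obtain \<mu> where m: "\<Psi> \<mu> {#(b', 0)#}" using tF[of "{#(b', 0)#}"] b F.cyc_in_verts by auto
    have "E.orbit_count a \<mu> = N a b'" if "a \<in> E.cyc" for a
      using N[OF that m] F.sum_orbit_count_base[OF b(2), of "N a"] by simp
    then show ?thesis using M[OF b(1) m] b by (simp add: F.orbit_count_base eq_commute[of b])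
  qed
  obtain h where h: "bij_betw h E.cyc F.cyc" "\<And>a b. a \<in> E.cyc \<Longrightarrow> b \<in> F.cyc \<Longrightarrow> N a b = (if b = h a then 1 else 0)"
    using nat_matrix_permutation[OF E.finite_cyc F.finite_cyc NM MN] by blast
  have hF: "h z \<in> F.cyc" if "z \<in> E.cyc" for z using bij_betwE[OF h(1)] that by blast
  have cnt: "E.orbit_count z \<mu> = F.orbit_count (h z) \<nu>" if z: "z \<in> E.cyc" and "\<Psi> \<mu> \<nu>" for z \<mu> \<nu>
  proof -
    have "E.orbit_count z \<mu> = (\<Sum>z'\<in>F.cyc. if z' = h z then F.orbit_count (h z) \<nu> else 0)"
      unfolding N[OF that] using h(2)[OF z] by (intro sum.cong) auto
    then show ?thesis using hF[OF z] by (simp add: sum.delta)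
  qed
  \<comment> \<open>Tested on the single pair at \<open>h (E.pre z)\<close> in degree zero: its
    count there is transported to \<open>E\<close>, turned into a count at \<open>z\<close> by the
    shift, and transported back as a count at \<open>F.pre (h z)\<close>. It is nonzero, so both
    vertices agree.\<close>
  have "h (E.pre z) = F.pre (h z)" if z: "z \<in> E.cyc" for z
  proof -
    have pz: "E.pre z \<in> E.cyc" by (rule E.pre_in_cyc[OF z])
    let ?\<nu> = "{#(h (E.pre z), 0)#}"
    obtain \<mu> where m: "\<Psi> \<mu> ?\<nu>" using tF[of ?\<nu>] hF[OF pz] F.cyc_in_verts by auto
    have "F.orbit_count (h (E.pre z)) ?\<nu> = E.orbit_count z (E.shift_type 1 \<mu>)"
      using cnt[OF pz m] E.orbit_count_pre[OF z] by simp
    also have "\<dots> = F.orbit_count (F.pre (h z)) ?\<nu>"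
      using cnt[OF z shift[OF m]] F.orbit_count_pre[OF hF[OF z]] by simp
    finally show ?thesis using F.orbit_count_base[OF hF[OF pz]] by (simp split: if_splits)
  qed
  then show ?thesis using that h(1) by blast
qed

section \<open>Twisting modules along a matching of the entryless cycles\<close>

locale cycle_match = E: leavitt E K + F: leavitt F K
  for E :: "('v, 'e) pre_digraph" and F :: "('w, 'f) pre_digraph" and K :: "'k::field itself" +
  fixes g :: "'w \<Rightarrow> 'v"
  assumes g_bij: "bij_betw g F.cyc E.cyc" and g_pre: "w \<in> F.cyc \<Longrightarrow> g (F.pre w) = E.pre (g w)"
begin

text \<open>Modules over the algebra of \<open>E\<close> are to become modules over that of
  \<open>F\<close>, so generators are substituted in the opposite direction. An arc with entryless
  head goes to the only arc into the matching vertex, and everything off the cycles goes to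
  zero.\<close>

fun tgen :: "('w, 'f) lgen \<Rightarrow> (('v, 'e) lgen word \<Rightarrow>\<^sub>0 'k)" where
  "tgen (Vert w) = (if w \<in> F.cyc then gen (Vert (g w)) else 0)"
| "tgen (Edge f) = (if head F f \<in> F.cyc then gen (Edge (E.in_arc (g (head F f)))) else 0)"
| "tgen (Ghost f) = (if head F f \<in> F.cyc then gen (Ghost (E.in_arc (g (head F f)))) else 0)"

definition tword :: "('w, 'f) lgen word \<Rightarrow> (('v, 'e) lgen word \<Rightarrow>\<^sub>0 'k)" where
  "tword w = prod_list (map tgen (letters w))"

text \<open>The extension to a unital homomorphism of free algebras. It maps 1 to 1 but the sum of
  all vertices to the sum over \<open>E.cyc\<close>, and these need not agree in the algebra of
  \<open>E\<close>.\<close>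

definition tau :: "(('w, 'f) lgen word \<Rightarrow>\<^sub>0 'k) \<Rightarrow> (('v, 'e) lgen word \<Rightarrow>\<^sub>0 'k)" where
  "tau p = (\<Sum>w\<in>Poly_Mapping.keys p. Poly_Mapping.single 0 (Poly_Mapping.lookup p w) * tword w)"

lemma g_cyc: "w \<in> F.cyc \<Longrightarrow> g w \<in> E.cyc"
  using g_bij by (auto simp: bij_betw_def)

lemma g_inject: "w \<in> F.cyc \<Longrightarrow> w' \<in> F.cyc \<Longrightarrow> g w = g w' \<longleftrightarrow> w = w'"
  using g_bij by (auto simp: bij_betw_def inj_on_def)

lemma tau_zero [simp]: "tau 0 = 0" by (simp add: tau_def)

lemma tau_add: "tau (p + q) = tau p + tau q"
  unfolding tau_def by (rule setsum_keys_plus_distrib) (auto simp: single_add distrib_right)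

lemma tau_uminus: "tau (- p) = - tau p"
  using tau_add[of "- p" p] by (simp add: eq_neg_iff_add_eq_0)

lemma tau_diff: "tau (p - q) = tau p - tau q"
  using tau_add[of p "- q"] by (simp add: tau_uminus)

lemma tau_sum: "tau (sum f S) = (\<Sum>i\<in>S. tau (f i))"
  by (induction S rule: infinite_finite_induct) (auto simp: tau_add)

lemma tau_single: "tau (Poly_Mapping.single w c) = Poly_Mapping.single 0 c * tword w"
  by (simp add: tau_def)

lemma tword_plus: "tword (u + w) = tword u * tword w"
  by (simp add: tword_def plus_word_def)

lemma tau_mult: "tau (p * q) = tau p * tau q"
proof (induction p rule: poly_induct)
  case (add u a p)
  have "tau (Poly_Mapping.single u a * q) = tau (Poly_Mapping.single u a) * tau q"
  proof (induction q rule: poly_induct)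
    case (add w b q)
    have "tau (Poly_Mapping.single u a * Poly_Mapping.single w b) =
        tau (Poly_Mapping.single u a) * tau (Poly_Mapping.single w b)"
    proof -
      have "tau (Poly_Mapping.single u a * Poly_Mapping.single w b) =
          Poly_Mapping.single 0 a * (Poly_Mapping.single 0 b * (tword u * tword w))"
        by (simp add: mult_single tau_single tword_plus flip: mult.assoc)
      also have "\<dots> = Poly_Mapping.single 0 a * (tword u * (Poly_Mapping.single 0 b * tword w))"
        by (simp only: scalar_left_commute[of "tword u"])
      finally show ?thesis by (simp add: tau_single mult.assoc)
    qed
    then show ?case using add by (simp add: distrib_left tau_add)
  qed simp
  then show ?case using add by (simp add: distrib_right tau_add)
qed simp

lemma tau_gen [simp]: "tau (gen a) = tgen a"
  by (simp add: gen_def tau_single tword_def single_one)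

lemma tau_scalar [simp]: "tau (Poly_Mapping.single 0 c) = Poly_Mapping.single 0 c"
  by (simp add: tau_single tword_def zero_word_def)

lemma tau_one [simp]: "tau 1 = 1"
  using tau_scalar[of 1] by simp

lemma in_arc_g: "w \<in> F.cyc \<Longrightarrow> E.in_arc (g w) \<in> arcs E" "w \<in> F.cyc \<Longrightarrow> head E (E.in_arc (g w)) = g w"
  "w \<in> F.cyc \<Longrightarrow> tail E (E.in_arc (g w)) = g (F.pre w)"
  using E.in_arc_cyc[OF g_cyc] g_pre by auto

lemma tgen_carrier: "tgen a \<in> carrier E.FA"
  using g_cyc E.cyc_in_verts in_arc_g by (cases a) auto

lemma tau_carrier [simp]: "tau p \<in> carrier E.FA"
proof -
  have "prod_list (map tgen as) \<in> carrier E.FA" for as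
    by (induction as) (auto simp: tgen_carrier)
  then show ?thesis unfolding tau_def tword_def by (intro fa_sum fa_mult) auto
qed

lemma homog_tau: assumes "homog n p" shows "homog n (tau p)"
proof -
  have g: "homog (letter_degree a) (tgen a)" for a by (cases a) (auto intro: homog_gen)
  have "homog (sum_list (map letter_degree as)) (prod_list (map tgen as))" for as
    by (induction as) (auto intro: homog_mult[OF g])
  then have "homog n (Poly_Mapping.single 0 (Poly_Mapping.lookup p w) * tword w)" if "w \<in> Poly_Mapping.keys p" for w
    using assms that by (intro homog_mult[OF homog_scalar, of n]) (auto simp: tword_def homog_def word_degree_def)
  then show ?thesis unfolding tau_def by (intro homog_sum)
qed

definition supported :: "((('v, 'e) lgen word \<Rightarrow>\<^sub>0 'k) set, 'u, 'z) rmodule_scheme \<Rightarrow> bool" where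
  "supported M \<longleftrightarrow> right_module E.LA M \<and>
     (\<forall>x\<in>carrier M. \<forall>v\<in>verts E - E.cyc. E.act M x (gen (Vert v)) = \<zero>\<^bsub>M\<^esub>)"

text \<open>Most relations go to zero or into the ideal of \<open>E\<close>. The exceptions are the
  sum relation at an entryless vertex, whose image misses the exits of the cycle, and the unit
  relation, whose image misses the vertices off the cycles. What is missing acts as zero on a
  supported module.\<close>

lemma tau_relation:
  fixes M :: "((('v, 'e) lgen word \<Rightarrow>\<^sub>0 'k) set, 'u, 'z) rmodule_scheme"
    and p :: "('w, 'f) lgen word \<Rightarrow>\<^sub>0 'k"
  assumes M: "supported M" and x: "x \<in> carrier M" and p: "p \<in> leavitt_relations F"
  shows "E.act M x (tau p) = \<zero>\<^bsub>M\<^esub>"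
proof -
  have rM: "right_module E.LA M" using M by (simp add: supported_def)
  interpret M: abelian_group M by (rule E.module_abelian_group[OF rM])
  have off: "E.act M y (gen (Vert v)) = \<zero>\<^bsub>M\<^esub>" if "y \<in> carrier M" "v \<in> verts E" "v \<notin> E.cyc" for y v
    using M that by (simp add: supported_def)
  note act = E.act_closed[OF rM] E.act_mult[OF rM] E.act_cong[OF rM]
  have L: ?thesis if "tau p \<in> E.LI" using that by (rule E.act_LI[OF rM x])
  have c: "g w \<in> verts E" if "w \<in> F.cyc" for w using E.cyc_in_verts[OF g_cyc[OF that]] .
  have LI: "a - b \<in> E.LI" if "E.cong a b" for a b using that by (simp add: E.cong_def)
  have ht: "tail F f \<in> F.cyc" "tail F f = F.pre (head F f)" if "f \<in> arcs F" "head F f \<in> F.cyc" for f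
    using F.head_in_cyc[OF that] by auto
  consider (VV) v w where "v \<in> verts F" "w \<in> verts F" "p = F.vx v * F.vx w - (if v = w then F.vx v else 0)"
    | (VX) e where "e \<in> arcs F" "p = F.vx (tail F e) * F.ed e - F.ed e"
    | (XV) e where "e \<in> arcs F" "p = F.ed e * F.vx (head F e) - F.ed e"
    | (VY) e where "e \<in> arcs F" "p = F.vx (head F e) * F.gh e - F.gh e"
    | (YV) e where "e \<in> arcs F" "p = F.gh e * F.vx (tail F e) - F.gh e"
    | (YX) e f where "e \<in> arcs F" "f \<in> arcs F" "p = F.gh e * F.ed f - (if e = f then F.vx (head F e) else 0)"
    | (CK) v where "v \<in> verts F" "p = (\<Sum>e\<in>out_arcs F v. F.ed e * F.gh e) - F.vx v"
    | (one) "p = (\<Sum>v\<in>verts F. F.vx v) - 1"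
    using p unfolding leavitt_relations_def F.is_regular_iff by blast
  then show ?thesis
  proof cases
    case VV
    show ?thesis
    proof (cases "v \<in> F.cyc \<and> w \<in> F.cyc")
      case True
      then show ?thesis using LI[OF E.VV[OF c c, of v w]] VV g_inject[of v w]
        by (intro L) (auto simp: tau_diff tau_mult split: if_splits)
    next
      case False
      then show ?thesis using VV by (intro L) (auto simp: tau_diff tau_mult)
    qed
  next
    case VX
    then show ?thesis using LI[OF E.VX[OF in_arc_g(1)], of "head F e"] in_arc_g(3)[of "head F e"] ht[of e]
      by (intro L) (auto simp: tau_diff tau_mult)
  next
    case XV
    then show ?thesis using LI[OF E.XV[OF in_arc_g(1)], of "head F e"] in_arc_g(2)[of "head F e"]
      by (intro L) (auto simp: tau_diff tau_mult)
  next
    case VY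
    then show ?thesis using LI[OF E.VY[OF in_arc_g(1)], of "head F e"] in_arc_g(2)[of "head F e"]
      by (intro L) (auto simp: tau_diff tau_mult)
  next
    case YV
    then show ?thesis using LI[OF E.YV[OF in_arc_g(1)], of "head F e"] in_arc_g(3)[of "head F e"] ht[of e]
      by (intro L) (auto simp: tau_diff tau_mult)
  next
    case YX
    show ?thesis
    proof (cases "head F e \<in> F.cyc \<and> head F f \<in> F.cyc")
      case True
      have "E.in_arc (g (head F e)) = E.in_arc (g (head F f)) \<longleftrightarrow> e = f"
        using True in_arc_g(2)[of "head F e"] in_arc_g(2)[of "head F f"] g_inject[of "head F e" "head F f"]
          F.head_in_cyc(1)[OF YX(1)] F.head_in_cyc(1)[OF YX(2)] by metis
      then show ?thesis
        using True YX LI[OF E.YX[OF in_arc_g(1) in_arc_g(1), of "head F e" "head F f"]] in_arc_g(2)[of "head F e"]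
        by (intro L) (auto simp: tau_diff tau_mult split: if_splits)
    next
      case False
      then show ?thesis using YX by (intro L) (auto simp: tau_diff tau_mult)
    qed
  next
    case CK
    show ?thesis
    proof (cases "v \<in> F.cyc")
      case False
      then have "head F e \<notin> F.cyc" if "e \<in> out_arcs F v" for e using ht[of e] that by auto
      then have "tau p = 0" using False CK by (simp add: tau_diff tau_mult tau_sum)
      then show ?thesis by (intro L) simp
    next
      case True
      \<comment> \<open>The vertex after \<open>v\<close> on its cycle; the arc into
        \<open>u\<close> is the only arc leaving \<open>v\<close> that is not sent to zero.\<close>
      obtain u where u: "u \<in> F.cyc" "F.pre u = v" using F.pre_image_cyc True by (metis imageE)
      let ?e = "F.in_arc u" and ?a = "E.in_arc (g u)"
      have e: "?e \<in> out_arcs F v" "head F ?e = u" using F.in_arc_cyc[OF u(1)] u(2) by auto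
      have tz: "tau (F.ed f * F.gh f) = (if f = ?e then E.ed ?a * E.gh ?a else 0)" if "f \<in> out_arcs F v" for f
      proof (cases "f = ?e")
        case True
        then show ?thesis using e u by (simp add: tau_mult)
      next
        case ne: False
        have "head F f \<notin> F.cyc"
        proof
          assume hc: "head F f \<in> F.cyc"
          then have "F.pre (head F f) = F.pre u" using ht[of f] that u by auto
          then have "head F f = u" using F.pre_inject[OF hc u(1)] by simp
          then show False using F.head_in_cyc(1)[of f] hc that ne by auto
        qed
        then show ?thesis using ne by (simp add: tau_mult)
      qed
      have "(\<Sum>f\<in>out_arcs F v. tau (F.ed f * F.gh f)) = (\<Sum>f\<in>out_arcs F v. if f = ?e then E.ed ?a * E.gh ?a else 0)"
        using tz by (intro sum.cong) auto
      then have t: "tau p = E.ed ?a * E.gh ?a - E.vx (g v)"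
        using CK True e(1) by (simp add: tau_diff tau_sum sum.delta)
      have gv: "g v \<in> verts E" by (rule c[OF True])
      have a: "?a \<in> out_arcs E (g v)" using in_arc_g[OF u(1)] u(2) by simp
      have "E.act M x (E.vx (g v)) = E.act M x (\<Sum>f\<in>out_arcs E (g v). E.ed f * E.gh f)"
        by (rule act(3)[OF E.cong_sym[OF E.sum_XY[OF gv]]])
      also have "\<dots> = (\<Oplus>\<^bsub>M\<^esub>f\<in>out_arcs E (g v). E.act M x (E.ed f * E.gh f))"
        by (rule E.act_sum[OF rM x]) auto
      also have "\<dots> = (\<Oplus>\<^bsub>M\<^esub>f\<in>out_arcs E (g v). if f = ?a then E.act M x (E.ed ?a * E.gh ?a) else \<zero>\<^bsub>M\<^esub>)"
      proof (rule M.finsum_cong'[OF refl])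
        fix f assume f: "f \<in> out_arcs E (g v)"
        show "E.act M x (E.ed f * E.gh f) = (if f = ?a then E.act M x (E.ed ?a * E.gh ?a) else \<zero>\<^bsub>M\<^esub>)"
        proof (cases "f = ?a")
          case ne: False
          have fa: "f \<in> arcs E" using f by simp
          \<comment> \<open>A head on a cycle would have the predecessor \<open>g v\<close>, as
            \<open>g u\<close> has, and hence be \<open>g u\<close>. So the other arcs leaving
            \<open>g v\<close> act as zero on \<open>M\<close>.\<close>
          have "head E f \<notin> E.cyc"
          proof
            assume hc: "head E f \<in> E.cyc"
            then have "E.pre (head E f) = E.pre (g u)" using E.head_in_cyc[OF fa hc] f g_pre[OF u(1)] u(2) by auto
            then have "head E f = g u" using E.pre_inject[OF hc g_cyc[OF u(1)]] by simp
            then show False using E.head_in_cyc(1)[OF fa hc] ne by simp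
          qed
          then have "E.act M (E.act M x (E.ed f)) (E.vx (head E f)) = \<zero>\<^bsub>M\<^esub>"
            using fa x by (intro off act(1)) auto
          moreover have "E.act M x (E.ed f * E.gh f) = E.act M x (E.ed f * E.vx (head E f) * E.gh f)"
            by (rule act(3)) (use fa in \<open>auto intro!: E.cong_mult_right E.cong_sym[OF E.XV]\<close>)
          ultimately show ?thesis
            using ne fa x act(2)[of x "E.ed f * E.vx (head E f)" "E.gh f"] act(2)[of x "E.ed f" "E.vx (head E f)"]
            by (simp add: E.act_zero_left[OF rM])
        qed simp
      qed (use x a in \<open>auto intro!: act(1)\<close>)
      also have "\<dots> = E.act M x (E.ed ?a * E.gh ?a)"
        using a x by (intro M.finsum_single) (auto intro!: act(1))
      finally have eq: "E.act M x (E.vx (g v)) = E.act M x (E.ed ?a * E.gh ?a)" .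
      have m: "E.act M x (E.ed ?a * E.gh ?a) \<in> carrier M" using a x by (intro act(1)) auto
      have "E.act M x (tau p) = E.act M x (E.ed ?a * E.gh ?a) \<oplus>\<^bsub>M\<^esub> E.act M x (- E.vx (g v))"
        unfolding t using a x gv E.act_add[OF rM x, of "E.ed ?a * E.gh ?a" "- E.vx (g v)"] by simp
      also have "\<dots> = \<zero>\<^bsub>M\<^esub>"
        using E.act_uminus[OF rM x, of "E.vx (g v)"] gv m eq by (simp add: M.r_neg)
      finally show ?thesis .
    qed
  next
    case one
    have "(\<Sum>v\<in>verts F. tau (F.vx v)) = (\<Sum>v\<in>F.cyc. E.vx (g v))"
      by (rule sum.mono_neutral_cong_right) (auto simp: F.cyc_in_verts)
    also have "\<dots> = (\<Sum>u\<in>E.cyc. E.vx u)" using g_bij by (rule sum.reindex_bij_betw)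
    finally have t: "tau p = (\<Sum>u\<in>E.cyc. E.vx u) - 1" by (simp add: one tau_diff tau_sum del: tau_gen)
    have s: "(\<Sum>u\<in>E.cyc. E.vx u) \<in> carrier E.FA" by (intro fa_sum) (auto simp: E.cyc_in_verts)
    have "x = (\<Oplus>\<^bsub>M\<^esub>v\<in>verts E. E.act M x (E.vx v))" by (rule E.vertex_decomposition[OF rM x])
    also have "\<dots> = (\<Oplus>\<^bsub>M\<^esub>u\<in>E.cyc. E.act M x (E.vx u))"
      by (rule M.add.finprod_mono_neutral_cong_right)
        (use off[OF x] x E.cyc_in_verts in \<open>auto intro!: act(1)\<close>)
    also have "\<dots> = E.act M x (\<Sum>u\<in>E.cyc. E.vx u)"
      by (rule E.act_sum[OF rM x, symmetric]) (auto simp: E.cyc_in_verts)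
    finally have eq: "E.act M x (\<Sum>u\<in>E.cyc. E.vx u) = x" by simp
    show ?thesis
      unfolding t using E.act_add[OF rM x s, of "- 1"] E.act_uminus[OF rM x, of 1] E.act_one[OF rM x] eq x
      by (simp add: M.r_neg)
  qed
qed

lemma tau_LI:
  fixes M :: "((('v, 'e) lgen word \<Rightarrow>\<^sub>0 'k) set, 'u, 'z) rmodule_scheme"
  assumes M: "supported M" and x: "x \<in> carrier M" and p: "p \<in> F.LI"
  shows "E.act M x (tau p) = \<zero>\<^bsub>M\<^esub>"
proof -
  have rM: "right_module E.LA M" using M by (simp add: supported_def)
  interpret M: abelian_group M by (rule E.module_abelian_group[OF rM])
  have "F.LI \<subseteq> {p \<in> carrier F.FA. \<forall>x\<in>carrier M. E.act M x (tau p) = \<zero>\<^bsub>M\<^esub>}"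
  proof (rule F.LI_minimal)
    show "leavitt_relations F \<subseteq> {p \<in> carrier F.FA. \<forall>x\<in>carrier M. E.act M x (tau p) = \<zero>\<^bsub>M\<^esub>}"
      using F.relations_carrier tau_relation[OF M] by auto
  qed (auto simp: tau_add tau_mult E.act_add[OF rM] E.act_mult[OF rM] E.act_zero_left[OF rM] E.act_zero[OF rM] E.act_closed[OF rM])
  then show ?thesis using x p by auto
qed

text \<open>On a supported module the choice of the representative is immaterial, by
  \<open>tau_LI\<close>.\<close>

definition twist_act :: "((('v, 'e) lgen word \<Rightarrow>\<^sub>0 'k) set, 'u, 'z) rmodule_scheme \<Rightarrow> 'u \<Rightarrow>
    (('w, 'f) lgen word \<Rightarrow>\<^sub>0 'k) set \<Rightarrow> 'u" where
  "twist_act M x r = E.act M x (tau (SOME p. p \<in> carrier F.FA \<and> F.proj p = r))"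

lemma twist_act_proj:
  fixes M :: "((('v, 'e) lgen word \<Rightarrow>\<^sub>0 'k) set, 'u, 'z) rmodule_scheme"
  assumes M: "supported M" and x: "x \<in> carrier M" and p: "p \<in> carrier F.FA"
  shows "twist_act M x (F.proj p) = E.act M x (tau p)"
proof -
  have rM: "right_module E.LA M" using M by (simp add: supported_def)
  interpret M: abelian_group M by (rule E.module_abelian_group[OF rM])
  define q where "q = (SOME q. q \<in> carrier F.FA \<and> F.proj q = F.proj p)"
  have q: "q \<in> carrier F.FA" "F.proj q = F.proj p"
    using someI[of "\<lambda>q. q \<in> carrier F.FA \<and> F.proj q = F.proj p" p] p unfolding q_def by auto
  then have "q - p \<in> F.LI" using F.proj_eq_iff[OF q(1) p] by (simp add: F.cong_def)
  then have z: "E.act M x (tau (q - p)) = \<zero>\<^bsub>M\<^esub>" by (rule tau_LI[OF M x])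
  have "E.act M x (tau q) = E.act M x (tau (q - p) + tau p)" by (simp add: tau_diff)
  also have "\<dots> = E.act M x (tau (q - p)) \<oplus>\<^bsub>M\<^esub> E.act M x (tau p)" by (rule E.act_add[OF rM x]) simp_all
  also have "\<dots> = E.act M x (tau p)" using z x by (simp add: E.act_closed[OF rM])
  finally show ?thesis by (simp add: twist_act_def q_def)
qed

text \<open>Only the action changes. With carrier and addition kept, homomorphisms retain their
  underlying maps and the module stays in the universe.\<close>

definition twist :: "((('v, 'e) lgen word \<Rightarrow>\<^sub>0 'k) set, 'u) rmodule \<Rightarrow> ((('w, 'f) lgen word \<Rightarrow>\<^sub>0 'k) set, 'u) rmodule" where
  "twist M = \<lparr>carrier = carrier M, monoid.mult = monoid.mult M, one = one M, ring.zero = ring.zero M, add = add M,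
     ract = twist_act M\<rparr>"

definition gtwist :: "((('v, 'e) lgen word \<Rightarrow>\<^sub>0 'k) set, 'u) gmodule \<Rightarrow> ((('w, 'f) lgen word \<Rightarrow>\<^sub>0 'k) set, 'u) gmodule" where
  "gtwist M = \<lparr>carrier = carrier M, monoid.mult = monoid.mult M, one = one M, ring.zero = ring.zero M, add = add M,
     ract = twist_act M, gcomp = gcomp M\<rparr>"

text \<open>Covers \<open>twist\<close> and \<open>gtwist\<close> at once, which produce different
  record types.\<close>

definition is_twist :: "((('w, 'f) lgen word \<Rightarrow>\<^sub>0 'k) set, 'u, 'y) rmodule_scheme \<Rightarrow>
    ((('v, 'e) lgen word \<Rightarrow>\<^sub>0 'k) set, 'u, 'z) rmodule_scheme \<Rightarrow> bool" where
  "is_twist N M \<longleftrightarrow> supported M \<and> carrier N = carrier M \<and> ring.zero N = ring.zero M \<and> add N = add M \<and> ract N = twist_act M"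

lemma is_twist_twist: "supported M \<Longrightarrow> is_twist (twist M) M"
  by (simp add: is_twist_def twist_def)

lemma is_twist_gtwist: "supported M \<Longrightarrow> is_twist (gtwist M) M"
  by (simp add: is_twist_def gtwist_def)

context
  fixes M :: "((('v, 'e) lgen word \<Rightarrow>\<^sub>0 'k) set, 'u, 'z) rmodule_scheme"
    and N :: "((('w, 'f) lgen word \<Rightarrow>\<^sub>0 'k) set, 'u, 'y) rmodule_scheme"
  assumes tw: "is_twist N M"
begin

lemma twist_supported: "supported M" and twist_sel: "carrier N = carrier M" "ring.zero N = ring.zero M" "add N = add M"
  using tw by (auto simp: is_twist_def)

lemma twist_rM: "right_module E.LA M" using twist_supported by (simp add: supported_def)

lemma twist_act: "x \<in> carrier M \<Longrightarrow> p \<in> carrier F.FA \<Longrightarrow> F.act N x p = E.act M x (tau p)"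
  using tw twist_act_proj[of M x p] by (simp add: is_twist_def)

lemma twist_finsum: "finsum N f A = finsum M f A"
  by (simp add: finsum_def finprod_def twist_sel)

lemma twist_right_module: "right_module F.LA N"
proof (rule F.right_moduleI)
  note rM = twist_rM
  interpret M: abelian_group M by (rule E.module_abelian_group[OF rM])
  show "abelian_group N"
  proof (rule abelian_groupI)
    show "\<exists>y\<in>carrier N. y \<oplus>\<^bsub>N\<^esub> x = \<zero>\<^bsub>N\<^esub>" if "x \<in> carrier N" for x
      using that by (intro bexI[of _ "\<ominus>\<^bsub>M\<^esub> x"]) (auto simp: twist_sel M.l_neg)
  qed (auto simp: twist_sel M.a_assoc intro: M.a_comm)
qed (simp_all add: twist_sel twist_act tau_add tau_mult E.act_closed[OF twist_rM] E.act_add_left[OF twist_rM]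
    E.act_add[OF twist_rM] E.act_mult[OF twist_rM] E.act_one[OF twist_rM]
    abelian_monoid.a_closed[OF abelian_group.axioms(1)[OF E.module_abelian_group[OF twist_rM]]])

text \<open>\<open>tau\<close> fixes the scalars, so both vector space structures agree and a
  spanning set remains one.\<close>

lemma twist_fin_dim: assumes "V \<subseteq> carrier M" "fin_dim E.LA M V" shows "fin_dim F.LA N V"
proof -
  interpret M: abelian_group M by (rule E.module_abelian_group[OF twist_rM])
  obtain B where B: "finite B" "B \<subseteq> V" "\<And>x. x \<in> V \<Longrightarrow> \<exists>c :: 'u \<Rightarrow> 'k. x = (\<Oplus>\<^bsub>M\<^esub>b\<in>B. E.act M b (E.scl (c b)))"
    using assms(2) unfolding fin_dim_def E.scal_LA by blast
  have b: "b \<in> carrier M" if "b \<in> B" for b using B(2) assms(1) that by auto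
  have eq: "(\<Oplus>\<^bsub>N\<^esub>b\<in>B. F.act N b (F.scl (c b))) = (\<Oplus>\<^bsub>M\<^esub>b\<in>B. E.act M b (E.scl (c b)))" for c :: "'u \<Rightarrow> 'k"
    unfolding twist_finsum using b by (intro M.finsum_cong') (auto simp: twist_act intro!: E.act_closed[OF twist_rM])
  have "\<exists>c :: 'u \<Rightarrow> 'k. x = (\<Oplus>\<^bsub>N\<^esub>b\<in>B. F.act N b (F.scl (c b)))" if "x \<in> V" for x
    using B(3)[OF that] by (simp only: eq)
  then show ?thesis unfolding fin_dim_def F.scal_LA using B(1,2) by blast
qed

end

lemma twist_hom:
  assumes M: "is_twist M' M" and N: "is_twist N' N" and f: "f \<in> rmod_hom E.LA M N"
  shows "f \<in> rmod_hom F.LA M' N'"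
proof (rule F.rmod_homI)
  note s = twist_sel[OF M] twist_sel[OF N]
  show "f \<in> extensional (carrier M')" using f s by (auto simp: rmod_hom_def PiE_def)
  show "f x \<in> carrier N'" if "x \<in> carrier M'" for x using E.hom_closed[OF f] that s by simp
  show "f (x \<oplus>\<^bsub>M'\<^esub> y) = f x \<oplus>\<^bsub>N'\<^esub> f y" if "x \<in> carrier M'" "y \<in> carrier M'" for x y
    using E.hom_add[OF f, of x y] that s by simp
  show "f (F.act M' x p) = F.act N' (f x) p" if "x \<in> carrier M'" "p \<in> carrier F.FA" for x p
    using E.hom_act[OF f, of x "tau p"] E.hom_closed[OF f, of x] that s twist_act[OF M, of x p] twist_act[OF N, of "f x" p]
    by simp
qed

lemma gtwist_sel [simp]: "carrier (gtwist M) = carrier M" "gcomp (gtwist M) = gcomp M"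
  by (simp_all add: gtwist_def)

lemma twist_carrier [simp]: "carrier (twist M) = carrier M"
  by (simp add: twist_def)

lemma gtwist_graded:
  assumes M: "supported M" and gM: "graded_module E.LA M"
  shows "graded_module F.LA (gtwist M)"
proof (rule F.graded_moduleI)
  note tw = is_twist_gtwist[OF M]
  note s = twist_sel[OF tw] and fs = twist_finsum[OF tw]
  show "right_module F.LA (gtwist M)" by (rule twist_right_module[OF tw])
  show "\<exists>D c. finite D \<and> (\<forall>i. c i \<in> gcomp (gtwist M) i) \<and> x = (\<Oplus>\<^bsub>gtwist M\<^esub>i\<in>D. c i)"
    if "x \<in> carrier (gtwist M)" for x
  proof -
    have x: "x \<in> carrier M" using that by simp
    obtain D c where "finite D" "\<And>i. c i \<in> gcomp M i" "x = (\<Oplus>\<^bsub>M\<^esub>i\<in>D. c i)"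
      using E.gcomp_decomposition[OF gM x] by blast
    then show ?thesis unfolding fs by (intro exI[of _ D] exI[of _ c]) simp
  qed
  show "c i = \<zero>\<^bsub>gtwist M\<^esub>"
    if "finite D" "\<And>i. c i \<in> gcomp (gtwist M) i" "(\<Oplus>\<^bsub>gtwist M\<^esub>i\<in>D. c i) = \<zero>\<^bsub>gtwist M\<^esub>" "i \<in> D" for D c i
    using E.gcomp_independent[OF gM that(1), of c i] that unfolding fs by (simp add: s)
  show "F.act (gtwist M) x p \<in> gcomp (gtwist M) (i + j)"
    if "x \<in> gcomp (gtwist M) i" "p \<in> carrier F.FA" "homog j p" for i j x p
    using twist_act[OF tw, of x p] E.gcomp_act[OF gM, of x i "tau p" j] E.gcomp_carrier[OF gM] that homog_tau by simp
  show "gcomp (gtwist M) i \<subseteq> carrier (gtwist M)" for i using E.gcomp_carrier[OF gM] by auto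
  show "\<zero>\<^bsub>gtwist M\<^esub> \<in> gcomp (gtwist M) i" for i using E.gcomp_zero[OF gM] by (simp add: s)
  show "x \<oplus>\<^bsub>gtwist M\<^esub> y \<in> gcomp (gtwist M) i" if "x \<in> gcomp (gtwist M) i" "y \<in> gcomp (gtwist M) i" for i x y
    using E.gcomp_add[OF gM] that by (simp add: s)
qed

lemma gtwist_hom:
  assumes "supported M" "supported N" "f \<in> gr_hom E.LA M N"
  shows "f \<in> gr_hom F.LA (gtwist M) (gtwist N)"
  using twist_hom[OF is_twist_gtwist[OF assms(1)] is_twist_gtwist[OF assms(2)] E.gr_homD(1)[OF assms(3)]] assms(3)
  by (auto simp: gr_hom_def)

text \<open>An equality, and not just an isomorphism, since the shift touches only the grading and
  the twist only the action.\<close>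

lemma gtwist_shift: "gtwist (shift n M) = shift n (gtwist M)"
proof -
  have "twist_act (shift n M) = twist_act M" by (simp add: twist_act_def fun_eq_iff)
  then show ?thesis by (simp add: gtwist_def shift_def)
qed

end

lemma cycle_match_inverse:
  fixes E :: "('v, 'e) pre_digraph" and F :: "('w, 'f) pre_digraph"
  assumes "cycle_match E F g"
  shows "cycle_match F E (inv_into (leavitt_graph.cyc F) g)"
proof -
  \<comment> \<open>Cycles and predecessors belong to the graphs alone; any field, here
    \<open>rat\<close>, gives access to them.\<close>
  interpret cycle_match E F "TYPE(rat)" g by fact
  have b: "bij_betw (inv_into F.cyc g) E.cyc F.cyc" by (rule bij_betw_inv_into[OF g_bij])
  show ?thesis
  proof
    show "bij_betw (inv_into F.cyc g) E.cyc F.cyc" by (rule b)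
    fix v assume v: "v \<in> E.cyc"
    obtain w where w: "w \<in> F.cyc" "v = g w" using v g_bij by (auto simp: bij_betw_def)
    have "inv_into F.cyc g (E.pre v) = inv_into F.cyc g (g (F.pre w))" using g_pre[OF w(1)] w(2) by simp
    also have "\<dots> = F.pre w" by (rule bij_betw_inv_into_left[OF g_bij F.pre_in_cyc[OF w(1)]])
    also have "\<dots> = F.pre (inv_into F.cyc g v)" using bij_betw_inv_into_left[OF g_bij w(1)] w(2) by simp
    finally show "inv_into F.cyc g (E.pre v) = F.pre (inv_into F.cyc g v)" .
  qed
qed

section \<open>The round trip of the substitutions\<close>

locale cycle_match_inv = A: cycle_match E F K g + B: cycle_match F E K g'
  for E :: "('v, 'e) pre_digraph" and F :: "('w, 'f) pre_digraph" and K :: "'k::field itself" and g g' +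
  assumes inverse: "v \<in> A.E.cyc \<Longrightarrow> g (g' v) = v"
begin

context
  fixes M :: "((('v, 'e) lgen word \<Rightarrow>\<^sub>0 'k) set, 'u, 'z) rmodule_scheme"
  assumes M: "A.supported M"
begin

lemma supported_right_module: "right_module A.E.LA M"
  using M by (simp add: A.supported_def)

text \<open>The double substitution returns the generators at entryless vertices. The others it
  kills, and these act as zero on a supported module anyway, because an arc or ghost arc factors
  through the vertex at its head.\<close>

lemma act_tgen_tgen:
  assumes x: "x \<in> carrier M" and a: "a \<in> leavitt_gens E"
  shows "A.E.act M x (A.tau (B.tgen a)) = A.E.act M x (gen a)"
proof -
  note rM = supported_right_module
  have off: "A.E.act M y (gen (Vert v)) = \<zero>\<^bsub>M\<^esub>" if "y \<in> carrier M" "v \<in> verts E" "v \<notin> A.E.cyc" for y v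
    using M that by (simp add: A.supported_def)
  note act = A.E.act_closed[OF rM] A.E.act_mult[OF rM] A.E.act_cong[OF rM]
  have zero: "A.E.act M x 0 = \<zero>\<^bsub>M\<^esub>" by (rule A.E.act_zero[OF rM x])
  show ?thesis
  proof (cases a)
    case (Vert v)
    then show ?thesis using a off[OF x, of v] zero B.g_cyc[of v] inverse[of v] by auto
  next
    case (Edge e)
    then have e: "e \<in> arcs E" using a by simp
    show ?thesis
    proof (cases "head E e \<in> A.E.cyc")
      case True
      then show ?thesis
        using Edge B.in_arc_g(2)[OF True] B.g_cyc[OF True] inverse[OF True] A.E.head_in_cyc(1)[OF e True] by simp
    next
      case False
      have "A.E.act M x (gen (Edge e)) = A.E.act M x (gen (Edge e) * gen (Vert (head E e)))"
        by (rule act(3)[OF A.E.cong_sym[OF A.E.XV[OF e]]])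
      also have "\<dots> = A.E.act M (A.E.act M x (gen (Edge e))) (gen (Vert (head E e)))"
        using x e by (intro act(2)) auto
      also have "\<dots> = \<zero>\<^bsub>M\<^esub>" using x e False by (intro off act(1)) auto
      finally show ?thesis using Edge False zero by simp
    qed
  next
    case (Ghost e)
    then have e: "e \<in> arcs E" using a by simp
    show ?thesis
    proof (cases "head E e \<in> A.E.cyc")
      case True
      then show ?thesis
        using Ghost B.in_arc_g(2)[OF True] B.g_cyc[OF True] inverse[OF True] A.E.head_in_cyc(1)[OF e True] by simp
    next
      case False
      have "A.E.act M x (gen (Ghost e)) = A.E.act M x (gen (Vert (head E e)) * gen (Ghost e))"
        by (rule act(3)[OF A.E.cong_sym[OF A.E.VY[OF e]]])
      also have "\<dots> = A.E.act M (A.E.act M x (gen (Vert (head E e)))) (gen (Ghost e))"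
        using x e by (intro act(2)) auto
      also have "\<dots> = \<zero>\<^bsub>M\<^esub>" using off[OF x _ False] e by (simp add: A.E.act_zero_left[OF rM])
      finally show ?thesis using Ghost False zero by simp
    qed
  qed
qed

text \<open>Words are treated letter by letter, with the module element generalized because each
  letter replaces it by its image.\<close>

lemma act_tau_tau:
  assumes x: "x \<in> carrier M" and p: "p \<in> carrier A.E.FA"
  shows "A.E.act M x (A.tau (B.tau p)) = A.E.act M x p"
proof -
  note rM = supported_right_module
  note act = A.E.act_closed[OF rM] A.E.act_mult[OF rM]
  have word: "Poly_Mapping.single (Word as) 1 \<in> carrier A.E.FA \<and>
      A.E.act M y (A.tau (prod_list (map B.tgen as))) = A.E.act M y (Poly_Mapping.single (Word as) 1)"
    if "set as \<subseteq> leavitt_gens E" "y \<in> carrier M" for as y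
    using that
  proof (induction as arbitrary: y)
    case Nil
    then show ?case by (simp flip: zero_word_def single_one)
  next
    case (Cons a as)
    have s: "Poly_Mapping.single (Word (a # as)) (1::'k) = gen a * Poly_Mapping.single (Word as) 1"
      by (simp add: gen_def mult_single plus_word_def)
    have a: "gen a \<in> carrier A.E.FA" using Cons.prems by simp
    have ya: "A.E.act M y (gen a) \<in> carrier M" by (rule act(1)[OF Cons.prems(2) a])
    have IH: "Poly_Mapping.single (Word as) 1 \<in> carrier A.E.FA"
        "A.E.act M (A.E.act M y (gen a)) (A.tau (prod_list (map B.tgen as))) =
         A.E.act M (A.E.act M y (gen a)) (Poly_Mapping.single (Word as) 1)"
      using Cons.IH[OF _ ya] Cons.prems(1) by auto
    have "A.E.act M y (A.tau (prod_list (map B.tgen (a # as)))) =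
        A.E.act M (A.E.act M y (A.tau (B.tgen a))) (A.tau (prod_list (map B.tgen as)))"
      using act(2)[OF Cons.prems(2), of "A.tau (B.tgen a)" "A.tau (prod_list (map B.tgen as))"]
      by (simp add: A.tau_mult)
    also have "\<dots> = A.E.act M (A.E.act M y (gen a)) (Poly_Mapping.single (Word as) 1)"
      using act_tgen_tgen[OF Cons.prems(2), of a] Cons.prems(1) IH(2) by simp
    also have "\<dots> = A.E.act M y (gen a * Poly_Mapping.single (Word as) 1)"
      by (rule act(2)[OF Cons.prems(2) a IH(1), symmetric])
    finally show ?case unfolding s using a IH(1) by simp
  qed
  from p show ?thesis
  proof (induction p rule: poly_word_induct)
    case zero
    then show ?case using x by (simp add: A.tau_zero B.tau_zero)
  next
    case (add w c q)
    have xc: "A.E.act M x (A.E.scl c) \<in> carrier M" using x by (intro act(1)) simp_all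
    note wd = word[OF add(1) xc, unfolded word.collapse]
    have "A.E.act M x (A.tau (B.tau (Poly_Mapping.single w c))) =
        A.E.act M (A.E.act M x (A.E.scl c)) (A.tau (B.tword w))"
      using act(2)[OF x, of "A.E.scl c" "A.tau (B.tword w)"]
      by (simp add: B.tau_single A.tau_mult A.tau_scalar)
    also have "\<dots> = A.E.act M (A.E.act M x (A.E.scl c)) (Poly_Mapping.single w 1)"
      using wd by (simp add: B.tword_def)
    also have "\<dots> = A.E.act M x (A.E.scl c * Poly_Mapping.single w 1)"
      using wd by (intro act(2)[OF x, symmetric]) simp_all
    finally have s: "A.E.act M x (A.tau (B.tau (Poly_Mapping.single w c))) = A.E.act M x (Poly_Mapping.single w c)"
      by (simp add: mult_single)
    have "Poly_Mapping.single w c \<in> carrier A.E.FA"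
      using fa_mult[of "A.E.scl c" "leavitt_gens E" "Poly_Mapping.single w 1"] wd by (simp add: mult_single)
    then show ?case using add s x
      by (simp add: A.tau_add B.tau_add A.E.act_add[OF rM])
  qed
qed

lemma supported_twist:
  assumes "A.is_twist N M" shows "B.supported N"
  using A.twist_right_module[OF assms] A.twist_act[OF assms] A.twist_sel[OF assms] A.E.act_zero[OF supported_right_module]
  by (simp add: B.supported_def)

end

text \<open>The doubly twisted module agrees with \<open>M\<close> on the carrier, but its action
  may have other values elsewhere. The two are therefore compared by the identity map and not by
  equality.\<close>

lemma round_trip_hom:
  assumes N: "A.is_twist N M" and M': "B.is_twist M' N"
  shows "(\<lambda>x\<in>carrier M. x) \<in> rmod_hom A.E.LA M' M" "(\<lambda>x\<in>carrier M. x) \<in> rmod_hom A.E.LA M M'"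
proof -
  note M = A.twist_supported[OF N]
  note rM = supported_right_module[OF M]
  interpret M: abelian_group M by (rule A.E.module_abelian_group[OF rM])
  note s = A.twist_sel[OF N] B.twist_sel[OF M']
  have act: "A.E.act M' x p = A.E.act M x p" if "x \<in> carrier M" "p \<in> carrier A.E.FA" for x p
    using B.twist_act[OF M', of x p] A.twist_act[OF N, of x "B.tau p"] act_tau_tau[OF M that] that s by simp
  show "(\<lambda>x\<in>carrier M. x) \<in> rmod_hom A.E.LA M' M" "(\<lambda>x\<in>carrier M. x) \<in> rmod_hom A.E.LA M M'"
    by (rule A.E.rmod_homI; use act s A.E.act_closed[OF rM] in simp)+
qed

end

text \<open>For functors that keep carriers and underlying maps the natural isomorphisms are
  identity maps, and their naturality is the unit law of composition. What remains is that the
  identity maps are morphisms in both directions.\<close>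

lemma concrete_equivalence:
  fixes C :: "(('r, 'u, 'y) rmodule_scheme, 'u \<Rightarrow> 'u) category"
    and D :: "(('s, 'u, 'z) rmodule_scheme, 'u \<Rightarrow> 'u) category"
  assumes C: "Comp C = (\<lambda>M N P g f. compose (carrier M) g f)" "Ident C = (\<lambda>M. \<lambda>x\<in>carrier M. x)"
    "\<And>M N f. f \<in> Hom C M N \<Longrightarrow> f \<in> carrier M \<rightarrow>\<^sub>E carrier N"
    and D: "Comp D = (\<lambda>M N P g f. compose (carrier M) g f)" "Ident D = (\<lambda>M. \<lambda>x\<in>carrier M. x)"
    "\<And>M N f. f \<in> Hom D M N \<Longrightarrow> f \<in> carrier M \<rightarrow>\<^sub>E carrier N"
    and T: "\<And>M. M \<in> Obj C \<Longrightarrow> T M \<in> Obj D" "\<And>M. carrier (T M) = carrier M"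
      "\<And>M N f. M \<in> Obj C \<Longrightarrow> N \<in> Obj C \<Longrightarrow> f \<in> Hom C M N \<Longrightarrow> f \<in> Hom D (T M) (T N)"
    and S: "\<And>M. M \<in> Obj D \<Longrightarrow> S M \<in> Obj C" "\<And>M. carrier (S M) = carrier M"
      "\<And>M N f. M \<in> Obj D \<Longrightarrow> N \<in> Obj D \<Longrightarrow> f \<in> Hom D M N \<Longrightarrow> f \<in> Hom C (S M) (S N)"
    and ST: "\<And>M. M \<in> Obj C \<Longrightarrow> (\<lambda>x\<in>carrier M. x) \<in> Hom C (S (T M)) M \<inter> Hom C M (S (T M))"
    and TS: "\<And>M. M \<in> Obj D \<Longrightarrow> (\<lambda>x\<in>carrier M. x) \<in> Hom D (T (S M)) M \<inter> Hom D M (T (S M))"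
  shows "is_equivalence C D \<lparr>omap = T, amap = \<lambda>M N f. f\<rparr>"
proof -
  have id: "compose A (\<lambda>x\<in>B. x) f = f" "compose A f (\<lambda>x\<in>A. x) = f" if "f \<in> A \<rightarrow>\<^sub>E B" for f A B
    using that by (auto simp: compose_def fun_eq_iff PiE_def extensional_def restrict_def)
  have idid: "compose A (\<lambda>x\<in>A. x) (\<lambda>x\<in>A. x) = (\<lambda>x\<in>A. x)" for A
    by (auto simp: compose_def fun_eq_iff)
  have "is_functor C D \<lparr>omap = T, amap = \<lambda>M N f. f\<rparr>"
    unfolding is_functor_def using T by (simp add: C D)
  moreover have "is_functor D C \<lparr>omap = S, amap = \<lambda>M N f. f\<rparr>"
    unfolding is_functor_def using S by (simp add: C D)
  moreover have "naturally_isomorphic C C (comp_functor \<lparr>omap = S, amap = \<lambda>M N f. f\<rparr> \<lparr>omap = T, amap = \<lambda>M N f. f\<rparr>) id_functor"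
    unfolding naturally_isomorphic_def comp_functor_def id_functor_def
    by (intro exI[of _ "\<lambda>M. \<lambda>x\<in>carrier M. x"])
      (use ST id[OF C(3)] in \<open>auto simp: C(1,2) T(2) S(2) cat_isos_def idid intro!: bexI[of _ "\<lambda>x\<in>carrier _. x"]\<close>)
  moreover have "naturally_isomorphic D D (comp_functor \<lparr>omap = T, amap = \<lambda>M N f. f\<rparr> \<lparr>omap = S, amap = \<lambda>M N f. f\<rparr>) id_functor"
    unfolding naturally_isomorphic_def comp_functor_def id_functor_def
    by (intro exI[of _ "\<lambda>M. \<lambda>x\<in>carrier M. x"])
      (use TS id[OF D(3)] in \<open>auto simp: D(1,2) T(2) S(2) cat_isos_def idid intro!: bexI[of _ "\<lambda>x\<in>carrier _. x"]\<close>)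
  ultimately show ?thesis unfolding is_equivalence_def by blast
qed

section \<open>Twisting in the three categories\<close>

context cycle_match
begin

lemma supported_objects:
  "M \<in> Obj (mod_cat TYPE('u) E.LA) \<Longrightarrow> supported M"
  "N \<in> Obj (gr_cat TYPE('u) E.LA) \<Longrightarrow> supported N"
  "N \<in> Obj (grZ_cat TYPE('u) E.LA) \<Longrightarrow> supported N"
  using E.fin_dim_vertex_zero[of M] E.fin_dim_vertex_zero[of N] E.fin_dim_gcomp_vertex_zero[of N] E.graded_right[of N]
  by (auto simp: mod_cat_def gr_cat_def grZ_cat_def supported_def)

lemma twist_objects:
  "M \<in> Obj (mod_cat TYPE('u) E.LA) \<Longrightarrow> twist M \<in> Obj (mod_cat TYPE('u) F.LA)"
  "N \<in> Obj (gr_cat TYPE('u) E.LA) \<Longrightarrow> gtwist N \<in> Obj (gr_cat TYPE('u) F.LA)"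
  "N \<in> Obj (grZ_cat TYPE('u) E.LA) \<Longrightarrow> gtwist N \<in> Obj (grZ_cat TYPE('u) F.LA)"
proof -
  show "twist M \<in> Obj (mod_cat TYPE('u) F.LA)" if M: "M \<in> Obj (mod_cat TYPE('u) E.LA)"
  proof -
    note tw = is_twist_twist[OF supported_objects(1)[OF M]]
    show ?thesis
      using M twist_right_module[OF tw] twist_fin_dim[OF tw, of "carrier M"] by (simp add: mod_cat_def)
  qed
  show "gtwist N \<in> Obj (gr_cat TYPE('u) F.LA)" if N: "N \<in> Obj (gr_cat TYPE('u) E.LA)"
  proof -
    note sup = supported_objects(2)[OF N]
    show ?thesis
      using N gtwist_graded[OF sup] twist_fin_dim[OF is_twist_gtwist[OF sup], of "carrier N"] by (simp add: gr_cat_def)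
  qed
  show "gtwist N \<in> Obj (grZ_cat TYPE('u) F.LA)" if N: "N \<in> Obj (grZ_cat TYPE('u) E.LA)"
  proof -
    note sup = supported_objects(3)[OF N]
    have g: "graded_module E.LA N" "fin_dim E.LA N (gcomp N i)" for i using N by (auto simp: grZ_cat_def)
    have "gcomp N i \<subseteq> carrier N" for i using E.gcomp_carrier[OF g(1)] by blast
    then show ?thesis
      using g gtwist_graded[OF sup g(1)] twist_fin_dim[OF is_twist_gtwist[OF sup]] by (simp add: grZ_cat_def)
  qed
qed

lemma twist_morphisms:
  assumes "M \<in> Obj (mod_cat TYPE('u) E.LA)" "N \<in> Obj (mod_cat TYPE('u) E.LA)" "f \<in> Hom (mod_cat TYPE('u) E.LA) M N"
  shows "f \<in> Hom (mod_cat TYPE('u) F.LA) (twist M) (twist N)"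
  using twist_hom[OF is_twist_twist[OF supported_objects(1)[OF assms(1)]] is_twist_twist[OF supported_objects(1)[OF assms(2)]]] assms(3)
  by (simp add: mod_cat_def)

lemma gtwist_morphisms_fin_dim:
  assumes "M \<in> Obj (gr_cat TYPE('u) E.LA)" "N \<in> Obj (gr_cat TYPE('u) E.LA)" "f \<in> Hom (gr_cat TYPE('u) E.LA) M N"
  shows "f \<in> Hom (gr_cat TYPE('u) F.LA) (gtwist M) (gtwist N)"
  using gtwist_hom[OF supported_objects(2)[OF assms(1)] supported_objects(2)[OF assms(2)]] assms(3)
  by (simp add: gr_cat_def)

lemma gtwist_morphisms_locally_finite:
  assumes "M \<in> Obj (grZ_cat TYPE('u) E.LA)" "N \<in> Obj (grZ_cat TYPE('u) E.LA)" "f \<in> Hom (grZ_cat TYPE('u) E.LA) M N"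
  shows "f \<in> Hom (grZ_cat TYPE('u) F.LA) (gtwist M) (gtwist N)"
  using gtwist_hom[OF supported_objects(3)[OF assms(1)] supported_objects(3)[OF assms(2)]] assms(3)
  by (simp add: grZ_cat_def)

end

context cycle_match_inv
begin

lemma twist_round_trip:
  assumes "A.supported M"
  shows "(\<lambda>x\<in>carrier M. x) \<in> rmod_hom A.E.LA (B.twist (A.twist M)) M \<inter> rmod_hom A.E.LA M (B.twist (A.twist M))"
  using round_trip_hom[OF A.is_twist_twist[OF assms] B.is_twist_twist[OF supported_twist[OF assms A.is_twist_twist[OF assms]]]]
  by simp

lemma gtwist_round_trip:
  assumes "A.supported M" and gM: "graded_module A.E.LA M"
  shows "(\<lambda>x\<in>carrier M. x) \<in> gr_hom A.E.LA (B.gtwist (A.gtwist M)) M \<inter> gr_hom A.E.LA M (B.gtwist (A.gtwist M))"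
  using round_trip_hom[OF A.is_twist_gtwist[OF assms(1)]
      B.is_twist_gtwist[OF supported_twist[OF assms(1) A.is_twist_gtwist[OF assms(1)]]]]
    A.E.gcomp_carrier[OF gM]
  by (auto simp: gr_hom_def B.gtwist_sel A.gtwist_sel)

end

lemma hom_PiE: "f \<in> rmod_hom R M N \<Longrightarrow> f \<in> carrier M \<rightarrow>\<^sub>E carrier N"
  by (simp add: rmod_hom_def)

lemma gr_hom_PiE: "f \<in> gr_hom R M N \<Longrightarrow> f \<in> carrier M \<rightarrow>\<^sub>E carrier N"
  using hom_PiE[of f R M N] by (simp add: gr_hom_def)

theorem theorem3p19:
  fixes E :: "('v, 'e) pre_digraph" and F :: "('w, 'f) pre_digraph"
  assumes "fin_digraph E" and "fin_digraph F"
    and "\<And>v. \<not> is_sink E v" and "\<And>v. \<not> is_source E v"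
    and "\<And>v. \<not> is_sink F v" and "\<And>v. \<not> is_source F v"
    and universe: "infinite (UNIV :: 'u set)" "\<exists>\<iota> :: 'k::field \<Rightarrow> 'u. inj \<iota>"
    and "\<phi> \<in> K0gr_order_iso TYPE('u) (leavitt_algebra TYPE('k) E) (leavitt_algebra TYPE('k) F)"
  shows "equivalent_categories
           (mod_cat TYPE('u) (leavitt_algebra TYPE('k) E))
           (mod_cat TYPE('u) (leavitt_algebra TYPE('k) F)) \<and>
         graded_equivalent
           (gr_cat TYPE('u) (leavitt_algebra TYPE('k) E))
           (gr_cat TYPE('u) (leavitt_algebra TYPE('k) F)) \<and>
         graded_equivalent
           (grZ_cat TYPE('u) (leavitt_algebra TYPE('k) E))
           (grZ_cat TYPE('u) (leavitt_algebra TYPE('k) F))"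
proof -
  have gE: "leavitt_graph E"
    using assms(1,3,4) by (auto simp: leavitt_graph_def leavitt_graph_axioms_def is_sink_def is_source_def)
  have gF: "leavitt_graph F"
    using assms(2,5,6) by (auto simp: leavitt_graph_def leavitt_graph_axioms_def is_sink_def is_source_def)
  interpret E: leavitt_graph E by (rule gE)
  interpret F: leavitt_graph F by (rule gF)
  obtain \<iota> :: "'k \<Rightarrow> 'u" where \<iota>: "inj \<iota>" using universe(2) by blast
  obtain h where h: "bij_betw h E.cyc F.cyc" "\<And>z. z \<in> E.cyc \<Longrightarrow> h (E.pre z) = F.pre (h z)"
    by (rule entryless_cycles_match[OF gE gF universe(1) \<iota> assms(9)]) blast
  define g where "g = inv_into E.cyc h"
  \<comment> \<open>The map of a match runs against the functor: \<open>h\<close> from the cycles of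
    \<open>E\<close> to those of \<open>F\<close> twists modules of \<open>F\<close>, and its
    inverse \<open>g\<close> twists modules of \<open>E\<close>.\<close>
  have cm: "cycle_match F E h"
    using gE gF h by (simp add: cycle_match_def cycle_match_axioms_def leavitt_def)
  have cm': "cycle_match E F g" unfolding g_def by (rule cycle_match_inverse[OF cm])
  interpret P: cycle_match_inv E F "TYPE('k)" g h
    by (intro cycle_match_inv.intro cycle_match_inv_axioms.intro cm cm')
      (use bij_betw_inv_into_left[OF h(1)] in \<open>simp add: g_def\<close>)
  \<comment> \<open>The same pair read backwards supplies the second natural isomorphism.\<close>
  interpret Q: cycle_match_inv F E "TYPE('k)" h g
    by (intro cycle_match_inv.intro cycle_match_inv_axioms.intro cm cm')
      (use bij_betw_inv_into_right[OF h(1)] in \<open>simp add: g_def\<close>)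
  let ?RE = "leavitt_algebra TYPE('k) E" and ?RF = "leavitt_algebra TYPE('k) F"
  have "is_equivalence (mod_cat TYPE('u) ?RE) (mod_cat TYPE('u) ?RF) \<lparr>omap = P.A.twist, amap = \<lambda>M N f. f\<rparr>"
  proof (rule concrete_equivalence[where S = "P.B.twist"])
    show "(\<lambda>x\<in>carrier M. x) \<in> Hom (mod_cat TYPE('u) ?RE) (P.B.twist (P.A.twist M)) M \<inter>
        Hom (mod_cat TYPE('u) ?RE) M (P.B.twist (P.A.twist M))" if "M \<in> Obj (mod_cat TYPE('u) ?RE)" for M
      using P.twist_round_trip[OF P.A.supported_objects(1)[OF that]] by (simp add: mod_cat_def)
    show "(\<lambda>x\<in>carrier M. x) \<in> Hom (mod_cat TYPE('u) ?RF) (P.A.twist (P.B.twist M)) M \<inter>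
        Hom (mod_cat TYPE('u) ?RF) M (P.A.twist (P.B.twist M))" if "M \<in> Obj (mod_cat TYPE('u) ?RF)" for M
      using Q.twist_round_trip[OF P.B.supported_objects(1)[OF that]] by (simp add: mod_cat_def)
  qed (simp_all add: P.A.twist_objects P.B.twist_objects P.A.twist_morphisms P.B.twist_morphisms,
      simp_all add: mod_cat_def hom_PiE)
  moreover have "is_equivalence (gr_cat TYPE('u) ?RE) (gr_cat TYPE('u) ?RF) \<lparr>omap = P.A.gtwist, amap = \<lambda>M N f. f\<rparr>"
  proof (rule concrete_equivalence[where S = "P.B.gtwist"])
    show "(\<lambda>x\<in>carrier M. x) \<in> Hom (gr_cat TYPE('u) ?RE) (P.B.gtwist (P.A.gtwist M)) M \<inter>
        Hom (gr_cat TYPE('u) ?RE) M (P.B.gtwist (P.A.gtwist M))" if "M \<in> Obj (gr_cat TYPE('u) ?RE)" for M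
      using P.gtwist_round_trip[OF P.A.supported_objects(2)[OF that]] that by (simp add: gr_cat_def)
    show "(\<lambda>x\<in>carrier M. x) \<in> Hom (gr_cat TYPE('u) ?RF) (P.A.gtwist (P.B.gtwist M)) M \<inter>
        Hom (gr_cat TYPE('u) ?RF) M (P.A.gtwist (P.B.gtwist M))" if "M \<in> Obj (gr_cat TYPE('u) ?RF)" for M
      using Q.gtwist_round_trip[OF P.B.supported_objects(2)[OF that]] that by (simp add: gr_cat_def)
  qed (simp_all add: P.A.twist_objects P.B.twist_objects P.A.gtwist_morphisms_fin_dim P.B.gtwist_morphisms_fin_dim,
      simp_all add: gr_cat_def gr_hom_PiE)
  moreover have "is_equivalence (grZ_cat TYPE('u) ?RE) (grZ_cat TYPE('u) ?RF) \<lparr>omap = P.A.gtwist, amap = \<lambda>M N f. f\<rparr>"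
  proof (rule concrete_equivalence[where S = "P.B.gtwist"])
    show "(\<lambda>x\<in>carrier M. x) \<in> Hom (grZ_cat TYPE('u) ?RE) (P.B.gtwist (P.A.gtwist M)) M \<inter>
        Hom (grZ_cat TYPE('u) ?RE) M (P.B.gtwist (P.A.gtwist M))" if "M \<in> Obj (grZ_cat TYPE('u) ?RE)" for M
      using P.gtwist_round_trip[OF P.A.supported_objects(3)[OF that]] that by (simp add: grZ_cat_def)
    show "(\<lambda>x\<in>carrier M. x) \<in> Hom (grZ_cat TYPE('u) ?RF) (P.A.gtwist (P.B.gtwist M)) M \<inter>
        Hom (grZ_cat TYPE('u) ?RF) M (P.A.gtwist (P.B.gtwist M))" if "M \<in> Obj (grZ_cat TYPE('u) ?RF)" for M
      using Q.gtwist_round_trip[OF P.B.supported_objects(3)[OF that]] that by (simp add: grZ_cat_def)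
  qed (simp_all add: P.A.twist_objects P.B.twist_objects P.A.gtwist_morphisms_locally_finite P.B.gtwist_morphisms_locally_finite,
      simp_all add: grZ_cat_def gr_hom_PiE)
  moreover have "graded_functor C \<lparr>omap = P.A.gtwist, amap = \<lambda>M N f. f\<rparr>"
    for C :: "(((('v, 'e) lgen word \<Rightarrow>\<^sub>0 'k) set, 'u) gmodule, 'u \<Rightarrow> 'u) category"
    by (simp add: graded_functor_def P.A.gtwist_shift)
  ultimately show ?thesis unfolding equivalent_categories_def graded_equivalent_def by blast
qed

end
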